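(* Let $u\ge d\ge1$, $E\in E(u)$, $C\in C(d)$ with $|\det E\,\det C|>1$, $f\in C^2(\mathbb{T}^u,\mathbb{R}^d)$, and suppose that $T=T(E,C,f)$ satisfies the transversality condition. Then there exists a neighborhood $U\subset C(d)\times C^2(\mathbb{T}^u,\mathbb{R}^d)$ of $(C,f)$ such that for every $(\tilde C,\tilde f)\in U$ the SRB measure $\mu_{\tilde T}$ of $\tilde T=T(E,\tilde C,\tilde f)$ is absolutely continuous with respect to the volume of $\mathbb{T}^u\times\mathbb{R}^d$ and its density is in $L^2(\mathbb{T}^u\times\mathbb{R}^d)$.
   Context: Basic setting. $\mathbb{T}^u=\mathbb{R}^u/\mathbb{Z}^u$; Euclidean and operator norms. $E(u)$: maps of $\mathbb{T}^u$ induced by linear $E:\mathbb{R}^u\to\mathbb{R}^u$ (same letter) with $E(\mathbb{Z}^u)\subset\mathbb{Z}^u$, $\|E^{-1}\|<1$. $C(d)$: linear $C:\mathbb{R}^d\to\mathbb{R}^d$ with $\|Cv\|<\|v\|$ for $v\ne0$ (matrix topology). $T(E,C,f)(x,y)=(E(x),C(y)+f(x))$ on $\mathbb{T}^u\times\mathbb{R}^d$. Its SRB measure is the unique invariant Borel probability $\mu_T$ with $\frac1n\sum_{k<n}\delta_{T^k(z)}\to\mu_T$ weakly for volume-a.e. $z$ (volume = normalized Lebesgue on $\mathbb{T}^u$ times Lebesgue on $\mathbb{R}^d$). $J=|\det E\det C|$, $\theta=\|C\|\|E^{-1}\|$, $\alpha_0=\|f\|_{C^2}/(1-\|C\|)$.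 For linear $A:\mathbb{R}^u\to\mathbb{R}^d$, $\mathfrak{m}(A)=\sup_{\dim W=d}\inf_{v\in W,\|v\|=1}\|A(v)\|$. Markov partition and words. Let $\gamma>0$ be such that for all $x\in\mathbb{T}^u$ and $y\in E^{-1}(x)$ there is a unique affine inverse branch $g_{y,x}:B(x,\gamma)\to\mathbb{T}^u$ with $g_{y,x}(x)=y$ and $E(g_{y,x}(z))=z$. Fix a Markov partition $\mathcal{R}=\{\mathcal{R}(1),\dots,\mathcal{R}(r)\}$ for $E$ with elements of diameter $<\gamma$: the $\mathcal{R}(i)$ are disjoint open sets, each is the interior of its closure, $E|_{\mathcal{R}(i)}$ is one-to-one, $\bigcup_i\overline{\mathcal{R}(i)}=\mathbb{T}^u$, and $E(\mathcal{R}(i))\cap\mathcal{R}(j)\ne\emptyset$ implies $\mathcal{R}(j)\subset E(\mathcal{R}(i))$. For $1\le n\le\infty$, $I^n$ is the set of words $\mathbf{a}=(a_i)_{i=1}^n$ in $\{1,\dots,r\}$ with $E(\mathcal{R}(a_{i+1}))\cap\mathcal{R}(a_i)\ne\emptyset$ for all $1\le i\le n-1$ (all $i\geq1$ if $n=\infty$); $[\mathbf{a}]_p=(a_j)_{j=1}^p$. For finite $n$, $\mathcal{R}(\mathbf{a})=\bigcap_{i=0}^{n-1}E^{-i}(\mathcal{R}(a_{n-i}))$. For $\mathbf{c}\in I^p$, $I^n(\mathbf{c})=\{\mathbf{a}\in I^n: E^n(\mathcal{R}(\mathbf{a}))\cap\mathcal{R}(\mathbf{c})\neq\emptyset\}$.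 For $x\in\mathcal{R}(\mathbf{c})$ and $\mathbf{a}\in I^n(\mathbf{c})$, $\mathbf{a}(x)$ is the point $y\in\mathcal{R}(\mathbf{a})$ with $E^n(y)=x$, and $S(x,\mathbf{a})=\sum_{i=1}^n C^{i-1}f([\mathbf{a}]_i(x))$. $S_{\mathbf{c}}(\cdot,\mathbf{a})$ denotes the $C^2$ extension of $S(\cdot,\mathbf{a})|_{\mathcal{R}(\mathbf{c})}$ to $\overline{\mathcal{R}(\mathbf{c})}$. Transversality. For $1\le p,q<\infty$, $\mathbf{c}\in I^p$, words $\mathbf{a},\mathbf{b}\in I^q(\mathbf{c})$ are transversal on $\mathbf{c}$ if $\mathfrak{m}(DS_{\mathbf{c}}(x,\mathbf{a})-DS_{\mathbf{c}}(y,\mathbf{b}))>3\theta^q\alpha_0$ for all $x,y\in\overline{\mathcal{R}(\mathbf{c})}$. Put $\tau(q)=\min_{p\ge1}\max_{\mathbf{c}\in I^p}\max_{\mathbf{a}\in I^q(\mathbf{c})}\#\{\mathbf{b}\in I^q(\mathbf{c}):\mathbf{a}\text{ is not transversal to }\mathbf{b}\text{ on }\mathbf{c}\}$. $T$ satisfies the transversality condition if $\tau(q)<J^q$ for some integer $q\geq 1$. *)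

theory Defs
  imports "HOL-Probability.Probability"
begin

section \<open>The torus\<close>

definition int_lattice :: "(real^'u) set" where
  "int_lattice = {k. \<forall>i. k $ i \<in> \<int>}"

lemma int_lattice_0 [simp]: "0 \<in> int_lattice"
  and int_lattice_add: "k \<in> int_lattice \<Longrightarrow> l \<in> int_lattice \<Longrightarrow> k + l \<in> int_lattice"
  and int_lattice_diff: "k \<in> int_lattice \<Longrightarrow> l \<in> int_lattice \<Longrightarrow> k - l \<in> int_lattice"
  and int_lattice_minus: "k \<in> int_lattice \<Longrightarrow> - k \<in> int_lattice"
  by (auto simp: int_lattice_def)

lemma int_lattice_nonempty: "int_lattice \<noteq> {}"
  using int_lattice_0 by blast

lemma closed_int_lattice: "closed (int_lattice :: (real^'u) set)"
proof -
  have "int_lattice = (\<Inter>i. (\<lambda>k :: real^'u. k $ i) -` \<int>)"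
    by (auto simp: int_lattice_def)
  moreover have "closed ((\<lambda>k :: real^'u. k $ i) -` \<int>)" for i
    by (intro closed_vimage closed_Ints continuous_intros)
  ultimately show ?thesis
    by (metis closed_INT)
qed

quotient_type (overloaded) 'u torus = "real^'u" / "\<lambda>x y. x - y \<in> int_lattice"
  morphisms rep_torus proj
proof (rule equivpI)
  show "reflp (\<lambda>x y :: real^'u. x - y \<in> int_lattice)"
    by (simp add: reflp_def)
  show "symp (\<lambda>x y :: real^'u. x - y \<in> int_lattice)"
    unfolding symp_def using int_lattice_minus by force
  show "transp (\<lambda>x y :: real^'u. x - y \<in> int_lattice)"
    unfolding transp_def using int_lattice_add by fastforce
qed

type_synonym 'n lin = "(real^'n) \<Rightarrow>\<^sub>L (real^'n)"
type_synonym ('u, 'd) phase = "'u torus \<times> (real^'d)"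

lemma proj_eq_iff: "proj x = proj y \<longleftrightarrow> x - y \<in> int_lattice"
  by (simp add: torus.abs_eq_iff)

lemma proj_rep [simp]: "proj (rep_torus x) = x"
  by (rule Quotient_abs_rep [OF Quotient_torus])

lemma proj_cases: obtains v where "x = proj v"
  by (metis proj_rep)

lemma infdist_int_lattice_add:
  assumes "k \<in> int_lattice"
  shows "infdist (v + k) int_lattice = infdist v int_lattice"
proof -
  have "infdist (v + k) int_lattice \<le> infdist v int_lattice"
    if "k \<in> int_lattice" for v k :: "real^'u"
  proof -
    have "infdist (v + k) int_lattice \<le> dist v a" if "a \<in> int_lattice" for a
      using infdist_le [OF int_lattice_add [OF that \<open>k \<in> int_lattice\<close>], of "v + k"]
      by (simp add: dist_norm)
    then show ?thesis
      unfolding infdist_notempty [OF int_lattice_nonempty, of v]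
      by (intro cINF_greatest int_lattice_nonempty)
  qed
  from this [OF assms, of v] this [OF int_lattice_minus [OF assms], of "v + k"] show ?thesis
    by simp
qed

lemma infdist_less_iff:
  assumes "A \<noteq> {}"
  shows "infdist x A < e \<longleftrightarrow> (\<exists>a\<in>A. dist x a < e)"
  unfolding infdist_notempty [OF assms]
  by (rule cINF_less_iff) (auto simp: assms)

instantiation torus :: (finite) metric_space
begin

lift_definition dist_torus :: "'a torus \<Rightarrow> 'a torus \<Rightarrow> real"
  is "\<lambda>x y. infdist (x - y) int_lattice"
proof -
  fix x x' y y' :: "real^'a"
  assume "x - x' \<in> int_lattice" "y - y' \<in> int_lattice"
  then have "(x - x') - (y - y') \<in> int_lattice"
    by (rule int_lattice_diff)
  from infdist_int_lattice_add [OF this, of "x' - y'"]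
  show "infdist (x - y) int_lattice = infdist (x' - y') int_lattice"
    by (simp add: algebra_simps)
qed

definition uniformity_torus :: "('a torus \<times> 'a torus) filter" where
  "uniformity_torus = (INF e\<in>{0<..}. principal {(x, y). dist x y < e})"

definition open_torus :: "'a torus set \<Rightarrow> bool" where
  "open_torus U \<longleftrightarrow> (\<forall>x\<in>U. eventually (\<lambda>(x', y). x' = x \<longrightarrow> y \<in> U) uniformity)"

instance
proof
  fix x y z :: "'a torus"
  show "dist x y = 0 \<longleftrightarrow> x = y"
    by transfer (simp add: in_closed_iff_infdist_zero [OF closed_int_lattice int_lattice_nonempty])
  show "dist x y \<le> dist x z + dist y z"
  proof transfer
    fix x y z :: "real^'a"
    let ?d = "\<lambda>v. infdist v int_lattice"
    have "?d (x - y) \<le> ?d (x - z) + ?d (y - z) + e" if "e > 0" for e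
    proof -
      have "?d (x - z) < ?d (x - z) + e / 2" "?d (y - z) < ?d (y - z) + e / 2"
        using that by auto
      then obtain a b where a: "a \<in> int_lattice" "dist (x - z) a < ?d (x - z) + e / 2"
        and b: "b \<in> int_lattice" "dist (y - z) b < ?d (y - z) + e / 2"
        using infdist_less_iff [OF int_lattice_nonempty] by meson
      have "?d (x - y) \<le> dist (x - y) (a - b)"
        by (rule infdist_le) (rule int_lattice_diff [OF a(1) b(1)])
      also have "\<dots> = norm ((x - z - a) - (y - z - b))"
        by (simp add: dist_norm algebra_simps)
      also have "\<dots> \<le> dist (x - z) a + dist (y - z) b"
        unfolding dist_norm by (rule norm_triangle_ineq4)
      finally show ?thesis
        using a b by simp
    qed
    then show "?d (x - y) \<le> ?d (x - z) + ?d (y - z)"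
      by (rule field_le_epsilon)
  qed
qed (simp_all add: uniformity_torus_def open_torus_def)

end

lemma dist_proj: "dist (proj x) (proj y) = infdist (x - y) int_lattice"
  by (rule dist_torus.abs_eq)

lemma dist_proj_le: "dist (proj x) (proj y) \<le> dist x y"
  unfolding dist_proj using infdist_le [OF int_lattice_0, of "x - y"] by (simp add: dist_norm)

lemma proj_ball: "proj ` ball x e = ball (proj x) e"
proof (intro set_eqI iffI)
  fix z assume "z \<in> proj ` ball x e"
  then show "z \<in> ball (proj x) e"
    by (auto intro: le_less_trans [OF dist_proj_le])
next
  fix z assume z: "z \<in> ball (proj x) e"
  obtain y where y: "z = proj y"
    by (rule proj_cases)
  from z y obtain k where k: "k \<in> int_lattice" "dist (x - y) k < e"
    by (auto simp: dist_proj infdist_less_iff [OF int_lattice_nonempty])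
  have "proj (y + k) = z" and "y + k \<in> ball x e"
    using k y by (auto simp: proj_eq_iff dist_norm algebra_simps)
  then show "z \<in> proj ` ball x e"
    by blast
qed

lemma continuous_on_proj: "continuous_on S proj"
  by (rule continuous_on_subset [of UNIV])
     (auto simp: continuous_on_iff intro: le_less_trans [OF dist_proj_le])

lemma open_proj_image:
  assumes "open S"
  shows "open (proj ` S)"
  unfolding open_contains_ball
proof safe
  fix x assume "x \<in> S"
  then obtain e where "e > 0" "ball x e \<subseteq> S"
    using assms open_contains_ball by blast
  then show "\<exists>e>0. ball (proj x) e \<subseteq> proj ` S"
    unfolding proj_ball [symmetric] by blast
qed

instance torus :: (finite) second_countable_topology
proof
  obtain B :: "(real^'a) set set" where B: "countable B" "topological_basis B"
    using ex_countable_basis by blast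
  have "topological_basis ((\<lambda>S. proj ` S) ` B)"
  proof (rule topological_basisI)
    show "open S" if "S \<in> (\<lambda>S. proj ` S) ` B" for S :: "'a torus set"
      using that B(2) by (auto intro!: open_proj_image dest: topological_basis_open)
    fix U :: "'a torus set" and x
    assume U: "open U" "x \<in> U"
    have "open (proj -` U :: (real^'a) set)"
      by (rule open_vimage [OF U(1) continuous_on_proj])
    moreover have "rep_torus x \<in> proj -` U"
      using U(2) by simp
    ultimately obtain S where "S \<in> B" "rep_torus x \<in> S" "S \<subseteq> proj -` U"
      using B(2) topological_basisE by blast
    then show "\<exists>S\<in>(\<lambda>S. proj ` S) ` B. x \<in> S \<and> S \<subseteq> U"
      by (intro bexI [of _ "proj ` S"]) (auto intro!: image_eqI [of x proj "rep_torus x"])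
  qed
  then show "\<exists>B :: 'a torus set set. countable B \<and> open = generate_topology B"
    using B(1) topological_basis_imp_subbasis by blast
qed

text \<open>The normalized Lebesgue measure of the torus is the image of Lebesgue measure on a
  fundamental domain of \<^term>\<open>proj\<close>.\<close>

definition torus_lebesgue :: "'u::finite torus measure" where
  "torus_lebesgue = distr (uniform_measure lborel {v :: real^'u. \<forall>i. 0 \<le> v $ i \<and> v $ i < 1}) borel proj"

definition phase_volume :: "('u::finite, 'd::finite) phase measure" where
  "phase_volume = torus_lebesgue \<Otimes>\<^sub>M lborel"

lemma sets_phase_volume: "sets (phase_volume :: ('u::finite, 'd::finite) phase measure) = sets borel"
proof -
  have "sets (phase_volume :: ('u, 'd) phase measure) = sets (borel \<Otimes>\<^sub>M borel)"
    unfolding phase_volume_def by (rule sets_pair_measure_cong) (simp_all add: torus_lebesgue_def)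
  then show ?thesis
    unfolding borel_prod .
qed

section \<open>Maps of class C2 on the torus\<close>

definition has_torus_derivative ::
    "('u::finite torus \<Rightarrow> 'b::real_normed_vector) \<Rightarrow> ((real^'u) \<Rightarrow>\<^sub>L 'b) \<Rightarrow> 'u torus \<Rightarrow> bool" where
  "has_torus_derivative f D x \<longleftrightarrow>
     (\<forall>v. proj v = x \<longrightarrow> ((\<lambda>w. f (proj w)) has_derivative blinfun_apply D) (at v))"

definition torus_deriv ::
    "('u::finite torus \<Rightarrow> 'b::real_normed_vector) \<Rightarrow> 'u torus \<Rightarrow> ((real^'u) \<Rightarrow>\<^sub>L 'b)" where
  "torus_deriv f x = (THE D. has_torus_derivative f D x)"

lemma torus_deriv_eq:
  assumes "has_torus_derivative f D x"
  shows "torus_deriv f x = D"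
  unfolding torus_deriv_def
proof (rule the_equality)
  show "has_torus_derivative f D x" by (rule assms)
next
  fix D' assume "has_torus_derivative f D' x"
  then have "blinfun_apply D' = blinfun_apply D"
    using assms proj_rep [of x] has_derivative_unique unfolding has_torus_derivative_def by blast
  then show "D' = D"
    by (simp add: blinfun_apply_inject)
qed

definition C2_on :: "'u::finite torus set \<Rightarrow> ('u torus \<Rightarrow> 'b::real_normed_vector) \<Rightarrow> bool" where
  "C2_on V f \<longleftrightarrow>
     (\<forall>x\<in>V. \<exists>D. has_torus_derivative f D x) \<and>
     (\<forall>x\<in>V. \<exists>D. has_torus_derivative (torus_deriv f) D x) \<and>
     continuous_on V (torus_deriv (torus_deriv f))"

text \<open>The second derivative is the iterated one, so its norm is the operator norm of the
  corresponding bilinear map.  The three suprema are combined by a maximum.\<close>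

definition C2_norm :: "('u::finite torus \<Rightarrow> 'b::real_normed_vector) \<Rightarrow> real" where
  "C2_norm f =
     Max {SUP x. norm (f x), SUP x. norm (torus_deriv f x), SUP x. norm (torus_deriv (torus_deriv f) x)}"

text \<open>A C2 extension of a map on \<open>A\<close> to the closure of \<open>A\<close> is given by a C2 map on an open
  neighbourhood of that closure.  For open \<open>A\<close>, the derivative at points of the closure depends
  only on \<open>g\<close>.\<close>

definition C2_extension ::
    "'u::finite torus set \<Rightarrow> ('u torus \<Rightarrow> 'b::real_normed_vector) \<Rightarrow> ('u torus \<Rightarrow> 'b) \<Rightarrow> bool" where
  "C2_extension A g F \<longleftrightarrow>
     (\<exists>V. open V \<and> closure A \<subseteq> V \<and> C2_on V F) \<and> (\<forall>x\<in>A. F x = g x)"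

section \<open>The skew products\<close>

definition expanding_maps :: "('u::finite) lin set" where
  "expanding_maps =
     {E. bij (blinfun_apply E) \<and> blinfun_apply E ` int_lattice \<subseteq> int_lattice \<and>
         onorm (inv (blinfun_apply E)) < 1}"

definition contractions :: "('d::finite) lin set" where
  "contractions = {C. \<forall>v. v \<noteq> 0 \<longrightarrow> norm (blinfun_apply C v) < norm v}"

text \<open>For \<open>E\<close> preserving the integer lattice, the choice of representative is irrelevant.\<close>

definition torus_map :: "('u::finite) lin \<Rightarrow> 'u torus \<Rightarrow> 'u torus" where
  "torus_map E x = proj (blinfun_apply E (rep_torus x))"

lemma torus_map_proj:
  assumes "E \<in> expanding_maps"
  shows "torus_map E (proj v) = proj (blinfun_apply E v)"
proof -
  have "rep_torus (proj v) - v \<in> int_lattice"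
    by (simp flip: proj_eq_iff)
  then have "blinfun_apply E (rep_torus (proj v) - v) \<in> int_lattice"
    using assms by (auto simp: expanding_maps_def)
  then show ?thesis
    by (simp add: torus_map_def proj_eq_iff blinfun.diff_right)
qed

definition skew_product ::
    "('u::finite) lin \<Rightarrow> ('d::finite) lin \<Rightarrow> ('u torus \<Rightarrow> real^'d) \<Rightarrow>
     ('u, 'd) phase \<Rightarrow> ('u, 'd) phase" where
  "skew_product E C f = (\<lambda>(x, y). (torus_map E x, blinfun_apply C y + f x))"

definition lin_det :: "('n::finite) lin \<Rightarrow> real" where
  "lin_det A = det (matrix (blinfun_apply A))"

definition jacobian :: "('u::finite) lin \<Rightarrow> ('d::finite) lin \<Rightarrow> real" where
  "jacobian E C = \<bar>lin_det E * lin_det C\<bar>"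

definition theta :: "('u::finite) lin \<Rightarrow> ('d::finite) lin \<Rightarrow> real" where
  "theta E C = norm C * onorm (inv (blinfun_apply E))"

definition alpha0 :: "('d::finite) lin \<Rightarrow> ('u::finite torus \<Rightarrow> real^'d) \<Rightarrow> real" where
  "alpha0 C f = C2_norm f / (1 - norm C)"

section \<open>SRB measures\<close>

text \<open>Weak convergence of the empirical measures is tested on bounded continuous functions, whose
  integrals against the empirical measures are Birkhoff averages.\<close>

definition describes_statistics ::
    "(('u::finite, 'd::finite) phase \<Rightarrow> ('u, 'd) phase) \<Rightarrow> ('u, 'd) phase measure \<Rightarrow> bool" where
  "describes_statistics T \<mu> \<longleftrightarrow>
     prob_space \<mu> \<and> sets \<mu> = sets borel \<and> distr \<mu> borel T = \<mu> \<and>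
     (AE z in phase_volume. \<forall>\<phi> :: ('u, 'd) phase \<Rightarrow> real.
        continuous_on UNIV \<phi> \<and> bounded (range \<phi>) \<longrightarrow>
        (\<lambda>n. (\<Sum>k<n. \<phi> ((T ^^ k) z)) / real n) \<longlonglongrightarrow> (\<integral>w. \<phi> w \<partial>\<mu>))"

definition is_SRB_measure ::
    "(('u::finite, 'd::finite) phase \<Rightarrow> ('u, 'd) phase) \<Rightarrow> ('u, 'd) phase measure \<Rightarrow> bool" where
  "is_SRB_measure T \<mu> \<longleftrightarrow>
     describes_statistics T \<mu> \<and> (\<forall>\<nu>. describes_statistics T \<nu> \<longrightarrow> \<nu> = \<mu>)"

section \<open>Markov partitions and words\<close>

text \<open>A map from a ball of the torus to the torus is affine if it lifts to an affine map of the
  covering space.\<close>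

definition affine_inverse_branch ::
    "('u::finite) lin \<Rightarrow> real \<Rightarrow> 'u torus \<Rightarrow> 'u torus \<Rightarrow> ('u torus \<Rightarrow> 'u torus) \<Rightarrow> bool" where
  "affine_inverse_branch E \<gamma> x y g \<longleftrightarrow>
     (\<exists>v L b. proj v = x \<and> linear L \<and> (\<forall>w\<in>ball v \<gamma>. g (proj w) = proj (L w + b))) \<and>
     g x = y \<and> (\<forall>z\<in>ball x \<gamma>. torus_map E (g z) = z)"

definition branch_radius :: "('u::finite) lin \<Rightarrow> real \<Rightarrow> bool" where
  "branch_radius E \<gamma> \<longleftrightarrow> \<gamma> > 0 \<and>
     (\<forall>x y. torus_map E y = x \<longrightarrow>
        (\<exists>g. affine_inverse_branch E \<gamma> x y g \<and>
             (\<forall>h. affine_inverse_branch E \<gamma> x y h \<longrightarrow> (\<forall>z\<in>ball x \<gamma>. h z = g z))))"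

definition markov_partition ::
    "('u::finite) lin \<Rightarrow> real \<Rightarrow> nat \<Rightarrow> (nat \<Rightarrow> 'u torus set) \<Rightarrow> bool" where
  "markov_partition E \<gamma> r R \<longleftrightarrow>
     (\<forall>i\<in>{1..r}. open (R i) \<and> interior (closure (R i)) = R i \<and>
        inj_on (torus_map E) (R i) \<and> diameter (R i) < \<gamma>) \<and>
     (\<forall>i\<in>{1..r}. \<forall>j\<in>{1..r}. i \<noteq> j \<longrightarrow> R i \<inter> R j = {}) \<and>
     (\<Union>i\<in>{1..r}. closure (R i)) = UNIV \<and>
     (\<forall>i\<in>{1..r}. \<forall>j\<in>{1..r}. torus_map E ` R i \<inter> R j \<noteq> {} \<longrightarrow> R j \<subseteq> torus_map E ` R i)"

text \<open>Words are lists, so that the letter \<open>a\<^sub>i\<close> is \<open>a ! (i - 1)\<close> and the truncation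
  \<open>[a]\<^sub>p\<close> is \<open>take p a\<close>.\<close>

definition words ::
    "('u::finite) lin \<Rightarrow> nat \<Rightarrow> (nat \<Rightarrow> 'u torus set) \<Rightarrow> nat \<Rightarrow> nat list set" where
  "words E r R n =
     {a. length a = n \<and> set a \<subseteq> {1..r} \<and>
         (\<forall>i. i + 1 < n \<longrightarrow> torus_map E ` R (a ! (i + 1)) \<inter> R (a ! i) \<noteq> {})}"

definition cylinder ::
    "('u::finite) lin \<Rightarrow> (nat \<Rightarrow> 'u torus set) \<Rightarrow> nat list \<Rightarrow> 'u torus set" where
  "cylinder E R a =
     (\<Inter>i\<in>{..<length a}. (torus_map E ^^ i) -` R (a ! (length a - i - 1)))"

definition words_over ::
    "('u::finite) lin \<Rightarrow> nat \<Rightarrow> (nat \<Rightarrow> 'u torus set) \<Rightarrow> nat \<Rightarrow> nat list \<Rightarrow> nat list set" where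
  "words_over E r R n c =
     {a \<in> words E r R n. (torus_map E ^^ n) ` cylinder E R a \<inter> cylinder E R c \<noteq> {}}"

definition preimage_point ::
    "('u::finite) lin \<Rightarrow> (nat \<Rightarrow> 'u torus set) \<Rightarrow> nat list \<Rightarrow> 'u torus \<Rightarrow> 'u torus" where
  "preimage_point E R a x = (THE y. y \<in> cylinder E R a \<and> (torus_map E ^^ length a) y = x)"

definition S_sum ::
    "('u::finite) lin \<Rightarrow> ('d::finite) lin \<Rightarrow> ('u torus \<Rightarrow> real^'d) \<Rightarrow>
     (nat \<Rightarrow> 'u torus set) \<Rightarrow> nat list \<Rightarrow> 'u torus \<Rightarrow> real^'d" where
  "S_sum E C f R a x =
     (\<Sum>i = 1..length a. (blinfun_apply C ^^ (i - 1)) (f (preimage_point E R (take i a) x)))"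

section \<open>Transversality\<close>

definition max_conorm :: "((real^'u::finite) \<Rightarrow>\<^sub>L (real^'d::finite)) \<Rightarrow> real" where
  "max_conorm A =
     (SUP W\<in>{W. subspace W \<and> dim W = CARD('d)}. INF v\<in>{v \<in> W. norm v = 1}. norm (blinfun_apply A v))"

text \<open>A pair of words whose sums have no C2 extension to the closed cylinder counts as not
  transversal.  The choice of \<open>F\<close> and \<open>G\<close> is irrelevant.\<close>

definition transversal ::
    "('u::finite) lin \<Rightarrow> ('d::finite) lin \<Rightarrow> ('u torus \<Rightarrow> real^'d) \<Rightarrow>
     (nat \<Rightarrow> 'u torus set) \<Rightarrow> nat \<Rightarrow> nat list \<Rightarrow> nat list \<Rightarrow> nat list \<Rightarrow> bool" where
  "transversal E C f R q c a b \<longleftrightarrow>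
     (\<exists>F G. C2_extension (cylinder E R c) (S_sum E C f R a) F \<and>
            C2_extension (cylinder E R c) (S_sum E C f R b) G \<and>
            (\<forall>x\<in>closure (cylinder E R c). \<forall>y\<in>closure (cylinder E R c).
               max_conorm (torus_deriv F x - torus_deriv G y) > 3 * theta E C ^ q * alpha0 C f))"

text \<open>The sets of words are finite, so the suprema are maxima; on natural numbers the supremum of
  the empty set is 0 and an infimum over a nonempty set is attained.\<close>

definition tau ::
    "('u::finite) lin \<Rightarrow> ('d::finite) lin \<Rightarrow> ('u torus \<Rightarrow> real^'d) \<Rightarrow>
     nat \<Rightarrow> (nat \<Rightarrow> 'u torus set) \<Rightarrow> nat \<Rightarrow> nat" where
  "tau E C f r R q =
     (INF p\<in>{1..}. SUP c\<in>words E r R p. SUP a\<in>words_over E r R q c.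
        card {b \<in> words_over E r R q c. \<not> transversal E C f R q c a b})"

definition transversality_condition ::
    "('u::finite) lin \<Rightarrow> ('d::finite) lin \<Rightarrow> ('u torus \<Rightarrow> real^'d) \<Rightarrow>
     nat \<Rightarrow> (nat \<Rightarrow> 'u torus set) \<Rightarrow> bool" where
  "transversality_condition E C f r R \<longleftrightarrow>
     (\<exists>q\<ge>1. real (tau E C f r R q) < jacobian E C ^ q)"

section \<open>Neighbourhoods in the parameter space\<close>

definition parameter_space :: "(('d::finite) lin \<times> ('u::finite torus \<Rightarrow> real^'d)) set" where
  "parameter_space = contractions \<times> Collect (C2_on UNIV)"

definition is_neighbourhood ::
    "(('d::finite) lin \<times> ('u::finite torus \<Rightarrow> real^'d)) set \<Rightarrow>
     'd lin \<Rightarrow> ('u torus \<Rightarrow> real^'d) \<Rightarrow> bool" where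
  "is_neighbourhood U C f \<longleftrightarrow> U \<subseteq> parameter_space \<and>
     (\<exists>\<epsilon>>0. \<forall>(C', f')\<in>parameter_space.
        norm (C' - C) < \<epsilon> \<and> C2_norm (\<lambda>x. f' x - f x) < \<epsilon> \<longrightarrow> (C', f') \<in> U)"

end

theory Submission
  imports Defs
begin

text \<open>The transfer operator \<open>P\<close> of \<open>T = T(E,C,f)\<close> describes the
  action of \<open>T\<close> on densities: its \<open>n\<close>-th power sends \<open>h\<close> to
  the function whose value at \<open>(x, y)\<close> is the sum of \<open>h\<close> over the
  \<open>T^n\<close>-preimages of \<open>(x, y)\<close>, divided by \<open>J^n\<close>. Starting
  from the density \<open>h0\<close> of a probability measure that is a product of Lebesgue
  measure on the torus with the uniform distribution on a cube of the fibre, the measures with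
  densities \<open>P^n h0\<close> converge weakly to the SRB measure. Hence a bound on the
  \<open>L\<^sup>2\<close> norms of \<open>P^n h0\<close> along a sequence of \<open>n\<close>
  gives an \<open>L\<^sup>2\<close> density of the SRB measure.

  The bound comes from a Lasota--Yorke inequality (\<open>transfer_op_L2_step\<close>). The
  function \<open>P^(q+n) h0\<close> at \<open>(x, y)\<close> is \<open>J^(-q)\<close> times a sum
  over the \<open>q\<close>-th preimages of \<open>x\<close>, and its square is a sum over pairs
  of preimages. If every preimage fails to be transversal to at most \<open>N\<close> preimages,
  then by the inequality \<open>2st \<le> s\<^sup>2 + t\<^sup>2\<close> the nontransversal pairs
  contribute at most \<open>N / J^q\<close> times the square of the \<open>L\<^sup>2\<close> norm
  of \<open>P^n h0\<close>. For a transversal pair the integral over the fibre depends only on the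
  difference of the two fibre sums. As a function of \<open>x\<close> this difference expands a
  \<open>d\<close>-dimensional subspace, so it pushes Lebesgue measure on a small ball forward to
  a measure with bounded density (\<open>transversal_pushforward\<close>), and the transversal
  pairs contribute at most a constant times the square of the integral of \<open>h0\<close>. Since
  \<open>N < J^q\<close>, the resulting recursion stays bounded.

  Transversality is a condition on preimages of order \<open>q\<close>, but it is used for
  preimages of order \<open>q + n\<close>. The derivative of a fibre sum of order \<open>q +
  n\<close> differs from that of its truncation to order \<open>q\<close> by at most
  \<open>\<theta>^q\<close> times the bound \<open>\<alpha>\<^sub>0\<close>
  (\<open>fiber_deriv_tail\<close>). Two such tails use up \<open>2 \<theta>^q
  \<alpha>\<^sub>0\<close> of the margin \<open>3 \<theta>^q \<alpha>\<^sub>0\<close>. What is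
  left of the margin absorbs a perturbation of \<open>(C, f)\<close>, which together with the
  continuity of \<open>J\<close> gives a whole neighbourhood
  (\<open>nontransversal_count_stable\<close>).

  The number \<open>\<tau>(q)\<close> counts words, whereas the inequality counts preimages. The
  points outside the cells of the Markov partition form a forward invariant set, and for almost
  every point the orbit spends a positive fraction of time away from the boundary, so almost every
  point has all its iterates in the cells. For such a point the preimages of order
  \<open>q\<close> have distinct itineraries, and preimages with transversal itineraries are
  transversal, so \<open>N\<close> may be taken to be \<open>\<tau>(q)\<close>
  (\<open>AE_nontransversal_preimages\<close>).

  The SRB measure is constructed explicitly, as the law of \<open>(x, C^0 f(x\<^sub>1) + C^1
  f(x\<^sub>2) + \<dots>)\<close> for a random past \<open>x\<^sub>1, x\<^sub>2, \<dots>\<close>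
  of a Lebesgue distributed point \<open>x\<close>. Correlations of Lipschitz functions under
  \<open>E\<close> decay exponentially, which yields the convergence of their Birkhoff averages.
  The contraction of the fibres transfers this to \<open>T\<close>, and a countable family of test
  functions yields a set of full volume of points that are typical for all bounded continuous
  functions at once (\<open>srb_is_SRB\<close>).\<close>

section \<open>Linear changes of variables\<close>

text \<open>Both sides are multiplicative in \<open>f\<close>, so it suffices to treat the maps
  that generate all linear maps: those that annihilate a coordinate, stretchings, transpositions
  and shears.\<close>

lemma measure_cbox_linear_image:
  fixes f :: "real^'n \<Rightarrow> real^'n"
  assumes "linear f"
  shows "measure lebesgue (f ` cbox a b) = \<bar>det (matrix f)\<bar> * measure lebesgue (cbox a b)"
proof -
  have "\<forall>a b. measure lebesgue (f ` cbox a b) = \<bar>det (matrix f)\<bar> * measure lebesgue (cbox a b)"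
  proof (rule induct_linear_elementary [OF assms]; intro allI)
    fix f g :: "real^'n \<Rightarrow> real^'n" and a b
    assume lin: "linear f" "linear g"
      and f: "\<forall>a b. measure lebesgue (f ` cbox a b) = \<bar>det (matrix f)\<bar> * measure lebesgue (cbox a b)"
      and g: "\<forall>a b. measure lebesgue (g ` cbox a b) = \<bar>det (matrix g)\<bar> * measure lebesgue (cbox a b)"
    have "measure lebesgue (f ` g ` cbox a b) = \<bar>det (matrix f)\<bar> * measure lebesgue (g ` cbox a b)"
      using measure_linear_sufficient [OF lin(1) measurable_linear_image_interval [OF lin(2)]] f by metis
    then show "measure lebesgue ((f \<circ> g) ` cbox a b) = \<bar>det (matrix (f \<circ> g))\<bar> * measure lebesgue (cbox a b)"
      using g matrix_compose [OF lin(2) lin(1)] by (simp add: image_comp abs_mult det_mul o_def)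
  next
    fix f :: "real^'n \<Rightarrow> real^'n" and i a b
    assume f: "linear f" and "\<And>x. f x $ i = 0"
    then have "\<not> inj f"
      by (metis linear_injective_imp_surjective one_neq_zero surjE vec_component)
    then show "measure lebesgue (f ` cbox a b) = \<bar>det (matrix f)\<bar> * measure lebesgue (cbox a b)"
      using negligible_linear_singular_image [OF f] det_nz_iff_inj [OF f] negligible_imp_measure0 by force
  next
    fix c :: "'n \<Rightarrow> real" and a b
    show "measure lebesgue ((\<lambda>x. \<chi> i. c i * x $ i) ` cbox a b) =
      \<bar>det (matrix (\<lambda>x. \<chi> i. c i * x $ i))\<bar> * measure lebesgue (cbox a b)"
      by (simp add: measure_stretch axis_def matrix_def det_diagonal)
  next
    fix m n :: 'n and a b :: "real^'n"
    assume "m \<noteq> n"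
    let ?p = "Transposition.transpose m n"
    let ?h = "\<lambda>v::real^'n. \<chi> i. v $ ?p i"
    have eq: "?h ` cbox a b = cbox (?h a) (?h b)"
    proof (intro set_eqI iffI)
      fix x assume "x \<in> cbox (?h a) (?h b)"
      then have "?h x \<in> cbox a b" unfolding mem_box_cart by simp (metis transpose_involutory)
      moreover have "x = ?h (?h x)" by (simp add: vec_eq_iff)
      ultimately show "x \<in> ?h ` cbox a b" by blast
    qed (auto simp: mem_box_cart)
    have "(\<Prod>i\<in>UNIV. ?h b $ i - ?h a $ i) = (\<Prod>i\<in>UNIV. b $ i - a $ i)"
      using prod.permute [OF permutes_swap_id [of m UNIV n], of "\<lambda>i. b $ i - a $ i"] by (simp add: o_def)
    moreover have "cbox (?h a) (?h b) = {} \<longleftrightarrow> cbox a b = {}"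
      unfolding eq [symmetric] by simp
    ultimately have meas: "measure lebesgue (?h ` cbox a b) = measure lebesgue (cbox a b)"
      by (cases "cbox a b = {}") (simp_all add: eq content_cbox_cart)
    have "matrix ?h = transpose (\<chi> i j. mat 1 $ i $ ?p j)"
      by (auto simp: vec_eq_iff transpose_def axis_def mat_def matrix_def)
    then have "\<bar>det (matrix ?h)\<bar> = 1"
      by (simp add: det_permute_columns permutes_swap_id sign_swap_id abs_mult)
    then show "measure lebesgue (?h ` cbox a b) = \<bar>det (matrix ?h)\<bar> * measure lebesgue (cbox a b)"
      using meas by simp
  next
    fix m n :: 'n and a b :: "real^'n"
    assume mn: "m \<noteq> n"
    let ?h = "\<lambda>v::real^'n. \<chi> i. if i = m then v $ m + v $ n else v $ i"
    have lin: "linear ?h"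
      by (rule linearI) (auto simp: algebra_simps vec_eq_iff)
    have "matrix ?h = (\<chi> k. if k = m then row m (mat 1) + 1 *s row n (mat 1) else row k (mat 1))"
      by (auto simp: matrix_def vec_eq_iff row_def mat_def axis_def)
    then have det: "det (matrix ?h) = 1"
      by (simp only: det_row_operation [OF mn] det_I)
    \<comment> \<open>The formula for sheared boxes is applied to a box on which the sheared-in
      coordinate \<open>n\<close> is nonnegative.\<close>
    let ?v = "\<chi> i. if i = n then - a $ n else 0"
    have shift: "?h ` (+) ?v ` cbox a b = (+) (?h ?v) ` ?h ` cbox a b"
      unfolding image_comp o_def by (simp add: linear_add [OF lin])
    have "measure lebesgue (?h ` cbox a b) = measure lebesgue (?h ` (+) ?v ` cbox a b)"
      unfolding shift by (rule measure_translation [symmetric])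
    also have "\<dots> = measure lebesgue ((+) ?v ` cbox a b)"
    proof (cases "cbox a b = {}")
      case False
      then show ?thesis
        unfolding cbox_translation [symmetric]
        by (intro measure_shear_interval mn) (simp_all add: cbox_translation)
    qed simp
    also have "\<dots> = measure lebesgue (cbox a b)"
      by (rule measure_translation)
    finally show "measure lebesgue (?h ` cbox a b) = \<bar>det (matrix ?h)\<bar> * measure lebesgue (cbox a b)"
      using det by simp
  qed
  then show ?thesis by blast
qed

text \<open>The measure on the right, with \<open>L\<close> moved into a push-forward, gives every
  box its volume, and Lebesgue measure is determined by the volumes of boxes.\<close>

lemma nn_integral_linear_bij:
  fixes L :: "real^'n \<Rightarrow> real^'n"
  assumes L: "linear L" "bij L" and [measurable]: "h \<in> borel_measurable borel"
  shows "(\<integral>\<^sup>+x. h x \<partial>lborel) = ennreal \<bar>det (matrix L)\<bar> * (\<integral>\<^sup>+x. h (L x) \<partial>lborel)"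
proof -
  let ?g = "inv L"
  have lg: "linear ?g"
    using L by (simp add: bij_is_inj inj_linear_imp_inv_linear)
  have mL[measurable]: "L \<in> borel_measurable borel"
    using L(1) linear_continuous_on[OF linear_conv_bounded_linear[THEN iffD1]] borel_measurable_continuous_onI by blast
  have dets: "\<bar>det (matrix L)\<bar> * \<bar>det (matrix ?g)\<bar> = 1"
  proof -
    have "L \<circ> ?g = id" using L(2) using bij_is_surj surj_iff by blast
    then have "matrix L ** matrix ?g = mat 1"
      using matrix_compose [OF lg L(1)] matrix_id_mat_1 by metis
    then show ?thesis by (metis abs_mult abs_one det_I det_mul)
  qed
  have "lborel = density (distr lborel borel L) (\<lambda>_. ennreal \<bar>det (matrix L)\<bar>)" (is "_ = ?D")
  proof (rule lborel_eqI)
    fix l u :: "real^'n" assume le: "\<And>b. b \<in> Basis \<Longrightarrow> l \<bullet> b \<le> u \<bullet> b"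
    have vim: "L -` box l u = ?g ` box l u"
      using L(2) by (metis bij_vimage_eq_inv_image)
    have meas: "?g ` box l u \<in> lmeasurable"
      "measure lebesgue (?g ` box l u) = \<bar>det (matrix ?g)\<bar> * measure lebesgue (box l u)"
      using measure_linear_sufficient [OF lg lmeasurable_box measure_cbox_linear_image [OF lg]] by auto
    have bor: "?g ` box l u \<in> sets borel"
      using measurable_sets[OF mL, of "box l u"] vim by simp
    have "emeasure lborel (?g ` box l u) = emeasure lebesgue (?g ` box l u)"
      using bor by simp
    also have "\<dots> = ennreal (\<bar>det (matrix ?g)\<bar> * measure lebesgue (box l u))"
      using emeasure_eq_measure2 [OF meas(1)] meas(2) by simp
    finally have e: "emeasure lborel (?g ` box l u) = ennreal (\<bar>det (matrix ?g)\<bar> * measure lborel (box l u))"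
      by simp
    have "emeasure ?D (box l u) = ennreal \<bar>det (matrix L)\<bar> * emeasure lborel (?g ` box l u)"
      by (subst emeasure_density) (auto simp: nn_integral_cmult emeasure_distr vim)
    also have "\<dots> = ennreal (\<bar>det (matrix L)\<bar> * \<bar>det (matrix ?g)\<bar> * measure lborel (box l u))"
      unfolding e by (simp add: ennreal_mult' mult.assoc)
    also have "\<dots> = (\<Prod>b\<in>Basis. (u - l) \<bullet> b)"
      using dets le by (simp add: measure_lborel_box_eq)
    finally show "emeasure ?D (box l u) = (\<Prod>b\<in>Basis. (u - l) \<bullet> b)" .
  qed simp
  then have "(\<integral>\<^sup>+x. h x \<partial>lborel) = (\<integral>\<^sup>+x. h x \<partial>?D)" by simp
  also have "\<dots> = ennreal \<bar>det (matrix L)\<bar> * (\<integral>\<^sup>+x. h (L x) \<partial>lborel)"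
    by (simp add: nn_integral_density nn_integral_distr nn_integral_cmult)
  finally show ?thesis .
qed

section \<open>Lebesgue measure on the torus\<close>

definition unit_cube :: "(real^'u) set" where
  "unit_cube = {v. \<forall>i. 0 \<le> v $ i \<and> v $ i < 1}"

definition vfloor :: "real^'u \<Rightarrow> real^'u" where
  "vfloor v = (\<chi> i. of_int \<lfloor>v $ i\<rfloor>)"

text \<open>The map \<open>rep_torus\<close> is an arbitrary choice of representatives. Reducing
  it modulo the lattice to the half-open unit cube makes it canonical, hence measurable.\<close>

definition cube_rep :: "'u torus \<Rightarrow> real^'u" where
  "cube_rep x = rep_torus x - vfloor (rep_torus x)"

definition tadd :: "'u torus \<Rightarrow> real^'u \<Rightarrow> 'u torus" where
  "tadd x t = proj (rep_torus x + t)"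

lemma vfloor_lattice [simp]: "vfloor v \<in> int_lattice"
  by (simp add: vfloor_def int_lattice_def)

lemma diff_vfloor_unit_cube [simp]: "v - vfloor v \<in> unit_cube"
  by (auto simp: vfloor_def unit_cube_def) linarith

text \<open>The half-open cube is a fundamental domain: its coordinate differences lie strictly
  between \<open>-1\<close> and \<open>1\<close>, where the only integer is \<open>0\<close>.\<close>

lemma unit_cube_eqI:
  assumes "v \<in> unit_cube" "w \<in> unit_cube" "v - w \<in> int_lattice"
  shows "v = w"
proof -
  have "v $ i = w $ i" for i
  proof -
    from assms(3) obtain n where n: "v $ i - w $ i = of_int n"
      by (auto simp: int_lattice_def elim!: Ints_cases)
    have "\<bar>v $ i - w $ i\<bar> < 1"
      using assms(1,2) by (simp add: unit_cube_def abs_if) (smt (verit))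
    then have "\<bar>n\<bar> < 1" using n by (metis of_int_abs of_int_less_1_iff)
    then show ?thesis using n by simp
  qed
  then show ?thesis by (simp add: vec_eq_iff)
qed

lemma diff_in_unit_cube_iff:
  assumes "k \<in> int_lattice"
  shows "v - k \<in> unit_cube \<longleftrightarrow> k = vfloor v"
proof
  assume "v - k \<in> unit_cube"
  moreover have "(v - k) - (v - vfloor v) \<in> int_lattice"
    using assms int_lattice_diff [OF vfloor_lattice] by simp
  ultimately have "v - k = v - vfloor v"
    using unit_cube_eqI diff_vfloor_unit_cube by blast
  then show "k = vfloor v" by simp
qed simp

lemma proj_add_lattice [simp]: "k \<in> int_lattice \<Longrightarrow> proj (v + k) = proj v"
  and proj_diff_lattice [simp]: "k \<in> int_lattice \<Longrightarrow> proj (v - k) = proj v"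
  by (auto simp: proj_eq_iff int_lattice_minus)

lemma proj_cube_rep [simp]: "proj (cube_rep x) = x"
  by (simp add: cube_rep_def)

lemma cube_rep_unit_cube [simp]: "cube_rep x \<in> unit_cube"
  by (simp add: cube_rep_def)

lemma cube_rep_eqI: "v \<in> unit_cube \<Longrightarrow> proj v = x \<Longrightarrow> cube_rep x = v"
  by (metis cube_rep_unit_cube proj_cube_rep proj_eq_iff unit_cube_eqI)

lemma cube_rep_proj: "cube_rep (proj v) = v - vfloor v"
  by (rule cube_rep_eqI) simp_all

lemma tadd_proj [simp]: "tadd (proj v) t = proj (v + t)"
  by (simp add: tadd_def proj_eq_iff) (metis proj_eq_iff proj_rep)

lemma tadd_0 [simp]: "tadd x 0 = x"
  by (simp add: tadd_def)

lemma tadd_tadd [simp]: "tadd (tadd x s) t = tadd x (s + t)"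
  by (cases x rule: proj_cases) (simp add: add.assoc)

lemma dist_tadd_le: "dist x (tadd x t) \<le> norm t"
  by (cases x rule: proj_cases) (simp add: dist_proj_le [THEN order_trans] dist_norm)

text \<open>The distance to the closed lattice is attained, so two points of the torus differ by a
  translation vector whose length is their distance. Estimates along straight segments thus become
  Lipschitz estimates on the torus.\<close>

lemma torus_lift:
  fixes x y :: "'u::finite torus"
  obtains t where "y = tadd x t" "norm t = dist x y"
proof -
  obtain v w where vw: "x = proj v" "y = proj w"
    by (metis proj_cases)
  obtain k where k: "k \<in> int_lattice" "infdist (w - v) int_lattice = dist (w - v) k"
    using infdist_attains_inf [OF closed_int_lattice int_lattice_nonempty] by blast
  have "y = tadd x (w - v - k)"
    using k vw by (metis add_diff_cancel_left' add_diff_eq diff_add_cancel proj_diff_lattice tadd_proj)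
  moreover have "norm (w - v - k) = dist x y"
    using k vw by (metis dist_commute dist_norm dist_proj)
  ultimately show ?thesis by (rule that)
qed

lemma unit_cube_subset_cbox: "unit_cube \<subseteq> cbox 0 (1 :: real^'u)"
  by (auto simp: unit_cube_def mem_box_cart less_imp_le)

lemma proj_image_cbox: "proj ` cbox 0 (1 :: real^'u::finite) = UNIV"
  using unit_cube_subset_cbox cube_rep_unit_cube proj_cube_rep by (metis UNIV_eq_I image_eqI subsetD)

lemma compact_UNIV_torus: "compact (UNIV :: 'u::finite torus set)"
  unfolding proj_image_cbox [symmetric]
  by (intro compact_continuous_image continuous_on_proj compact_cbox)

instance torus :: (finite) complete_space
proof
  fix X :: "nat \<Rightarrow> 'a torus"
  assume "Cauchy X"
  then show "convergent X"
    using compact_imp_complete [OF compact_UNIV_torus] by (auto simp: complete_def convergent_def)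
qed

lemma dist_torus_le: "dist x y \<le> real CARD('u)" for x y :: "'u::finite torus"
proof -
  have "dist x y \<le> norm (cube_rep x - cube_rep y)"
    using dist_proj_le [of "cube_rep x" "cube_rep y"] by (simp add: dist_norm)
  also have "\<dots> \<le> (\<Sum>i\<in>UNIV. \<bar>(cube_rep x - cube_rep y) $ i\<bar>)"
    by (rule norm_le_l1_cart)
  also have "\<dots> \<le> (\<Sum>i\<in>(UNIV :: 'u set). 1)"
  proof (rule sum_mono)
    fix i
    show "\<bar>(cube_rep x - cube_rep y) $ i\<bar> \<le> 1"
      using cube_rep_unit_cube [of x] cube_rep_unit_cube [of y]
      by (auto simp: unit_cube_def abs_le_iff) (smt (verit))+
  qed
  finally show ?thesis by simp
qed

lemma measurable_proj [measurable]: "proj \<in> borel_measurable borel"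
  by (intro borel_measurable_continuous_onI continuous_on_proj)

text \<open>The representative jumps, but the sublevel sets of its coordinates below
  \<open>1\<close> are images of compact parts of the closed cube and hence closed.\<close>

lemma measurable_cube_rep [measurable]: "(cube_rep :: 'u::finite torus \<Rightarrow> real^'u) \<in> borel_measurable borel"
proof -
  have le: "closed {x :: 'u torus. cube_rep x $ i \<le> c}" for i and c :: real
  proof (cases "c < 1")
    case True
    have "{x. cube_rep x $ i \<le> c} = proj ` (cbox 0 1 \<inter> {v :: real^'u. v $ i \<le> c})"
    proof (intro set_eqI iffI)
      fix x assume "x \<in> {x. cube_rep x $ i \<le> c}"
      then show "x \<in> proj ` (cbox 0 1 \<inter> {v. v $ i \<le> c})"
        using unit_cube_subset_cbox cube_rep_unit_cube by (intro image_eqI [of _ _ "cube_rep x"]) auto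
    next
      fix x assume "x \<in> proj ` (cbox 0 1 \<inter> {v :: real^'u. v $ i \<le> c})"
      then obtain v where v: "x = proj v" "v \<in> cbox 0 1" "v $ i \<le> c" by auto
      have "0 \<le> v $ i" using v by (auto simp: mem_box_cart)
      then have "vfloor v $ i = 0" using v True by (simp add: vfloor_def floor_eq_iff)
      then show "x \<in> {x. cube_rep x $ i \<le> c}" using v by (simp add: cube_rep_proj)
    qed
    moreover have "closed {v :: real^'u. v $ i \<le> c}"
      by (intro closed_Collect_le continuous_intros)
    ultimately show ?thesis
      by (auto intro!: compact_imp_closed compact_continuous_image continuous_on_proj compact_Int_closed)
  next
    case False
    have "cube_rep x $ i \<le> c" for x :: "'u torus"
      using False cube_rep_unit_cube [of x] unfolding unit_cube_def
      by (metis (mono_tags, lifting) linorder_not_less mem_Collect_eq order.strict_trans2 less_imp_le)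
    then have "{x :: 'u torus. cube_rep x $ i \<le> c} = UNIV" by blast
    then show ?thesis by simp
  qed
  have comp: "(\<lambda>x :: 'u torus. cube_rep x $ i) \<in> borel_measurable borel" for i
    using le by (auto simp: borel_measurable_iff_le borel_closed)
  have "(\<lambda>x :: 'u torus. cube_rep x \<bullet> b) \<in> borel_measurable borel" if "b \<in> Basis" for b
    using that comp by (auto simp: Basis_vec_def inner_axis)
  then show ?thesis by (subst borel_measurable_euclidean_space) simp
qed

lemma measurable_vfloor [measurable]: "(vfloor :: real^'u::finite \<Rightarrow> _) \<in> borel_measurable borel"
proof -
  have "(\<lambda>v. cube_rep (proj v)) \<in> borel_measurable (borel :: (real^'u) measure)" by measurable
  then have "(\<lambda>v :: real^'u. v - cube_rep (proj v)) \<in> borel_measurable borel" by measurable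
  then show ?thesis by (simp add: cube_rep_proj)
qed

lemma sets_unit_cube [measurable]: "unit_cube \<in> sets (borel :: (real^'u::finite) measure)"
proof -
  have "unit_cube = {v :: real^'u. v = v - vfloor v}"
    using diff_in_unit_cube_iff [OF int_lattice_0] by (auto simp: cube_rep_proj)
  moreover have "{v \<in> space borel. v = v - vfloor v} \<in> sets (borel :: (real^'u::finite) measure)" by measurable
  ultimately show ?thesis by simp
qed

lemma emeasure_unit_cube [simp]: "emeasure lborel (unit_cube :: (real^'u::finite) set) = 1"
proof (rule antisym)
  have one: "inner 1 b = 1" if "b \<in> Basis" for b :: "real^'u"
    using that by (auto simp: Basis_vec_def inner_axis)
  have "emeasure lborel (unit_cube :: (real^'u) set) \<le> emeasure lborel (cbox 0 (1 :: real^'u))"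
    by (intro emeasure_mono unit_cube_subset_cbox) simp
  also have "\<dots> = 1" by (subst emeasure_lborel_cbox) (auto simp: one)
  finally show "emeasure lborel (unit_cube :: (real^'u) set) \<le> 1" .
  have "1 = emeasure lborel (box 0 (1 :: real^'u))"
    by (subst emeasure_lborel_box) (auto simp: one)
  also have "\<dots> \<le> emeasure lborel (unit_cube :: (real^'u) set)"
    by (intro emeasure_mono) (auto simp: unit_cube_def mem_box_cart less_imp_le)
  finally show "1 \<le> emeasure lborel (unit_cube :: (real^'u) set)" .
qed

lemma sets_torus_lebesgue [measurable_cong, simp]: "sets torus_lebesgue = sets borel"
  by (simp add: torus_lebesgue_def)

lemma space_torus_lebesgue [simp]: "space torus_lebesgue = UNIV"
  by (simp add: torus_lebesgue_def)

lemma nn_integral_torus: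
  assumes [measurable]: "h \<in> borel_measurable borel"
  shows "(\<integral>\<^sup>+x. h x \<partial>torus_lebesgue) = (\<integral>\<^sup>+v. indicator unit_cube v * h (proj v) \<partial>lborel)"
  by (simp add: torus_lebesgue_def nn_integral_distr uniform_measure_def nn_integral_density divide_ennreal_def
      flip: unit_cube_def)

lemma prob_space_torus: "prob_space (torus_lebesgue :: 'u::finite torus measure)"
proof
  have "emeasure (torus_lebesgue :: 'u torus measure) (space torus_lebesgue) =
    (\<integral>\<^sup>+x. 1 \<partial>(torus_lebesgue :: 'u torus measure))" by simp
  also have "\<dots> = 1" by (subst nn_integral_torus) simp_all
  finally show "emeasure (torus_lebesgue :: 'u torus measure) (space torus_lebesgue) = 1" .
qed

interpretation torus: prob_space "torus_lebesgue :: 'u::finite torus measure"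
  by (rule prob_space_torus)

lemma countable_int_lattice: "countable (int_lattice :: (real^'u::finite) set)"
proof -
  have "int_lattice \<subseteq> range (\<lambda>(n :: 'u \<Rightarrow> int). \<chi> i. of_int (n i))"
  proof
    fix k :: "real^'u" assume "k \<in> int_lattice"
    then have keq: "(\<chi> i. of_int \<lfloor>k $ i\<rfloor>) = k"
      by (auto simp: int_lattice_def vec_eq_iff elim!: Ints_cases)
    show "k \<in> range (\<lambda>(n :: 'u \<Rightarrow> int). \<chi> i. of_int (n i))"
      by (rule image_eqI [where x = "\<lambda>i. \<lfloor>k $ i\<rfloor>"]) (simp_all add: keq)
  qed
  then show ?thesis by (rule countable_subset) simp
qed

lemma finite_int_lattice_bounded:
  assumes "bounded B"
  shows "finite (int_lattice \<inter> B :: (real^'u::finite) set)"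
proof -
  obtain c where c: "\<And>v. v \<in> B \<Longrightarrow> norm v \<le> c"
    using assms by (auto simp: bounded_iff)
  have "int_lattice \<inter> B \<subseteq> (\<lambda>(n :: 'u \<Rightarrow> int). \<chi> i. of_int (n i)) ` (PiE UNIV (\<lambda>_. {- \<lceil>c\<rceil>..\<lceil>c\<rceil>}))"
  proof
    fix k :: "real^'u" assume k: "k \<in> int_lattice \<inter> B"
    then have keq: "(\<chi> i. of_int \<lfloor>k $ i\<rfloor>) = k"
      by (auto simp: int_lattice_def vec_eq_iff elim!: Ints_cases)
    have fl: "\<lfloor>k $ i\<rfloor> \<in> {- \<lceil>c\<rceil>..\<lceil>c\<rceil>}" for i
      using component_le_norm_cart [of k i] c [of k] k
      by (auto simp: le_floor_iff floor_le_iff) linarith+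
    show "k \<in> (\<lambda>(n :: 'u \<Rightarrow> int). \<chi> i. of_int (n i)) ` (PiE UNIV (\<lambda>_. {- \<lceil>c\<rceil>..\<lceil>c\<rceil>}))"
      by (rule image_eqI [where x = "\<lambda>i. \<lfloor>k $ i\<rfloor>"]) (use keq fl in \<open>simp_all add: PiE_UNIV_domain\<close>)
  qed
  then show ?thesis by (rule finite_subset) (intro finite_imageI finite_PiE; simp)
qed

lemma nn_integral_count_space_single:
  assumes "a \<in> A"
  shows "(\<integral>\<^sup>+m. indicator {a} m \<partial>count_space A) = 1"
  using assms by (subst nn_integral_indicator) auto

lemma nn_integral_lborel_shift:
  fixes t :: "'a::euclidean_space"
  assumes [measurable]: "g \<in> borel_measurable borel"
  shows "(\<integral>\<^sup>+v. g v \<partial>lborel) = (\<integral>\<^sup>+v. g (v + t) \<partial>lborel)"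
proof -
  have "(\<integral>\<^sup>+v. g v \<partial>lborel) = (\<integral>\<^sup>+v. g v \<partial>distr lborel borel ((+) t))"
    by (simp add: lborel_distr_plus)
  then show ?thesis by (simp add: nn_integral_distr add.commute)
qed

text \<open>Any weight whose lattice translates add up to \<open>1\<close> integrates periodic
  functions in the same way as the unit cube: insert the partition of unity by translated cubes,
  and move each translation from the cube to the weight. This compares the unit cube with its
  image under \<open>E\<close>.\<close>

lemma fundamental_domain:
  fixes F :: "real^'u::finite \<Rightarrow> ennreal"
  assumes [measurable]: "F \<in> borel_measurable borel" "H \<in> borel_measurable borel"
    and part: "\<And>w. (\<integral>\<^sup>+m. F (w + m) \<partial>count_space int_lattice) = 1"
    and per: "\<And>v m. m \<in> int_lattice \<Longrightarrow> H (v + m) = H v"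
  shows "(\<integral>\<^sup>+v. F v * H v \<partial>lborel) = (\<integral>\<^sup>+v. indicator unit_cube v * H v \<partial>lborel)"
proof -
  let ?C = "count_space (int_lattice :: (real^'u) set)"
  let ?I = "indicator unit_cube :: real^'u \<Rightarrow> ennreal"
  have one: "(\<integral>\<^sup>+m. ?I (v - m) \<partial>?C) = 1" for v
  proof -
    have "(\<integral>\<^sup>+m. ?I (v - m) \<partial>?C) = (\<integral>\<^sup>+m. indicator {vfloor v} m \<partial>?C)"
      by (intro nn_integral_cong) (auto simp: diff_in_unit_cube_iff indicator_def)
    then show ?thesis using nn_integral_count_space_single by simp
  qed
  have "(\<integral>\<^sup>+v. F v * H v \<partial>lborel) = (\<integral>\<^sup>+v. (\<integral>\<^sup>+m. F v * H v * ?I (v - m) \<partial>?C) \<partial>lborel)"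
    by (simp add: nn_integral_cmult one)
  also have "\<dots> = (\<integral>\<^sup>+m. (\<integral>\<^sup>+v. F v * H v * ?I (v - m) \<partial>lborel) \<partial>?C)"
    by (rule nn_integral_count_space_nn_integral) (auto simp: countable_int_lattice)
  also have "\<dots> = (\<integral>\<^sup>+m. (\<integral>\<^sup>+v. F (v + m) * H v * ?I v \<partial>lborel) \<partial>?C)"
  proof (rule nn_integral_cong)
    fix m assume "m \<in> space ?C"
    then show "(\<integral>\<^sup>+v. F v * H v * ?I (v - m) \<partial>lborel) = (\<integral>\<^sup>+v. F (v + m) * H v * ?I v \<partial>lborel)"
      by (subst nn_integral_lborel_shift [of _ m]) (simp_all add: per)
  qed
  also have "\<dots> = (\<integral>\<^sup>+v. (\<integral>\<^sup>+m. F (v + m) * H v * ?I v \<partial>?C) \<partial>lborel)"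
    by (rule nn_integral_count_space_nn_integral [symmetric]) (auto simp: countable_int_lattice)
  also have "\<dots> = (\<integral>\<^sup>+v. ?I v * H v \<partial>lborel)"
    unfolding mult.assoc by (simp add: nn_integral_multc part mult.commute)
  finally show ?thesis .
qed

section \<open>Inverse branches of expanding endomorphisms\<close>

lemma emeasure_torus_UNIV [simp]: "emeasure torus_lebesgue UNIV = 1"
  using prob_space.emeasure_space_1 [OF prob_space_torus] by simp

locale torus_endo =
  fixes E :: "('u::finite) lin"
  assumes expanding: "E \<in> expanding_maps"
begin

definition Ei :: "real^'u \<Rightarrow> real^'u" where "Ei = inv (blinfun_apply E)"

definition lam :: real where "lam = onorm Ei"

definition preimages :: "nat \<Rightarrow> 'u torus \<Rightarrow> 'u torus set" where
  "preimages n x = {a. (torus_map E ^^ n) a = x}"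

text \<open>One representative of each coset of the lattice modulo its image under
  \<open>E\<close>. Each digit selects an inverse branch of \<open>E\<close>.\<close>

definition digits :: "(real^'u) set" where
  "digits = int_lattice \<inter> blinfun_apply E ` unit_cube"

text \<open>An inverse branch that is defined on the whole torus and affine on the unit cube,
  hence in general discontinuous across the boundary of the cube.\<close>

definition branch :: "real^'u \<Rightarrow> 'u torus \<Rightarrow> 'u torus" where
  "branch k x = proj (Ei (cube_rep x + k))"

definition deg :: real where "deg = \<bar>lin_det E\<bar>"

lemma bij_E: "bij (blinfun_apply E)" and E_lattice: "k \<in> int_lattice \<Longrightarrow> blinfun_apply E k \<in> int_lattice"
  and lam_less_1: "lam < 1"
  using expanding by (auto simp: expanding_maps_def lam_def Ei_def)

lemma E_Ei [simp]: "blinfun_apply E (Ei v) = v" and Ei_E [simp]: "Ei (blinfun_apply E v) = v"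
  using bij_E by (simp_all add: Ei_def bij_is_surj surj_f_inv_f bij_is_inj)

lemma linear_Ei: "linear Ei"
  unfolding Ei_def
  by (intro inj_linear_imp_inv_linear bounded_linear.linear [OF blinfun.bounded_linear_right] bij_is_inj bij_E)

lemma bounded_linear_Ei: "bounded_linear Ei"
  using linear_Ei linear_conv_bounded_linear by blast

lemma measurable_Ei [measurable]: "Ei \<in> borel_measurable borel"
  using linear_continuous_on [OF bounded_linear_Ei] borel_measurable_continuous_onI by blast

lemma lam_nonneg: "0 \<le> lam"
  unfolding lam_def using bounded_linear_Ei by (rule onorm_pos_le)

lemma norm_Ei: "norm (Ei v) \<le> lam * norm v"
  unfolding lam_def using bounded_linear_Ei by (rule onorm)

lemma norm_Ei_pow: "norm ((Ei ^^ n) v) \<le> lam ^ n * norm v"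
proof (induction n)
  case (Suc n)
  have "norm ((Ei ^^ Suc n) v) \<le> lam * norm ((Ei ^^ n) v)" using norm_Ei by simp
  also have "\<dots> \<le> lam * (lam ^ n * norm v)" by (intro mult_left_mono Suc lam_nonneg)
  finally show ?case by (simp add: mult.assoc)
qed simp

lemma lam_pos: "0 < lam"
proof (rule ccontr)
  assume "\<not> 0 < lam"
  then have "lam = 0" using lam_nonneg by simp
  then have "(v :: real^'u) = 0" for v using norm_Ei [of "blinfun_apply E v"] by simp
  then show False by (metis zero_neq_one)
qed

lemma torus_map_tadd: "torus_map E (tadd x t) = tadd (torus_map E x) (blinfun_apply E t)"
  by (cases x rule: proj_cases) (simp add: torus_map_proj [OF expanding] blinfun.add_right)

text \<open>Moving a point \<open>a\<close> by \<open>E\<^sup>-\<^sup>n t\<close> moves its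
  \<open>n\<close>-th image by \<open>t\<close>. All statements about the local inverse branches
  of the \<open>n\<close>-th iterate reduce to this identity.\<close>

lemma torus_map_pow_tadd: "(torus_map E ^^ n) (tadd a ((Ei ^^ n) t)) = tadd ((torus_map E ^^ n) a) t"
proof (induction n arbitrary: t)
  case (Suc n)
  have "(Ei ^^ Suc n) t = (Ei ^^ n) (Ei t)" by (simp only: funpow_Suc_right o_apply)
  then show ?case using Suc [of "Ei t"] by (simp add: torus_map_tadd del: funpow.simps(2)) (simp add: torus_map_tadd)
qed simp

lemma tadd_inj: "tadd a t = tadd b t \<longleftrightarrow> a = b"
proof
  assume "tadd a t = tadd b t"
  then have "tadd (tadd a t) (- t) = tadd (tadd b t) (- t)" by simp
  then show "a = b" by simp
qed simp

text \<open>The set of preimages moves rigidly with the base point: translation by a vector of the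
  covering space lifts to a bijection of the preimages, although no branch is globally continuous.\<close>

lemma preimages_tadd:
  "preimages n (tadd x t) = (\<lambda>a. tadd a ((Ei ^^ n) t)) ` preimages n x"
proof (intro set_eqI iffI)
  fix a assume "a \<in> preimages n (tadd x t)"
  then have a: "(torus_map E ^^ n) a = tadd x t" by (simp add: preimages_def)
  have lin: "linear (Ei ^^ n)"
    by (induction n) (simp_all only: funpow.simps linear_id linear_compose linear_Ei)
  have "(torus_map E ^^ n) (tadd a ((Ei ^^ n) (- t))) = x"
    by (simp add: torus_map_pow_tadd a)
  moreover have "a = tadd (tadd a ((Ei ^^ n) (- t))) ((Ei ^^ n) t)"
    using linear_neg [OF lin] by simp
  ultimately show "a \<in> (\<lambda>a. tadd a ((Ei ^^ n) t)) ` preimages n x"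
    unfolding preimages_def by blast
qed (auto simp: preimages_def torus_map_pow_tadd)

lemma sum_preimages_tadd:
  "(\<Sum>a\<in>preimages n (tadd x t). g a) = (\<Sum>a\<in>preimages n x. g (tadd a ((Ei ^^ n) t)))"
  unfolding preimages_tadd by (subst sum.reindex) (auto simp: inj_on_def tadd_inj)

text \<open>Two digits give the same preimage only if their images under
  \<open>E\<^sup>-\<^sup>1\<close> differ by a lattice vector, but these images lie in the unit
  cube. Every preimage is reached by subtracting the integral part of the image under
  \<open>E\<^sup>-\<^sup>1\<close>.\<close>

lemma bij_digits: "bij_betw (\<lambda>k. proj (Ei (v + k))) digits {a. torus_map E a = proj v}"
  unfolding bij_betw_def
proof
  show "inj_on (\<lambda>k. proj (Ei (v + k))) digits"
  proof (rule inj_onI)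
    fix k l assume kl: "k \<in> digits" "l \<in> digits" and "proj (Ei (v + k)) = proj (Ei (v + l))"
    then have "Ei (v + k) - Ei (v + l) \<in> int_lattice" by (simp add: proj_eq_iff)
    then have "Ei k - Ei l \<in> int_lattice" by (simp add: linear_add [OF linear_Ei])
    moreover have "Ei k \<in> unit_cube" "Ei l \<in> unit_cube" using kl by (auto simp: digits_def)
    ultimately have "Ei k = Ei l" by (intro unit_cube_eqI)
    then show "k = l" by (metis E_Ei)
  qed
  show "(\<lambda>k. proj (Ei (v + k))) ` digits = {a. torus_map E a = proj v}"
  proof (intro set_eqI iffI)
    fix a assume "a \<in> (\<lambda>k. proj (Ei (v + k))) ` digits"
    then show "a \<in> {a. torus_map E a = proj v}"
      by (auto simp: torus_map_proj [OF expanding] digits_def)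
  next
    fix a assume "a \<in> {a. torus_map E a = proj v}"
    moreover obtain w where w: "a = proj w" by (rule proj_cases)
    ultimately have l: "blinfun_apply E w - v \<in> int_lattice"
      by (simp add: torus_map_proj [OF expanding] proj_eq_iff)
    define m where "m = vfloor (Ei (blinfun_apply E w - v))"
    define k where "k = blinfun_apply E w - v - blinfun_apply E m"
    have "k \<in> int_lattice" unfolding k_def m_def by (intro int_lattice_diff l E_lattice) simp
    moreover have "Ei k \<in> unit_cube"
      unfolding k_def m_def by (simp add: linear_diff [OF linear_Ei])
    then have "k \<in> blinfun_apply E ` unit_cube" by (metis E_Ei image_eqI)
    ultimately have "k \<in> digits" by (simp add: digits_def)
    moreover have "Ei (v + k) = w - m"
      unfolding k_def by (simp add: linear_diff [OF linear_Ei])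
    then have "proj (Ei (v + k)) = a" using w by (simp add: m_def)
    ultimately show "a \<in> (\<lambda>k. proj (Ei (v + k))) ` digits" by blast
  qed
qed

lemma bij_branch: "bij_betw (\<lambda>k. branch k x) digits (preimages 1 x)"
  using bij_digits [of "cube_rep x"] by (simp add: branch_def preimages_def)

lemma torus_map_branch: "k \<in> digits \<Longrightarrow> torus_map E (branch k x) = x"
  using bij_branch [of x] by (auto simp: bij_betw_def preimages_def)

lemma finite_digits [simp]: "finite digits"
proof -
  have "bounded (unit_cube :: (real^'u) set)"
    using bounded_subset [OF bounded_cbox unit_cube_subset_cbox] .
  then have "bounded (blinfun_apply E ` unit_cube)"
    by (rule bounded_linear_image) (rule blinfun.bounded_linear_right)
  then show ?thesis unfolding digits_def by (rule finite_int_lattice_bounded)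
qed

lemma sum_preimages_branch: "(\<Sum>a\<in>preimages 1 x. g a) = (\<Sum>k\<in>digits. g (branch k x))"
  using sum.reindex_bij_betw [OF bij_branch, of g x] by simp

lemma measurable_branch [measurable]: "branch k \<in> borel_measurable borel"
  unfolding branch_def by measurable

text \<open>Like the image of the unit cube under \<open>E\<close>, the union of the cubes
  translated by the digits is a fundamental domain of the image of the lattice: for given
  \<open>w\<close>, exactly one lattice vector \<open>m\<close> makes the integral part of
  \<open>E(w + m)\<close> a digit.\<close>

lemma digits_partition:
  "(\<integral>\<^sup>+m. (\<Sum>k\<in>digits. indicator unit_cube (blinfun_apply E (w + m) - k)) \<partial>count_space int_lattice) = (1::ennreal)"
proof -
  \<comment> \<open>The only possible digit for \<open>m\<close> is \<open>l + E m\<close>, and it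
    is a digit precisely for \<open>m = m0\<close>.\<close>
  define l where "l = vfloor (blinfun_apply E w)"
  define m0 where "m0 = - vfloor (Ei l)"
  have *: "(\<Sum>k\<in>digits. indicator unit_cube (blinfun_apply E (w + m) - k)) = (indicator {m0} m :: ennreal)"
    if m: "m \<in> int_lattice" for m
  proof -
    have "indicator unit_cube (blinfun_apply E (w + m) - k) = (if k = l + blinfun_apply E m then 1 else 0 :: ennreal)"
      if "k \<in> digits" for k
    proof -
      have "blinfun_apply E (w + m) - k = blinfun_apply E w - (k - blinfun_apply E m)"
        by (simp add: blinfun.add_right)
      moreover have "k - blinfun_apply E m \<in> int_lattice"
        using that m by (auto simp: digits_def intro: int_lattice_diff E_lattice)
      ultimately show ?thesis
        using diff_in_unit_cube_iff [of "k - blinfun_apply E m" "blinfun_apply E w"]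
        by (auto simp: l_def indicator_def algebra_simps)
    qed
    then have "(\<Sum>k\<in>digits. indicator unit_cube (blinfun_apply E (w + m) - k)) =
      (\<Sum>k\<in>digits. if k = l + blinfun_apply E m then 1 else 0 :: ennreal)" by (rule sum.cong [OF refl])
    also have "\<dots> = (if l + blinfun_apply E m \<in> digits then 1 else 0)" by simp
    also have "l + blinfun_apply E m \<in> digits \<longleftrightarrow> Ei l + m \<in> unit_cube"
    proof -
      have "l + blinfun_apply E m \<in> int_lattice" using m by (auto simp: l_def intro: int_lattice_add E_lattice)
      moreover have "l + blinfun_apply E m = blinfun_apply E (Ei l + m)" by (simp add: blinfun.add_right)
      ultimately show ?thesis
        unfolding digits_def using bij_E by (auto simp: bij_is_inj inj_image_mem_iff)
    qed
    also have "Ei l + m \<in> unit_cube \<longleftrightarrow> m = m0"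
      using diff_in_unit_cube_iff [OF int_lattice_minus [OF m], of "Ei l"] minus_equation_iff [of m "vfloor (Ei l)"]
      by (auto simp: m0_def)
    finally show ?thesis by (simp add: indicator_def)
  qed
  have "(\<integral>\<^sup>+m. (\<Sum>k\<in>digits. indicator unit_cube (blinfun_apply E (w + m) - k)) \<partial>count_space int_lattice) =
    (\<integral>\<^sup>+m. indicator {m0} m \<partial>count_space int_lattice)"
    by (intro nn_integral_cong) (auto simp: *)
  also have "\<dots> = 1"
    by (rule nn_integral_count_space_single) (auto simp: m0_def int_lattice_minus)
  finally show ?thesis .
qed

text \<open>The branches together map the unit cube onto a region that the lattice translates
  cover exactly once, and \<open>E\<close> expands volume by the factor \<open>deg\<close>.\<close>

lemma nn_integral_branches:
  assumes [measurable]: "h \<in> borel_measurable borel"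
  shows "(\<integral>\<^sup>+x. (\<Sum>k\<in>digits. h (branch k x)) \<partial>torus_lebesgue) = ennreal deg * (\<integral>\<^sup>+x. h x \<partial>torus_lebesgue)"
proof -
  have mE [measurable]: "blinfun_apply E \<in> borel_measurable borel"
    by (intro borel_measurable_continuous_onI linear_continuous_on blinfun.bounded_linear_right)
  let ?I = "indicator unit_cube :: real^'u \<Rightarrow> ennreal"
  have branch_sum: "(\<Sum>k\<in>digits. h (branch k (proj v))) = (\<Sum>k\<in>digits. h (proj (Ei (v + k))))" for v
    using sum.reindex_bij_betw [OF bij_digits, of h v] sum_preimages_branch [of h "proj v"]
    by (simp add: preimages_def)
  have "(\<integral>\<^sup>+x. (\<Sum>k\<in>digits. h (branch k x)) \<partial>torus_lebesgue) =
    (\<integral>\<^sup>+v. ?I v * (\<Sum>k\<in>digits. h (branch k (proj v))) \<partial>lborel)"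
    by (rule nn_integral_torus) measurable
  also have "\<dots> = (\<integral>\<^sup>+v. (\<Sum>k\<in>digits. ?I v * h (proj (Ei (v + k)))) \<partial>lborel)"
    by (simp add: branch_sum sum_distrib_left)
  also have "\<dots> = (\<Sum>k\<in>digits. (\<integral>\<^sup>+v. ?I v * h (proj (Ei (v + k))) \<partial>lborel))"
    by (rule nn_integral_sum) measurable
  also have "\<dots> = (\<Sum>k\<in>digits. (\<integral>\<^sup>+v. ?I (v - k) * h (proj (Ei v)) \<partial>lborel))"
  proof (rule sum.cong [OF refl])
    fix k
    show "(\<integral>\<^sup>+v. ?I v * h (proj (Ei (v + k))) \<partial>lborel) = (\<integral>\<^sup>+v. ?I (v - k) * h (proj (Ei v)) \<partial>lborel)"
      by (subst (2) nn_integral_lborel_shift [of _ k]) simp_all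
  qed
  also have "\<dots> = (\<integral>\<^sup>+v. (\<Sum>k\<in>digits. ?I (v - k)) * h (proj (Ei v)) \<partial>lborel)"
    by (subst nn_integral_sum [symmetric]) (auto simp: sum_distrib_right)
  also have "\<dots> = ennreal deg * (\<integral>\<^sup>+w. (\<Sum>k\<in>digits. ?I (blinfun_apply E w - k)) * h (proj w) \<partial>lborel)"
    using nn_integral_linear_bij [of "blinfun_apply E" "\<lambda>v. (\<Sum>k\<in>digits. ?I (v - k)) * h (proj (Ei v))"] bij_E
    by (simp add: deg_def lin_det_def linear_conv_bounded_linear blinfun.bounded_linear_right)
  also have "(\<integral>\<^sup>+w. (\<Sum>k\<in>digits. ?I (blinfun_apply E w - k)) * h (proj w) \<partial>lborel) =
    (\<integral>\<^sup>+w. ?I w * h (proj w) \<partial>lborel)"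
    by (rule fundamental_domain) (auto simp: digits_partition)
  also have "\<dots> = (\<integral>\<^sup>+x. h x \<partial>torus_lebesgue)"
    by (rule nn_integral_torus [symmetric]) measurable
  finally show ?thesis .
qed

text \<open>The index of the sublattice is the determinant, obtained here by integrating the
  constant function \<open>1\<close> over all branches.\<close>

lemma card_digits: "real (card digits) = deg"
proof -
  have "ennreal (real (card digits)) = ennreal deg"
    using nn_integral_branches [of "\<lambda>_. 1"] by (simp add: ennreal_of_nat_eq_real_of_nat)
  then show ?thesis by (simp add: deg_def)
qed

lemma digits_nonempty: "digits \<noteq> {}"
proof -
  have "0 \<in> digits"
    unfolding digits_def using linear_0 [OF linear_Ei]
    by (auto intro!: image_eqI [of _ _ 0] simp: unit_cube_def)
  then show ?thesis by blast
qed

lemma deg_pos: "0 < deg"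
  using card_digits digits_nonempty by (metis card_gt_0_iff finite_digits of_nat_0_less_iff)

lemma preimages_0 [simp]: "preimages 0 x = {x}"
  by (auto simp: preimages_def)

lemma preimages_Suc: "preimages (Suc n) x = (\<Union>b\<in>preimages 1 x. preimages n b)"
  by (auto simp: preimages_def)

lemma finite_preimages [simp]: "finite (preimages n x)"
proof (induction n arbitrary: x)
  case (Suc n)
  have "finite (preimages 1 x)" using bij_branch finite_digits bij_betw_finite by blast
  then show ?case unfolding preimages_Suc by (intro finite_UN_I Suc)
qed simp

lemma sum_preimages_add:
  "(\<Sum>a\<in>preimages (m + n) x. g a) = (\<Sum>b\<in>preimages m x. \<Sum>a\<in>preimages n b. g a)"
proof -
  have "(\<Sum>a\<in>preimages (m + n) x. g a) =
    (\<Sum>b\<in>preimages m x. \<Sum>a\<in>{a \<in> preimages (m + n) x. (torus_map E ^^ n) a = b}. g a)"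
    by (rule sum.group [symmetric]) (simp_all, auto simp: preimages_def funpow_add)
  also have "\<dots> = (\<Sum>b\<in>preimages m x. \<Sum>a\<in>preimages n b. g a)"
    by (intro sum.cong refl) (auto simp: preimages_def funpow_add)
  finally show ?thesis .
qed

lemma card_preimages: "real (card (preimages n x)) = deg ^ n"
proof (induction n arbitrary: x)
  case (Suc n)
  have "real (card (preimages (Suc n) x)) = (\<Sum>a\<in>preimages (1 + n) x. 1)" by simp
  also have "\<dots> = (\<Sum>b\<in>preimages 1 x. deg ^ n)"
    unfolding sum_preimages_add using Suc by simp
  also have "\<dots> = deg ^ Suc n"
    using bij_betw_same_card [OF bij_branch, of x] card_digits by simp
  finally show ?case .
qed simp

lemma torus_map_lipschitz: "dist (torus_map E x) (torus_map E y) \<le> norm E * dist x y"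
proof -
  obtain t where t: "y = tadd x t" "norm t = dist x y" by (rule torus_lift)
  have "dist (torus_map E x) (torus_map E y) \<le> norm (blinfun_apply E t)"
    unfolding t torus_map_tadd by (rule dist_tadd_le)
  also have "\<dots> \<le> norm E * norm t" by (rule norm_blinfun)
  finally show ?thesis using t by simp
qed

lemma continuous_torus_map: "continuous_on UNIV (torus_map E)"
proof -
  have "(norm E)-lipschitz_on UNIV (torus_map E)"
    by (rule lipschitz_onI) (auto simp: torus_map_lipschitz)
  then show ?thesis by (rule lipschitz_on_continuous_on)
qed

lemma measurable_torus_map [measurable]: "torus_map E \<in> borel_measurable borel"
  by (intro borel_measurable_continuous_onI continuous_torus_map)

lemma nn_integral_torus_map:
  assumes [measurable]: "h \<in> borel_measurable borel"
  shows "(\<integral>\<^sup>+x. h (torus_map E x) \<partial>torus_lebesgue) = (\<integral>\<^sup>+x. h x \<partial>torus_lebesgue)"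
proof -
  have "ennreal deg * (\<integral>\<^sup>+x. h (torus_map E x) \<partial>torus_lebesgue) =
    (\<integral>\<^sup>+x. (\<Sum>k\<in>digits. h (torus_map E (branch k x))) \<partial>torus_lebesgue)"
    by (rule nn_integral_branches [symmetric]) measurable
  also have "\<dots> = (\<integral>\<^sup>+x. ennreal deg * h x \<partial>torus_lebesgue)"
    by (intro nn_integral_cong) (simp add: torus_map_branch card_digits [symmetric] ennreal_of_nat_eq_real_of_nat)
  also have "\<dots> = ennreal deg * (\<integral>\<^sup>+x. h x \<partial>torus_lebesgue)"
    by (rule nn_integral_cmult) simp
  finally show ?thesis
    using deg_pos by (simp add: ennreal_mult_cancel_left)
qed

lemma distr_torus_map: "distr torus_lebesgue borel (torus_map E) = torus_lebesgue"
proof (rule measure_eqI)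
  fix A assume "A \<in> sets (distr (torus_lebesgue :: 'u torus measure) borel (torus_map E))"
  then have [measurable]: "A \<in> sets borel" by simp
  have "emeasure (distr torus_lebesgue borel (torus_map E)) A = (\<integral>\<^sup>+x. indicator A (torus_map E x) \<partial>torus_lebesgue)"
    by (subst nn_integral_indicator [symmetric], simp, subst nn_integral_distr) simp_all
  also have "\<dots> = emeasure torus_lebesgue A"
    by (subst nn_integral_torus_map) simp_all
  finally show "emeasure (distr torus_lebesgue borel (torus_map E)) A = emeasure torus_lebesgue A" .
qed simp

end

section \<open>Decay of correlations and Birkhoff averages\<close>

text \<open>Between consecutive squares \<open>j\<^sup>2\<close> and \<open>(j +
  1)\<^sup>2\<close> a bounded sequence adds at most \<open>(2j + 1) M\<close> to its partial
  sums, which is negligible against \<open>j\<^sup>2\<close>.\<close>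

lemma averages_tendsto_0_from_squares:
  fixes X :: "nat \<Rightarrow> real"
  assumes bnd: "\<And>k. \<bar>X k\<bar> \<le> M"
    and sq: "(\<lambda>j. (\<Sum>k<j^2. X k) / real (j^2)) \<longlonglongrightarrow> 0"
  shows "(\<lambda>n. (\<Sum>k<n. X k) / real n) \<longlonglongrightarrow> 0"
proof -
  \<comment> \<open>The square \<open>(s n)\<^sup>2\<close> is the largest one not exceeding
    \<open>n\<close>.\<close>
  define s where "s n = nat \<lfloor>sqrt (real n)\<rfloor>" for n
  have M: "0 \<le> M" using bnd [of 0] by simp
  have s_le: "(s n)^2 \<le> n" for n
  proof -
    have "real (s n) \<le> sqrt (real n)" by (simp add: s_def)
    then have "(real (s n))^2 \<le> real n" by (metis of_nat_0_le_iff power_mono real_sqrt_pow2)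
    then show ?thesis by (metis of_nat_le_iff of_nat_power)
  qed
  have n_le: "real n \<le> (real (s n) + 1)^2" for n
  proof -
    have "sqrt (real n) \<le> real (s n) + 1" by (simp add: s_def)
    then show ?thesis by (metis power_mono real_sqrt_ge_zero real_sqrt_pow2 of_nat_0_le_iff)
  qed
  have s_top: "filterlim s at_top sequentially"
    unfolding s_def
    by (intro filterlim_compose [OF filterlim_nat_sequentially] filterlim_compose [OF filterlim_floor_sequentially]
        filterlim_compose [OF sqrt_at_top] filterlim_real_sequentially)
  let ?A = "\<lambda>j. (\<Sum>k<j^2. X k) / real (j^2)"
  have 1: "(\<lambda>n. \<bar>?A (s n)\<bar> + M * (2 / real (s n) + 1 / (real (s n))^2)) \<longlonglongrightarrow> 0 + M * (0 + 0)"
  proof -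
    have "(\<lambda>j. M * (2 / real j + 1 / (real j)^2)) \<longlonglongrightarrow> M * (0 + 0)"
      by (intro tendsto_intros) real_asymp+
    moreover have "(\<lambda>j. \<bar>?A j\<bar>) \<longlonglongrightarrow> 0" using sq by (rule tendsto_rabs_zero)
    ultimately have "(\<lambda>j. \<bar>?A j\<bar> + M * (2 / real j + 1 / (real j)^2)) \<longlonglongrightarrow> 0 + M * (0 + 0)"
      by (rule tendsto_add [rotated])
    then show ?thesis by (rule filterlim_compose [OF _ s_top])
  qed
  have 2: "\<bar>(\<Sum>k<n. X k) / real n\<bar> \<le> \<bar>?A (s n)\<bar> + M * (2 / real (s n) + 1 / (real (s n))^2)" if "n > 0" "s n > 0" for n
  proof -
    let ?j = "s n"
    have "(\<Sum>k<n. X k) = (\<Sum>k<?j^2. X k) + (\<Sum>k\<in>{?j^2..<n}. X k)"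
      using s_le [of n] by (simp add: sum.atLeastLessThan_concat lessThan_atLeast0)
    moreover have "\<bar>\<Sum>k\<in>{?j^2..<n}. X k\<bar> \<le> (\<Sum>k\<in>{?j^2..<n}. M)"
      by (intro order_trans [OF sum_abs] sum_mono bnd)
    then have "\<bar>\<Sum>k\<in>{?j^2..<n}. X k\<bar> \<le> (real n - real (?j^2)) * M"
      using s_le [of n] by (simp add: of_nat_diff)
    moreover have "(real n - real (?j^2)) * M \<le> (2 * real ?j + 1) * M"
      using n_le [of n] M by (intro mult_right_mono) (simp_all add: power2_eq_square algebra_simps)
    ultimately have b: "\<bar>\<Sum>k<n. X k\<bar> \<le> \<bar>\<Sum>k<?j^2. X k\<bar> + (2 * real ?j + 1) * M"
      by linarith
    have j: "0 < (real ?j)^2" "(real ?j)^2 \<le> real n" using that s_le [of n] by (simp_all flip: of_nat_power)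
    have "\<bar>(\<Sum>k<n. X k) / real n\<bar> = \<bar>\<Sum>k<n. X k\<bar> / real n" by simp
    also have "\<dots> \<le> (\<bar>\<Sum>k<?j^2. X k\<bar> + (2 * real ?j + 1) * M) / real n"
      using b by (rule divide_right_mono) simp
    also have "\<dots> \<le> (\<bar>\<Sum>k<?j^2. X k\<bar> + (2 * real ?j + 1) * M) / (real ?j)^2"
      using j M that by (intro divide_left_mono mult_pos_pos add_nonneg_nonneg mult_nonneg_nonneg) auto
    also have "\<dots> = \<bar>?A (s n)\<bar> + M * (2 / real (s n) + 1 / (real (s n))^2)"
    proof -
      have "(a + (2 * t + 1) * M) / t^2 = a / t^2 + M * (2 / t + 1 / t^2)" if "t > 0" for a t
        using that by (simp add: divide_simps power2_eq_square)
      from this [of "real (s n)" "\<bar>\<Sum>k<?j^2. X k\<bar>"] that show ?thesis by (simp add: abs_divide)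
    qed
    finally show ?thesis .
  qed
  have ev: "eventually (\<lambda>n. n > 0 \<and> s n > 0) sequentially"
  proof -
    have "eventually (\<lambda>n. 1 \<le> s n) sequentially" using s_top by (simp add: filterlim_at_top)
    with eventually_gt_at_top [of "0::nat"] show ?thesis by eventually_elim simp
  qed
  show ?thesis
  proof (rule Lim_null_comparison)
    show "\<forall>\<^sub>F n in sequentially. norm ((\<Sum>k<n. X k) / real n) \<le> \<bar>?A (s n)\<bar> + M * (2 / real (s n) + 1 / (real (s n))^2)"
      using ev by eventually_elim (use 2 in simp)
    show "(\<lambda>n. \<bar>?A (s n)\<bar> + M * (2 / real (s n) + 1 / (real (s n))^2)) \<longlonglongrightarrow> 0" using 1 by simp
  qed
qed

lemma measure_torus_UNIV [simp]: "measure torus_lebesgue UNIV = 1"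
  by (simp add: measure_def)

lemma integral_eq_enn2real:
  assumes "f \<in> borel_measurable M" "\<And>x. 0 \<le> f x"
  shows "integral\<^sup>L M f = enn2real (\<integral>\<^sup>+x. ennreal (f x) \<partial>M)"
  using assms by (intro integral_eq_nn_integral) auto

lemma integrable_torus:
  fixes h :: "'u::finite torus \<Rightarrow> real"
  assumes "h \<in> borel_measurable borel" "\<And>x. \<bar>h x\<bar> \<le> B"
  shows "integrable torus_lebesgue h"
  using assms by (intro finite_measure.integrable_const_bound [where B = B])
    (auto intro: prob_space.finite_measure prob_space_torus)

context torus_endo begin

lemma measurable_torus_map_pow [measurable]: "(torus_map E ^^ n) \<in> borel_measurable borel"
  by (induction n) (simp_all add: measurable_comp)

lemma integral_branches:
  assumes h [measurable]: "h \<in> borel_measurable borel" and B: "\<And>x. \<bar>h x\<bar> \<le> B"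
  shows "(\<integral>x. (\<Sum>k\<in>digits. h (branch k x)) \<partial>torus_lebesgue) = deg * (\<integral>x. h x \<partial>torus_lebesgue)"
proof -
  have pos: "(\<integral>x. (\<Sum>k\<in>digits. g (branch k x)) \<partial>torus_lebesgue) = deg * (\<integral>x. g x \<partial>torus_lebesgue)"
    if [measurable]: "g \<in> borel_measurable borel" and g: "\<And>x. 0 \<le> g x" for g
    using nn_integral_branches [of "\<lambda>x. ennreal (g x)"] deg_pos g
    by (simp add: integral_eq_enn2real sum_nonneg sum_ennreal enn2real_mult)
  have i: "integrable torus_lebesgue (\<lambda>x. h (branch k x))" for k
    by (rule integrable_torus [where B = B]) (auto simp: B)
  have "0 \<le> h x + B" for x using B [of x] by linarith
  then have "(\<integral>x. (\<Sum>k\<in>digits. h (branch k x) + B) \<partial>torus_lebesgue) = deg * (\<integral>x. h x + B \<partial>torus_lebesgue)"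
    using pos [of "\<lambda>x. h x + B"] by simp
  then show ?thesis
    using i integrable_torus [OF h B]
    by (simp add: sum.distrib card_digits algebra_simps)
qed

text \<open>Averaging over the \<open>n\<close>-th preimages: the Perron--Frobenius operator of
  the endomorphism with respect to Lebesgue measure.\<close>

definition transfer :: "nat \<Rightarrow> ('u torus \<Rightarrow> real) \<Rightarrow> 'u torus \<Rightarrow> real" where
  "transfer n h x = (\<Sum>a\<in>preimages n x. h a) / deg ^ n"

lemma transfer_0 [simp]: "transfer 0 h = h"
  by (simp add: transfer_def fun_eq_iff)

lemma transfer_Suc: "transfer (Suc n) h x = (\<Sum>k\<in>digits. transfer n h (branch k x)) / deg"
proof -
  have "(\<Sum>a\<in>preimages (Suc n) x. h a) = (\<Sum>k\<in>digits. \<Sum>a\<in>preimages n (branch k x). h a)"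
    using sum_preimages_add [of h 1 n x] by (simp only: sum_preimages_branch plus_1_eq_Suc)
  then show ?thesis by (simp add: transfer_def sum_divide_distrib mult.commute)
qed

lemma transfer_measurable [measurable]:
  "h \<in> borel_measurable borel \<Longrightarrow> transfer n h \<in> borel_measurable borel"
proof (induction n)
  case (Suc n)
  then have [measurable]: "transfer n h \<in> borel_measurable borel" by simp
  have "(\<lambda>x. (\<Sum>k\<in>digits. transfer n h (branch k x)) / deg) \<in> borel_measurable borel" by measurable
  then show ?case by (simp add: transfer_Suc [abs_def])
qed simp

lemma transfer_le:
  assumes "\<And>x. \<bar>h x\<bar> \<le> B" shows "\<bar>transfer n h x\<bar> \<le> B"
proof -
  have "\<bar>\<Sum>a\<in>preimages n x. h a\<bar> \<le> (\<Sum>a\<in>preimages n x. B)"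
    by (intro order_trans [OF sum_abs] sum_mono assms)
  also have "\<dots> = deg ^ n * B" by (simp add: card_preimages)
  finally show ?thesis using deg_pos by (simp add: transfer_def abs_divide divide_le_eq mult.commute)
qed

lemma integral_transfer:
  assumes [measurable]: "h \<in> borel_measurable borel" and B: "\<And>x. \<bar>h x\<bar> \<le> B"
  shows "(\<integral>x. transfer n h x \<partial>torus_lebesgue) = (\<integral>x. h x \<partial>torus_lebesgue)"
proof (induction n)
  case (Suc n)
  have "(\<integral>x. transfer (Suc n) h x \<partial>torus_lebesgue) =
    (\<integral>x. (\<Sum>k\<in>digits. transfer n h (branch k x)) \<partial>torus_lebesgue) / deg"
    unfolding transfer_Suc by simp
  also have "\<dots> = (\<integral>x. transfer n h x \<partial>torus_lebesgue)"
    using integral_branches [of "transfer n h" B] deg_pos transfer_le [OF B] by simp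
  finally show ?case using Suc by simp
qed simp

text \<open>The preimages of nearby points are paired by a translation that \<open>n\<close>
  inverse branches have contracted by \<open>lam ^ n\<close>.\<close>

lemma transfer_lipschitz:
  assumes L0: "0 \<le> L" and L: "\<And>x y. \<bar>h x - h y\<bar> \<le> L * dist x y"
  shows "\<bar>transfer n h x - transfer n h y\<bar> \<le> L * lam ^ n * dist x y"
proof -
  obtain t where t: "y = tadd x t" "norm t = dist x y" by (rule torus_lift)
  have "\<bar>(\<Sum>a\<in>preimages n x. h a) - (\<Sum>a\<in>preimages n y. h a)\<bar> =
    \<bar>\<Sum>a\<in>preimages n x. h a - h (tadd a ((Ei ^^ n) t))\<bar>"
    unfolding t sum_preimages_tadd by (simp add: sum_subtractf)
  also have "\<dots> \<le> (\<Sum>a\<in>preimages n x. L * (lam ^ n * dist x y))"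
  proof (intro order_trans [OF sum_abs] sum_mono)
    fix a
    have "\<bar>h a - h (tadd a ((Ei ^^ n) t))\<bar> \<le> L * dist a (tadd a ((Ei ^^ n) t))" by (rule L)
    also have "\<dots> \<le> L * norm ((Ei ^^ n) t)" by (intro mult_left_mono dist_tadd_le L0)
    also have "\<dots> \<le> L * (lam ^ n * dist x y)" using norm_Ei_pow [of n t] t L0 by (intro mult_left_mono) auto
    finally show "\<bar>h a - h (tadd a ((Ei ^^ n) t))\<bar> \<le> L * (lam ^ n * dist x y)" .
  qed
  also have "\<dots> = deg ^ n * (L * (lam ^ n * dist x y))" by (simp add: card_preimages)
  finally have "\<bar>((\<Sum>a\<in>preimages n x. h a) - (\<Sum>a\<in>preimages n y. h a)) / deg ^ n\<bar> \<le> L * (lam ^ n * dist x y)"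
    using deg_pos by (simp add: abs_divide divide_le_eq mult.commute)
  then show ?thesis by (simp add: transfer_def diff_divide_distrib mult.assoc)
qed

lemma integral_torus_map_pow:
  fixes h :: "'u torus \<Rightarrow> real"
  assumes [measurable]: "h \<in> borel_measurable borel"
  shows "(\<integral>x. h ((torus_map E ^^ n) x) \<partial>torus_lebesgue) = (\<integral>x. h x \<partial>torus_lebesgue)"
proof (induction n)
  case (Suc n)
  have "(\<integral>x. h x \<partial>torus_lebesgue) = (\<integral>x. h ((torus_map E ^^ n) x) \<partial>distr torus_lebesgue borel (torus_map E))"
    using Suc by (simp add: distr_torus_map)
  also have "\<dots> = (\<integral>x. h ((torus_map E ^^ n) (torus_map E x)) \<partial>torus_lebesgue)"
    by (rule integral_distr) measurable
  finally show ?case by (simp only: funpow_Suc_right o_apply)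
qed simp

text \<open>Averaging over preimages turns the integral into that of \<open>g\<close> times the
  \<open>n\<close>-th transfer of \<open>h\<close>. The latter has mean zero and a Lipschitz
  constant of order \<open>lam ^ n\<close>, so it is uniformly small on a space of bounded
  diameter.\<close>

lemma decay_of_correlations:
  fixes g h :: "'u torus \<Rightarrow> real"
  assumes L0: "0 \<le> L" and L: "\<And>x y. \<bar>h x - h y\<bar> \<le> L * dist x y" and B: "\<And>x. \<bar>h x\<bar> \<le> B"
    and [measurable]: "h \<in> borel_measurable borel" "g \<in> borel_measurable borel" and M: "\<And>x. \<bar>g x\<bar> \<le> M"
    and mean: "(\<integral>x. h x \<partial>torus_lebesgue) = 0"
  shows "\<bar>\<integral>x. h x * g ((torus_map E ^^ n) x) \<partial>torus_lebesgue\<bar> \<le> M * (L * real CARD('u)) * lam ^ n"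
proof -
  \<comment> \<open>The factor \<open>g\<close> is constant on the set of preimages and can be
    pulled out.\<close>
  have tr: "transfer n (\<lambda>x. h x * g ((torus_map E ^^ n) x)) x = g x * transfer n h x" for x
    unfolding transfer_def by (simp add: preimages_def sum_distrib_left mult.commute)
  have small: "\<bar>transfer n h x\<bar> \<le> L * real CARD('u) * lam ^ n" for x
  proof -
    have "\<bar>transfer n h x - transfer n h y\<bar> \<le> L * real CARD('u) * lam ^ n" for y
    proof -
      have "\<bar>transfer n h x - transfer n h y\<bar> \<le> L * lam ^ n * dist x y" by (rule transfer_lipschitz [OF L0 L])
      also have "\<dots> \<le> L * lam ^ n * real CARD('u)"
        using dist_torus_le lam_nonneg L0 by (intro mult_left_mono mult_nonneg_nonneg) auto
      finally show ?thesis by (simp add: mult_ac)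
    qed
    then have le: "\<bar>transfer n h x - transfer n h y\<bar> \<le> L * real CARD('u) * lam ^ n" for y .
    have int: "integrable torus_lebesgue (transfer n h)"
      by (rule integrable_torus [where B = B]) (auto intro: transfer_le B)
    have "transfer n h x = (\<integral>y. transfer n h x - transfer n h y \<partial>torus_lebesgue)"
      using int integral_transfer [of h B n] mean B by simp
    also have "\<bar>\<dots>\<bar> \<le> (\<integral>y. L * real CARD('u) * lam ^ n \<partial>(torus_lebesgue :: 'u torus measure))"
      using int le by (intro order_trans [OF integral_abs_bound] integral_mono) auto
    also have "\<dots> = L * real CARD('u) * lam ^ n"
      by simp
    finally show ?thesis .
  qed
  have bnd: "\<bar>h x * g ((torus_map E ^^ n) x)\<bar> \<le> B * M" for x
    unfolding abs_mult using order_trans [OF abs_ge_zero B] by (intro mult_mono B M) auto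
  have "(\<integral>x. h x * g ((torus_map E ^^ n) x) \<partial>torus_lebesgue) = (\<integral>x. g x * transfer n h x \<partial>torus_lebesgue)"
    using integral_transfer [where h = "\<lambda>x. h x * g ((torus_map E ^^ n) x)" and n = n, OF _ bnd] by (simp add: tr)
  also have "\<bar>\<dots>\<bar> \<le> (\<integral>x. M * (L * real CARD('u) * lam ^ n) \<partial>(torus_lebesgue :: 'u torus measure))"
  proof (intro order_trans [OF integral_abs_bound] integral_mono)
    have p: "\<bar>g x * transfer n h x\<bar> \<le> M * (L * real CARD('u) * lam ^ n)" for x
      unfolding abs_mult using order_trans [OF abs_ge_zero M] by (intro mult_mono small M) auto
    then show "\<bar>g x * transfer n h x\<bar> \<le> M * (L * real CARD('u) * lam ^ n)" for x .
    show "integrable torus_lebesgue (\<lambda>x. \<bar>g x * transfer n h x\<bar>)"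
      by (rule integrable_torus [where B = "M * (L * real CARD('u) * lam ^ n)"]) (use p in auto)
  qed (simp)
  also have "\<dots> = M * (L * real CARD('u)) * lam ^ n"
    by simp
  finally show ?thesis .
qed

text \<open>By the decay of correlations, the Birkhoff sum over \<open>n\<close> steps of a
  Lipschitz function of mean zero has second moment of order \<open>n\<close>. Along \<open>n =
  j\<^sup>2\<close> the second moments of the averages are then summable, so the averages tend to
  \<open>0\<close> almost everywhere, and the gaps between squares are harmless.\<close>

lemma birkhoff_lipschitz:
  fixes g :: "'u torus \<Rightarrow> real"
  assumes L0: "0 \<le> L" and L: "\<And>x y. \<bar>g x - g y\<bar> \<le> L * dist x y"
  shows "AE x in torus_lebesgue.
    (\<lambda>n. (\<Sum>k<n. g ((torus_map E ^^ k) x)) / real n) \<longlonglongrightarrow> (\<integral>x. g x \<partial>torus_lebesgue)"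
proof -
  have "L-lipschitz_on UNIV g" using L L0 by (intro lipschitz_onI) (auto simp: dist_real_def)
  then have cont: "continuous_on UNIV g" by (rule lipschitz_on_continuous_on)
  then have [measurable]: "g \<in> borel_measurable borel" by (rule borel_measurable_continuous_onI)
  have "compact (range g)" using cont by (rule compact_continuous_image [OF _ compact_UNIV_torus])
  then obtain B where B: "\<And>x. \<bar>g x\<bar> \<le> B"
    using compact_imp_bounded [of "range g"] by (auto simp: bounded_iff)
  define m where "m = (\<integral>x. g x \<partial>torus_lebesgue)"
  define h where "h x = g x - m" for x
  define M where "M = B + \<bar>m\<bar>"
  have hM: "\<bar>h x\<bar> \<le> M" for x using B [of x] unfolding h_def M_def by linarith
  then have M0: "0 \<le> M" using order_trans [OF abs_ge_zero] by blast
  have [measurable]: "h \<in> borel_measurable borel" unfolding h_def by measurable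
  have hL: "\<bar>h x - h y\<bar> \<le> L * dist x y" for x y using L by (simp add: h_def)
  have h0: "(\<integral>x. h x \<partial>torus_lebesgue) = 0"
    unfolding h_def using integrable_torus [of g B] B by (simp add: m_def)
  define X where "X k x = h ((torus_map E ^^ k) x)" for k x
  have [measurable]: "X k \<in> borel_measurable borel" for k unfolding X_def by measurable
  have XM: "\<bar>X k x\<bar> \<le> M" for k x by (simp add: X_def hM)
  define c where "c = M * (L * real CARD('u))"
  have c0: "0 \<le> c" using M0 L0 by (simp add: c_def)
  have cov: "\<bar>\<integral>x. X j x * X (j + n) x \<partial>torus_lebesgue\<bar> \<le> c * lam ^ n" for j n
  proof -
    have "(\<integral>x. X j x * X (j + n) x \<partial>torus_lebesgue) = (\<integral>x. h x * h ((torus_map E ^^ n) x) \<partial>torus_lebesgue)"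
      using integral_torus_map_pow [where h = "\<lambda>x. h x * h ((torus_map E ^^ n) x)" and n = j]
      by (simp add: X_def funpow_add add.commute [of j n])
    then show ?thesis
      using decay_of_correlations [where h = h and g = h and n = n, OF L0 hL hM _ _ hM h0] by (simp add: c_def)
  qed
  define S where "S n x = (\<Sum>k<n. X k x)" for n x
  have [measurable]: "S n \<in> borel_measurable borel" for n unfolding S_def by measurable
  have SM: "\<bar>S n x\<bar> \<le> real n * M" for n x
  proof -
    have "\<bar>S n x\<bar> \<le> (\<Sum>k<n. M)" unfolding S_def by (intro order_trans [OF sum_abs] sum_mono XM)
    then show ?thesis by simp
  qed
  have geo: "(\<Sum>j<n. lam ^ (n - j)) \<le> 1 / (1 - lam)" for n
  proof -
    have "(\<Sum>j<n. lam ^ (n - j)) \<le> (\<Sum>j<n. lam ^ (n - Suc j))"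
      using lam_pos lam_less_1 by (intro sum_mono power_decreasing) auto
    also have "\<dots> = (\<Sum>j<n. lam ^ j)" by (rule sum.nat_diff_reindex)
    also have "\<dots> = (1 - lam ^ n) / (1 - lam)" using lam_less_1 by (simp add: sum_gp_strict)
    also have "\<dots> \<le> 1 / (1 - lam)" using lam_pos lam_less_1 by (intro divide_right_mono) auto
    finally show ?thesis .
  qed
  \<comment> \<open>The increment of the second moment from \<open>n\<close> to \<open>n +
    1\<close>: twice the sum of the covariances with all earlier terms, and one variance.\<close>
  define K where "K = 2 * (c / (1 - lam)) + c"
  have K0: "0 \<le> K" using c0 lam_less_1 by (simp add: K_def)
  have int2: "integrable torus_lebesgue (\<lambda>x. (S n x)^2)" for n
  proof (rule integrable_torus [where B = "(real n * M)^2"])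
    fix x
    have "\<bar>S n x\<bar>^2 \<le> (real n * M)^2" by (intro power_mono SM abs_ge_zero)
    then show "\<bar>(S n x)^2\<bar> \<le> (real n * M)^2" by simp
  qed simp
  have var: "(\<integral>x. (S n x)^2 \<partial>torus_lebesgue) \<le> real n * K" for n
  proof (induction n)
    case (Suc n)
    have intp: "integrable torus_lebesgue (\<lambda>x. X j x * X k x)" for j k
    proof (rule integrable_torus [where B = "M * M"])
      show "\<bar>X j x * X k x\<bar> \<le> M * M" for x unfolding abs_mult by (intro mult_mono XM M0) auto
    qed simp
    have exp: "(S (Suc n) x)^2 = (S n x)^2 + (2 * (\<Sum>j<n. X j x * X n x) + X n x * X n x)" for x
    proof -
      have "S (Suc n) x = S n x + X n x" by (simp add: S_def)
      moreover have "S n x * X n x = (\<Sum>j<n. X j x * X n x)" by (simp add: S_def sum_distrib_right)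
      ultimately show ?thesis by (simp add: power2_sum power2_eq_square [of "X n x"])
    qed
    have "(\<integral>x. (S (Suc n) x)^2 \<partial>torus_lebesgue) =
      (\<integral>x. (S n x)^2 \<partial>torus_lebesgue) + (2 * (\<Sum>j<n. \<integral>x. X j x * X n x \<partial>torus_lebesgue) + (\<integral>x. X n x * X n x \<partial>torus_lebesgue))"
      unfolding exp using int2 intp by simp
    also have "\<dots> \<le> real n * K + (2 * (\<Sum>j<n. c * lam ^ (n - j)) + c)"
    proof -
      have "(\<Sum>j<n. \<integral>x. X j x * X n x \<partial>torus_lebesgue) \<le> (\<Sum>j<n. c * lam ^ (n - j))"
      proof (rule sum_mono)
        fix j assume "j \<in> {..<n}"
        then show "(\<integral>x. X j x * X n x \<partial>torus_lebesgue) \<le> c * lam ^ (n - j)"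
          using cov [of j "n - j"] by (simp add: abs_le_iff)
      qed
      moreover have "(\<integral>x. X n x * X n x \<partial>torus_lebesgue) \<le> c" using cov [of n 0] by (simp add: abs_le_iff)
      ultimately show ?thesis using Suc by linarith
    qed
    also have "\<dots> \<le> real n * K + K"
    proof -
      have "(\<Sum>j<n. c * lam ^ (n - j)) \<le> c * (1 / (1 - lam))"
        unfolding sum_distrib_left [symmetric] by (intro mult_left_mono geo c0)
      then show ?thesis by (simp add: K_def)
    qed
    finally show ?case by (simp add: algebra_simps)
  qed (simp add: S_def)
  \<comment> \<open>The averages along squares; the index shift avoids division by
    \<open>0\<close>.\<close>
  define N where "N j = (Suc j)^2" for j
  have N: "real (N j) = (real (Suc j))^2" "0 < real (N j)" for j by (simp_all add: N_def)
  define Y where "Y j x = S (N j) x / real (N j)" for j x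
  have [measurable]: "Y j \<in> borel_measurable borel" for j unfolding Y_def by measurable
  have Y2: "(Y j x)^2 = (S (N j) x)^2 / (real (N j))^2" for j x by (simp only: Y_def power_divide)
  have Yint: "(\<integral>\<^sup>+x. ennreal ((Y j x)^2) \<partial>torus_lebesgue) \<le> ennreal (K * (1 / (real (Suc j))^2))" for j
  proof -
    have "integrable torus_lebesgue (\<lambda>x. (Y j x)^2)"
      unfolding Y2 by (intro integrable_divide int2)
    then have "(\<integral>\<^sup>+x. ennreal ((Y j x)^2) \<partial>torus_lebesgue) = ennreal (\<integral>x. (Y j x)^2 \<partial>torus_lebesgue)"
      by (intro nn_integral_eq_integral AE_I2) simp_all
    also have "(\<integral>x. (Y j x)^2 \<partial>torus_lebesgue) = (\<integral>x. (S (N j) x)^2 \<partial>torus_lebesgue) / (real (N j))^2"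
      unfolding Y2 by simp
    also have "ennreal \<dots> \<le> ennreal (real (N j) * K / (real (N j))^2)"
      by (intro ennreal_leI divide_right_mono var) simp
    also have "real (N j) * K / (real (N j))^2 = K * (1 / real (N j))"
      using N(2) [of j] by (simp add: power2_eq_square)
    finally show ?thesis unfolding N(1) .
  qed
  have summ: "summable (\<lambda>j. K * (1 / (real (Suc j))^2))"
  proof -
    have "summable (\<lambda>j. inverse (real j ^ 2))" by (rule inverse_power_summable) simp
    then have "summable (\<lambda>j. inverse (real (Suc j) ^ 2))" by (rule summable_Suc_iff [THEN iffD2])
    then have "summable (\<lambda>j. 1 / (real (Suc j))^2)" by (simp only: inverse_eq_divide)
    then show ?thesis by (rule summable_mult)
  qed
  have "(\<integral>\<^sup>+x. (\<Sum>j. ennreal ((Y j x)^2)) \<partial>torus_lebesgue) = (\<Sum>j. \<integral>\<^sup>+x. ennreal ((Y j x)^2) \<partial>torus_lebesgue)"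
    by (rule nn_integral_suminf) measurable
  also have "\<dots> \<le> (\<Sum>j. ennreal (K * (1 / (real (Suc j))^2)))"
    by (intro suminf_le Yint) auto
  also have "\<dots> < \<infinity>"
    using K0 by (subst suminf_ennreal2 [OF _ summ]) simp_all
  finally have "AE x in torus_lebesgue. (\<Sum>j. ennreal ((Y j x)^2)) \<noteq> \<infinity>"
    by (intro nn_integral_PInf_AE) auto
  then show ?thesis
  proof eventually_elim
    fix x assume "(\<Sum>j. ennreal ((Y j x)^2)) \<noteq> \<infinity>"
    then have "summable (\<lambda>j. (Y j x)^2)"
      by (intro summable_suminf_not_top) auto
    then have "(\<lambda>j. (Y j x)^2) \<longlonglongrightarrow> 0" by (rule summable_LIMSEQ_zero)
    then have "(\<lambda>j. Y j x) \<longlonglongrightarrow> 0" by simp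
    then have "(\<lambda>j. (\<Sum>k<j^2. X k x) / real (j^2)) \<longlonglongrightarrow> 0"
      unfolding Y_def S_def N_def by (rule LIMSEQ_imp_Suc)
    then have "(\<lambda>n. (\<Sum>k<n. X k x) / real n) \<longlonglongrightarrow> 0"
      by (rule averages_tendsto_0_from_squares [OF XM])
    then have lim: "(\<lambda>n. (\<Sum>k<n. X k x) / real n + m) \<longlonglongrightarrow> 0 + m"
      by (intro tendsto_add tendsto_const)
    have "eventually (\<lambda>n. (\<Sum>k<n. X k x) / real n + m = (\<Sum>k<n. g ((torus_map E ^^ k) x)) / real n) sequentially"
      using eventually_gt_at_top [of 0]
      by eventually_elim (simp add: X_def h_def sum_subtractf diff_divide_distrib)
    then show "(\<lambda>n. (\<Sum>k<n. g ((torus_map E ^^ k) x)) / real n) \<longlonglongrightarrow> (\<integral>x. g x \<partial>torus_lebesgue)"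
      using Lim_transform_eventually [OF lim] unfolding m_def [symmetric] by simp
  qed
qed

end

section \<open>Images of Lebesgue measure under transversal maps\<close>

text \<open>A lower bound \<open>c\<close> for \<open>max_conorm A\<close> together with a
  subspace that witnesses it. The proofs work with the witness: it splits the space into expanded
  and complementary directions.\<close>

definition conorm_ge :: "((real^'u::finite) \<Rightarrow>\<^sub>L (real^'d::finite)) \<Rightarrow> real \<Rightarrow> bool" where
  "conorm_ge A c \<longleftrightarrow>
     (\<exists>W. subspace W \<and> dim W = CARD('d) \<and> (\<forall>v\<in>W. c * norm v \<le> norm (blinfun_apply A v)))"

lemma conorm_ge_perturb:
  assumes "conorm_ge A c" "norm (A' - A) \<le> e" "c' \<le> c - e"
  shows "conorm_ge A' c'"
proof -
  obtain W where W: "subspace W" "dim W = CARD('b)" "\<And>v. v \<in> W \<Longrightarrow> c * norm v \<le> norm (blinfun_apply A v)"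
    using assms(1) by (auto simp: conorm_ge_def)
  have "c' * norm v \<le> norm (blinfun_apply A' v)" if "v \<in> W" for v
  proof -
    have "norm (blinfun_apply A v) \<le> norm (blinfun_apply A' v) + norm (blinfun_apply (A' - A) v)"
      by (metis add.commute blinfun.diff_left norm_minus_commute norm_triangle_sub)
    also have "norm (blinfun_apply (A' - A) v) \<le> e * norm v"
      using norm_blinfun [of "A' - A" v] assms(2) by (meson mult_right_mono norm_ge_zero order_trans)
    finally have "c * norm v - e * norm v \<le> norm (blinfun_apply A' v)" using W(3) [OF that] by linarith
    moreover have "c' * norm v \<le> (c - e) * norm v" using assms(3) by (intro mult_right_mono) auto
    ultimately show ?thesis by (simp add: left_diff_distrib)
  qed
  then show ?thesis unfolding conorm_ge_def using W by blast
qed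

text \<open>Let \<open>W\<close> be a \<open>d\<close>-dimensional subspace on which
  \<open>A\<close> expands. Slice the ball into about \<open>(1/s) ^ (u - d)\<close> cells of
  width \<open>s\<close> in the directions orthogonal to \<open>W\<close>. Within a cell, points
  that \<open>G\<close> maps into the same ball of radius \<open>s\<close> differ by
  \<open>O(s)\<close>, because \<open>G\<close> is close to the linear map \<open>A\<close>. So
  each cell contributes a volume \<open>O(s ^ u)\<close>, which gives \<open>O(s ^ d)\<close> in
  total.\<close>

lemma small_ball_preimage:
  fixes r \<eta> M :: real
  assumes r: "0 < r" and \<eta>: "0 < \<eta>" and M: "0 \<le> M"
  shows "\<exists>K\<ge>0. \<forall>(A :: (real^'u::finite) \<Rightarrow>\<^sub>L (real^'d::finite)) G v0 z s.
    conorm_ge A \<eta> \<and> norm A \<le> M \<and> 0 < s \<and> s \<le> 1 \<and>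
    (\<forall>v\<in>ball v0 r. \<forall>w\<in>ball v0 r. norm (G v - G w - blinfun_apply A (v - w)) \<le> \<eta> / 2 * norm (v - w)) \<longrightarrow>
    emeasure lborel {v \<in> ball v0 r. norm (G v - z) < s} \<le> ennreal (K * s ^ CARD('d))"
proof -
  let ?u = "CARD('u)" and ?d = "CARD('d)"
  \<comment> \<open>The diameter of the part of a cell that is mapped into a ball of radius
    \<open>s\<close> is at most \<open>K1 * s\<close>.\<close>
  define K1 where "K1 = 2 / \<eta> * (2 + (\<eta> / 2 + M) * real ?u) + real ?u"
  define V where "V = unit_ball_vol (real ?u)"
  define K where "K = (2 * r + 5) ^ (?u - ?d) * (V * K1 ^ ?u)"
  have K1: "0 \<le> K1" using \<eta> M by (simp add: K1_def)
  have V: "0 \<le> V" by (simp add: V_def)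
  have K: "0 \<le> K" using r K1 V by (simp add: K_def)
  have main: "emeasure lborel {v \<in> ball v0 r. norm (G v - z) < s} \<le> ennreal (K * s ^ ?d)"
    if cg: "conorm_ge A \<eta>" and nA: "norm A \<le> M" and s: "0 < s" "s \<le> 1" and
      app: "\<And>v w. v \<in> ball v0 r \<Longrightarrow> w \<in> ball v0 r \<Longrightarrow> norm (G v - G w - blinfun_apply A (v - w)) \<le> \<eta> / 2 * norm (v - w)"
    for A :: "(real^'u) \<Rightarrow>\<^sub>L (real^'d)" and G v0 z s
  proof -
    obtain W where W: "subspace W" "dim W = ?d" and exp: "\<And>v. v \<in> W \<Longrightarrow> \<eta> * norm v \<le> norm (blinfun_apply A v)"
      using cg by (auto simp: conorm_ge_def)
    define W' where "W' = {y. \<forall>x\<in>W. orthogonal x y}"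
    have subW': "subspace W'" unfolding W'_def by (rule subspace_orthogonal_to_vectors)
    have dimW': "dim W' + ?d = ?u"
      using dim_subspace_orthogonal_to_vectors [OF W(1) subspace_UNIV] W(2) by (simp add: W'_def)
    obtain B where B: "B \<subseteq> W'" "pairwise orthogonal B" "\<And>x. x \<in> B \<Longrightarrow> norm x = 1"
      "independent B" "card B = dim W'" "span B = W'"
      using orthonormal_basis_subspace [OF subW'] by metis
    have finB: "finite B" using B(4) by (rule independent_imp_finite)
    have cardB: "card B = ?u - ?d" using B(5) dimW' by simp
    let ?Z = "{v \<in> ball v0 r. norm (G v - z) < s}"
    let ?k = "\<lambda>v b. \<lfloor>(v - v0) \<bullet> b / s\<rfloor>"
    have close: "norm (v - w) \<le> K1 * s"
      if vw: "v \<in> ?Z" "w \<in> ?Z" and same: "\<And>b. b \<in> B \<Longrightarrow> ?k v b = ?k w b" for v w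
    proof -
      \<comment> \<open>Split the difference into its component \<open>p\<close> along
        \<open>W\<close>, which \<open>A\<close> expands, and its component \<open>n\<close>
        orthogonal to \<open>W\<close>, which is small because both points lie in the same cell.\<close>
      obtain p n where pn: "p \<in> span W" "\<And>x. x \<in> span W \<Longrightarrow> orthogonal n x" "v - w = p + n"
        using orthogonal_subspace_decomp_exists [of W "v - w"] by metis
      moreover have "span W = W" using W(1) by (simp add: span_eq_iff)
      ultimately have pW: "p \<in> W" and nW': "n \<in> W'"
        by (auto simp: W'_def orthogonal_commute)
      have nb: "\<bar>n \<bullet> b\<bar> \<le> s" if b: "b \<in> B" for b
      proof -
        have "p \<bullet> b = 0" using b B(1) pW by (auto simp: W'_def orthogonal_def)
        then have "n \<bullet> b = (v - v0) \<bullet> b - (w - v0) \<bullet> b" using pn(3) by (metis add.left_neutral add_diff_cancel_right inner_add_left inner_diff_left diff_diff_eq2 diff_add_cancel)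
        moreover have "\<bar>(v - v0) \<bullet> b / s - (w - v0) \<bullet> b / s\<bar> \<le> 1"
          using same [OF b] by linarith
        then have "\<bar>(v - v0) \<bullet> b - (w - v0) \<bullet> b\<bar> \<le> s"
          using s by (simp add: diff_divide_distrib [symmetric] abs_divide)
        ultimately show ?thesis by simp
      qed
      have "n = (\<Sum>b\<in>B. (n \<bullet> b) *\<^sub>R b)"
        using orthonormal_basis_expand [of B n] nW' B finB by simp
      then have "norm n \<le> (\<Sum>b\<in>B. norm ((n \<bullet> b) *\<^sub>R b))" by (metis norm_sum)
      also have "\<dots> \<le> (\<Sum>b\<in>B. s)" using nb B(3) by (intro sum_mono) simp
      also have "\<dots> \<le> real ?u * s" using cardB s by (simp add: mult_right_mono)
      finally have n: "norm n \<le> real ?u * s" .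
      have "norm (G v - G w) < 2 * s"
        using vw norm_triangle_ineq4 [of "G v - z" "G w - z"] by simp
      moreover have "norm (blinfun_apply A (v - w)) \<le> norm (G v - G w) + norm (G v - G w - blinfun_apply A (v - w))"
        by (metis norm_minus_commute norm_triangle_sub)
      moreover have "norm (G v - G w - blinfun_apply A (v - w)) \<le> \<eta> / 2 * norm (v - w)"
        using vw by (intro app) auto
      moreover have "\<eta> / 2 * norm (v - w) \<le> \<eta> / 2 * (norm p + norm n)"
        using \<eta> pn(3) norm_triangle_ineq [of p n] by (intro mult_left_mono) auto
      moreover have "norm (blinfun_apply A p) \<le> norm (blinfun_apply A (v - w)) + norm (blinfun_apply A n)"
        using norm_triangle_ineq4 [of "blinfun_apply A (v - w)" "blinfun_apply A n"] pn(3) by (simp add: blinfun.add_right)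
      moreover have "norm (blinfun_apply A n) \<le> M * norm n"
        using norm_blinfun [of A n] nA by (meson mult_right_mono norm_ge_zero order_trans)
      ultimately have "\<eta> * norm p \<le> 2 * s + \<eta> / 2 * norm p + (\<eta> / 2 + M) * norm n"
        using exp [OF pW] by (simp add: algebra_simps)
      moreover have "(\<eta> / 2 + M) * norm n \<le> (\<eta> / 2 + M) * (real ?u * s)"
        using n \<eta> M by (intro mult_left_mono) auto
      ultimately have "\<eta> / 2 * norm p \<le> (2 + (\<eta> / 2 + M) * real ?u) * s"
        by (simp add: algebra_simps)
      then have "norm p \<le> 2 / \<eta> * ((2 + (\<eta> / 2 + M) * real ?u) * s)"
        using \<eta> by (simp add: field_simps)
      moreover have "norm (v - w) \<le> norm p + norm n" using pn(3) norm_triangle_ineq by metis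
      ultimately show ?thesis using n by (simp add: K1_def distrib_right mult.assoc)
    qed
    \<comment> \<open>Cells that meet the ball have coordinates between \<open>-L\<close> and
      \<open>L\<close>.\<close>
    define L where "L = \<lceil>r / s\<rceil> + 1"
    have L: "real_of_int (2 * L + 1) \<le> (2 * r + 5) / s"
    proof -
      have "real_of_int (2 * \<lceil>q\<rceil> + 3) \<le> 2 * q + 5" for q :: real by simp linarith
      from this [of "r / s"] have "real_of_int (2 * L + 1) \<le> 2 * (r / s) + 5" by (simp add: L_def)
      also have "\<dots> \<le> 2 * (r / s) + 5 / s" using s by (simp add: pos_le_divide_eq)
      finally show ?thesis by (simp add: add_divide_distrib)
    qed
    have L0: "0 \<le> L" using r s by (simp add: L_def) (smt (verit) divide_pos_pos ceiling_less_zero zero_le_ceiling)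
    define I where "I = PiE B (\<lambda>_. {- L..L})"
    have finI: "finite I" using finB by (simp add: I_def finite_PiE)
    have cardI: "real (card I) \<le> ((2 * r + 5) / s) ^ (?u - ?d)"
    proof -
      have "real (card I) = real_of_int (2 * L + 1) ^ (?u - ?d)"
        using finB L0 by (simp add: I_def card_PiE cardB)
      also have "\<dots> \<le> ((2 * r + 5) / s) ^ (?u - ?d)"
        using L L0 by (intro power_mono) auto
      finally show ?thesis .
    qed
    define P where "P k = {v \<in> ?Z. \<forall>b\<in>B. ?k v b = k b}" for k
    define Q where "Q k = (if P k = {} then {} else cball (SOME w. w \<in> P k) (K1 * s))" for k
    have PQ: "P k \<subseteq> Q k" for k
    proof
      fix v assume v: "v \<in> P k"
      then have w: "(SOME w. w \<in> P k) \<in> P k" by (rule someI)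
      have "norm (v - (SOME w. w \<in> P k)) \<le> K1 * s"
        using v w by (intro close) (auto simp: P_def)
      then show "v \<in> Q k" using v by (auto simp: Q_def dist_norm norm_minus_commute)
    qed
    have Qm: "Q k \<in> sets lborel" for k by (simp add: Q_def)
    have Qe: "emeasure lborel (Q k) \<le> ennreal (V * (K1 * s) ^ ?u)" for k
      using K1 s by (auto simp: Q_def emeasure_cball V_def)
    have "?Z \<subseteq> (\<Union>k\<in>I. Q k)"
    proof
      fix v assume v: "v \<in> ?Z"
      have "restrict (?k v) B \<in> I"
        unfolding I_def
      proof (rule restrict_PiE_iff [THEN iffD2], intro ballI)
        fix b assume b: "b \<in> B"
        have "\<bar>(v - v0) \<bullet> b\<bar> \<le> norm (v - v0) * norm b" by (rule Cauchy_Schwarz_ineq2)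
        also have "\<dots> \<le> r" using v B(3) [OF b] by (simp add: dist_norm norm_minus_commute)
        finally have "\<bar>(v - v0) \<bullet> b / s\<bar> \<le> r / s" using s by (simp add: abs_divide divide_right_mono)
        moreover have "- (\<lceil>q\<rceil> + 1) \<le> \<lfloor>x\<rfloor> \<and> \<lfloor>x\<rfloor> \<le> \<lceil>q\<rceil> + 1" if "\<bar>x\<bar> \<le> q" for x q :: real
          using that by linarith
        ultimately show "?k v b \<in> {- L..L}" unfolding L_def atLeastAtMost_iff by blast
      qed
      moreover have "v \<in> P (restrict (?k v) B)" using v by (simp add: P_def)
      ultimately show "v \<in> (\<Union>k\<in>I. Q k)" using PQ by blast
    qed
    then have "emeasure lborel ?Z \<le> emeasure lborel (\<Union>k\<in>I. Q k)"
      by (rule emeasure_mono) (use finI Qm in auto)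
    also have "\<dots> \<le> (\<Sum>k\<in>I. emeasure lborel (Q k))"
      by (rule emeasure_subadditive_finite) (use finI Qm in auto)
    also have "\<dots> \<le> (\<Sum>k\<in>I. ennreal (V * (K1 * s) ^ ?u))" by (intro sum_mono Qe)
    also have "\<dots> = ennreal (real (card I) * (V * (K1 * s) ^ ?u))"
      using V K1 s by (simp add: ennreal_of_nat_eq_real_of_nat ennreal_mult)
    also have "\<dots> \<le> ennreal (((2 * r + 5) / s) ^ (?u - ?d) * (V * (K1 * s) ^ ?u))"
      using V K1 s by (intro ennreal_leI mult_right_mono cardI) auto
    also have "((2 * r + 5) / s) ^ (?u - ?d) * (V * (K1 * s) ^ ?u) = K * s ^ ?d"
    proof -
      have "s ^ ?u = s ^ (?u - ?d) * s ^ ?d" using dimW' by (simp flip: power_add)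
      then show ?thesis using s by (simp add: K_def power_divide power_mult_distrib)
    qed
    finally show ?thesis .
  qed
  show ?thesis
  proof (intro exI [of _ K] conjI allI impI K, elim conjE)
    fix A :: "(real^'u) \<Rightarrow>\<^sub>L (real^'d)" and G v0 z and s :: real
    assume "conorm_ge A \<eta>" "norm A \<le> M" "0 < s" "s \<le> 1"
      "\<forall>v\<in>ball v0 r. \<forall>w\<in>ball v0 r. norm (G v - G w - blinfun_apply A (v - w)) \<le> \<eta> / 2 * norm (v - w)"
    then show "emeasure lborel {v \<in> ball v0 r. norm (G v - z) < s} \<le> ennreal (K * s ^ ?d)"
      by (intro main) auto
  qed
qed

text \<open>On an open set the indicator is at most the lower limit of its averages over balls of
  radius tending to \<open>0\<close>. By Fubini, the integral of such an average against
  \<open>N\<close> involves only the masses of balls; Fatou's lemma concludes.\<close>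

lemma dominated_on_open:
  fixes N :: "'a::euclidean_space measure"
  assumes fin: "finite_measure N" and sets [measurable_cong, simp]: "sets N = sets borel" and K: "0 \<le> K"
    and ball: "\<And>z s. 0 < s \<Longrightarrow> s \<le> 1 \<Longrightarrow> emeasure N (ball z s) \<le> ennreal (K * s ^ DIM('a))"
    and U: "open U"
  shows "emeasure N U \<le> ennreal (K / unit_ball_vol (real DIM('a))) * emeasure lborel U"
proof -
  interpret finite_measure N by (rule fin)
  interpret pair_sigma_finite N "lborel :: 'a measure" ..
  define c where "c = K / unit_ball_vol (real DIM('a))"
  define s where "s j = 1 / real (Suc j)" for j
  have s: "0 < s j" "s j \<le> 1" for j by (simp_all add: s_def)
  define vol where "vol j = unit_ball_vol (real DIM('a)) * s j ^ DIM('a)" for j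
  have vol: "0 < vol j" for j using s [of j] by (simp add: vol_def)
  have [measurable]: "U \<in> sets borel" using U by (rule borel_open)
  \<comment> \<open>\<open>g j w\<close> is the average of the indicator of \<open>U\<close> over
    the ball of radius \<open>s j\<close> around \<open>w\<close>.\<close>
  define g where "g j w = (\<integral>\<^sup>+z. indicator U z * indicator (ball z (s j)) w * ennreal (1 / vol j) \<partial>lborel)" for j w
  have [measurable]: "{p :: 'a \<times> 'a. dist (snd p) (fst p) < t} \<in> sets (borel \<Otimes>\<^sub>M borel)" for t :: real
  proof -
    have "open {p :: 'a \<times> 'a. dist (snd p) (fst p) < t}" by (intro open_Collect_less continuous_intros)
    then show ?thesis unfolding borel_prod by (rule borel_open)
  qed
  have ind: "indicator (ball z t) w = (indicator {p. dist (snd p) (fst p) < t} (w, z) :: ennreal)" for z w :: 'a and t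
    by (simp add: indicator_def)
  have meas [measurable]: "(\<lambda>(w, z). indicator U z * indicator (ball z (s j)) w * ennreal (1 / vol j)) \<in> borel_measurable (N \<Otimes>\<^sub>M lborel)" for j
    unfolding ind by measurable
  have gm [measurable]: "g j \<in> borel_measurable N" for j
    unfolding g_def by (rule lborel.borel_measurable_nn_integral [OF meas])
  have "emeasure N U = (\<integral>\<^sup>+w. indicator U w \<partial>N)" by simp
  also have "\<dots> \<le> (\<integral>\<^sup>+w. liminf (\<lambda>j. g j w) \<partial>N)"
  proof (rule nn_integral_mono)
    fix w
    show "indicator U w \<le> liminf (\<lambda>j. g j w)"
    proof (cases "w \<in> U")
      case True
      then obtain e where e: "e > 0" "ball w e \<subseteq> U" using U open_contains_ball by blast
      have "(\<lambda>j. s j) \<longlonglongrightarrow> 0" unfolding s_def using LIMSEQ_inverse_real_of_nat by (simp add: inverse_eq_divide)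
      then have "eventually (\<lambda>j. s j < e) sequentially" using e(1) by (rule order_tendstoD)
      then have "eventually (\<lambda>j. 1 \<le> g j w) sequentially"
      proof eventually_elim
        case (elim j)
        have "g j w = (\<integral>\<^sup>+z. indicator (ball w (s j)) z * ennreal (1 / vol j) \<partial>lborel)"
          unfolding g_def using elim e(2) by (intro nn_integral_cong) (auto simp: indicator_def dist_commute subset_iff)
        also have "\<dots> = emeasure lborel (ball w (s j)) * ennreal (1 / vol j)"
          by (subst nn_integral_multc) (auto intro!: borel_measurable_indicator)
        also have "\<dots> = ennreal (vol j * (1 / vol j))"
          using s [of j] vol [of j] by (simp add: emeasure_ball vol_def flip: ennreal_mult)
        finally show ?case using vol [of j] by simp
      qed
      then have "1 \<le> liminf (\<lambda>j. g j w)" by (rule Liminf_bounded)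
      then show ?thesis using True by simp
    qed simp
  qed
  also have "\<dots> \<le> liminf (\<lambda>j. \<integral>\<^sup>+w. g j w \<partial>N)" by (rule nn_integral_liminf) measurable
  also have "\<dots> \<le> liminf (\<lambda>j. ennreal c * emeasure lborel U)"
  proof (intro Liminf_mono always_eventually allI)
    fix j
    have "(\<integral>\<^sup>+w. g j w \<partial>N) = (\<integral>\<^sup>+z. (\<integral>\<^sup>+w. indicator U z * indicator (ball z (s j)) w * ennreal (1 / vol j) \<partial>N) \<partial>lborel)"
      unfolding g_def by (rule Fubini' [OF meas, symmetric])
    also have "\<dots> = (\<integral>\<^sup>+z. indicator U z * (emeasure N (ball z (s j)) * ennreal (1 / vol j)) \<partial>lborel)"
    proof (rule nn_integral_cong)
      fix z
      have "(\<integral>\<^sup>+w. indicator U z * indicator (ball z (s j)) w * ennreal (1 / vol j) \<partial>N) =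
        (\<integral>\<^sup>+w. (indicator U z * ennreal (1 / vol j)) * indicator (ball z (s j)) w \<partial>N)"
        by (simp only: mult_ac)
      also have "\<dots> = (indicator U z * ennreal (1 / vol j)) * emeasure N (ball z (s j))"
        by (rule nn_integral_cmult_indicator) simp
      finally show "(\<integral>\<^sup>+w. indicator U z * indicator (ball z (s j)) w * ennreal (1 / vol j) \<partial>N) =
        indicator U z * (emeasure N (ball z (s j)) * ennreal (1 / vol j))"
        by (simp only: mult_ac)
    qed
    also have "\<dots> \<le> (\<integral>\<^sup>+z. indicator U z * ennreal c \<partial>lborel)"
    proof (intro nn_integral_mono mult_left_mono)
      fix z
      have "emeasure N (ball z (s j)) * ennreal (1 / vol j) \<le> ennreal (K * s j ^ DIM('a)) * ennreal (1 / vol j)"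
        using s by (intro mult_right_mono ball) auto
      also have "\<dots> = ennreal c"
        using s [of j] vol [of j] K by (simp add: c_def vol_def flip: ennreal_mult)
      finally show "emeasure N (ball z (s j)) * ennreal (1 / vol j) \<le> ennreal c" .
    qed simp
    finally show "(\<integral>\<^sup>+w. g j w \<partial>N) \<le> ennreal c * emeasure lborel U"
      using nn_integral_cmult_indicator [of U lborel "ennreal c"] by (simp add: mult.commute)
  qed
  also have "\<dots> = ennreal c * emeasure lborel U" by (simp add: Liminf_const)
  finally show ?thesis by (simp add: c_def)
qed

text \<open>Outer regularity of Lebesgue measure extends the comparison from open sets to Borel
  sets.\<close>

lemma dominated_nn_integral:
  fixes N :: "'a::euclidean_space measure"
  assumes fin: "finite_measure N" and sets [measurable_cong, simp]: "sets N = sets borel" and K: "0 \<le> K"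
    and ball: "\<And>z s. 0 < s \<Longrightarrow> s \<le> 1 \<Longrightarrow> emeasure N (ball z s) \<le> ennreal (K * s ^ DIM('a))"
    and [measurable]: "h \<in> borel_measurable borel"
  shows "(\<integral>\<^sup>+x. h x \<partial>N) \<le> ennreal (K / unit_ball_vol (real DIM('a))) * (\<integral>\<^sup>+x. h x \<partial>lborel)"
proof -
  define c where "c = ennreal (K / unit_ball_vol (real DIM('a)))"
  have le: "emeasure N A \<le> c * emeasure lborel A" if A: "A \<in> sets borel" for A
  proof (rule ennreal_le_epsilon)
    fix e :: real assume "0 < e"
    define \<delta> where "\<delta> = e / (K / unit_ball_vol (real DIM('a)) + 1)"
    have c1: "0 < K / unit_ball_vol (real DIM('a)) + 1" using K by (simp add: add_nonneg_pos)
    have \<delta>: "0 < \<delta>" using \<open>0 < e\<close> c1 by (simp add: \<delta>_def)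
    obtain U where U: "open U" "A \<subseteq> U" "emeasure lborel (U - A) < ennreal \<delta>"
      using outer_regular_lborel [OF A \<delta>] by metis
    have [measurable]: "U \<in> sets borel" "A \<in> sets borel" using U A by auto
    have "emeasure N A \<le> emeasure N U" using U by (intro emeasure_mono) auto
    also have "\<dots> \<le> c * emeasure lborel U"
      unfolding c_def by (rule dominated_on_open [OF fin sets K ball U(1)])
    also have "emeasure lborel U = emeasure lborel A + emeasure lborel (U - A)"
      using U(2) by (subst plus_emeasure) (auto simp: Un_absorb1)
    also have "c * \<dots> \<le> c * (emeasure lborel A + ennreal \<delta>)"
      using U(3) by (intro mult_left_mono add_left_mono) auto
    also have "\<dots> = c * emeasure lborel A + c * ennreal \<delta>" by (simp add: distrib_left)
    also have "c * ennreal \<delta> \<le> ennreal e"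
    proof -
      have "c * ennreal \<delta> = ennreal (K / unit_ball_vol (real DIM('a)) * \<delta>)"
        unfolding c_def using K \<delta> by (intro ennreal_mult [symmetric]) auto
      also have "\<dots> \<le> ennreal ((K / unit_ball_vol (real DIM('a)) + 1) * \<delta>)"
        using \<delta> by (intro ennreal_leI mult_right_mono) auto
      also have "\<dots> = ennreal e" using c1 by (simp add: \<delta>_def)
      finally show ?thesis .
    qed
    finally show "emeasure N A \<le> c * emeasure lborel A + ennreal e" by (simp add: add_left_mono)
  qed
  have "N \<le> density lborel (\<lambda>_. c)"
    by (subst le_measure) (auto simp: emeasure_density nn_integral_cmult le)
  then have "(\<integral>\<^sup>+x. h x \<partial>N) \<le> (\<integral>\<^sup>+x. h x \<partial>density lborel (\<lambda>_. c))"
    by (intro nn_integral_mono_measure) auto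
  then show ?thesis by (simp add: nn_integral_density nn_integral_cmult c_def)
qed

text \<open>The bound on preimages of small balls turns into a bound on the density of the image
  of Lebesgue measure. The constant depends only on \<open>r\<close>, \<open>\<eta>\<close> and
  \<open>M\<close>. This uniformity is what allows the same bound for preimages of every order.\<close>

lemma transversal_pushforward:
  fixes r \<eta> M :: real
  assumes r: "0 < r" and \<eta>: "0 < \<eta>" and M: "0 \<le> M"
  shows "\<exists>K\<ge>0. \<forall>(A :: (real^'u::finite) \<Rightarrow>\<^sub>L (real^'d::finite)) G v0 h.
    conorm_ge A \<eta> \<and> norm A \<le> M \<and> continuous_on UNIV G \<and> h \<in> borel_measurable borel \<and>
    (\<forall>v\<in>ball v0 r. \<forall>w\<in>ball v0 r. norm (G v - G w - blinfun_apply A (v - w)) \<le> \<eta> / 2 * norm (v - w)) \<longrightarrow>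
    (\<integral>\<^sup>+v. indicator (ball v0 r) v * h (G v) \<partial>lborel) \<le> ennreal K * (\<integral>\<^sup>+y. h y \<partial>lborel)"
proof -
  obtain K where K0: "0 \<le> K" and K: "\<And>(A :: (real^'u::finite) \<Rightarrow>\<^sub>L (real^'d::finite)) G v0 z s.
    \<lbrakk>conorm_ge A \<eta>; norm A \<le> M; 0 < s; s \<le> 1;
    \<forall>v\<in>ball v0 r. \<forall>w\<in>ball v0 r. norm (G v - G w - blinfun_apply A (v - w)) \<le> \<eta> / 2 * norm (v - w)\<rbrakk> \<Longrightarrow>
    emeasure lborel {v \<in> ball v0 r. norm (G v - z) < s} \<le> ennreal (K * s ^ CARD('d))"
    using small_ball_preimage [OF r \<eta> M, where 'u = 'u and 'd = 'd] by blast
  show ?thesis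
  proof (intro exI [of _ "K / unit_ball_vol (real DIM(real^'d))"] conjI allI impI, use K0 in simp, elim conjE)
    fix A :: "(real^'u) \<Rightarrow>\<^sub>L (real^'d)" and G v0 and h :: "real^'d \<Rightarrow> ennreal"
    assume A: "conorm_ge A \<eta>" "norm A \<le> M" and G: "continuous_on UNIV G" and [measurable]: "h \<in> borel_measurable borel"
      and app: "\<forall>v\<in>ball v0 r. \<forall>w\<in>ball v0 r. norm (G v - G w - blinfun_apply A (v - w)) \<le> \<eta> / 2 * norm (v - w)"
    have [measurable]: "G \<in> borel_measurable borel" using G by (rule borel_measurable_continuous_onI)
    define N where "N = distr (density lborel (indicator (ball v0 r))) borel G"
    have e: "emeasure N X = emeasure lborel {v \<in> ball v0 r. G v \<in> X}" if [measurable]: "X \<in> sets borel" for X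
    proof -
      have "emeasure N X = emeasure (density lborel (indicator (ball v0 r))) (G -` X)"
        unfolding N_def by (subst emeasure_distr) auto
      also have "\<dots> = (\<integral>\<^sup>+v. indicator (ball v0 r) v * indicator (G -` X) v \<partial>lborel)"
        using measurable_sets [OF \<open>G \<in> borel_measurable borel\<close> that] by (intro emeasure_density) (auto intro!: borel_measurable_indicator)
      also have "\<dots> = (\<integral>\<^sup>+v. indicator {v \<in> ball v0 r. G v \<in> X} v \<partial>lborel)"
        by (intro nn_integral_cong) (simp add: indicator_def)
      also have "\<dots> = emeasure lborel {v \<in> ball v0 r. G v \<in> X}"
        by (rule nn_integral_indicator) measurable
      finally show ?thesis .
    qed
    have "emeasure N (space N) \<noteq> \<infinity>"
      using emeasure_bounded_finite [of "ball v0 r"] by (simp add: e N_def [THEN arg_cong [where f = space]] less_top del: mem_ball)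
    then have fin: "finite_measure N" by (rule finite_measureI)
    have "(\<integral>\<^sup>+v. indicator (ball v0 r) v * h (G v) \<partial>lborel) = (\<integral>\<^sup>+y. h y \<partial>N)"
      unfolding N_def by (subst nn_integral_distr) (auto intro!: nn_integral_density [symmetric] borel_measurable_indicator)
    also have "\<dots> \<le> ennreal (K / unit_ball_vol (real DIM(real^'d))) * (\<integral>\<^sup>+y. h y \<partial>lborel)"
    proof (rule dominated_nn_integral [OF fin _ K0])
      fix z s assume s: "(0::real) < s" "s \<le> 1"
      show "emeasure N (ball z s) \<le> ennreal (K * s ^ DIM(real^'d))"
        using K [OF A s app, of z] by (simp add: e dist_norm norm_minus_commute)
    qed (simp_all add: N_def)
    finally show "(\<integral>\<^sup>+v. indicator (ball v0 r) v * h (G v) \<partial>lborel) \<le>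
      ennreal (K / unit_ball_vol (real DIM(real^'d))) * (\<integral>\<^sup>+y. h y \<partial>lborel)" .
  qed
qed

section \<open>Test functions\<close>

lemma tendsto_open_approximation:
  fixes U :: "'a::metric_space set"
  assumes "open U" "U \<noteq> UNIV"
  shows "(\<lambda>k. min 1 (real k * infdist x (- U))) \<longlonglongrightarrow> indicator U x"
proof (cases "x \<in> U")
  case True
  have "closed (- U)" "- U \<noteq> {}" using assms by auto
  then have pos: "0 < infdist x (- U)"
    using True in_closed_iff_infdist_zero [of "- U" x] infdist_nonneg [of x "- U"] by force
  have "eventually (\<lambda>k. 1 / infdist x (- U) \<le> real k) sequentially"
    by (metis eventually_sequentiallyI of_nat_le_iff order_trans real_arch_simple)
  then have "eventually (\<lambda>k. min 1 (real k * infdist x (- U)) = 1) sequentially"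
    by eventually_elim (use pos in \<open>simp add: field_simps\<close>)
  then show ?thesis using True by (simp add: tendsto_eventually)
qed simp

lemma measure_eqI_bounded_continuous:
  fixes M N :: "'a::metric_space measure"
  assumes M: "prob_space M" "sets M = sets borel" and N: "prob_space N" "sets N = sets borel"
    and eq: "\<And>g :: 'a \<Rightarrow> real. continuous_on UNIV g \<Longrightarrow> bounded (range g) \<Longrightarrow> (\<integral>x. g x \<partial>M) = (\<integral>x. g x \<partial>N)"
  shows "M = N"
proof -
  have open_eq: "emeasure M U = emeasure N U" if U: "open U" for U
  proof (cases "U = UNIV")
    case True
    then show ?thesis
      using prob_space.emeasure_space_1 [OF M(1)] prob_space.emeasure_space_1 [OF N(1)]
        sets_eq_imp_space_eq [OF M(2)] sets_eq_imp_space_eq [OF N(2)] by simp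
  next
    case False
    let ?g = "\<lambda>k x. min 1 (real k * infdist x (- U))"
    have g: "continuous_on UNIV (?g k)" "\<And>x. norm (?g k x) \<le> 1" for k
      by (auto intro!: continuous_intros simp: infdist_nonneg)
    have lim: "(\<lambda>k. \<integral>x. ?g k x \<partial>P) \<longlonglongrightarrow> measure P U" if P: "prob_space P" "sets P = sets borel" for P :: "'a measure"
    proof -
      interpret prob_space P by (rule P(1))
      have UP [measurable]: "U \<in> sets P" using U P(2) by auto
      have "(\<lambda>k. \<integral>x. ?g k x \<partial>P) \<longlonglongrightarrow> (\<integral>x. indicator U x \<partial>P)"
      proof (rule integral_dominated_convergence [where w = "\<lambda>_. 1"])
        show "?g k \<in> borel_measurable P" for k
          using borel_measurable_continuous_onI [OF g(1)] measurable_cong_sets [OF P(2) refl] by blast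
        show "AE x in P. (\<lambda>k. ?g k x) \<longlonglongrightarrow> indicator U x"
          using tendsto_open_approximation [OF U False] by simp
      qed (use g(2) in auto)
      then show ?thesis using UP sets.sets_into_space [OF UP] by (simp add: Int_absorb2)
    qed
    have bdd: "bounded (range (?g k))" for k using g(2) by (auto simp: bounded_iff)
    have "measure M U = measure N U"
      using lim [OF M] lim [OF N] unfolding eq [OF g(1) bdd] by (rule LIMSEQ_unique)
    then show ?thesis
      using prob_space.finite_measure [OF M(1)] prob_space.finite_measure [OF N(1)] by (simp add: finite_measure.emeasure_eq_measure)
  qed
  show ?thesis
  proof (rule measure_eqI_generator_eq [where A = "\<lambda>_. UNIV" and \<Omega> = UNIV and E = "{S. open S}"])
    show "sets M = sigma_sets UNIV {S. open S}" "sets N = sigma_sets UNIV {S. open S}"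
      using M(2) N(2) by (simp_all add: sets_borel)
    show "emeasure M UNIV \<noteq> \<infinity>" for i :: nat
      using prob_space.emeasure_space_1 [OF M(1)] sets_eq_imp_space_eq [OF M(2)] by simp
  qed (use open_eq in \<open>auto simp: Int_stable_def\<close>)
qed

text \<open>The functions \<open>max 0 (q - m dist x d)\<close> with rational height, integral
  slope and apex in a countable dense set form a countable family. Every nonnegative continuous
  function is the supremum of the members below it, hence the limit of the maxima of the first
  \<open>j\<close> of these. In this way convergence for a countable family of Lipschitz functions
  controls all continuous functions.\<close>

lemma tent_minorants:
  obtains G :: "nat set \<Rightarrow> 'a::{metric_space, second_countable_topology} \<Rightarrow> real"
  where "\<And>S. finite S \<Longrightarrow> \<exists>L\<ge>0. \<forall>x y. \<bar>G S x - G S y\<bar> \<le> L * dist x y"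
    and "\<And>S. finite S \<Longrightarrow> \<exists>B. \<forall>x. 0 \<le> G S x \<and> G S x \<le> B"
    and "\<And>g :: 'a \<Rightarrow> real. continuous_on UNIV g \<Longrightarrow> (\<And>x. 0 \<le> g x) \<Longrightarrow>
      \<exists>S. (\<forall>j. finite (S j) \<and> (\<forall>x. G (S j) x \<le> g x)) \<and> (\<forall>x. (\<lambda>j. G (S j) x) \<longlonglongrightarrow> g x)"
proof -
  obtain D :: "'a set" where D: "countable D" "\<And>U. open U \<Longrightarrow> U \<noteq> {} \<Longrightarrow> \<exists>d\<in>D. d \<in> U"
    using countable_dense_setE by blast
  define J where "J = (\<rat> :: real set) \<times> (UNIV :: nat set) \<times> D"
  have cJ: "countable J" unfolding J_def using D(1) by (intro countable_SIGMA countable_rat) auto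
  have Jne: "J \<noteq> {}" using D(2) [of UNIV] by (auto simp: J_def intro!: exI [of _ 0])
  define b where "b i x = (case from_nat_into J i of (q, m, d) \<Rightarrow> max 0 (q - real m * dist x d))" for i x
  define G where "G S x = Max (insert 0 ((\<lambda>i. b i x) ` S))" for S x
  have G_le: "G S x \<le> t \<longleftrightarrow> 0 \<le> t \<and> (\<forall>i\<in>S. b i x \<le> t)" if "finite S" for S x t
    using that by (simp add: G_def)
  have G_ge: "b i x \<le> G S x" if "finite S" "i \<in> S" for S x i
    using that by (auto simp: G_def)
  have G_0: "0 \<le> G S x" if "finite S" for S x using that by (simp add: G_def)
  have b_Lip: "\<exists>m\<ge>0. \<forall>x y. \<bar>b i x - b i y\<bar> \<le> m * dist x y" for i
  proof -
    obtain q m d where qmd: "from_nat_into J i = (q, m, d)" by (metis prod_cases3)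
    have "\<bar>b i x - b i y\<bar> \<le> real m * dist x y" for x y
    proof -
      have "\<bar>dist x d - dist y d\<bar> \<le> dist x y" by (metis abs_dist_diff_le dist_commute)
      then have "real m * \<bar>dist x d - dist y d\<bar> \<le> real m * dist x y" by (rule mult_left_mono) simp
      then have "\<bar>real m * dist x d - real m * dist y d\<bar> \<le> real m * dist x y"
        by (simp add: abs_mult right_diff_distrib [symmetric])
      then show ?thesis by (simp add: b_def qmd)
    qed
    then show ?thesis by (intro exI [of _ "real m"]) auto
  qed
  have Lip: "\<exists>L\<ge>0. \<forall>x y. \<bar>G S x - G S y\<bar> \<le> L * dist x y" if "finite S" for S
    using that
  proof (induction S)
    case empty
    show ?case by (intro exI [of _ 0]) (simp add: G_def)
  next
    case (insert i S)
    obtain L where L: "L \<ge> 0" "\<And>x y. \<bar>G S x - G S y\<bar> \<le> L * dist x y" using insert.IH by blast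
    obtain m where m: "m \<ge> 0" "\<And>x y. \<bar>b i x - b i y\<bar> \<le> m * dist x y" using b_Lip by blast
    have ins: "G (insert i S) x = max (b i x) (G S x)" for x
      using insert.hyps(1) by (simp add: G_def insert_commute [of 0])
    have "\<bar>G (insert i S) x - G (insert i S) y\<bar> \<le> (m + L) * dist x y" for x y
      using L(2) [of x y] m(2) [of x y] by (simp add: ins distrib_right)
    then show ?case using L(1) m(1) by (intro exI [of _ "m + L"]) auto
  qed
  have b_bdd: "\<exists>B. \<forall>x. b i x \<le> B" for i
  proof -
    obtain q m d where qmd: "from_nat_into J i = (q, m, d)" by (metis prod_cases3)
    have "b i x \<le> max 0 q" for x by (simp add: b_def qmd) (smt (verit) mult_nonneg_nonneg of_nat_0_le_iff zero_le_dist)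
    then show ?thesis by blast
  qed
  have bdd: "\<exists>B. \<forall>x. 0 \<le> G S x \<and> G S x \<le> B" if fin: "finite S" for S
  proof -
    obtain B where B: "\<And>i x. b i x \<le> B i" using b_bdd by metis
    have "G S x \<le> (\<Sum>i\<in>S. \<bar>B i\<bar>)" for x
    proof -
      have "b i x \<le> (\<Sum>i\<in>S. \<bar>B i\<bar>)" if "i \<in> S" for i
        using B [of i x] member_le_sum [OF that, of "\<lambda>i. \<bar>B i\<bar>"] fin by fastforce
      then show ?thesis using fin by (simp add: G_le sum_nonneg)
    qed
    then show ?thesis using G_0 [OF fin] by blast
  qed
  have approx: "\<exists>S. (\<forall>j. finite (S j) \<and> (\<forall>x. G (S j) x \<le> g x)) \<and> (\<forall>x. (\<lambda>j. G (S j) x) \<longlonglongrightarrow> g x)"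
    if g: "continuous_on UNIV g" "\<And>x. 0 \<le> g x" for g :: "'a \<Rightarrow> real"
  proof -
    define S where "S j = {i. i \<le> j \<and> (\<forall>x. b i x \<le> g x)}" for j :: nat
    have fin: "finite (S j)" for j by (rule finite_subset [of _ "{..j}"]) (auto simp: S_def)
    have le: "G (S j) x \<le> g x" for j x
      using fin g(2) by (simp add: G_le) (simp add: S_def)
    have "(\<lambda>j. G (S j) x) \<longlonglongrightarrow> g x" for x
    proof (rule LIMSEQ_I)
      fix e :: real assume e: "0 < e"
      have "\<exists>i. (\<forall>y. b i y \<le> g y) \<and> g x - e < b i x"
      proof (cases "g x < e")
        case True
        obtain d where "d \<in> D" using D(2) [of UNIV] by auto
        then have "(0, 0, d) \<in> J" by (simp add: J_def)
        then obtain i where "from_nat_into J i = (0, 0, d)" using from_nat_into_surj [OF cJ] by blast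
        then have "b i y = 0" for y by (simp add: b_def)
        then show ?thesis using True g(2) by (intro exI [of _ i]) auto
      next
        case False
        \<comment> \<open>The tent of height \<open>q\<close> slightly below \<open>g x\<close> is
          made so steep that it vanishes outside the ball on which \<open>g\<close> exceeds
          \<open>q\<close>, and its apex so close to \<open>x\<close> that it still exceeds
          \<open>g x - e\<close> at \<open>x\<close>.\<close>
        obtain q where q: "q \<in> \<rat>" "g x - e / 2 < q" "q < g x - e / 4" using Rats_dense_in_real [of "g x - e / 2" "g x - e / 4"] e by auto
        have "eventually (\<lambda>y. q < g y) (nhds x)"
          using g(1) q(3) e by (intro order_tendstoD [of g "g x"])
            (auto simp: continuous_on_eq_continuous_at isCont_def tendsto_at_iff_tendsto_nhds)
        then obtain r where r: "r > 0" "\<And>y. dist y x < r \<Longrightarrow> q < g y" by (auto simp: eventually_nhds_metric)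
        obtain m :: nat where m: "q < real m * (r / 2)" using r(1) ex_less_of_nat_mult [of "r/2" q] by auto
        have q0: "0 < q" using False q e by linarith
        have m0: "0 < real m" using m q0 r(1) by (cases "m = 0") auto
        let ?\<rho> = "min (r / 2) (e / (4 * real m))"
        have "0 < ?\<rho>" using r(1) e m0 by simp
        then have "x \<in> ball x ?\<rho>" by (simp only: centre_in_ball)
        then obtain d where "d \<in> D" "d \<in> ball x ?\<rho>" using D(2) [OF open_ball] by blast
        then have d: "d \<in> D" "dist d x < ?\<rho>" by (simp_all add: dist_commute)
        have "(q, m, d) \<in> J" using q d by (simp add: J_def)
        then obtain i where i: "from_nat_into J i = (q, m, d)" using from_nat_into_surj [OF cJ] by blast
        have "b i y \<le> g y" for y
        proof (cases "dist y x < r")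
          case True
          have "b i y \<le> q" using q0 by (simp add: b_def i)
          then show ?thesis using r(2) [OF True] by simp
        next
          case False
          then have "r / 2 \<le> dist y d" using d(2) dist_triangle [of y x d] by simp
          then have "real m * (r / 2) \<le> real m * dist y d" by (rule mult_left_mono) simp
          then have "b i y = 0" using m by (simp add: b_def i)
          then show ?thesis using g(2) by simp
        qed
        moreover have "real m * dist x d < e / 2"
        proof -
          have "real m * dist x d \<le> real m * (e / (4 * real m))" using d(2) by (intro mult_left_mono) (auto simp: dist_commute)
          also have "\<dots> < e / 2" using m0 e by simp
          finally show ?thesis .
        qed
        then have "g x - e < b i x" using q(2) by (simp add: b_def i)
        ultimately show ?thesis by blast
      qed
      then obtain i where i: "\<And>y. b i y \<le> g y" "g x - e < b i x" by blast
      have "norm (G (S j) x - g x) < e" if "i \<le> j" for j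
      proof -
        have "i \<in> S j" using that i by (simp add: S_def)
        then have "b i x \<le> G (S j) x" using G_ge fin by blast
        then show ?thesis using le [of j x] i(2) by simp
      qed
      then show "\<exists>no. \<forall>j\<ge>no. norm (G (S j) x - g x) < e" by blast
    qed
    then show ?thesis using fin le by blast
  qed
  show ?thesis by (rule that [of G, OF Lip bdd approx])
qed

section \<open>Continuously differentiable maps on the torus\<close>

lemma continuous_torusI:
  fixes F :: "'u::finite torus \<Rightarrow> 'b::metric_space"
  assumes "continuous_on UNIV (\<lambda>v :: real^'u. F (proj v))"
  shows "continuous_on UNIV F"
  unfolding continuous_on_iff
proof (intro ballI allI impI)
  fix x and e :: real assume e: "0 < e"
  obtain v :: "real^'u" where v: "x = proj v" by (rule proj_cases)
  obtain d where d: "d > 0" "\<And>w :: real^'u. dist w v < d \<Longrightarrow> dist (F (proj w)) (F (proj v)) < e"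
    using assms e unfolding continuous_on_iff by (metis UNIV_I)
  have "dist (F y) (F x) < e" if "dist y x < d" for y
  proof -
    obtain t where t: "y = tadd x t" "norm t = dist x y" by (rule torus_lift)
    show ?thesis using d(2) [of "v + t"] t v that by (simp add: dist_norm dist_commute)
  qed
  then show "\<exists>d>0. \<forall>y\<in>UNIV. dist y x < d \<longrightarrow> dist (F y) (F x) < e" using d(1) by blast
qed

lemma bounded_torus:
  fixes F :: "'u::finite torus \<Rightarrow> 'b::real_normed_vector"
  assumes "continuous_on UNIV F"
  obtains B where "0 < B" "\<And>x. norm (F x) \<le> B"
proof -
  have "bounded (range F)" using assms by (intro compact_imp_bounded compact_continuous_image compact_UNIV_torus)
  then show ?thesis using that by (auto simp: bounded_pos)
qed

text \<open>On the compact torus, continuity of the derivative provides the modulus of continuity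
  from which the distortion of fibre sums is estimated.\<close>

definition C1_map :: "('u::finite torus \<Rightarrow> 'b::real_normed_vector) \<Rightarrow> bool" where
  "C1_map f \<longleftrightarrow> (\<forall>x. has_torus_derivative f (torus_deriv f x) x) \<and> continuous_on UNIV (torus_deriv f)"

lemma C2_on_imp_C1_map:
  assumes "C2_on UNIV f"
  shows "C1_map f"
proof -
  have 1: "has_torus_derivative f (torus_deriv f x) x" for x
    using assms torus_deriv_eq unfolding C2_on_def by blast
  have "\<forall>x. \<exists>D. has_torus_derivative (torus_deriv f) D x" using assms by (simp add: C2_on_def)
  then obtain D where D: "\<And>x. has_torus_derivative (torus_deriv f) (D x) x" by metis
  have "continuous_on UNIV (\<lambda>v. torus_deriv f (proj v))"
    using D by (auto simp: has_torus_derivative_def continuous_on_eq_continuous_at intro!: has_derivative_continuous)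
  then show ?thesis using 1 continuous_torusI by (auto simp: C1_map_def)
qed

lemma C1_map_lift:
  "C1_map f \<Longrightarrow> ((\<lambda>w. f (proj w)) has_derivative blinfun_apply (torus_deriv f (proj v))) (at v)"
  by (simp add: C1_map_def has_torus_derivative_def)

lemma C1_map_continuous:
  assumes "C1_map f" shows "continuous_on UNIV f"
  by (rule continuous_torusI)
     (use C1_map_lift [OF assms] in \<open>auto simp: continuous_on_eq_continuous_at intro!: has_derivative_continuous\<close>)

lemma C1_map_lipschitz:
  assumes "C1_map f" and M: "\<And>x. norm (torus_deriv f x) \<le> M"
  shows "norm (f x - f y) \<le> M * dist x y"
proof -
  obtain t where t: "y = tadd x t" "norm t = dist x y" by (rule torus_lift)
  obtain v where v: "x = proj v" by (rule proj_cases)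
  have "norm (f (proj v) - f (proj (v + t))) \<le> M * norm (v - (v + t))"
  proof (rule differentiable_bound [of UNIV "\<lambda>w. f (proj w)" "\<lambda>w. blinfun_apply (torus_deriv f (proj w))"])
    show "onorm (blinfun_apply (torus_deriv f (proj w))) \<le> M" for w
      using M [of "proj w"] by (simp add: norm_blinfun.rep_eq)
  qed (use C1_map_lift [OF assms(1)] in auto)
  then show ?thesis using t v by simp
qed

text \<open>In finite dimension the norm is attained on the compact unit sphere, so the strict
  pointwise inequality becomes a uniform one.\<close>

lemma norm_contraction_less_1:
  fixes C :: "('d::finite) lin"
  assumes "C \<in> contractions"
  shows "norm C < 1"
proof -
  let ?S = "sphere (0 :: real^'d) 1"
  have ne: "?S \<noteq> {}" using vector_choose_size [of 1] by (auto simp: dist_norm)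
  have "continuous_on ?S (\<lambda>v. norm (blinfun_apply C v))"
    by (intro continuous_intros)
  then obtain w where w: "w \<in> ?S" "\<And>v. v \<in> ?S \<Longrightarrow> norm (blinfun_apply C v) \<le> norm (blinfun_apply C w)"
    using continuous_attains_sup [OF compact_sphere ne] by blast
  let ?m = "norm (blinfun_apply C w)"
  have "norm C \<le> ?m"
  proof (rule norm_blinfun_bound)
    fix v
    show "norm (blinfun_apply C v) \<le> ?m * norm v"
    proof (cases "v = 0")
      case False
      then have "norm (blinfun_apply C ((1 / norm v) *\<^sub>R v)) \<le> ?m" by (intro w(2)) simp
      then show ?thesis using False by (simp add: blinfun.scaleR_right field_simps)
    qed simp
  qed simp
  moreover have "w \<noteq> 0" using w(1) by auto
  then have "?m < 1" using assms w(1) unfolding contractions_def by fastforce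
  ultimately show ?thesis by simp
qed

section \<open>The natural extension\<close>

context torus_endo begin

text \<open>The digit of \<open>x\<close> records which inverse branch leads from the image of
  \<open>x\<close> back to \<open>x\<close>.\<close>

definition digit :: "'u torus \<Rightarrow> real^'u" where
  "digit x = (THE k. k \<in> digits \<and> branch k (torus_map E x) = x)"

lemma digit_unique: "\<exists>!k. k \<in> digits \<and> branch k (torus_map E x) = x"
  using bij_branch [of "torus_map E x"] unfolding bij_betw_def inj_on_def preimages_def by force

lemma digit_in_digits: "digit x \<in> digits" and branch_digit: "branch (digit x) (torus_map E x) = x"
  using theI' [OF digit_unique [of x]] by (simp_all add: digit_def)

lemma digit_branch: "k \<in> digits \<Longrightarrow> digit (branch k x) = k"
  unfolding digit_def by (rule the1_equality [OF digit_unique]) (simp add: torus_map_branch)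

lemma measurable_digit [measurable]: "digit \<in> borel \<rightarrow>\<^sub>M count_space digits"
proof (rule measurable_count_space_eq2 [THEN iffD2], simp, safe)
  show "digit x \<in> digits" for x by (rule digit_in_digits)
  fix k assume k: "k \<in> digits"
  have "digit -` {k} \<inter> space borel = {x \<in> space borel. dist (branch k (torus_map E x)) x = 0}"
    using k digit_in_digits branch_digit digit_branch by auto metis
  also have "\<dots> \<in> sets borel" by measurable
  finally show "digit -` {k} \<inter> space borel \<in> sets borel" .
qed

text \<open>A baker's transformation. The first coordinate runs backwards along the inverse
  branches that are prescribed by the digits of the second, which runs forwards. Since the digits
  of a Lebesgue random point are independent and uniform, the first coordinates form a random past
  of the initial point.\<close>

definition baker :: "'u torus \<times> 'u torus \<Rightarrow> 'u torus \<times> 'u torus" where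
  "baker p = (branch (digit (snd p)) (fst p), torus_map E (snd p))"

abbreviation torus2 :: "('u torus \<times> 'u torus) measure" where
  "torus2 \<equiv> torus_lebesgue \<Otimes>\<^sub>M torus_lebesgue"

lemma measurable_baker [measurable]: "baker \<in> torus2 \<rightarrow>\<^sub>M torus2"
proof -
  have "(\<lambda>p. branch (digit (snd p)) (fst p)) \<in> (borel \<Otimes>\<^sub>M borel) \<rightarrow>\<^sub>M borel"
    by (rule measurable_compose_countable' [where I = digits]) (auto intro: countable_finite)
  then have "baker \<in> (borel \<Otimes>\<^sub>M borel) \<rightarrow>\<^sub>M (borel \<Otimes>\<^sub>M borel)"
    unfolding baker_def by measurable
  then show ?thesis by (simp cong: measurable_cong_sets)
qed

lemma measurable_baker_pow [measurable]: "(baker ^^ n) \<in> torus2 \<rightarrow>\<^sub>M torus2"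
proof (induction n)
  case (Suc n)
  show ?case unfolding funpow.simps by (rule measurable_comp [OF Suc measurable_baker])
qed simp

text \<open>Decompose the second coordinate by its first digit. The rest of it is again Lebesgue
  distributed, and the sum over the digits of the branches applied to the first coordinate
  preserves Lebesgue measure up to the factor \<open>deg\<close>.\<close>

lemma nn_integral_baker:
  assumes [measurable]: "h \<in> borel_measurable torus2"
  shows "(\<integral>\<^sup>+p. h (baker p) \<partial>torus2) = (\<integral>\<^sup>+p. h p \<partial>torus2)"
proof -
  interpret pair_sigma_finite "torus_lebesgue :: 'u torus measure" "torus_lebesgue :: 'u torus measure" ..
  let ?T = "torus_lebesgue :: 'u torus measure"
  have [measurable]: "h \<in> borel_measurable (borel \<Otimes>\<^sub>M borel)"
    using assms by (simp cong: measurable_cong_sets)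
  have meas: "(\<lambda>p. h (baker p)) \<in> borel_measurable (?T \<Otimes>\<^sub>M ?T)"
    by (rule measurable_compose [OF measurable_baker assms])
  define g where "g x' = (\<integral>\<^sup>+x. h (baker (x, x')) \<partial>?T)" for x'
  have snd_meas: "(\<lambda>x'. \<integral>\<^sup>+x. H (x, x') \<partial>?T) \<in> borel_measurable borel"
    if "H \<in> borel_measurable (?T \<Otimes>\<^sub>M ?T)" for H :: "_ \<Rightarrow> ennreal"
  proof -
    have "(\<lambda>(x', x). H (x, x')) \<in> borel_measurable (?T \<Otimes>\<^sub>M ?T)"
      using measurable_compose [OF measurable_pair_swap' that] by (simp add: case_prod_beta')
    from torus.borel_measurable_nn_integral [OF this]
    show ?thesis by (simp cong: measurable_cong_sets)
  qed
  have [measurable]: "g \<in> borel_measurable borel" unfolding g_def by (rule snd_meas [OF meas])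
  note snd_meas [OF assms, measurable]
  have "(\<integral>\<^sup>+p. h (baker p) \<partial>torus2) = (\<integral>\<^sup>+x'. g x' \<partial>?T)"
    unfolding g_def using meas by (rule nn_integral_snd [symmetric])
  also have "\<dots> = (\<integral>\<^sup>+x'. (\<integral>\<^sup>+x. h (x, x') \<partial>?T) \<partial>?T)"
  proof -
    \<comment> \<open>Substitute \<open>x' = branch k x''\<close>, which has the digit
      \<open>k\<close> and the image \<open>x''\<close>, then sum the branches in the first
      coordinate.\<close>
    have "ennreal deg * (\<integral>\<^sup>+x'. g x' \<partial>?T) = (\<integral>\<^sup>+x''. (\<Sum>k\<in>digits. g (branch k x'')) \<partial>?T)"
      by (rule nn_integral_branches [symmetric]) measurable
    also have "\<dots> = (\<integral>\<^sup>+x''. (\<Sum>k\<in>digits. \<integral>\<^sup>+x. h (branch k x, x'') \<partial>?T) \<partial>?T)"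
      by (intro nn_integral_cong sum.cong refl) (simp add: g_def baker_def digit_branch torus_map_branch)
    also have "\<dots> = (\<integral>\<^sup>+x''. (\<integral>\<^sup>+x. (\<Sum>k\<in>digits. h (branch k x, x'')) \<partial>?T) \<partial>?T)"
      by (intro nn_integral_cong nn_integral_sum [symmetric]) measurable
    also have "\<dots> = (\<integral>\<^sup>+x''. ennreal deg * (\<integral>\<^sup>+x. h (x, x'') \<partial>?T) \<partial>?T)"
      by (intro nn_integral_cong nn_integral_branches) measurable
    also have "\<dots> = ennreal deg * (\<integral>\<^sup>+x''. (\<integral>\<^sup>+x. h (x, x'') \<partial>?T) \<partial>?T)"
      by (rule nn_integral_cmult) measurable
    finally show ?thesis using deg_pos by (simp add: ennreal_mult_cancel_left)
  qed
  also have "\<dots> = (\<integral>\<^sup>+p. h p \<partial>torus2)"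
    by (rule nn_integral_snd) measurable
  finally show ?thesis .
qed

lemma nn_integral_baker_pow:
  assumes "h \<in> borel_measurable torus2"
  shows "(\<integral>\<^sup>+p. h ((baker ^^ n) p) \<partial>torus2) = (\<integral>\<^sup>+p. h p \<partial>torus2)"
proof (induction n)
  case (Suc n)
  have "(\<integral>\<^sup>+p. h ((baker ^^ Suc n) p) \<partial>torus2) = (\<integral>\<^sup>+p. h ((baker ^^ n) (baker p)) \<partial>torus2)"
    by (simp only: funpow_Suc_right o_apply)
  also have "\<dots> = (\<integral>\<^sup>+p. h ((baker ^^ n) p) \<partial>torus2)"
    by (rule nn_integral_baker) (rule measurable_compose [OF measurable_baker_pow assms])
  finally show ?case using Suc by simp
qed simp

definition past :: "nat \<Rightarrow> 'u torus \<times> 'u torus \<Rightarrow> 'u torus" where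
  "past n p = fst ((baker ^^ n) p)"

lemma past_0 [simp]: "past 0 p = fst p" by (simp add: past_def)

lemma torus_map_past: "(torus_map E ^^ j) (past (j + n) p) = past n p"
proof (induction j)
  case (Suc j)
  have "torus_map E (past (Suc j + n) p) = past (j + n) p"
    by (simp add: past_def baker_def torus_map_branch digit_in_digits)
  then show ?case using Suc by (simp only: funpow_Suc_right o_apply)
qed simp

lemma measurable_past [measurable]: "past n \<in> torus2 \<rightarrow>\<^sub>M borel"
proof -
  have "(\<lambda>p. fst ((baker ^^ n) p)) \<in> torus2 \<rightarrow>\<^sub>M torus_lebesgue"
    by (rule measurable_compose [OF measurable_baker_pow measurable_fst])
  then show ?thesis unfolding past_def measurable_cong_sets [OF refl sets_torus_lebesgue] .
qed

lemma distr_past: "distr torus2 borel (past n) = torus_lebesgue"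
proof (rule measure_eqI)
  interpret prob_space "torus_lebesgue :: 'u torus measure" by (rule prob_space_torus)
  fix A assume "A \<in> sets (distr torus2 borel (past n))"
  then have [measurable]: "A \<in> sets borel" by simp
  have "emeasure (distr torus2 borel (past n)) A = (\<integral>\<^sup>+p. indicator A (past n p) \<partial>torus2)"
    by (subst nn_integral_indicator [symmetric], simp, subst nn_integral_distr) simp_all
  also have "\<dots> = (\<integral>\<^sup>+p. indicator A (fst p) \<partial>torus2)"
    unfolding past_def by (rule nn_integral_baker_pow) measurable
  also have "\<dots> = emeasure torus_lebesgue A"
    by (subst torus.nn_integral_fst [symmetric]) simp_all
  finally show "emeasure (distr torus2 borel (past n)) A = emeasure torus_lebesgue A" .
qed simp

end

section \<open>The measure carried by the attractor\<close>

locale skew = torus_endo E for E :: "('u::finite) lin" +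
  fixes C :: "('d::finite) lin" and f :: "'u torus \<Rightarrow> real^'d"
  assumes contraction: "C \<in> contractions" and C1: "C1_map f"
begin

abbreviation T :: "('u, 'd) phase \<Rightarrow> ('u, 'd) phase" where "T \<equiv> skew_product E C f"

text \<open>The second component of \<open>T^n (a, 0)\<close>. If \<open>a\<close> is the
  \<open>n\<close>-th preimage of \<open>x\<close> that is selected by a word, this is the sum
  \<open>S(x, a)\<close> along the word.\<close>

definition fiber_sum :: "nat \<Rightarrow> 'u torus \<Rightarrow> real^'d" where
  "fiber_sum n a = (\<Sum>i = 1..n. (blinfun_apply C ^^ (i - 1)) (f ((torus_map E ^^ (n - i)) a)))"

definition sup_f :: real where "sup_f = (SOME B. 0 < B \<and> (\<forall>x. norm (f x) \<le> B))"

lemma norm_C: "norm C < 1" using contraction by (rule norm_contraction_less_1)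

lemma continuous_f: "continuous_on UNIV f" using C1 by (rule C1_map_continuous)

lemma measurable_f [measurable]: "f \<in> borel_measurable borel"
  using continuous_f by (rule borel_measurable_continuous_onI)

lemma sup_f: "0 < sup_f" "norm (f x) \<le> sup_f"
proof -
  have "\<exists>B. 0 < B \<and> (\<forall>x. norm (f x) \<le> B)" using bounded_torus [OF continuous_f] by metis
  from someI_ex [OF this] show "0 < sup_f" "norm (f x) \<le> sup_f" by (simp_all add: sup_f_def)
qed

lemma linear_C_pow: "linear (blinfun_apply C ^^ n)"
  by (induction n) (simp_all only: funpow.simps linear_id linear_compose bounded_linear.linear [OF blinfun.bounded_linear_right])

lemma norm_C_pow: "norm ((blinfun_apply C ^^ n) v) \<le> norm C ^ n * norm v"
proof (induction n)
  case (Suc n)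
  have "norm ((blinfun_apply C ^^ Suc n) v) \<le> norm C * norm ((blinfun_apply C ^^ n) v)" by (simp add: norm_blinfun)
  also have "\<dots> \<le> norm C * (norm C ^ n * norm v)" by (intro mult_left_mono Suc norm_ge_zero)
  finally show ?case by (simp add: mult.assoc)
qed simp

lemma fiber_sum_Suc: "fiber_sum (Suc n) a = blinfun_apply C (fiber_sum n a) + f ((torus_map E ^^ n) a)"
proof -
  have "fiber_sum (Suc n) a = f ((torus_map E ^^ n) a) +
    (\<Sum>i = Suc 1..Suc n. (blinfun_apply C ^^ (i - 1)) (f ((torus_map E ^^ (Suc n - i)) a)))"
    unfolding fiber_sum_def by (subst sum.atLeast_Suc_atMost) simp_all
  also have "(\<Sum>i = Suc 1..Suc n. (blinfun_apply C ^^ (i - 1)) (f ((torus_map E ^^ (Suc n - i)) a))) =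
    (\<Sum>i = 1..n. (blinfun_apply C ^^ i) (f ((torus_map E ^^ (n - i)) a)))"
    by (subst sum.shift_bounds_cl_Suc_ivl) simp
  also have "\<dots> = (\<Sum>i = 1..n. blinfun_apply C ((blinfun_apply C ^^ (i - 1)) (f ((torus_map E ^^ (n - i)) a))))"
    by (rule sum.cong [OF refl]) (metis Suc_pred' atLeastAtMost_iff funpow.simps(2) less_eq_Suc_le One_nat_def o_apply)
  also have "\<dots> = blinfun_apply C (fiber_sum n a)"
    by (simp add: fiber_sum_def blinfun.sum_right)
  finally show ?thesis by simp
qed

lemma fiber_sum_0 [simp]: "fiber_sum 0 a = 0"
  by (simp add: fiber_sum_def)

lemma T_pow: "(T ^^ n) (x, y) = ((torus_map E ^^ n) x, (blinfun_apply C ^^ n) y + fiber_sum n x)"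
  by (induction n) (simp_all add: skew_product_def fiber_sum_Suc blinfun.add_right)

text \<open>The cocycle identity, read off from the semigroup property of the iterates of
  \<open>T\<close>.\<close>

lemma fiber_sum_add:
  "fiber_sum (m + n) a = fiber_sum m ((torus_map E ^^ n) a) + (blinfun_apply C ^^ m) (fiber_sum n a)"
proof -
  have "(T ^^ (m + n)) (a, 0) = (T ^^ m) ((T ^^ n) (a, 0))" by (simp add: funpow_add)
  then show ?thesis by (simp add: T_pow linear_0 [OF linear_C_pow])
qed

lemma fiber_sum_le: "norm (fiber_sum n a) \<le> sup_f / (1 - norm C)"
proof (induction n)
  case (Suc n)
  have "norm (fiber_sum (Suc n) a) \<le> norm (blinfun_apply C (fiber_sum n a)) + norm (f ((torus_map E ^^ n) a))"
    unfolding fiber_sum_Suc by (rule norm_triangle_ineq)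
  also have "\<dots> \<le> norm C * (sup_f / (1 - norm C)) + sup_f"
    by (intro add_mono order_trans [OF norm_blinfun] mult_left_mono Suc sup_f norm_ge_zero)
  also have "\<dots> = sup_f / (1 - norm C)" using norm_C by (simp add: field_simps)
  finally show ?case .
qed (use sup_f norm_C in \<open>simp add: less_imp_le\<close>)

lemma continuous_T: "continuous_on UNIV T"
  unfolding skew_product_def case_prod_beta
  by (intro continuous_intros continuous_on_compose2 [OF continuous_torus_map] continuous_on_compose2 [OF continuous_f]) auto

lemma T_lipschitz: "\<exists>L. L-lipschitz_on UNIV T"
proof -
  obtain M where M: "0 < M" "\<And>x. norm (torus_deriv f x) \<le> M"
    using bounded_torus C1 unfolding C1_map_def by blast
  have "dist (T p) (T q) \<le> (norm E + norm C + M) * dist p q" for p q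
  proof -
    have "dist (T p) (T q) \<le> dist (fst (T p)) (fst (T q)) + dist (snd (T p)) (snd (T q))"
      unfolding dist_prod_def by (rule sqrt_add_le_add_sqrt [THEN order_trans]) auto
    also have "dist (fst (T p)) (fst (T q)) \<le> norm E * dist (fst p) (fst q)"
      using torus_map_lipschitz by (simp add: skew_product_def case_prod_beta)
    also have "dist (snd (T p)) (snd (T q)) \<le> norm (blinfun_apply C (snd p - snd q)) + norm (f (fst p) - f (fst q))"
      unfolding skew_product_def case_prod_beta dist_norm snd_conv blinfun.diff_right
      by (metis add_diff_add norm_triangle_ineq)
    also have "\<dots> \<le> norm C * dist (snd p) (snd q) + M * dist (fst p) (fst q)"
      unfolding dist_norm [of "snd p"] by (intro add_mono norm_blinfun C1_map_lipschitz [OF C1 M(2)])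
    finally have "dist (T p) (T q) \<le> norm E * dist (fst p) (fst q) + (norm C * dist (snd p) (snd q) + M * dist (fst p) (fst q))"
      by simp
    also have "\<dots> \<le> norm E * dist p q + (norm C * dist p q + M * dist p q)"
      using M(1) by (intro add_mono mult_left_mono dist_fst_le dist_snd_le) auto
    finally show ?thesis by (simp add: distrib_right)
  qed
  then show ?thesis using M(1) by (intro exI [of _ "norm E + norm C + M"] lipschitz_onI) auto
qed

lemma T_pow_lipschitz: "\<exists>L. L-lipschitz_on UNIV (T ^^ n)"
proof (induction n)
  case 0
  have "1-lipschitz_on UNIV (id :: ('u, 'd) phase \<Rightarrow> _)" by (simp add: lipschitz_on_def)
  then show ?case by auto
next
  case (Suc n)
  then obtain K where K: "K-lipschitz_on UNIV (T ^^ n)" by blast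
  obtain L where L: "L-lipschitz_on UNIV T" using T_lipschitz by blast
  have "(L * K)-lipschitz_on UNIV (T \<circ> (T ^^ n))"
    by (rule lipschitz_on_compose [OF K lipschitz_on_subset [OF L]]) simp
  then show ?case by auto
qed

text \<open>An observable of \<open>T\<close> evaluated along orbits that start on the zero
  section. This is a function on the torus, where the ergodic theorem is available.\<close>

definition zero_fiber_obs :: "(('u, 'd) phase \<Rightarrow> real) \<Rightarrow> nat \<Rightarrow> 'u torus \<Rightarrow> real" where
  "zero_fiber_obs g n x = g ((T ^^ n) (x, 0))"

lemma zero_fiber_obs_lipschitz:
  assumes L: "0 \<le> L" "\<And>p q. \<bar>g p - g q\<bar> \<le> L * dist p q"
  shows "\<exists>K\<ge>0. \<forall>x y. \<bar>zero_fiber_obs g n x - zero_fiber_obs g n y\<bar> \<le> K * dist x y"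
proof -
  obtain K where K: "K-lipschitz_on UNIV (T ^^ n)" using T_pow_lipschitz by blast
  have K0: "0 \<le> K" using K by (rule lipschitz_on_nonneg)
  have "\<bar>zero_fiber_obs g n x - zero_fiber_obs g n y\<bar> \<le> (L * K) * dist x y" for x y
  proof -
    have "\<bar>zero_fiber_obs g n x - zero_fiber_obs g n y\<bar> \<le> L * dist ((T ^^ n) (x, 0)) ((T ^^ n) (y, 0))"
      unfolding zero_fiber_obs_def by (rule L(2))
    also have "\<dots> \<le> L * (K * dist (x, 0 :: real^'d) (y, 0))"
      using lipschitz_onD [OF K] L(1) by (intro mult_left_mono) auto
    also have "dist (x, 0 :: real^'d) (y, 0) = dist x y" by (simp add: dist_Pair_Pair)
    finally show ?thesis by (simp add: mult.assoc)
  qed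
  then show ?thesis using L(1) K0 by (intro exI [of _ "L * K"]) auto
qed

text \<open>The point over \<open>fst p\<close> of the attractor whose past is \<open>past 1 p,
  past 2 p, \<dots>\<close>.\<close>

definition attractor_height :: "'u torus \<times> 'u torus \<Rightarrow> real^'d" where
  "attractor_height p = (\<Sum>i. (blinfun_apply C ^^ i) (f (past (Suc i) p)))"

definition srb :: "('u, 'd) phase measure" where
  "srb = distr torus2 borel (\<lambda>p. (fst p, attractor_height p))"

text \<open>The \<open>n\<close>-th partial sum is the fibre sum that starts from the
  \<open>n\<close>-th point of the past. So the attractor is approached by pushing the zero
  section forward from the remote past.\<close>

lemma attractor_height_sums:
  "(\<lambda>n. fiber_sum n (past n p)) \<longlonglongrightarrow> attractor_height p"
proof -
  have "summable (\<lambda>i. (blinfun_apply C ^^ i) (f (past (Suc i) p)))"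
  proof (rule summable_comparison_test' [where g = "\<lambda>i. norm C ^ i * sup_f" and N = 0])
    show "summable (\<lambda>i. norm C ^ i * sup_f)" using norm_C by (intro summable_mult2 summable_geometric) simp
    show "norm ((blinfun_apply C ^^ i) (f (past (Suc i) p))) \<le> norm C ^ i * sup_f" for i
      by (rule order_trans [OF norm_C_pow]) (intro mult_left_mono sup_f zero_le_power norm_ge_zero)
  qed
  then have "(\<lambda>n. \<Sum>i<n. (blinfun_apply C ^^ i) (f (past (Suc i) p))) \<longlonglongrightarrow> attractor_height p"
    unfolding attractor_height_def by (rule summable_LIMSEQ)
  moreover have "fiber_sum n (past n p) = (\<Sum>i<n. (blinfun_apply C ^^ i) (f (past (Suc i) p)))" for n
  proof -
    have "fiber_sum n (past n p) = (\<Sum>i = 1..n. (blinfun_apply C ^^ (i - 1)) (f (past i p)))"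
      unfolding fiber_sum_def
    proof (rule sum.cong [OF refl])
      fix i assume "i \<in> {1..n}"
      then show "(blinfun_apply C ^^ (i - 1)) (f ((torus_map E ^^ (n - i)) (past n p))) = (blinfun_apply C ^^ (i - 1)) (f (past i p))"
        using torus_map_past [of "n - i" i p] by simp
    qed
    also have "\<dots> = (\<Sum>i<n. (blinfun_apply C ^^ i) (f (past (Suc i) p)))"
      by (simp add: sum.atLeast1_atMost_eq)
    finally show ?thesis .
  qed
  ultimately show ?thesis by simp
qed

lemma measurable_fiber_sum [measurable]: "fiber_sum n \<in> borel_measurable borel"
proof (induction n)
  case 0
  show ?case by (simp add: fiber_sum_def)
next
  case (Suc n)
  have [measurable]: "blinfun_apply C \<in> borel_measurable borel"
    by (intro borel_measurable_continuous_onI linear_continuous_on blinfun.bounded_linear_right)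
  note Suc [measurable]
  have "(\<lambda>a. blinfun_apply C (fiber_sum n a) + f ((torus_map E ^^ n) a)) \<in> borel_measurable borel" by measurable
  then show ?case by (simp add: fiber_sum_Suc [abs_def])
qed

lemma measurable_attractor_height [measurable]: "attractor_height \<in> torus2 \<rightarrow>\<^sub>M borel"
  by (rule borel_measurable_LIMSEQ_metric [OF _ attractor_height_sums]) measurable

lemma measurable_srb_map: "(\<lambda>p. (fst p, attractor_height p)) \<in> torus2 \<rightarrow>\<^sub>M borel"
proof -
  have "(\<lambda>p. (fst p, attractor_height p)) \<in> torus2 \<rightarrow>\<^sub>M borel \<Otimes>\<^sub>M borel" by measurable
  then show ?thesis by (simp only: borel_prod)
qed

lemma prob_space_torus2: "prob_space torus2"
  by (intro prob_space_pair prob_space_torus)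

lemma prob_space_srb: "prob_space srb" and sets_srb [simp]: "sets srb = sets borel"
  unfolding srb_def using prob_space.prob_space_distr [OF prob_space_torus2 measurable_srb_map] by simp_all

text \<open>Since the \<open>n\<close>-th point of the past is again Lebesgue distributed, the
  \<open>n\<close>-th integral equals that of \<open>g\<close> over partial sums of the attractor
  height, and dominated convergence applies.\<close>

lemma zero_fiber_obs_tendsto:
  assumes g: "continuous_on UNIV g" "bounded (range g)"
  shows "(\<lambda>n. \<integral>x. zero_fiber_obs g n x \<partial>torus_lebesgue) \<longlonglongrightarrow> (\<integral>z. g z \<partial>srb)"
proof -
  interpret prob_space torus2 by (rule prob_space_torus2)
  obtain B where B: "\<And>z. \<bar>g z\<bar> \<le> B" using g(2) by (auto simp: bounded_iff)
  have gm [measurable]: "g \<in> borel_measurable borel" using g(1) by (rule borel_measurable_continuous_onI)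
  have zm [measurable]: "zero_fiber_obs g n \<in> borel_measurable borel" for n
  proof -
    have "(\<lambda>x. ((torus_map E ^^ n) x, fiber_sum n x)) \<in> borel \<rightarrow>\<^sub>M borel \<Otimes>\<^sub>M borel" by measurable
    then have "(\<lambda>x. g ((torus_map E ^^ n) x, fiber_sum n x)) \<in> borel_measurable borel"
      unfolding borel_prod by measurable
    then show ?thesis unfolding zero_fiber_obs_def T_pow by (simp add: linear_0 [OF linear_C_pow])
  qed
  have "(\<integral>x. zero_fiber_obs g n x \<partial>torus_lebesgue) = (\<integral>p. g (fst p, fiber_sum n (past n p)) \<partial>torus2)" for n
  proof -
    have "(\<integral>x. zero_fiber_obs g n x \<partial>torus_lebesgue) = (\<integral>x. zero_fiber_obs g n x \<partial>distr torus2 borel (past n))"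
      by (simp add: distr_past)
    also have "\<dots> = (\<integral>p. zero_fiber_obs g n (past n p) \<partial>torus2)"
      by (rule integral_distr) measurable
    finally show ?thesis
      using torus_map_past [of n 0] by (simp add: zero_fiber_obs_def T_pow linear_0 [OF linear_C_pow])
  qed
  moreover have "(\<lambda>n. \<integral>p. g (fst p, fiber_sum n (past n p)) \<partial>torus2) \<longlonglongrightarrow> (\<integral>p. g (fst p, attractor_height p) \<partial>torus2)"
  proof (rule integral_dominated_convergence [where w = "\<lambda>_. B"])
    show "(\<lambda>p. g (fst p, attractor_height p)) \<in> borel_measurable torus2"
      by (rule measurable_compose [OF measurable_srb_map gm])
    have "(\<lambda>p. (fst p, fiber_sum n (past n p))) \<in> torus2 \<rightarrow>\<^sub>M borel \<Otimes>\<^sub>M borel" for n by measurable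
    then show "(\<lambda>p. g (fst p, fiber_sum n (past n p))) \<in> borel_measurable torus2" for n
      unfolding borel_prod by measurable
    show "AE p in torus2. (\<lambda>n. g (fst p, fiber_sum n (past n p))) \<longlonglongrightarrow> g (fst p, attractor_height p)"
    proof (rule AE_I2)
      fix p
      have "(\<lambda>n. (fst p, fiber_sum n (past n p))) \<longlonglongrightarrow> (fst p, attractor_height p)"
        by (intro tendsto_intros attractor_height_sums)
      then show "(\<lambda>n. g (fst p, fiber_sum n (past n p))) \<longlonglongrightarrow> g (fst p, attractor_height p)"
        by (rule continuous_on_tendsto_compose [OF g(1)]) auto
    qed
  qed (use B in auto)
  moreover have "(\<integral>p. g (fst p, attractor_height p) \<partial>torus2) = (\<integral>z. g z \<partial>srb)"
    unfolding srb_def by (rule integral_distr [symmetric, OF measurable_srb_map gm])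
  ultimately show ?thesis by simp
qed

end

section \<open>Typical points\<close>

text \<open>Shifting a window by one step changes two terms.\<close>

lemma sum_shift_le:
  fixes v :: "nat \<Rightarrow> real"
  assumes B: "\<And>k. \<bar>v k\<bar> \<le> B"
  shows "\<bar>(\<Sum>k<n. v (k + N)) - (\<Sum>k<n. v k)\<bar> \<le> 2 * real N * B"
proof (induction N)
  case (Suc N)
  have "(\<Sum>k<n. v (Suc (k + N))) + v N = (\<Sum>k<n. v (k + N)) + v (n + N)"
    by (induction n) simp_all
  then have "\<bar>(\<Sum>k<n. v (k + Suc N)) - (\<Sum>k<n. v (k + N))\<bar> \<le> 2 * B"
    using B [of N] B [of "n + N"] by simp
  then show ?case using Suc by (simp add: algebra_simps)
qed simp

context skew begin

text \<open>After \<open>N\<close> further steps the point \<open>(x, y)\<close> and the point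
  \<open>(x, 0)\<close> of the zero section are exponentially close. So the average of
  \<open>g\<close> along the orbit is close to the average on the torus of the function
  \<open>zero_fiber_obs g N\<close>, whose mean is close to the integral against
  \<open>srb\<close>.\<close>

lemma sandwich_averages:
  fixes g :: "('u, 'd) phase \<Rightarrow> real"
  assumes L: "0 \<le> L" "\<And>p q. \<bar>g p - g q\<bar> \<le> L * dist p q" and B: "\<And>p. \<bar>g p\<bar> \<le> B"
    and x: "\<And>n. (\<lambda>m. (\<Sum>k<m. zero_fiber_obs g n ((torus_map E ^^ k) x)) / real m) \<longlonglongrightarrow>
      (\<integral>x. zero_fiber_obs g n x \<partial>torus_lebesgue)"
  shows "(\<lambda>m. (\<Sum>k<m. g ((T ^^ k) (x, y))) / real m) \<longlonglongrightarrow> (\<integral>z. g z \<partial>srb)"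
proof (rule LIMSEQ_I)
  fix e :: real assume e: "0 < e"
  \<comment> \<open>The fibre coordinates along the orbit stay in a ball of radius
    \<open>R\<close>.\<close>
  define R where "R = norm y + sup_f / (1 - norm C)"
  have R: "norm (snd ((T ^^ k) (x, y))) \<le> R" for k
  proof -
    have "norm ((blinfun_apply C ^^ k) y) \<le> norm y"
      using norm_C_pow [of k y] norm_C by (meson mult_left_le_one_le norm_ge_zero order_trans power_le_one less_imp_le zero_le_power)
    then have "norm ((blinfun_apply C ^^ k) y + fiber_sum k x) \<le> R"
      unfolding R_def by (intro norm_triangle_mono fiber_sum_le)
    then show ?thesis by (simp add: T_pow)
  qed
  have "L-lipschitz_on UNIV g" using L by (intro lipschitz_onI) (auto simp: dist_real_def)
  then have cont: "continuous_on UNIV g" by (rule lipschitz_on_continuous_on)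
  have lim: "(\<lambda>n. \<integral>x. zero_fiber_obs g n x \<partial>torus_lebesgue) \<longlonglongrightarrow> (\<integral>z. g z \<partial>srb)"
    by (rule zero_fiber_obs_tendsto [OF cont]) (use B in \<open>auto simp: bounded_iff\<close>)
  have "(\<lambda>n. L * (norm C ^ n * R)) \<longlonglongrightarrow> L * (0 * R)"
    using norm_C by (intro tendsto_intros LIMSEQ_power_zero) simp
  then have "eventually (\<lambda>n. L * (norm C ^ n * R) < e / 4) sequentially"
    by (rule order_tendstoD(2)) (use e in simp)
  moreover have "eventually (\<lambda>n. dist (\<integral>x. zero_fiber_obs g n x \<partial>torus_lebesgue) (\<integral>z. g z \<partial>srb) < e / 4) sequentially"
    using lim by (rule tendstoD) (use e in simp)
  ultimately have "eventually (\<lambda>n. L * (norm C ^ n * R) < e / 4 \<and>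
    dist (\<integral>x. zero_fiber_obs g n x \<partial>torus_lebesgue) (\<integral>z. g z \<partial>srb) < e / 4) sequentially"
    by (rule eventually_conj)
  then obtain N where N: "L * (norm C ^ N * R) < e / 4"
    "dist (\<integral>x. zero_fiber_obs g N x \<partial>torus_lebesgue) (\<integral>z. g z \<partial>srb) < e / 4"
    unfolding eventually_sequentially by blast
  let ?v = "\<lambda>k. g ((T ^^ k) (x, y))" and ?w = "\<lambda>k. zero_fiber_obs g N ((torus_map E ^^ k) x)"
  let ?I = "\<integral>x. zero_fiber_obs g N x \<partial>torus_lebesgue"
  \<comment> \<open>At time \<open>k + N\<close>, compare the orbit with the one that starts on
    the zero section at time \<open>k\<close>.\<close>
  have close: "\<bar>?v (k + N) - ?w k\<bar> \<le> e / 4" for k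
  proof -
    have "?v (k + N) = g ((T ^^ N) ((T ^^ k) (x, y)))" by (simp add: funpow_add add.commute [of k])
    moreover have "\<bar>g ((T ^^ N) (a, b)) - g ((T ^^ N) (a, 0))\<bar> \<le> L * (norm C ^ N * norm b)" for a b
    proof -
      have "\<bar>g ((T ^^ N) (a, b)) - g ((T ^^ N) (a, 0))\<bar> \<le> L * dist ((T ^^ N) (a, b)) ((T ^^ N) (a, 0))" by (rule L)
      also have "dist ((T ^^ N) (a, b)) ((T ^^ N) (a, 0)) = norm ((blinfun_apply C ^^ N) b)"
        by (simp add: T_pow dist_Pair_Pair linear_0 [OF linear_C_pow] dist_norm)
      also have "L * \<dots> \<le> L * (norm C ^ N * norm b)" by (intro mult_left_mono norm_C_pow L)
      finally show ?thesis .
    qed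
    moreover have "fst ((T ^^ k) (x, y)) = (torus_map E ^^ k) x" by (simp add: T_pow)
    ultimately have "\<bar>?v (k + N) - ?w k\<bar> \<le> L * (norm C ^ N * norm (snd ((T ^^ k) (x, y))))"
      unfolding zero_fiber_obs_def by (metis prod.collapse)
    also have "\<dots> \<le> L * (norm C ^ N * R)" by (intro mult_left_mono R L zero_le_power norm_ge_zero)
    finally show ?thesis using N(1) by simp
  qed
  have "eventually (\<lambda>m. dist ((\<Sum>k<m. ?w k) / real m) ?I < e / 4) sequentially"
    using x [of N] by (rule tendstoD) (use e in simp)
  moreover have "(\<lambda>m. (2 * real N * B) / real m) \<longlonglongrightarrow> 0"
    by (rule lim_const_over_n)
  then have "eventually (\<lambda>m. (2 * real N * B) / real m < e / 4) sequentially"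
    by (rule order_tendstoD(2)) (use e in simp)
  ultimately have "eventually (\<lambda>m. norm ((\<Sum>k<m. ?v k) / real m - (\<integral>z. g z \<partial>srb)) < e) sequentially"
    using eventually_gt_at_top [of "0::nat"]
  proof eventually_elim
    case (elim m)
    have "\<bar>(\<Sum>k<m. ?v (k + N)) - (\<Sum>k<m. ?w k)\<bar> \<le> (\<Sum>k<m. e / 4)"
      unfolding sum_subtractf [symmetric] by (intro order_trans [OF sum_abs] sum_mono close)
    moreover have "\<bar>(\<Sum>k<m. ?v (k + N)) - (\<Sum>k<m. ?v k)\<bar> \<le> 2 * real N * B"
      by (rule sum_shift_le) (rule B)
    ultimately have "\<bar>(\<Sum>k<m. ?v k) - (\<Sum>k<m. ?w k)\<bar> \<le> real m * (e / 4) + 2 * real N * B"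
      unfolding sum_constant card_lessThan by linarith
    then have "\<bar>(\<Sum>k<m. ?v k) - (\<Sum>k<m. ?w k)\<bar> / real m \<le> (real m * (e / 4) + 2 * real N * B) / real m"
      by (rule divide_right_mono) simp
    also have "\<dots> = e / 4 + (2 * real N * B) / real m" using elim by (simp add: add_divide_distrib)
    finally have "\<bar>(\<Sum>k<m. ?v k) / real m - (\<Sum>k<m. ?w k) / real m\<bar> \<le> e / 4 + (2 * real N * B) / real m"
      using elim by (simp add: diff_divide_distrib [symmetric] abs_divide)
    then show ?case using elim N(2) unfolding dist_real_def real_norm_def by linarith
  qed
  then show "\<exists>no. \<forall>m\<ge>no. norm ((\<Sum>k<m. ?v k) / real m - (\<integral>z. g z \<partial>srb)) < e"
    by (simp add: eventually_sequentially)
qed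

text \<open>Minorants give a lower bound on the lower limit of the averages. Applied to \<open>g +
  B\<close> and to \<open>B - g\<close>, this bounds the averages from both sides.\<close>

lemma averages_bounded_continuous:
  fixes G :: "nat set \<Rightarrow> ('u, 'd) phase \<Rightarrow> real"
  assumes G: "\<And>S. finite S \<Longrightarrow> (\<lambda>m. (\<Sum>k<m. G S (w k)) / real m) \<longlonglongrightarrow> (\<integral>z. G S z \<partial>srb)"
    and Gm: "\<And>S. finite S \<Longrightarrow> G S \<in> borel_measurable borel" and G0: "\<And>S x. finite S \<Longrightarrow> 0 \<le> G S x"
    and approx: "\<And>g. continuous_on UNIV g \<Longrightarrow> (\<And>x. 0 \<le> g x) \<Longrightarrow>
      \<exists>S. (\<forall>j. finite (S j) \<and> (\<forall>x. G (S j) x \<le> g x)) \<and> (\<forall>x. (\<lambda>j. G (S j) x) \<longlonglongrightarrow> g x)"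
    and g: "continuous_on UNIV g" "bounded (range g)"
  shows "(\<lambda>m. (\<Sum>k<m. g (w k)) / real m) \<longlonglongrightarrow> (\<integral>z. g z \<partial>srb)"
proof -
  interpret prob_space srb by (rule prob_space_srb)
  obtain B where B: "\<And>z. \<bar>g z\<bar> \<le> B" using g(2) by (auto simp: bounded_iff)
  have int: "integrable srb h" if "continuous_on UNIV h" "\<And>z. \<bar>h z\<bar> \<le> D"
    for h :: "('u, 'd) phase \<Rightarrow> real" and D :: real
    using borel_measurable_continuous_onI [OF that(1)] that(2)
    by (intro integrable_const_bound [where B = D]) (auto simp: measurable_cong_sets [OF sets_srb refl])
  have low: "eventually (\<lambda>m. (\<integral>z. h z \<partial>srb) - e < (\<Sum>k<m. h (w k)) / real m) sequentially"
    if h: "continuous_on UNIV h" "\<And>z. 0 \<le> h z" "\<And>z. h z \<le> D" and e: "0 < e"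
    for h :: "('u, 'd) phase \<Rightarrow> real" and D e :: real
  proof -
    obtain S where S: "\<And>j. finite (S j)" "\<And>j x. G (S j) x \<le> h x" "\<And>x. (\<lambda>j. G (S j) x) \<longlonglongrightarrow> h x"
      using approx [OF h(1,2)] by blast
    have "(\<lambda>j. \<integral>z. G (S j) z \<partial>srb) \<longlonglongrightarrow> (\<integral>z. h z \<partial>srb)"
    proof (rule integral_dominated_convergence [where w = "\<lambda>_. D"])
      show "h \<in> borel_measurable srb" "G (S j) \<in> borel_measurable srb" for j
        using borel_measurable_continuous_onI [OF h(1)] Gm [OF S(1)] by (auto simp: measurable_cong_sets [OF sets_srb refl])
      show "AE x in srb. norm (G (S j) x) \<le> D" for j
      proof (rule AE_I2)
        show "norm (G (S j) x) \<le> D" for x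
          using S(2) [of j x] h(3) [of x] G0 [OF S(1), of j x] by simp
      qed
    qed (use S in auto)
    then have "eventually (\<lambda>j. (\<integral>z. h z \<partial>srb) - e < (\<integral>z. G (S j) z \<partial>srb)) sequentially"
      by (rule order_tendstoD(1)) (use e in simp)
    then obtain j where j: "(\<integral>z. h z \<partial>srb) - e < (\<integral>z. G (S j) z \<partial>srb)"
      unfolding eventually_sequentially by blast
    have "eventually (\<lambda>m. (\<integral>z. h z \<partial>srb) - e < (\<Sum>k<m. G (S j) (w k)) / real m) sequentially"
      by (rule order_tendstoD(1) [OF G [OF S(1)] j])
    then show ?thesis
    proof eventually_elim
      case (elim m)
      have "(\<Sum>k<m. G (S j) (w k)) / real m \<le> (\<Sum>k<m. h (w k)) / real m"
        by (intro divide_right_mono sum_mono S(2)) simp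
      then show ?case using elim by linarith
    qed
  qed
  show ?thesis
  proof (rule LIMSEQ_I)
    fix e :: real assume e: "0 < e"
    have ig: "integrable srb g" by (rule int [OF g(1) B])
    have 1: "0 \<le> g z + B" "g z + B \<le> 2 * B" "0 \<le> B - g z" "B - g z \<le> 2 * B" for z
      using B [of z] by linarith+
    have up: "eventually (\<lambda>m. (\<integral>z. g z + B \<partial>srb) - e < (\<Sum>k<m. g (w k) + B) / real m) sequentially"
      by (rule low [OF _ 1(1,2) e]) (intro continuous_intros g(1))
    have dn: "eventually (\<lambda>m. (\<integral>z. B - g z \<partial>srb) - e < (\<Sum>k<m. B - g (w k)) / real m) sequentially"
      by (rule low [OF _ 1(3,4) e]) (intro continuous_intros g(1))
    have "(\<integral>z. g z + B \<partial>srb) = (\<integral>z. g z \<partial>srb) + B" "(\<integral>z. B - g z \<partial>srb) = B - (\<integral>z. g z \<partial>srb)"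
      using ig prob_space by simp_all
    note eqs = this
    have "eventually (\<lambda>m. norm ((\<Sum>k<m. g (w k)) / real m - (\<integral>z. g z \<partial>srb)) < e) sequentially"
      using up dn eventually_gt_at_top [of "0::nat"]
    proof eventually_elim
      case (elim m)
      have "(\<Sum>k<m. g (w k) + B) / real m = (\<Sum>k<m. g (w k)) / real m + B"
        "(\<Sum>k<m. B - g (w k)) / real m = B - (\<Sum>k<m. g (w k)) / real m"
        using elim(3) by (simp_all add: sum.distrib sum_subtractf add_divide_distrib diff_divide_distrib)
      then show ?case using elim(1,2) unfolding eqs real_norm_def by linarith
    qed
    then show "\<exists>no. \<forall>m\<ge>no. norm ((\<Sum>k<m. g (w k)) / real m - (\<integral>z. g z \<partial>srb)) < e"
      by (simp add: eventually_sequentially)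
  qed
qed

definition typical :: "('u, 'd) phase \<Rightarrow> bool" where
  "typical z \<longleftrightarrow> (\<forall>g :: ('u, 'd) phase \<Rightarrow> real. continuous_on UNIV g \<and> bounded (range g) \<longrightarrow>
    (\<lambda>n. (\<Sum>k<n. g ((T ^^ k) z)) / real n) \<longlonglongrightarrow> (\<integral>w. g w \<partial>srb))"

text \<open>The exceptional sets of countably many observables and all \<open>n\<close> form a
  null set of the torus; outside its product with the fibre, which is again a null set, the
  averages converge for every fibre coordinate.\<close>

lemma AE_typical: "AE z in phase_volume. typical z"
proof -
  obtain G :: "nat set \<Rightarrow> ('u, 'd) phase \<Rightarrow> real"
    where Lip: "\<And>S. finite S \<Longrightarrow> \<exists>L\<ge>0. \<forall>x y. \<bar>G S x - G S y\<bar> \<le> L * dist x y"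
      and bdd: "\<And>S. finite S \<Longrightarrow> \<exists>B. \<forall>x. 0 \<le> G S x \<and> G S x \<le> B"
      and approx: "\<And>g. continuous_on UNIV g \<Longrightarrow> (\<And>x. 0 \<le> g x) \<Longrightarrow>
      \<exists>S. (\<forall>j. finite (S j) \<and> (\<forall>x. G (S j) x \<le> g x)) \<and> (\<forall>x. (\<lambda>j. G (S j) x) \<longlonglongrightarrow> g x)"
    by (rule tent_minorants) blast
  define P where "P x \<longleftrightarrow> (\<forall>S\<in>{S. finite S}. \<forall>n. (\<lambda>m. (\<Sum>k<m. zero_fiber_obs (G S) n ((torus_map E ^^ k) x)) / real m) \<longlonglongrightarrow>
      (\<integral>x. zero_fiber_obs (G S) n x \<partial>torus_lebesgue))" for x
  have "AE x in torus_lebesgue. P x"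
    unfolding P_def
  proof (subst AE_ball_countable [OF countable_Collect_finite], intro ballI)
    fix S :: "nat set" assume "S \<in> {S. finite S}"
    then obtain L where L: "L \<ge> 0" "\<And>x y. \<bar>G S x - G S y\<bar> \<le> L * dist x y" using Lip by blast
    show "AE x in torus_lebesgue. \<forall>n. (\<lambda>m. (\<Sum>k<m. zero_fiber_obs (G S) n ((torus_map E ^^ k) x)) / real m) \<longlonglongrightarrow>
      (\<integral>x. zero_fiber_obs (G S) n x \<partial>torus_lebesgue)"
      unfolding AE_all_countable
    proof
      fix n
      obtain K where "K \<ge> 0" "\<And>x y. \<bar>zero_fiber_obs (G S) n x - zero_fiber_obs (G S) n y\<bar> \<le> K * dist x y"
        using zero_fiber_obs_lipschitz [OF L] by blast
      then show "AE x in torus_lebesgue. (\<lambda>m. (\<Sum>k<m. zero_fiber_obs (G S) n ((torus_map E ^^ k) x)) / real m) \<longlonglongrightarrow>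
        (\<integral>x. zero_fiber_obs (G S) n x \<partial>torus_lebesgue)" by (rule birkhoff_lipschitz)
    qed
  qed
  then obtain N where N: "{x \<in> space torus_lebesgue. \<not> P x} \<subseteq> N" "emeasure torus_lebesgue N = 0" "N \<in> sets torus_lebesgue"
    by (rule AE_E)
  have "N \<times> (UNIV :: (real^'d) set) \<in> null_sets phase_volume"
  proof -
    have "N \<times> space (lborel :: (real^'d) measure) \<in> null_sets (torus_lebesgue \<Otimes>\<^sub>M lborel)"
      using N by (intro lborel.times_in_null_sets1) auto
    then show ?thesis by (simp add: phase_volume_def)
  qed
  then have "AE z in phase_volume. z \<notin> N \<times> (UNIV :: (real^'d) set)" by (rule AE_not_in)
  then show ?thesis
  proof eventually_elim
    fix z :: "('u, 'd) phase" assume "z \<notin> N \<times> UNIV"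
    then have z: "P (fst z)" using N(1) by (cases z) auto
    have Gm: "G S \<in> borel_measurable borel" if fin: "finite S" for S
    proof -
      obtain L where "L \<ge> 0" "\<And>x y. \<bar>G S x - G S y\<bar> \<le> L * dist x y" using Lip [OF fin] by blast
      then have "L-lipschitz_on UNIV (G S)" by (intro lipschitz_onI) (auto simp: dist_real_def)
      then show ?thesis by (intro borel_measurable_continuous_onI lipschitz_on_continuous_on)
    qed
    have G: "(\<lambda>m. (\<Sum>k<m. G S ((T ^^ k) z)) / real m) \<longlonglongrightarrow> (\<integral>z. G S z \<partial>srb)" if fin: "finite S" for S
    proof -
      obtain L where L: "L \<ge> 0" "\<And>x y. \<bar>G S x - G S y\<bar> \<le> L * dist x y" using Lip [OF fin] by blast
      obtain B where B: "\<And>x. 0 \<le> G S x" "\<And>x. G S x \<le> B" using bdd [OF fin] by blast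
      have "(\<lambda>m. (\<Sum>k<m. G S ((T ^^ k) (fst z, snd z))) / real m) \<longlonglongrightarrow> (\<integral>z. G S z \<partial>srb)"
        using z fin B by (intro sandwich_averages [OF L, of B]) (auto simp: P_def)
      then show ?thesis by simp
    qed
    show "typical z"
      unfolding typical_def
    proof (intro allI impI, elim conjE)
      fix g :: "('u, 'd) phase \<Rightarrow> real" assume g: "continuous_on UNIV g" "bounded (range g)"
      show "(\<lambda>n. (\<Sum>k<n. g ((T ^^ k) z)) / real n) \<longlonglongrightarrow> (\<integral>w. g w \<partial>srb)"
        by (rule averages_bounded_continuous [where G = G, OF G Gm _ approx g]) (use bdd in blast)+
    qed
  qed
qed

lemma AE_phase_volume_ex:
  assumes "AE z in (phase_volume :: ('u, 'd) phase measure). P z"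
  shows "\<exists>z. P z"
proof (rule ccontr)
  assume "\<nexists>z. P z"
  then have "AE z in (phase_volume :: ('u, 'd) phase measure). False" using assms by (auto elim: AE_mp)
  then have "emeasure (phase_volume :: ('u, 'd) phase measure) (space phase_volume) = 0"
    by (simp add: AE_iff_measurable [OF sets.top])
  moreover have "emeasure (phase_volume :: ('u, 'd) phase measure) (space phase_volume) = emeasure torus_lebesgue (UNIV :: 'u torus set) * emeasure lborel (UNIV :: (real^'d) set)"
    unfolding phase_volume_def space_pair_measure space_torus_lebesgue space_lborel space_borel
    by (rule lborel.emeasure_pair_measure_Times) auto
  ultimately show False by simp
qed

text \<open>A single typical point determines all integrals of bounded continuous functions.
  Invariance follows as shifting the orbit by one step does not change limits of averages, and
  uniqueness as two such measures have a common typical point.\<close>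

lemma srb_is_SRB: "is_SRB_measure T srb"
proof -
  obtain z0 where z0: "typical z0" using AE_phase_volume_ex [OF AE_typical] by blast
  interpret prob_space srb by (rule prob_space_srb)
  have Tm: "T \<in> borel \<rightarrow>\<^sub>M borel" using continuous_T by (rule borel_measurable_continuous_onI)
  have Tm': "T \<in> srb \<rightarrow>\<^sub>M borel" using Tm by (simp add: measurable_cong_sets [OF sets_srb refl])
  have inv: "distr srb borel T = srb"
  proof (rule measure_eqI_bounded_continuous)
    show "prob_space (distr srb borel T)" using Tm' by (rule prob_space_distr)
    fix g :: "('u, 'd) phase \<Rightarrow> real" assume g: "continuous_on UNIV g" "bounded (range g)"
    have gT: "continuous_on UNIV (\<lambda>z. g (T z))" "bounded (range (\<lambda>z. g (T z)))"
      using continuous_on_compose2 [OF g(1) continuous_T] by (auto intro: bounded_subset [OF g(2)])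
    obtain B where B: "\<And>z. \<bar>g z\<bar> \<le> B" using g(2) by (auto simp: bounded_iff)
    have "(\<lambda>n. (\<Sum>k<n. g ((T ^^ k) z0)) / real n) \<longlonglongrightarrow> (\<integral>w. g w \<partial>srb)"
      using z0 g by (simp add: typical_def)
    moreover have "(\<lambda>n. ((\<Sum>k<n. g ((T ^^ (k + 1)) z0)) - (\<Sum>k<n. g ((T ^^ k) z0))) / real n) \<longlonglongrightarrow> 0"
    proof (rule Lim_null_comparison)
      show "(\<lambda>n. (2 * real 1 * B) / real n) \<longlonglongrightarrow> 0" by (rule lim_const_over_n)
      show "\<forall>\<^sub>F n in sequentially. norm (((\<Sum>k<n. g ((T ^^ (k + 1)) z0)) - (\<Sum>k<n. g ((T ^^ k) z0))) / real n) \<le> (2 * real 1 * B) / real n"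
      proof (intro always_eventually allI)
        fix n
        have "\<bar>(\<Sum>k<n. g ((T ^^ (k + 1)) z0)) - (\<Sum>k<n. g ((T ^^ k) z0))\<bar> \<le> 2 * real 1 * B"
          by (rule sum_shift_le [of "\<lambda>k. g ((T ^^ k) z0)"]) (rule B)
        then show "norm (((\<Sum>k<n. g ((T ^^ (k + 1)) z0)) - (\<Sum>k<n. g ((T ^^ k) z0))) / real n) \<le> (2 * real 1 * B) / real n"
          unfolding real_norm_def abs_divide by (simp add: divide_right_mono)
      qed
    qed
    ultimately have "(\<lambda>n. ((\<Sum>k<n. g ((T ^^ (k + 1)) z0)) - (\<Sum>k<n. g ((T ^^ k) z0))) / real n + (\<Sum>k<n. g ((T ^^ k) z0)) / real n) \<longlonglongrightarrow> 0 + (\<integral>w. g w \<partial>srb)"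
      by (intro tendsto_add)
    then have "(\<lambda>n. (\<Sum>k<n. g (T ((T ^^ k) z0))) / real n) \<longlonglongrightarrow> (\<integral>w. g w \<partial>srb)"
      by (simp add: diff_divide_distrib)
    moreover have "(\<lambda>n. (\<Sum>k<n. g (T ((T ^^ k) z0))) / real n) \<longlonglongrightarrow> (\<integral>w. g (T w) \<partial>srb)"
      using z0 gT unfolding typical_def by blast
    ultimately have "(\<integral>w. g w \<partial>srb) = (\<integral>w. g (T w) \<partial>srb)" by (rule LIMSEQ_unique)
    then show "(\<integral>w. g w \<partial>distr srb borel T) = (\<integral>w. g w \<partial>srb)"
      using integral_distr [OF Tm' borel_measurable_continuous_onI [OF g(1)]] by simp
  qed (simp_all add: prob_space_srb)
  have ds: "describes_statistics T srb"
    unfolding describes_statistics_def using prob_space_srb inv AE_typical unfolding typical_def by simp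
  moreover have "N = srb" if N: "describes_statistics T N" for N
  proof (rule measure_eqI_bounded_continuous)
    show "prob_space N" "sets N = sets borel" using N by (simp_all add: describes_statistics_def)
    have "AE z in phase_volume. typical z \<and> (\<forall>g :: ('u, 'd) phase \<Rightarrow> real.
        continuous_on UNIV g \<and> bounded (range g) \<longrightarrow>
        (\<lambda>n. (\<Sum>k<n. g ((T ^^ k) z)) / real n) \<longlonglongrightarrow> (\<integral>w. g w \<partial>N))"
      using N AE_typical unfolding describes_statistics_def by (intro AE_conjI) auto
    then obtain z where z: "typical z" "\<And>g :: ('u, 'd) phase \<Rightarrow> real.
        continuous_on UNIV g \<and> bounded (range g) \<Longrightarrow>
        (\<lambda>n. (\<Sum>k<n. g ((T ^^ k) z)) / real n) \<longlonglongrightarrow> (\<integral>w. g w \<partial>N)"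
      using AE_phase_volume_ex by blast
    fix g :: "('u, 'd) phase \<Rightarrow> real" assume g: "continuous_on UNIV g" "bounded (range g)"
    have "(\<lambda>n. (\<Sum>k<n. g ((T ^^ k) z)) / real n) \<longlonglongrightarrow> (\<integral>w. g w \<partial>srb)"
      using z(1) g unfolding typical_def by blast
    then show "(\<integral>w. g w \<partial>N) = (\<integral>w. g w \<partial>srb)"
      using z(2) g LIMSEQ_unique by blast
  qed (simp_all add: prob_space_srb)
  ultimately show ?thesis unfolding is_SRB_measure_def by blast
qed

end

section \<open>The transfer operator on densities\<close>

locale invertible_skew = skew E C f
  for E :: "('u::finite) lin" and C :: "('d::finite) lin" and f :: "'u torus \<Rightarrow> real^'d" +
  assumes det_C: "lin_det C \<noteq> 0"
begin

definition Ci :: "real^'d \<Rightarrow> real^'d" where "Ci = inv (blinfun_apply C)"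

definition J :: real where "J = jacobian E C"

text \<open>The summand is \<open>h\<close> at the point over \<open>a\<close> that
  \<open>T^n\<close> maps to \<open>(x, y)\<close>, and \<open>J ^ n\<close> is the Jacobian of
  \<open>T^n\<close>.\<close>

definition transfer_op :: "nat \<Rightarrow> (('u, 'd) phase \<Rightarrow> ennreal) \<Rightarrow> ('u, 'd) phase \<Rightarrow> ennreal" where
  "transfer_op n h = (\<lambda>(x, y). ennreal (1 / J ^ n) * (\<Sum>a\<in>preimages n x. h (a, (Ci ^^ n) (y - fiber_sum n a))))"

lemma linear_C: "linear (blinfun_apply C)"
  by (rule bounded_linear.linear [OF blinfun.bounded_linear_right])

lemma bij_C: "bij (blinfun_apply C)"
proof -
  have "inj (blinfun_apply C)" using det_C det_nz_iff_inj [OF linear_C] by (simp add: lin_det_def)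
  then show ?thesis using linear_injective_imp_surjective [OF linear_C] by (auto simp: bij_def)
qed

lemma C_Ci [simp]: "blinfun_apply C (Ci v) = v" and Ci_C [simp]: "Ci (blinfun_apply C v) = v"
  using bij_C by (simp_all add: Ci_def bij_is_surj surj_f_inv_f bij_is_inj)

lemma linear_Ci: "linear Ci"
  unfolding Ci_def by (intro inj_linear_imp_inv_linear linear_C bij_is_inj bij_C)

lemma linear_Ci_pow: "linear (Ci ^^ n)"
  by (induction n) (simp_all only: funpow.simps linear_id linear_compose linear_Ci)

lemma measurable_Ci_pow [measurable]: "(Ci ^^ n) \<in> borel_measurable borel"
  using linear_Ci_pow by (intro borel_measurable_continuous_onI linear_continuous_on) (simp add: linear_conv_bounded_linear)

lemma measurable_C [measurable]: "blinfun_apply C \<in> borel_measurable borel"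
  by (intro borel_measurable_continuous_onI linear_continuous_on blinfun.bounded_linear_right)

lemma Ci_pow_C_pow [simp]: "(Ci ^^ n) ((blinfun_apply C ^^ n) v) = v"
proof (induction n)
  case (Suc n)
  have "(Ci ^^ Suc n) w = (Ci ^^ n) (Ci w)" for w by (simp only: funpow_Suc_right o_apply)
  then show ?case using Suc by (simp only: funpow.simps(2) [of n "blinfun_apply C"] o_apply Ci_C)
qed simp

lemma J_pos: "0 < J" and J_eq: "J = deg * \<bar>lin_det C\<bar>"
  using deg_pos det_C by (simp_all add: J_def jacobian_def deg_def abs_mult)

lemma nn_integral_Ci_pow:
  assumes [measurable]: "h \<in> borel_measurable borel"
  shows "(\<integral>\<^sup>+y. h ((Ci ^^ n) y) \<partial>lborel) = ennreal (\<bar>lin_det C\<bar> ^ n) * (\<integral>\<^sup>+y. h y \<partial>lborel)"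
proof (induction n)
  case (Suc n)
  have "(\<integral>\<^sup>+y. h ((Ci ^^ Suc n) y) \<partial>lborel) = (\<integral>\<^sup>+y. h ((Ci ^^ n) (Ci y)) \<partial>lborel)"
    by (simp only: funpow_Suc_right o_apply)
  also have "\<dots> = ennreal \<bar>lin_det C\<bar> * (\<integral>\<^sup>+y. h ((Ci ^^ n) y) \<partial>lborel)"
    using nn_integral_linear_bij [OF linear_C bij_C, of "\<lambda>y. h ((Ci ^^ n) (Ci y))"] measurable_Ci_pow [of 1]
    by (simp add: lin_det_def)
  finally show ?case using Suc by (simp add: ennreal_mult mult.assoc)
qed simp

lemma transfer_op_0 [simp]: "transfer_op 0 h = h"
  by (simp add: transfer_op_def fun_eq_iff)

text \<open>Undoing \<open>m + n\<close> steps in the fibre at once or in two stages gives the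
  same point; a restatement of the cocycle identity.\<close>

lemma fiber_coordinate:
  assumes "a \<in> preimages n b"
  shows "(Ci ^^ n) ((Ci ^^ m) (y - fiber_sum m b) - fiber_sum n a) = (Ci ^^ (m + n)) (y - fiber_sum (m + n) a)"
proof -
  have b: "(torus_map E ^^ n) a = b" using assms by (simp add: preimages_def)
  have pow: "(Ci ^^ (m + n)) w = (Ci ^^ n) ((Ci ^^ m) w)" for w
    by (metis add.commute comp_apply funpow_add)
  have "y - fiber_sum (m + n) a = (y - fiber_sum m b) - (blinfun_apply C ^^ m) (fiber_sum n a)"
    by (simp add: fiber_sum_add b)
  then show ?thesis
    by (simp only: pow linear_diff [OF linear_Ci_pow] Ci_pow_C_pow)
qed

lemma transfer_op_add: "transfer_op (m + n) h = transfer_op m (transfer_op n h)"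
proof (rule ext, clarify)
  fix x y
  have "transfer_op m (transfer_op n h) (x, y) = ennreal (1 / J ^ m) * (\<Sum>b\<in>preimages m x. ennreal (1 / J ^ n) *
      (\<Sum>a\<in>preimages n b. h (a, (Ci ^^ n) ((Ci ^^ m) (y - fiber_sum m b) - fiber_sum n a))))"
    by (simp add: transfer_op_def)
  also have "\<dots> = ennreal (1 / J ^ m) * ennreal (1 / J ^ n) * (\<Sum>b\<in>preimages m x.
      (\<Sum>a\<in>preimages n b. h (a, (Ci ^^ n) ((Ci ^^ m) (y - fiber_sum m b) - fiber_sum n a))))"
    by (simp add: sum_distrib_left mult.assoc)
  also have "ennreal (1 / J ^ m) * ennreal (1 / J ^ n) = ennreal (1 / J ^ (m + n))"
    using J_pos by (simp add: power_add flip: ennreal_mult)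
  also have "(\<Sum>b\<in>preimages m x. (\<Sum>a\<in>preimages n b. h (a, (Ci ^^ n) ((Ci ^^ m) (y - fiber_sum m b) - fiber_sum n a)))) =
    (\<Sum>b\<in>preimages m x. (\<Sum>a\<in>preimages n b. h (a, (Ci ^^ (m + n)) (y - fiber_sum (m + n) a))))"
  proof (intro sum.cong refl)
    fix b a assume "a \<in> preimages n b"
    then show "h (a, (Ci ^^ n) ((Ci ^^ m) (y - fiber_sum m b) - fiber_sum n a)) = h (a, (Ci ^^ (m + n)) (y - fiber_sum (m + n) a))"
      by (simp add: fiber_coordinate)
  qed
  also have "\<dots> = (\<Sum>a\<in>preimages (m + n) x. h (a, (Ci ^^ (m + n)) (y - fiber_sum (m + n) a)))"
    by (rule sum_preimages_add [symmetric])
  finally show "transfer_op (m + n) h (x, y) = transfer_op m (transfer_op n h) (x, y)"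
    by (simp add: transfer_op_def)
qed

lemma transfer_op_branches:
  "transfer_op 1 h (x, y) = ennreal (1 / J) * (\<Sum>k\<in>digits. h (branch k x, Ci (y - fiber_sum 1 (branch k x))))"
  by (simp add: transfer_op_def sum_preimages_branch [unfolded One_nat_def])

lemma measurable_transfer_op_1:
  assumes [measurable]: "h \<in> borel_measurable (borel \<Otimes>\<^sub>M borel)"
  shows "transfer_op 1 h \<in> borel_measurable (borel \<Otimes>\<^sub>M borel)"
proof -
  have [measurable]: "Ci \<in> borel_measurable borel" using measurable_Ci_pow [of 1] by simp
  have "(\<lambda>p. ennreal (1 / J) * (\<Sum>k\<in>digits. h (branch k (fst p), Ci (snd p - fiber_sum 1 (branch k (fst p)))))) \<in> borel_measurable (borel \<Otimes>\<^sub>M borel)"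
    by measurable
  moreover have "transfer_op 1 h = (\<lambda>p. ennreal (1 / J) * (\<Sum>k\<in>digits. h (branch k (fst p), Ci (snd p - fiber_sum 1 (branch k (fst p))))))"
    by (rule ext, clarify) (simp only: transfer_op_branches fst_conv snd_conv)
  ultimately show ?thesis by simp
qed

lemma measurable_transfer_op [measurable]:
  assumes "h \<in> borel_measurable (borel \<Otimes>\<^sub>M borel)"
  shows "transfer_op n h \<in> borel_measurable (borel \<Otimes>\<^sub>M borel)"
proof (induction n)
  case (Suc n)
  then show ?case using measurable_transfer_op_1 transfer_op_add [of 1 n h] by simp
qed (simp add: assms)

abbreviation volume :: "('u, 'd) phase measure" where "volume \<equiv> phase_volume"

lemma borel_pair_volume: "borel_measurable (borel \<Otimes>\<^sub>M borel) = (borel_measurable volume :: (('u, 'd) phase \<Rightarrow> 'c::topological_space) set)"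
  by (rule measurable_cong_sets) (simp_all only: sets_phase_volume borel_prod)

lemma nn_integral_volume:
  assumes "h \<in> borel_measurable (borel \<Otimes>\<^sub>M borel)"
  shows "(\<integral>\<^sup>+z. h z \<partial>volume) = (\<integral>\<^sup>+x. (\<integral>\<^sup>+y. h (x, y) \<partial>lborel) \<partial>torus_lebesgue)"
  using assms unfolding borel_pair_volume unfolding phase_volume_def by (rule lborel.nn_integral_fst [symmetric])

lemma measurable_T [measurable]: "T \<in> (borel \<Otimes>\<^sub>M borel) \<rightarrow>\<^sub>M (borel \<Otimes>\<^sub>M borel)"
  unfolding borel_prod using continuous_T by (rule borel_measurable_continuous_onI)

lemma measurable_T_pow [measurable]: "(T ^^ n) \<in> (borel \<Otimes>\<^sub>M borel) \<rightarrow>\<^sub>M (borel \<Otimes>\<^sub>M borel)"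
proof (induction n)
  case (Suc n)
  show ?case unfolding funpow.simps by (rule measurable_comp [OF Suc measurable_T])
qed simp

lemma transfer_op_1_dual:
  assumes [measurable]: "h \<in> borel_measurable (borel \<Otimes>\<^sub>M borel)" "g \<in> borel_measurable (borel \<Otimes>\<^sub>M borel)"
  shows "(\<integral>\<^sup>+z. g z * transfer_op 1 h z \<partial>volume) = (\<integral>\<^sup>+z. g (T z) * h z \<partial>volume)"
proof -
  note measurable_transfer_op_1 [measurable]
  have [measurable]: "Ci \<in> borel_measurable borel" using measurable_Ci_pow [of 1] by simp
  define G where "G a = (\<integral>\<^sup>+y. g (T (a, y)) * h (a, y) \<partial>lborel)" for a
  have G_meas [measurable]: "G \<in> borel_measurable borel"
    unfolding G_def by measurable
  have inner: "(\<integral>\<^sup>+y. g (x, y) * transfer_op 1 h (x, y) \<partial>lborel) =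
    ennreal (1 / J) * ennreal \<bar>lin_det C\<bar> * (\<Sum>k\<in>digits. G (branch k x))" for x
  proof -
    have [measurable]: "(\<lambda>y. g (x, y)) \<in> borel_measurable borel" by measurable
    have [measurable]: "(\<lambda>y. h (a, y)) \<in> borel_measurable borel" for a by measurable
    have summand: "(\<integral>\<^sup>+y. g (x, y) * h (branch k x, Ci (y - fiber_sum 1 (branch k x))) \<partial>lborel) = ennreal \<bar>lin_det C\<bar> * G (branch k x)"
      if k: "k \<in> digits" for k
    proof -
      have "(\<integral>\<^sup>+y. g (x, y) * h (branch k x, Ci (y - fiber_sum 1 (branch k x))) \<partial>lborel) =
        (\<integral>\<^sup>+y. g (x, y + fiber_sum 1 (branch k x)) * h (branch k x, Ci y) \<partial>lborel)"
        by (subst nn_integral_lborel_shift [of _ "fiber_sum 1 (branch k x)"]) simp_all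
      also have "\<dots> = ennreal \<bar>lin_det C\<bar> * (\<integral>\<^sup>+y. g (x, blinfun_apply C y + fiber_sum 1 (branch k x)) * h (branch k x, Ci (blinfun_apply C y)) \<partial>lborel)"
        unfolding lin_det_def by (rule nn_integral_linear_bij [OF linear_C bij_C]) measurable
      also have "\<dots> = ennreal \<bar>lin_det C\<bar> * G (branch k x)"
        by (simp add: G_def skew_product_def torus_map_branch [OF k] fiber_sum_Suc)
      finally show ?thesis .
    qed
    have "(\<integral>\<^sup>+y. g (x, y) * transfer_op 1 h (x, y) \<partial>lborel) =
      (\<integral>\<^sup>+y. ennreal (1 / J) * (\<Sum>k\<in>digits. g (x, y) * h (branch k x, Ci (y - fiber_sum 1 (branch k x)))) \<partial>lborel)"
      by (simp add: transfer_op_branches [unfolded One_nat_def] sum_distrib_left mult_ac)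
    also have "\<dots> = ennreal (1 / J) * (\<Sum>k\<in>digits. \<integral>\<^sup>+y. g (x, y) * h (branch k x, Ci (y - fiber_sum 1 (branch k x))) \<partial>lborel)"
      by (subst nn_integral_cmult, measurable, subst nn_integral_sum, measurable)
    also have "\<dots> = ennreal (1 / J) * (\<Sum>k\<in>digits. ennreal \<bar>lin_det C\<bar> * G (branch k x))"
      using summand by simp
    finally show ?thesis by (simp add: sum_distrib_left mult.assoc)
  qed
  have "(\<integral>\<^sup>+z. g z * transfer_op 1 h z \<partial>volume) =
    (\<integral>\<^sup>+x. ennreal (1 / J) * ennreal \<bar>lin_det C\<bar> * (\<Sum>k\<in>digits. G (branch k x)) \<partial>torus_lebesgue)"
    by (subst nn_integral_volume, measurable) (simp only: inner)
  also have "\<dots> = ennreal (1 / J) * ennreal \<bar>lin_det C\<bar> * (ennreal deg * (\<integral>\<^sup>+x. G x \<partial>torus_lebesgue))"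
    by (subst nn_integral_cmult, measurable) (simp add: nn_integral_branches)
  also have "\<dots> = ennreal (1 / J * \<bar>lin_det C\<bar> * deg) * (\<integral>\<^sup>+x. G x \<partial>torus_lebesgue)"
  proof -
    have "ennreal (1 / J * \<bar>lin_det C\<bar> * deg) = ennreal (1 / J) * ennreal \<bar>lin_det C\<bar> * ennreal deg"
      using J_pos deg_pos by (subst ennreal_mult, simp, simp, subst ennreal_mult) simp_all
    then show ?thesis by (simp only: mult.assoc)
  qed
  also have "1 / J * \<bar>lin_det C\<bar> * deg = 1" using deg_pos det_C by (simp add: J_eq)
  also have "(\<integral>\<^sup>+x. G x \<partial>torus_lebesgue) = (\<integral>\<^sup>+z. g (T z) * h z \<partial>volume)"
    unfolding G_def by (rule nn_integral_volume [symmetric]) measurable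
  finally show ?thesis by simp
qed

text \<open>The transfer operator is dual to composition with \<open>T^n\<close>, i.e. it
  describes the densities of images of measures under \<open>T^n\<close>.\<close>

lemma transfer_op_dual:
  assumes [measurable]: "h \<in> borel_measurable (borel \<Otimes>\<^sub>M borel)" "g \<in> borel_measurable (borel \<Otimes>\<^sub>M borel)"
  shows "(\<integral>\<^sup>+z. g z * transfer_op n h z \<partial>volume) = (\<integral>\<^sup>+z. g ((T ^^ n) z) * h z \<partial>volume)"
  using assms(2)
proof (induction n arbitrary: g)
  case (Suc n)
  note Suc.prems [measurable]
  have "(\<integral>\<^sup>+z. g z * transfer_op (Suc n) h z \<partial>volume) = (\<integral>\<^sup>+z. g z * transfer_op 1 (transfer_op n h) z \<partial>volume)"
    using transfer_op_add [of 1 n h] by simp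
  also have "\<dots> = (\<integral>\<^sup>+z. g (T z) * transfer_op n h z \<partial>volume)"
    by (rule transfer_op_1_dual) measurable
  also have "\<dots> = (\<integral>\<^sup>+z. g (T ((T ^^ n) z)) * h z \<partial>volume)"
    by (rule Suc.IH) measurable
  finally show ?case by simp
qed simp

end

section \<open>Derivatives of the fibre sums\<close>

context skew begin

definition Ei_lin :: "('u) lin" where "Ei_lin = Blinfun Ei"

text \<open>The derivative of the fibre sum with respect to the base point \<open>x\<close> rather
  than the preimage \<open>a\<close>. The recursion is the chain rule for \<open>fiber_sum (Suc n)
  a = C (fiber_sum n a) + f (E^n a)\<close>, where each step contributes one factor
  \<open>E\<^sup>-\<^sup>1\<close> because \<open>x\<close> enters through its preimages.\<close>

primrec fiber_deriv :: "nat \<Rightarrow> 'u torus \<Rightarrow> (real^'u) \<Rightarrow>\<^sub>L (real^'d)" where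
  "fiber_deriv 0 a = 0"
| "fiber_deriv (Suc n) a = ((C o\<^sub>L fiber_deriv n a) + torus_deriv f ((torus_map E ^^ n) a)) o\<^sub>L Ei_lin"

lemma Ei_lin_apply [simp]: "blinfun_apply Ei_lin v = Ei v"
  unfolding Ei_lin_def using bounded_linear_Ei by (rule bounded_linear_Blinfun_apply [THEN fun_cong])

lemma norm_Ei_lin: "norm Ei_lin = lam"
  unfolding norm_blinfun.rep_eq lam_def by (rule arg_cong [where f = onorm]) auto

lemma theta_eq: "theta E C = norm C * lam"
  by (simp add: theta_def lam_def Ei_def)

lemma fiber_sum_has_derivative:
  "((\<lambda>v. fiber_sum n (tadd a ((Ei ^^ n) (v - v0)))) has_derivative
    blinfun_apply (fiber_deriv n (tadd a ((Ei ^^ n) (v - v0))))) (at v)"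
proof (induction n arbitrary: v v0)
  case (Suc n)
  have eq: "(Ei ^^ Suc n) (v - v0) = (Ei ^^ n) (Ei v - Ei v0)" for v
    by (simp only: funpow_Suc_right o_apply linear_diff [OF linear_Ei])
  have 1: "((\<lambda>v. blinfun_apply C (fiber_sum n (tadd a ((Ei ^^ n) (Ei v - Ei v0))))) has_derivative
    (\<lambda>w. blinfun_apply C (blinfun_apply (fiber_deriv n (tadd a ((Ei ^^ n) (Ei v - Ei v0)))) (Ei w)))) (at v)"
    by (intro bounded_linear.has_derivative [OF blinfun.bounded_linear_right]
        has_derivative_compose [OF bounded_linear_imp_has_derivative [OF bounded_linear_Ei] Suc.IH])
  obtain w0 where w0: "(torus_map E ^^ n) a = proj w0" by (rule proj_cases)
  have pt: "(torus_map E ^^ n) (tadd a ((Ei ^^ n) (Ei v - Ei v0))) = proj (w0 + (Ei v - Ei v0))" for v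
    by (simp add: torus_map_pow_tadd w0)
  have 2: "((\<lambda>v. f (proj (w0 + (Ei v - Ei v0)))) has_derivative
    (\<lambda>w. blinfun_apply (torus_deriv f (proj (w0 + (Ei v - Ei v0)))) (Ei w))) (at v)"
  proof (rule has_derivative_compose [OF _ C1_map_lift [OF C1]])
    show "((\<lambda>v. w0 + (Ei v - Ei v0)) has_derivative Ei) (at v)"
      using has_derivative_add [OF has_derivative_const has_derivative_diff [OF bounded_linear_imp_has_derivative [OF bounded_linear_Ei] has_derivative_const]]
      by simp
  qed
  show ?case
    using has_derivative_add [OF 1 2] unfolding eq fiber_sum_Suc pt fiber_deriv.simps
    by (simp add: blinfun.add_left blinfun.add_right)
qed (simp add: zero_blinfun.rep_eq)

lemma fiber_deriv_le:
  assumes M: "0 \<le> M" "\<And>x. norm (torus_deriv f x) \<le> M"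
  shows "norm (fiber_deriv n a) \<le> M / (1 - norm C)"
proof (induction n)
  case (Suc n)
  have "norm (fiber_deriv (Suc n) a) \<le> norm ((C o\<^sub>L fiber_deriv n a) + torus_deriv f ((torus_map E ^^ n) a)) * lam"
    unfolding fiber_deriv.simps norm_Ei_lin [symmetric] by (rule norm_blinfun_compose)
  also have "\<dots> \<le> (norm C * (M / (1 - norm C)) + M) * 1"
  proof (intro mult_mono)
    show "norm ((C o\<^sub>L fiber_deriv n a) + torus_deriv f ((torus_map E ^^ n) a)) \<le> norm C * (M / (1 - norm C)) + M"
      by (intro order_trans [OF norm_triangle_ineq] add_mono order_trans [OF norm_blinfun_compose] mult_left_mono Suc M norm_ge_zero)
  qed (use lam_less_1 lam_nonneg M norm_C in auto)
  also have "\<dots> = M / (1 - norm C)" using norm_C by (simp add: field_simps)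
  finally show ?case .
qed (use M norm_C in simp)

text \<open>The last \<open>q\<close> steps before the base point are common to both derivatives,
  and the remaining part has been multiplied \<open>q\<close> times by \<open>C\<close> and by the
  inverse of \<open>E\<close>, which multiplies its norm by at most \<open>\<theta>^q\<close>.\<close>

lemma fiber_deriv_tail:
  assumes M: "0 \<le> M" "\<And>x. norm (torus_deriv f x) \<le> M"
  shows "norm (fiber_deriv (q + n) a - fiber_deriv q ((torus_map E ^^ n) a)) \<le> theta E C ^ q * (M / (1 - norm C))"
proof (induction q)
  case (Suc q)
  have "fiber_deriv (Suc q + n) a - fiber_deriv (Suc q) ((torus_map E ^^ n) a) =
    (C o\<^sub>L (fiber_deriv (q + n) a - fiber_deriv q ((torus_map E ^^ n) a))) o\<^sub>L Ei_lin"
    by (rule blinfun_eqI) (simp add: funpow_add blinfun.diff_left blinfun.add_left blinfun.diff_right)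
  also have "norm \<dots> \<le> norm C * norm (fiber_deriv (q + n) a - fiber_deriv q ((torus_map E ^^ n) a)) * lam"
    by (rule order_trans [OF norm_blinfun_compose]) (simp add: norm_Ei_lin lam_nonneg mult_right_mono norm_blinfun_compose)
  also have "\<dots> \<le> norm C * (theta E C ^ q * (M / (1 - norm C))) * lam"
    by (intro mult_right_mono mult_left_mono Suc lam_nonneg norm_ge_zero)
  finally show ?case by (simp add: theta_eq mult_ac)
qed (use fiber_deriv_le [OF M] in simp)

text \<open>Inverse branches contract, so a displacement of the base point by \<open>t\<close>
  displaces all earlier points by less. The geometric series in \<open>C\<close> then gives a
  modulus of continuity that is uniform in \<open>n\<close> and \<open>a\<close>.\<close>

lemma fiber_deriv_modulus:
  assumes \<omega>: "0 \<le> \<omega>" "\<And>x t'. norm t' \<le> norm t \<Longrightarrow> norm (torus_deriv f (tadd x t') - torus_deriv f x) \<le> \<omega>"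
  shows "norm (fiber_deriv n (tadd a ((Ei ^^ n) t)) - fiber_deriv n a) \<le> \<omega> / (1 - norm C)"
  using \<omega>(2)
proof (induction n arbitrary: t)
  case (Suc n)
  have Eit: "norm (Ei t) \<le> norm t"
    using norm_Ei [of t] lam_less_1 mult_right_mono [of lam 1 "norm t"] by simp
  have eq: "(Ei ^^ Suc n) t = (Ei ^^ n) (Ei t)" by (simp only: funpow_Suc_right o_apply)
  let ?b = "tadd a ((Ei ^^ n) (Ei t))"
  have IH: "norm (fiber_deriv n ?b - fiber_deriv n a) \<le> \<omega> / (1 - norm C)"
    by (rule Suc.IH) (use Suc.prems Eit in force)
  have D: "norm (torus_deriv f ((torus_map E ^^ n) ?b) - torus_deriv f ((torus_map E ^^ n) a)) \<le> \<omega>"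
    unfolding torus_map_pow_tadd by (rule Suc.prems [OF Eit])
  have "fiber_deriv (Suc n) ?b - fiber_deriv (Suc n) a =
    ((C o\<^sub>L (fiber_deriv n ?b - fiber_deriv n a)) + (torus_deriv f ((torus_map E ^^ n) ?b) - torus_deriv f ((torus_map E ^^ n) a))) o\<^sub>L Ei_lin"
    by (rule blinfun_eqI) (simp add: blinfun.diff_left blinfun.add_left blinfun.diff_right)
  also have "norm \<dots> \<le> (norm C * (\<omega> / (1 - norm C)) + \<omega>) * 1"
  proof (rule order_trans [OF norm_blinfun_compose], rule mult_mono)
    show "norm ((C o\<^sub>L (fiber_deriv n ?b - fiber_deriv n a)) + (torus_deriv f ((torus_map E ^^ n) ?b) - torus_deriv f ((torus_map E ^^ n) a))) \<le> norm C * (\<omega> / (1 - norm C)) + \<omega>"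
      by (intro order_trans [OF norm_triangle_ineq] add_mono order_trans [OF norm_blinfun_compose] mult_left_mono IH D norm_ge_zero)
  qed (use lam_less_1 lam_nonneg \<omega>(1) norm_C in \<open>auto simp: norm_Ei_lin\<close>)
  also have "\<dots> = \<omega> / (1 - norm C)" using norm_C by (simp add: field_simps)
  finally show ?case unfolding eq .
qed (use \<omega>(1) norm_C in simp)

lemma torus_deriv_modulus:
  assumes "0 < \<omega>"
  obtains \<rho> where "0 < \<rho>" "\<And>x t. norm t < \<rho> \<Longrightarrow> norm (torus_deriv f (tadd x t) - torus_deriv f x) \<le> \<omega>"
proof -
  have "uniformly_continuous_on UNIV (torus_deriv f)"
    using C1 compact_uniformly_continuous [OF _ compact_UNIV_torus] by (auto simp: C1_map_def)
  then obtain d where d: "d > 0" "\<And>x y. dist y x < d \<Longrightarrow> dist (torus_deriv f y) (torus_deriv f x) < \<omega>"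
    using assms unfolding uniformly_continuous_on_def by (metis UNIV_I)
  show ?thesis
  proof (rule that [OF d(1)])
    fix x and t :: "real^'u" assume "norm t < d"
    then have "dist (tadd x t) x < d" using dist_tadd_le [of x t] by (simp add: dist_commute)
    then show "norm (torus_deriv f (tadd x t) - torus_deriv f x) \<le> \<omega>" using d(2) by (simp add: dist_norm less_imp_le)
  qed
qed

end

section \<open>Pairs of preimages\<close>

lemma ennreal_sum_squares_bound: "2 * (x * y) \<le> x * x + y * (y :: ennreal)"
proof (cases x; cases y)
  fix a b :: real assume "x = ennreal a" "0 \<le> a" "y = ennreal b" "0 \<le> b"
  moreover have "2 * (a * b) \<le> a * a + b * b" using sum_squares_bound [of a b] by (simp add: power2_eq_square mult.assoc)
  then have "ennreal (2 * (a * b)) \<le> ennreal (a * a + b * b)" by (rule ennreal_leI)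
  ultimately show ?thesis by (simp add: ennreal_mult ennreal_plus)
qed (auto simp: ennreal_top_mult)

text \<open>Bound each product by the mean of the two squares. By symmetry both squares yield the
  same sum, in which each element is counted at most \<open>N\<close> times.\<close>

lemma sparse_relation_sum:
  fixes x :: "'a \<Rightarrow> ennreal"
  assumes A: "finite A" and sym: "\<And>a b. R a b \<Longrightarrow> R b a" and card: "\<And>a. a \<in> A \<Longrightarrow> card {b \<in> A. R a b} \<le> N"
  shows "(\<Sum>a\<in>A. \<Sum>b\<in>{b \<in> A. R a b}. x a * x b) \<le> of_nat N * (\<Sum>a\<in>A. x a * x a)"
proof -
  let ?S = "\<Sum>a\<in>A. \<Sum>b\<in>{b \<in> A. R a b}. x a * x a"
  have "2 * (\<Sum>a\<in>A. \<Sum>b\<in>{b \<in> A. R a b}. x a * x b) = (\<Sum>a\<in>A. \<Sum>b\<in>{b \<in> A. R a b}. 2 * (x a * x b))"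
    by (simp add: sum_distrib_left)
  also have "\<dots> \<le> (\<Sum>a\<in>A. \<Sum>b\<in>{b \<in> A. R a b}. x a * x a + x b * x b)"
    by (intro sum_mono ennreal_sum_squares_bound)
  also have "\<dots> = ?S + (\<Sum>a\<in>A. \<Sum>b\<in>{b \<in> A. R a b}. x b * x b)"
    by (simp add: sum.distrib)
  also have "(\<Sum>a\<in>A. \<Sum>b\<in>{b \<in> A. R a b}. x b * x b) = (\<Sum>b\<in>A. \<Sum>a\<in>{a \<in> A. R a b}. x b * x b)"
    using A by (intro sum.swap_restrict) auto
  also have "\<dots> = ?S"
    by (intro sum.cong refl) (use sym in blast)+
  finally have "2 * (\<Sum>a\<in>A. \<Sum>b\<in>{b \<in> A. R a b}. x a * x b) \<le> 2 * ?S" by (simp add: mult_2)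
  then have "(\<Sum>a\<in>A. \<Sum>b\<in>{b \<in> A. R a b}. x a * x b) \<le> ?S"
    by (subst (asm) ennreal_mult_le_mult_iff) auto
  also have "?S \<le> (\<Sum>a\<in>A. of_nat N * (x a * x a))"
    using card by (intro sum_mono) (auto intro!: mult_right_mono)
  finally show ?thesis by (simp add: sum_distrib_left)
qed

text \<open>The overlap of two translates of a function depends only on their difference. Its
  total integral over all differences is the square of the integral, which is why integration of
  overlaps over transversal pairs costs only the \<open>L\<^sup>1\<close> norm.\<close>

lemma nn_integral_correlation:
  fixes g :: "'a::euclidean_space \<Rightarrow> ennreal"
  assumes [measurable]: "g \<in> borel_measurable borel"
  defines "k \<equiv> \<lambda>w. \<integral>\<^sup>+y. g y * g (y + w) \<partial>lborel"
  shows "k \<in> borel_measurable borel" "(\<integral>\<^sup>+y. g (y - s) * g (y - t) \<partial>lborel) = k (s - t)"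
    "(\<integral>\<^sup>+w. k w \<partial>lborel) = (\<integral>\<^sup>+y. g y \<partial>lborel) * (\<integral>\<^sup>+y. g y \<partial>lborel)"
proof -
  have m [measurable]: "(\<lambda>(w, y). g y * g (y + w)) \<in> borel_measurable (lborel \<Otimes>\<^sub>M lborel)" by measurable
  show "k \<in> borel_measurable borel"
    using lborel.borel_measurable_nn_integral [OF m] by (simp add: k_def)
  show "(\<integral>\<^sup>+y. g (y - s) * g (y - t) \<partial>lborel) = k (s - t)"
    unfolding k_def by (subst nn_integral_lborel_shift [of _ s]) (simp_all add: algebra_simps)
  have "(\<integral>\<^sup>+w. k w \<partial>lborel) = (\<integral>\<^sup>+y. (\<integral>\<^sup>+w. g y * g (y + w) \<partial>lborel) \<partial>lborel)"
    unfolding k_def by (rule lborel_pair.Fubini' [OF m, symmetric])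
  also have "\<dots> = (\<integral>\<^sup>+y. g y * (\<integral>\<^sup>+w. g w \<partial>lborel) \<partial>lborel)"
  proof (rule nn_integral_cong)
    fix y
    have "(\<integral>\<^sup>+w. g y * g (y + w) \<partial>lborel) = g y * (\<integral>\<^sup>+w. g (w + y) \<partial>lborel)"
      by (subst nn_integral_cmult) (simp_all add: add.commute)
    then show "(\<integral>\<^sup>+w. g y * g (y + w) \<partial>lborel) = g y * (\<integral>\<^sup>+w. g w \<partial>lborel)"
      by (simp add: nn_integral_lborel_shift [of g y])
  qed
  also have "\<dots> = (\<integral>\<^sup>+y. g y \<partial>lborel) * (\<integral>\<^sup>+y. g y \<partial>lborel)"
    by (rule nn_integral_multc) measurable
  finally show "(\<integral>\<^sup>+w. k w \<partial>lborel) = (\<integral>\<^sup>+y. g y \<partial>lborel) * (\<integral>\<^sup>+y. g y \<partial>lborel)" .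
qed

lemma conorm_ge_minus: "conorm_ge (- A) c \<longleftrightarrow> conorm_ge A c"
  by (simp add: conorm_ge_def blinfun.minus_left)

context skew begin

text \<open>The continuation of the inverse branch through \<open>a\<close> along the covering
  space: as \<open>v\<close> moves away from \<open>v0\<close>, this is the preimage of
  \<open>proj v\<close> that starts at the preimage \<open>a\<close> of \<open>proj v0\<close>.\<close>

definition lift_branch :: "nat \<Rightarrow> real^'u \<Rightarrow> 'u torus \<Rightarrow> real^'u \<Rightarrow> 'u torus" where
  "lift_branch m v0 a v = tadd a ((Ei ^^ m) (v - v0))"

text \<open>The form of the transversality condition that the \<open>L\<^sup>2\<close> estimate
  uses. The margin \<open>c\<close> exceeds the size of two tails beyond order \<open>q\<close>,
  and \<open>N\<close> bounds the number of partners without this margin, the preimage itself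
  included.\<close>

definition robustly_transversal :: "nat \<Rightarrow> nat \<Rightarrow> bool" where
  "robustly_transversal q N \<longleftrightarrow>
    (\<exists>M c. 0 \<le> M \<and> (\<forall>x. norm (torus_deriv f x) \<le> M) \<and> 2 * (theta E C ^ q * (M / (1 - norm C))) < c \<and>
      (AE x in torus_lebesgue. \<forall>a\<in>preimages q x.
        card {b \<in> preimages q x. \<not> conorm_ge (fiber_deriv q a - fiber_deriv q b) c} \<le> N))"

lemma linear_Ei_pow: "linear (Ei ^^ n)"
  by (induction n) (simp_all only: funpow.simps linear_id linear_compose linear_Ei)

lemma lift_branch_move: "lift_branch m v0 a v = tadd (lift_branch m v0 a w) ((Ei ^^ m) (v - w))"
  unfolding lift_branch_def tadd_tadd
  by (simp add: linear_diff [OF linear_Ei_pow])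

lemma continuous_fiber_sum_lift: "continuous_on UNIV (\<lambda>v. fiber_sum m (lift_branch m v0 a v))"
  unfolding lift_branch_def
  by (rule has_derivative_continuous_on [where f' = "\<lambda>v. blinfun_apply (fiber_deriv m (tadd a ((Ei ^^ m) (v - v0))))"])
     (use fiber_sum_has_derivative in \<open>simp add: has_derivative_at_withinI\<close>)

text \<open>Suppose that the order-\<open>q\<close> parts of two inverse branches are transversal
  at one point of a ball. The full derivatives of order \<open>q + n\<close> are within two tails
  of these, so transversality persists with the margin \<open>\<eta>\<close> that remains. By the
  uniform modulus of continuity, the radius \<open>r\<close> can be chosen so that the derivative
  of the difference of the fibre sums changes by less than \<open>\<eta> / 2\<close> on the ball.
  Neither \<open>r\<close> nor the constant depends on \<open>n\<close>.\<close>

lemma transversal_pair_integral: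
  assumes M: "0 \<le> M" "\<And>x. norm (torus_deriv f x) \<le> M"
    and margin: "2 * (theta E C ^ q * (M / (1 - norm C))) < c0"
  obtains r K where "0 < r" "0 \<le> K"
    "\<And>n v0 a b h. h \<in> borel_measurable borel \<Longrightarrow>
      \<exists>w\<in>ball v0 r. conorm_ge (fiber_deriv q ((torus_map E ^^ n) (lift_branch (q + n) v0 a w)) -
        fiber_deriv q ((torus_map E ^^ n) (lift_branch (q + n) v0 b w))) c0 \<Longrightarrow>
      (\<integral>\<^sup>+v. indicator (ball v0 r) v *
        h (fiber_sum (q + n) (lift_branch (q + n) v0 a v) - fiber_sum (q + n) (lift_branch (q + n) v0 b v)) \<partial>lborel)
      \<le> ennreal K * (\<integral>\<^sup>+y. h y \<partial>lborel)"
proof -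
  \<comment> \<open>\<open>\<beta>\<close> bounds one tail, \<open>\<eta>\<close> is the margin
    that is left after two tails, and \<open>\<omega>\<close> is the oscillation of
    \<open>Df\<close> for which two fibre derivatives together oscillate by at most \<open>\<eta>
    / 2\<close>.\<close>
  define \<beta> where "\<beta> = theta E C ^ q * (M / (1 - norm C))"
  define \<eta> where "\<eta> = c0 - 2 * \<beta>"
  have \<eta>: "0 < \<eta>" using margin by (simp add: \<eta>_def \<beta>_def)
  define \<omega> where "\<omega> = \<eta> * (1 - norm C) / 4"
  have \<omega>: "0 < \<omega>" using \<eta> norm_C by (simp add: \<omega>_def)
  obtain \<rho> where \<rho>: "0 < \<rho>" "\<And>x t. norm t < \<rho> \<Longrightarrow> norm (torus_deriv f (tadd x t) - torus_deriv f x) \<le> \<omega>"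
    using torus_deriv_modulus [OF \<omega>] by metis
  define r where "r = \<rho> / 2"
  have r: "0 < r" using \<rho> by (simp add: r_def)
  define D where "D = 2 * (M / (1 - norm C))"
  have D: "0 \<le> D" using M norm_C by (simp add: D_def)
  obtain K where K0: "0 \<le> K" and K: "\<And>(A :: (real^'u) \<Rightarrow>\<^sub>L (real^'d)) G v0 h.
    \<lbrakk>conorm_ge A \<eta>; norm A \<le> D; continuous_on UNIV G; h \<in> borel_measurable borel;
    \<forall>v\<in>ball v0 r. \<forall>w\<in>ball v0 r. norm (G v - G w - blinfun_apply A (v - w)) \<le> \<eta> / 2 * norm (v - w)\<rbrakk> \<Longrightarrow>
    (\<integral>\<^sup>+v. indicator (ball v0 r) v * h (G v) \<partial>lborel) \<le> ennreal K * (\<integral>\<^sup>+y. h y \<partial>lborel)"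
    using transversal_pushforward [OF r \<eta> D, where 'u = 'u and 'd = 'd] by blast
  show ?thesis
  proof (rule that [OF r K0])
    fix n v0 a b and h :: "real^'d \<Rightarrow> ennreal"
    assume h: "h \<in> borel_measurable borel"
    define m where "m = q + n"
    define \<Lambda> where "\<Lambda> v = fiber_deriv m (lift_branch m v0 a v) - fiber_deriv m (lift_branch m v0 b v)" for v
    define G where "G v = fiber_sum m (lift_branch m v0 a v) - fiber_sum m (lift_branch m v0 b v)" for v
    assume "\<exists>w\<in>ball v0 r. conorm_ge (fiber_deriv q ((torus_map E ^^ n) (lift_branch (q + n) v0 a w)) -
        fiber_deriv q ((torus_map E ^^ n) (lift_branch (q + n) v0 b w))) c0"
    then obtain w where w: "w \<in> ball v0 r" and cg: "conorm_ge (fiber_deriv q ((torus_map E ^^ n) (lift_branch m v0 a w)) -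
        fiber_deriv q ((torus_map E ^^ n) (lift_branch m v0 b w))) c0"
      by (auto simp: m_def)
    have tail: "norm (fiber_deriv m x - fiber_deriv q ((torus_map E ^^ n) x)) \<le> \<beta>" for x
      unfolding m_def \<beta>_def by (rule fiber_deriv_tail [OF M])
    have cg': "conorm_ge (\<Lambda> w) \<eta>"
    proof (rule conorm_ge_perturb [OF cg, of _ "2 * \<beta>"])
      let ?a = "lift_branch m v0 a w" and ?b = "lift_branch m v0 b w"
      have "\<Lambda> w - (fiber_deriv q ((torus_map E ^^ n) ?a) - fiber_deriv q ((torus_map E ^^ n) ?b)) =
        (fiber_deriv m ?a - fiber_deriv q ((torus_map E ^^ n) ?a)) - (fiber_deriv m ?b - fiber_deriv q ((torus_map E ^^ n) ?b))"
        by (simp add: \<Lambda>_def)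
      also have "norm \<dots> \<le> \<beta> + \<beta>" by (intro order_trans [OF norm_triangle_ineq4] add_mono tail)
      finally show "norm (\<Lambda> w - (fiber_deriv q ((torus_map E ^^ n) ?a) - fiber_deriv q ((torus_map E ^^ n) ?b))) \<le> 2 * \<beta>" by simp
    qed (simp add: \<eta>_def)
    have nA: "norm (\<Lambda> w) \<le> D"
      unfolding \<Lambda>_def D_def
      by (rule order_trans [OF norm_triangle_ineq4]) (use fiber_deriv_le [OF M, of m "lift_branch m v0 a w"] fiber_deriv_le [OF M, of m "lift_branch m v0 b w"] in simp)
    have Gder: "(G has_derivative blinfun_apply (\<Lambda> v)) (at v)" for v
      unfolding G_def \<Lambda>_def lift_branch_def minus_blinfun.rep_eq
      by (intro has_derivative_diff fiber_sum_has_derivative)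
    have near: "norm (\<Lambda> v - \<Lambda> w) \<le> \<eta> / 2" if v: "v \<in> ball v0 r" for v
    proof -
      have "norm (v - w) < \<rho>"
        using v w dist_triangle_less_add [of v v0 r w r] by (simp add: r_def dist_norm norm_minus_commute)
      then have mod: "norm (fiber_deriv m (lift_branch m v0 x v) - fiber_deriv m (lift_branch m v0 x w)) \<le> \<omega> / (1 - norm C)" for x
        unfolding lift_branch_move [of m v0 x v w] using \<omega> \<rho>(2)
        by (intro fiber_deriv_modulus) auto
      have "\<Lambda> v - \<Lambda> w = (fiber_deriv m (lift_branch m v0 a v) - fiber_deriv m (lift_branch m v0 a w)) -
        (fiber_deriv m (lift_branch m v0 b v) - fiber_deriv m (lift_branch m v0 b w))"
        by (simp add: \<Lambda>_def)
      also have "norm \<dots> \<le> \<omega> / (1 - norm C) + \<omega> / (1 - norm C)"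
        by (intro order_trans [OF norm_triangle_ineq4] add_mono mod)
      also have "\<dots> = \<eta> / 2"
      proof -
        have "\<eta> * k / 4 / k + \<eta> * k / 4 / k = \<eta> / 2" if "0 < k" for k using that by simp
        from this [of "1 - norm C"] norm_C show ?thesis unfolding \<omega>_def by simp
      qed
      finally show ?thesis .
    qed
    have "(\<integral>\<^sup>+v. indicator (ball v0 r) v * h (G v) \<partial>lborel) \<le> ennreal K * (\<integral>\<^sup>+y. h y \<partial>lborel)"
    proof (rule K [OF cg' nA _ h])
      show "continuous_on UNIV G"
        unfolding G_def by (intro continuous_intros continuous_fiber_sum_lift)
      show "\<forall>v\<in>ball v0 r. \<forall>v'\<in>ball v0 r. norm (G v - G v' - blinfun_apply (\<Lambda> w) (v - v')) \<le> \<eta> / 2 * norm (v - v')"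
      proof (intro ballI)
        fix v v' assume vv: "v \<in> ball v0 r" "v' \<in> ball v0 r"
        have "norm ((G v - blinfun_apply (\<Lambda> w) v) - (G v' - blinfun_apply (\<Lambda> w) v')) \<le> \<eta> / 2 * norm (v - v')"
        \<comment> \<open>Mean value inequality for the deviation of \<open>G\<close> from its
          linear part at \<open>w\<close>.\<close>
        proof (rule differentiable_bound [OF convex_ball [of v0 r]])
          fix z assume z: "z \<in> ball v0 r"
          show "((\<lambda>v. G v - blinfun_apply (\<Lambda> w) v) has_derivative blinfun_apply (\<Lambda> z - \<Lambda> w)) (at z within ball v0 r)"
            unfolding minus_blinfun.rep_eq
            by (intro has_derivative_diff has_derivative_at_withinI [OF Gder] bounded_linear_imp_has_derivative blinfun.bounded_linear_right)
          show "onorm (blinfun_apply (\<Lambda> z - \<Lambda> w)) \<le> \<eta> / 2"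
            using near [OF z] by (simp add: norm_blinfun.rep_eq)
        qed (use vv in auto)
        then show "norm (G v - G v' - blinfun_apply (\<Lambda> w) (v - v')) \<le> \<eta> / 2 * norm (v - v')"
          by (simp add: blinfun.diff_right algebra_simps)
      qed
    qed
    then show "(\<integral>\<^sup>+v. indicator (ball v0 r) v *
        h (fiber_sum (q + n) (lift_branch (q + n) v0 a v) - fiber_sum (q + n) (lift_branch (q + n) v0 b v)) \<partial>lborel)
      \<le> ennreal K * (\<integral>\<^sup>+y. h y \<partial>lborel)"
      by (simp add: G_def m_def)
  qed
qed

end

section \<open>A Lasota--Yorke inequality\<close>

context invertible_skew begin

text \<open>Densities of this form stay explicit under all powers of the transfer operator: only
  the fibre sums of the preimages enter.\<close>

definition fiber_density :: "(real^'d \<Rightarrow> ennreal) \<Rightarrow> ('u, 'd) phase \<Rightarrow> ennreal" where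
  "fiber_density \<psi> z = \<psi> (snd z)"

lemma measurable_fiber_density [measurable]: "\<psi> \<in> borel_measurable borel \<Longrightarrow> fiber_density \<psi> \<in> borel_measurable (borel \<Otimes>\<^sub>M borel)"
  unfolding fiber_density_def by (rule measurable_compose [OF measurable_snd])

lemma nn_integral_transfer_op:
  assumes "h \<in> borel_measurable (borel \<Otimes>\<^sub>M borel)"
  shows "(\<integral>\<^sup>+z. transfer_op n h z \<partial>volume) = (\<integral>\<^sup>+z. h z \<partial>volume)"
  using transfer_op_dual [OF assms, of "\<lambda>_. 1"] by simp

lemma sum_if_filter:
  "finite A \<Longrightarrow> (\<Sum>b\<in>{b \<in> A. P b}. F b) = (\<Sum>b\<in>A. if P b then F b else (0::ennreal))"
  by (rule sum.inter_filter)

text \<open>A double sum over pairs of related \<open>q\<close>-th preimages, refined to pairs of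
  \<open>(q + n)\<close>-th preimages. The relation of a refined pair is that of their images.\<close>

lemma sum_related_preimages:
  fixes F :: "'u torus \<Rightarrow> ennreal"
  shows "(\<Sum>a\<in>preimages q x. \<Sum>b\<in>{b \<in> preimages q x. R a b}. (\<Sum>a'\<in>preimages n a. F a') * (\<Sum>b'\<in>preimages n b. F b')) =
    (\<Sum>a\<in>preimages (q + n) x. \<Sum>b\<in>preimages (q + n) x. if R ((torus_map E ^^ n) a) ((torus_map E ^^ n) b) then F a * F b else 0)"
proof -
  have "(\<Sum>a\<in>preimages (q + n) x. \<Sum>b\<in>preimages (q + n) x. if R ((torus_map E ^^ n) a) ((torus_map E ^^ n) b) then F a * F b else 0) =
    (\<Sum>a\<in>preimages q x. \<Sum>a'\<in>preimages n a. \<Sum>b\<in>preimages q x. \<Sum>b'\<in>preimages n b. if R ((torus_map E ^^ n) a') ((torus_map E ^^ n) b') then F a' * F b' else 0)"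
    unfolding sum_preimages_add ..
  also have "\<dots> = (\<Sum>a\<in>preimages q x. \<Sum>b\<in>preimages q x. \<Sum>a'\<in>preimages n a. \<Sum>b'\<in>preimages n b. if R ((torus_map E ^^ n) a') ((torus_map E ^^ n) b') then F a' * F b' else 0)"
    by (intro sum.cong refl sum.swap)
  also have "\<dots> = (\<Sum>a\<in>preimages q x. \<Sum>b\<in>preimages q x. \<Sum>a'\<in>preimages n a. \<Sum>b'\<in>preimages n b. if R a b then F a' * F b' else 0)"
    by (intro sum.cong refl) (simp add: preimages_def)
  also have "\<dots> = (\<Sum>a\<in>preimages q x. \<Sum>b\<in>preimages q x. if R a b then (\<Sum>a'\<in>preimages n a. F a') * (\<Sum>b'\<in>preimages n b. F b') else 0)"
    by (intro sum.cong refl) (simp add: sum_product)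
  also have "\<dots> = (\<Sum>a\<in>preimages q x. \<Sum>b\<in>{b \<in> preimages q x. R a b}. (\<Sum>a'\<in>preimages n a. F a') * (\<Sum>b'\<in>preimages n b. F b'))"
    by (intro sum.cong refl sum_if_filter [symmetric]) simp
  finally show ?thesis ..
qed

lemma transfer_op_iterate:
  "fiber_density \<psi> = h0 \<Longrightarrow> transfer_op n h0 (a, (Ci ^^ q) (y - fiber_sum q a)) =
    ennreal (1 / J ^ n) * (\<Sum>a'\<in>preimages n a. \<psi> ((Ci ^^ (q + n)) (y - fiber_sum (q + n) a')))"
  by (auto simp: transfer_op_def fiber_density_def fiber_coordinate intro!: arg_cong2 [where f = "(*)"] sum.cong)

text \<open>Pointwise decomposition of the square. The pairs that fail to be transversal are few
  for each preimage and are absorbed in the diagonal; the diagonal is the transfer operator of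
  order \<open>q\<close> applied to a square. The transversal pairs are refined down to order
  \<open>q + n\<close>, where the fibre sums are smooth functions of the base point and the
  density is explicit.\<close>

lemma transfer_op_square_le:
  assumes good: "\<And>a. a \<in> preimages q x \<Longrightarrow>
      card {b \<in> preimages q x. \<not> conorm_ge (fiber_deriv q a - fiber_deriv q b) c0} \<le> N"
  shows "transfer_op (q + n) (fiber_density \<psi>) (x, y) * transfer_op (q + n) (fiber_density \<psi>) (x, y) \<le>
    ennreal (real N / J ^ q) * transfer_op q (\<lambda>z. transfer_op n (fiber_density \<psi>) z * transfer_op n (fiber_density \<psi>) z) (x, y) +
    ennreal (1 / J ^ (q + n)) * ennreal (1 / J ^ (q + n)) *
    (\<Sum>a\<in>preimages (q + n) x. \<Sum>b\<in>preimages (q + n) x.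
      if conorm_ge (fiber_deriv q ((torus_map E ^^ n) a) - fiber_deriv q ((torus_map E ^^ n) b)) c0
      then \<psi> ((Ci ^^ (q + n)) (y - fiber_sum (q + n) a)) * \<psi> ((Ci ^^ (q + n)) (y - fiber_sum (q + n) b)) else 0)"
proof -
  define R where "R a b \<longleftrightarrow> conorm_ge (fiber_deriv q a - fiber_deriv q b) c0" for a b
  have R_sym: "R b a" if "R a b" for a b
    using that conorm_ge_minus [of "fiber_deriv q a - fiber_deriv q b" c0] by (simp add: R_def)
  define A where "A = preimages q x"
  have [simp]: "finite A" by (simp add: A_def)
  define H where "H a = transfer_op n (fiber_density \<psi>) (a, (Ci ^^ q) (y - fiber_sum q a))" for a
  define F where "F a = \<psi> ((Ci ^^ (q + n)) (y - fiber_sum (q + n) a))" for a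
  define cq where "cq = ennreal (1 / J ^ q)"
  define cn where "cn = ennreal (1 / J ^ n)"
  have HF: "H a = cn * (\<Sum>a'\<in>preimages n a. F a')" for a
    unfolding H_def cn_def F_def by (rule transfer_op_iterate) simp
  have "transfer_op (q + n) (fiber_density \<psi>) (x, y) = cq * (\<Sum>a\<in>A. H a)"
    unfolding transfer_op_add by (simp add: transfer_op_def [of q] cq_def A_def H_def)
  then have "transfer_op (q + n) (fiber_density \<psi>) (x, y) * transfer_op (q + n) (fiber_density \<psi>) (x, y) =
    cq * cq * ((\<Sum>a\<in>A. H a) * (\<Sum>a\<in>A. H a))" by (simp add: mult_ac)
  also have "(\<Sum>a\<in>A. H a) * (\<Sum>a\<in>A. H a) = (\<Sum>a\<in>A. \<Sum>b\<in>A. H a * H b)" by (rule sum_product)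
  also have "\<dots> = (\<Sum>a\<in>A. (\<Sum>b\<in>{b \<in> A. \<not> R a b}. H a * H b) + (\<Sum>b\<in>{b \<in> A. R a b}. H a * H b))"
    by (intro sum.cong refl) (simp add: sum_if_filter flip: sum.distrib, intro sum.cong, auto)
  also have "\<dots> = (\<Sum>a\<in>A. \<Sum>b\<in>{b \<in> A. \<not> R a b}. H a * H b) + (\<Sum>a\<in>A. \<Sum>b\<in>{b \<in> A. R a b}. H a * H b)"
    by (rule sum.distrib)
  also have "cq * cq * \<dots> \<le> cq * cq * (of_nat N * (\<Sum>a\<in>A. H a * H a) + (\<Sum>a\<in>A. \<Sum>b\<in>{b \<in> A. R a b}. H a * H b))"
    by (intro mult_left_mono add_right_mono sparse_relation_sum) (use good R_sym in \<open>auto simp: A_def R_def\<close>)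
  also have "\<dots> = (cq * of_nat N) * (cq * (\<Sum>a\<in>A. H a * H a)) + cq * cq * (\<Sum>a\<in>A. \<Sum>b\<in>{b \<in> A. R a b}. H a * H b)"
    by (simp add: distrib_left mult_ac)
  also have "cq * of_nat N = ennreal (real N / J ^ q)"
    using J_pos unfolding cq_def ennreal_of_nat_eq_real_of_nat by (subst ennreal_mult [symmetric]) simp_all
  also have "cq * (\<Sum>a\<in>A. H a * H a) = transfer_op q (\<lambda>z. transfer_op n (fiber_density \<psi>) z * transfer_op n (fiber_density \<psi>) z) (x, y)"
    by (simp add: transfer_op_def [of q] cq_def A_def H_def)
  also have "(\<Sum>a\<in>A. \<Sum>b\<in>{b \<in> A. R a b}. H a * H b) = cn * cn * (\<Sum>a\<in>A. \<Sum>b\<in>{b \<in> A. R a b}. (\<Sum>a'\<in>preimages n a. F a') * (\<Sum>b'\<in>preimages n b. F b'))"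
    unfolding HF by (simp add: sum_distrib_left mult_ac)
  also have "\<dots> = cn * cn * (\<Sum>a\<in>preimages (q + n) x. \<Sum>b\<in>preimages (q + n) x. if R ((torus_map E ^^ n) a) ((torus_map E ^^ n) b) then F a * F b else 0)"
    unfolding A_def sum_related_preimages ..
  also have "cq * cq * (cn * cn * (\<Sum>a\<in>preimages (q + n) x. \<Sum>b\<in>preimages (q + n) x. if R ((torus_map E ^^ n) a) ((torus_map E ^^ n) b) then F a * F b else 0)) =
    (cq * cn) * (cq * cn) * (\<Sum>a\<in>preimages (q + n) x. \<Sum>b\<in>preimages (q + n) x. if R ((torus_map E ^^ n) a) ((torus_map E ^^ n) b) then F a * F b else 0)"
    by (simp only: mult_ac)
  also have "cq * cn = ennreal (1 / J ^ (q + n))"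
    using J_pos unfolding cq_def cn_def by (subst ennreal_mult [symmetric]) (simp_all add: power_add)
  finally show ?thesis by (simp only: R_def F_def)
qed

lemma unit_cube_cover:
  assumes "0 < r"
  obtains V :: "(real^'u) set" where "finite V" "unit_cube \<subseteq> (\<Union>v\<in>V. ball v r)"
proof -
  obtain V where V: "finite V" "V \<subseteq> cbox 0 (1 :: real^'u)" "cbox 0 (1 :: real^'u) \<subseteq> (\<Union>v\<in>V. ball v r)"
    by (rule compactE_image [OF compact_cbox, of "cbox 0 (1 :: real^'u)" "\<lambda>v. ball v r"]) (use assms in auto)
  show ?thesis using that [OF V(1)] V(3) unit_cube_subset_cbox by (meson subset_trans)
qed

text \<open>Integrate the pointwise inequality. The first term keeps its integral under the
  transfer operator. In the second, the integral over the fibre of a pair is the correlation of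
  the density at the difference of the fibre sums, and \<open>transversal_pair_integral\<close>
  bounds its integral over each of finitely many balls that cover the torus. There are \<open>deg
  ^ (q + n)\<close> preimages, and the powers of the Jacobian cancel exactly, so that the constant
  does not depend on \<open>n\<close>.\<close>

lemma transfer_op_L2_step:
  assumes "robustly_transversal q N"
  obtains K where "0 \<le> K"
    "\<And>n \<psi>. \<psi> \<in> borel_measurable borel \<Longrightarrow>
      (\<integral>\<^sup>+z. transfer_op (q + n) (fiber_density \<psi>) z * transfer_op (q + n) (fiber_density \<psi>) z \<partial>volume) \<le>
      ennreal (real N / J ^ q) * (\<integral>\<^sup>+z. transfer_op n (fiber_density \<psi>) z * transfer_op n (fiber_density \<psi>) z \<partial>volume) +
      ennreal K * ((\<integral>\<^sup>+y. \<psi> y \<partial>lborel) * (\<integral>\<^sup>+y. \<psi> y \<partial>lborel))"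
proof -
  obtain M c0 where M: "0 \<le> M" "\<And>x. norm (torus_deriv f x) \<le> M"
    and margin: "2 * (theta E C ^ q * (M / (1 - norm C))) < c0"
    and good: "AE x in torus_lebesgue. \<forall>a\<in>preimages q x.
      card {b \<in> preimages q x. \<not> conorm_ge (fiber_deriv q a - fiber_deriv q b) c0} \<le> N"
    using assms unfolding robustly_transversal_def by blast
  obtain r K where r: "0 < r" and K0: "0 \<le> K" and K: "\<And>n v0 a b h. h \<in> borel_measurable borel \<Longrightarrow>
      \<exists>w\<in>ball v0 r. conorm_ge (fiber_deriv q ((torus_map E ^^ n) (lift_branch (q + n) v0 a w)) -
        fiber_deriv q ((torus_map E ^^ n) (lift_branch (q + n) v0 b w))) c0 \<Longrightarrow>
      (\<integral>\<^sup>+v. indicator (ball v0 r) v *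
        h (fiber_sum (q + n) (lift_branch (q + n) v0 a v) - fiber_sum (q + n) (lift_branch (q + n) v0 b v)) \<partial>lborel)
      \<le> ennreal K * (\<integral>\<^sup>+y. h y \<partial>lborel)"
  proof (rule transversal_pair_integral [OF M margin], goal_cases)
    case (1 r K)
    show ?case by (rule 1(1)) (use 1(2-) in blast)+
  qed
  obtain V :: "(real^'u) set" where V: "finite V" "unit_cube \<subseteq> (\<Union>v\<in>V. ball v r)"
    using unit_cube_cover [OF r] .
  show ?thesis
  proof (rule that [of "real (card V) * K"])
    show "0 \<le> real (card V) * K" using K0 by simp
    fix n and \<psi> :: "real^'d \<Rightarrow> ennreal" assume \<psi> [measurable]: "\<psi> \<in> borel_measurable borel"
    define m where "m = q + n"
    define h where "h = transfer_op n (fiber_density \<psi>)"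
    define P where "P = transfer_op m (fiber_density \<psi>)"
    define g where "g y = \<psi> ((Ci ^^ m) y)" for y
    define k where "k w = (\<integral>\<^sup>+y. g y * g (y + w) \<partial>lborel)" for w
    define cm where "cm = ennreal (1 / J ^ m)"
    define I where "I = (\<integral>\<^sup>+y. \<psi> y \<partial>lborel)"
    have [measurable]: "h \<in> borel_measurable (borel \<Otimes>\<^sub>M borel)" "P \<in> borel_measurable (borel \<Otimes>\<^sub>M borel)"
      unfolding h_def P_def by measurable
    have [measurable]: "g \<in> borel_measurable borel" unfolding g_def by measurable
    have k [measurable]: "k \<in> borel_measurable borel"
      and k_eq: "(\<integral>\<^sup>+y. g (y - s) * g (y - t) \<partial>lborel) = k (s - t)"
      and k_int: "(\<integral>\<^sup>+w. k w \<partial>lborel) = (\<integral>\<^sup>+y. g y \<partial>lborel) * (\<integral>\<^sup>+y. g y \<partial>lborel)" for s t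
      unfolding k_def by (rule nn_integral_correlation; measurable)+
    have g_int: "(\<integral>\<^sup>+y. g y \<partial>lborel) = ennreal (\<bar>lin_det C\<bar> ^ m) * I"
      unfolding g_def I_def by (rule nn_integral_Ci_pow [OF \<psi>])
    define S where "S v0 a v = fiber_sum m (lift_branch m v0 a v)" for v0 a v
    have [measurable]: "S v0 a \<in> borel_measurable borel" for v0 a
      unfolding S_def by (intro borel_measurable_continuous_onI continuous_fiber_sum_lift)
    \<comment> \<open>Membership in \<open>pair\<close> does not depend on the point of the ball,
      so that for a fixed ball the sum has a fixed set of terms that can be integrated separately.\<close>
    define pair where "pair v0 a b \<longleftrightarrow> (\<exists>w\<in>ball v0 r. conorm_ge (fiber_deriv q ((torus_map E ^^ n) (lift_branch m v0 a w)) -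
        fiber_deriv q ((torus_map E ^^ n) (lift_branch m v0 b w))) c0)" for v0 a b
    define B where "B v0 v = cm * cm * (\<Sum>a\<in>preimages m (proj v0). \<Sum>b\<in>preimages m (proj v0).
      if pair v0 a b then k (S v0 a v - S v0 b v) else 0)" for v0 v
    have [measurable]: "B v0 \<in> borel_measurable borel" for v0 unfolding B_def by measurable
    define Q where "Q = (\<integral>\<^sup>+z. h z * h z \<partial>volume)"
    define ct where "ct = ennreal (real N / J ^ q)"
    define h2 where "h2 = transfer_op q (\<lambda>z. h z * h z)"
    have [measurable]: "h2 \<in> borel_measurable (borel \<Otimes>\<^sub>M borel)" unfolding h2_def by measurable
    have fiber: "(\<integral>\<^sup>+y. P (x, y) * P (x, y) \<partial>lborel) \<le> ct * (\<integral>\<^sup>+y. h2 (x, y) \<partial>lborel) + (\<Sum>v0\<in>V. indicator (ball v0 r) (cube_rep x) * B v0 (cube_rep x))"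
      if x: "\<forall>a\<in>preimages q x. card {b \<in> preimages q x. \<not> conorm_ge (fiber_deriv q a - fiber_deriv q b) c0} \<le> N" for x
    proof -
      define v where "v = cube_rep x"
      have "v \<in> unit_cube" by (simp add: v_def)
      then obtain v0 where v0: "v0 \<in> V" "v \<in> ball v0 r" using V(2) by blast
      have xv: "x = tadd (proj v0) (v - v0)" by (simp add: v_def)
      let ?R = "\<lambda>a b. conorm_ge (fiber_deriv q ((torus_map E ^^ n) a) - fiber_deriv q ((torus_map E ^^ n) b)) c0"
      \<comment> \<open>The preimages of \<open>x\<close> are the continuations of those of the
        centre \<open>v0\<close>. A pair that is transversal at \<open>x\<close> belongs to
        \<open>pair\<close>, with witness \<open>v\<close>.\<close>
      have pt: "P (x, y) * P (x, y) \<le> ct * h2 (x, y) + cm * cm * (\<Sum>a\<in>preimages m (proj v0). \<Sum>b\<in>preimages m (proj v0).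
          if pair v0 a b then g (y - S v0 a v) * g (y - S v0 b v) else 0)" for y
      proof -
        have "P (x, y) * P (x, y) \<le> ct * h2 (x, y) + cm * cm * (\<Sum>a\<in>preimages m x. \<Sum>b\<in>preimages m x.
          if ?R a b then g (y - fiber_sum m a) * g (y - fiber_sum m b) else 0)"
          unfolding P_def ct_def h2_def cm_def g_def m_def h_def by (rule transfer_op_square_le) (use x in blast)
        also have "(\<Sum>a\<in>preimages m x. \<Sum>b\<in>preimages m x. if ?R a b then g (y - fiber_sum m a) * g (y - fiber_sum m b) else 0) =
          (\<Sum>a\<in>preimages m (proj v0). \<Sum>b\<in>preimages m (proj v0).
            if ?R (lift_branch m v0 a v) (lift_branch m v0 b v) then g (y - S v0 a v) * g (y - S v0 b v) else 0)"
          unfolding xv sum_preimages_tadd S_def lift_branch_def ..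
        also have "\<dots> \<le> (\<Sum>a\<in>preimages m (proj v0). \<Sum>b\<in>preimages m (proj v0).
          if pair v0 a b then g (y - S v0 a v) * g (y - S v0 b v) else 0)"
          using v0(2) by (intro sum_mono) (auto simp: pair_def simp del: mem_ball)
        finally show ?thesis by (simp add: add_left_mono mult_left_mono)
      qed
      have "(\<integral>\<^sup>+y. P (x, y) * P (x, y) \<partial>lborel) \<le> (\<integral>\<^sup>+y. ct * h2 (x, y) + cm * cm * (\<Sum>a\<in>preimages m (proj v0). \<Sum>b\<in>preimages m (proj v0).
          if pair v0 a b then g (y - S v0 a v) * g (y - S v0 b v) else 0) \<partial>lborel)"
        by (intro nn_integral_mono pt)
      also have "\<dots> = ct * (\<integral>\<^sup>+y. h2 (x, y) \<partial>lborel) + (\<integral>\<^sup>+y. cm * cm * (\<Sum>a\<in>preimages m (proj v0). \<Sum>b\<in>preimages m (proj v0).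
          if pair v0 a b then g (y - S v0 a v) * g (y - S v0 b v) else 0) \<partial>lborel)"
        by (subst nn_integral_add, measurable) (simp add: nn_integral_cmult)
      also have "(\<integral>\<^sup>+y. cm * cm * (\<Sum>a\<in>preimages m (proj v0). \<Sum>b\<in>preimages m (proj v0).
          if pair v0 a b then g (y - S v0 a v) * g (y - S v0 b v) else 0) \<partial>lborel) =
          cm * cm * (\<Sum>a\<in>preimages m (proj v0). \<Sum>b\<in>preimages m (proj v0).
          \<integral>\<^sup>+y. (if pair v0 a b then g (y - S v0 a v) * g (y - S v0 b v) else 0) \<partial>lborel)"
        by (subst nn_integral_cmult, measurable) (subst nn_integral_sum, measurable, subst nn_integral_sum, measurable)
      also have "\<dots> = B v0 v"
        unfolding B_def by (intro arg_cong2 [where f = "(*)"] sum.cong refl) (simp add: k_eq)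
      also have "B v0 v = indicator (ball v0 r) v * B v0 v" using v0(2) by simp
      also have "\<dots> \<le> (\<Sum>v0\<in>V. indicator (ball v0 r) v * B v0 v)"
        using V(1) v0(1) by (intro member_le_sum) auto
      finally show ?thesis by (simp add: v_def add_left_mono)
    qed
    have B_int: "(\<integral>\<^sup>+v. indicator (ball v0 r) v * B v0 v \<partial>lborel) \<le> ennreal K * (I * I)" for v0
    proof -
      have [measurable]: "indicator (ball v0 r) \<in> borel_measurable (borel :: (real^'u) measure)" by (intro borel_measurable_indicator) simp
      have "(\<integral>\<^sup>+v. indicator (ball v0 r) v * B v0 v \<partial>lborel) =
        (\<integral>\<^sup>+v. cm * cm * (\<Sum>a\<in>preimages m (proj v0). \<Sum>b\<in>preimages m (proj v0).
          if pair v0 a b then indicator (ball v0 r) v * k (S v0 a v - S v0 b v) else 0) \<partial>lborel)"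
        unfolding B_def by (intro nn_integral_cong) (simp add: sum_distrib_left mult_ac if_distrib [where f = "\<lambda>t. _ * t"] cong: if_cong)
      also have "\<dots> = cm * cm * (\<Sum>a\<in>preimages m (proj v0). \<Sum>b\<in>preimages m (proj v0).
          \<integral>\<^sup>+v. (if pair v0 a b then indicator (ball v0 r) v * k (S v0 a v - S v0 b v) else 0) \<partial>lborel)"
        by (subst nn_integral_cmult, measurable) (subst nn_integral_sum, measurable, subst nn_integral_sum, measurable)
      also have "\<dots> \<le> cm * cm * (\<Sum>a\<in>preimages m (proj v0). \<Sum>b\<in>preimages m (proj v0). ennreal K * (\<integral>\<^sup>+y. k y \<partial>lborel))"
      proof (intro mult_left_mono sum_mono)
        fix a b
        show "(\<integral>\<^sup>+v. (if pair v0 a b then indicator (ball v0 r) v * k (S v0 a v - S v0 b v) else 0) \<partial>lborel) \<le> ennreal K * (\<integral>\<^sup>+y. k y \<partial>lborel)"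
        proof (cases "pair v0 a b")
          case True
          then have "(\<integral>\<^sup>+v. indicator (ball v0 r) v * k (S v0 a v - S v0 b v) \<partial>lborel) \<le> ennreal K * (\<integral>\<^sup>+y. k y \<partial>lborel)"
            unfolding pair_def S_def m_def by (rule K [OF k])
          then show ?thesis using True by simp
        qed simp
      qed simp
      also have "\<dots> = cm * cm * (ennreal (deg ^ m) * (ennreal (deg ^ m) * (ennreal K * (\<integral>\<^sup>+y. k y \<partial>lborel))))"
        by (simp add: ennreal_of_nat_eq_real_of_nat card_preimages)
      also have "\<dots> = (cm * ennreal (deg ^ m) * ennreal (\<bar>lin_det C\<bar> ^ m)) * (cm * ennreal (deg ^ m) * ennreal (\<bar>lin_det C\<bar> ^ m)) * (ennreal K * (I * I))"
        unfolding k_int g_int by (simp only: mult_ac)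
      also have "cm * ennreal (deg ^ m) * ennreal (\<bar>lin_det C\<bar> ^ m) = 1"
      proof -
        \<comment> \<open>The factor \<open>deg ^ m\<close> counts the preimages, \<open>\<bar>det
          C\<bar> ^ m\<close> is the integral of the rescaled density, and \<open>J\<close> is the
          product of the two bases.\<close>
        have "cm * ennreal (deg ^ m) * ennreal (\<bar>lin_det C\<bar> ^ m) = ennreal (1 / J ^ m * deg ^ m * \<bar>lin_det C\<bar> ^ m)"
          unfolding cm_def using J_pos deg_pos by (subst ennreal_mult, simp, simp, subst ennreal_mult) simp_all
        also have "1 / J ^ m * deg ^ m * \<bar>lin_det C\<bar> ^ m = 1"
          using deg_pos det_C by (simp add: J_eq power_mult_distrib)
        finally show ?thesis by simp
      qed
      finally show ?thesis by simp
    qed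
    have "(\<integral>\<^sup>+z. P z * P z \<partial>volume) = (\<integral>\<^sup>+x. (\<integral>\<^sup>+y. P (x, y) * P (x, y) \<partial>lborel) \<partial>torus_lebesgue)"
      by (rule nn_integral_volume) measurable
    also have "\<dots> \<le> (\<integral>\<^sup>+x. ct * (\<integral>\<^sup>+y. h2 (x, y) \<partial>lborel) + (\<Sum>v0\<in>V. indicator (ball v0 r) (cube_rep x) * B v0 (cube_rep x)) \<partial>torus_lebesgue)"
      using good by (intro nn_integral_mono_AE) (auto elim!: eventually_mono intro!: fiber)
    also have "\<dots> = ct * (\<integral>\<^sup>+x. (\<integral>\<^sup>+y. h2 (x, y) \<partial>lborel) \<partial>torus_lebesgue) + (\<integral>\<^sup>+x. (\<Sum>v0\<in>V. indicator (ball v0 r) (cube_rep x) * B v0 (cube_rep x)) \<partial>torus_lebesgue)"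
    proof -
      have [measurable]: "indicator (ball v0 r) \<in> borel_measurable (borel :: (real^'u) measure)" for v0 by (intro borel_measurable_indicator) simp
      show ?thesis by (subst nn_integral_add, measurable) (simp add: nn_integral_cmult)
    qed
    also have "(\<integral>\<^sup>+x. (\<integral>\<^sup>+y. h2 (x, y) \<partial>lborel) \<partial>torus_lebesgue) = (\<integral>\<^sup>+z. h2 z \<partial>volume)"
      by (rule nn_integral_volume [symmetric]) measurable
    also have "\<dots> = Q" unfolding h2_def Q_def by (rule nn_integral_transfer_op) measurable
    also have "(\<integral>\<^sup>+x. (\<Sum>v0\<in>V. indicator (ball v0 r) (cube_rep x) * B v0 (cube_rep x)) \<partial>torus_lebesgue) \<le> ennreal (real (card V) * K) * (I * I)"
    proof -
      have [measurable]: "indicator (ball v0 r) \<in> borel_measurable (borel :: (real^'u) measure)" for v0 by (intro borel_measurable_indicator) simp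
      have "(\<integral>\<^sup>+x. (\<Sum>v0\<in>V. indicator (ball v0 r) (cube_rep x) * B v0 (cube_rep x)) \<partial>torus_lebesgue) =
        (\<integral>\<^sup>+v. indicator unit_cube v * (\<Sum>v0\<in>V. indicator (ball v0 r) (cube_rep (proj v)) * B v0 (cube_rep (proj v))) \<partial>lborel)"
        by (rule nn_integral_torus) measurable
      also have "\<dots> \<le> (\<integral>\<^sup>+v. (\<Sum>v0\<in>V. indicator (ball v0 r) v * B v0 v) \<partial>lborel)"
        by (intro nn_integral_mono) (auto simp: indicator_def [of unit_cube] cube_rep_eqI)
      also have "\<dots> = (\<Sum>v0\<in>V. \<integral>\<^sup>+v. indicator (ball v0 r) v * B v0 v \<partial>lborel)"
        by (rule nn_integral_sum) measurable
      also have "\<dots> \<le> (\<Sum>v0\<in>V. ennreal K * (I * I))" by (intro sum_mono B_int)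
      also have "\<dots> = ennreal (real (card V) * K) * (I * I)"
        using K0 by (simp add: ennreal_of_nat_eq_real_of_nat ennreal_mult mult.assoc)
      finally show ?thesis .
    qed
    finally have "(\<integral>\<^sup>+z. P z * P z \<partial>volume) \<le> ct * Q + ennreal (real (card V) * K) * (I * I)"
      by (simp add: add_left_mono)
    then show "(\<integral>\<^sup>+z. transfer_op (q + n) (fiber_density \<psi>) z * transfer_op (q + n) (fiber_density \<psi>) z \<partial>volume) \<le>
      ennreal (real N / J ^ q) * (\<integral>\<^sup>+z. transfer_op n (fiber_density \<psi>) z * transfer_op n (fiber_density \<psi>) z \<partial>volume) +
      ennreal (real (card V) * K) * ((\<integral>\<^sup>+y. \<psi> y \<partial>lborel) * (\<integral>\<^sup>+y. \<psi> y \<partial>lborel))"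
      unfolding P_def Q_def h_def I_def ct_def m_def .
  qed
qed

end

section \<open>Square-integrable densities by duality\<close>

text \<open>The indicator of an open set is an increasing limit of Lipschitz functions, so the
  inequality passes from Lipschitz functions to positive combinations of such indicators.\<close>

lemma open_combination_le:
  fixes V N :: "'a::metric_space measure" and U :: "'i \<Rightarrow> 'a set"
  assumes V: "sets V = sets borel" and N: "prob_space N" "sets N = sets borel" and K: "0 \<le> K"
    and key: "\<And>(g :: 'a \<Rightarrow> real) L B. 0 \<le> L \<Longrightarrow> (\<And>x y. \<bar>g x - g y\<bar> \<le> L * dist x y) \<Longrightarrow> (\<And>x. 0 \<le> g x) \<Longrightarrow> (\<And>x. g x \<le> B) \<Longrightarrow>
      ennreal ((\<integral>x. g x \<partial>N)\<^sup>2) \<le> ennreal K * (\<integral>\<^sup>+x. ennreal ((g x)\<^sup>2) \<partial>V)"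
    and I: "finite I" and U: "\<And>i. i \<in> I \<Longrightarrow> open (U i) \<and> U i \<noteq> UNIV" and c: "\<And>i. i \<in> I \<Longrightarrow> 0 \<le> c i"
  shows "ennreal ((\<integral>x. (\<Sum>i\<in>I. c i * indicator (U i) x) \<partial>N)\<^sup>2) \<le>
    ennreal K * (\<integral>\<^sup>+x. ennreal ((\<Sum>i\<in>I. c i * indicator (U i) x)\<^sup>2) \<partial>V)"
proof -
  interpret prob_space N by (rule N(1))
  define t where "t i k x = min 1 (real k * infdist x (- U i))" for i k x
  define G where "G k x = (\<Sum>i\<in>I. c i * t i k x)" for k x
  define g where "g x = (\<Sum>i\<in>I. c i * indicator (U i) x)" for x :: 'a
  have t: "0 \<le> t i k x" "t i k x \<le> 1" "i \<in> I \<Longrightarrow> t i k x \<le> indicator (U i) x" for i k x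
    using U [of i] by (auto simp: t_def infdist_nonneg indicator_def)
  have t_Lip: "\<bar>t i k x - t i k y\<bar> \<le> real k * dist x y" for i k x y
  proof -
    have "\<bar>infdist x (- U i) - infdist y (- U i)\<bar> \<le> dist x y"
      using infdist_triangle_abs [of x "- U i" y] by simp
    then have "real k * \<bar>infdist x (- U i) - infdist y (- U i)\<bar> \<le> real k * dist x y"
      by (rule mult_left_mono) simp
    then have "\<bar>real k * infdist x (- U i) - real k * infdist y (- U i)\<bar> \<le> real k * dist x y"
      by (simp add: abs_mult right_diff_distrib [symmetric])
    moreover have "\<bar>min 1 a - min 1 b\<bar> \<le> \<bar>a - b\<bar>" for a b :: real by linarith
    ultimately show ?thesis unfolding t_def by (rule order_trans [rotated])
  qed
  have G_Lip: "\<bar>G k x - G k y\<bar> \<le> (\<Sum>i\<in>I. c i * real k) * dist x y" for k x y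
  proof -
    have "\<bar>G k x - G k y\<bar> \<le> (\<Sum>i\<in>I. \<bar>c i * t i k x - c i * t i k y\<bar>)"
      unfolding G_def sum_subtractf [symmetric] by (rule sum_abs)
    also have "\<dots> \<le> (\<Sum>i\<in>I. c i * (real k * dist x y))"
    proof (rule sum_mono)
      fix i assume i: "i \<in> I"
      have "\<bar>c i * t i k x - c i * t i k y\<bar> = c i * \<bar>t i k x - t i k y\<bar>"
        using c [OF i] by (simp add: right_diff_distrib [symmetric] abs_mult)
      then show "\<bar>c i * t i k x - c i * t i k y\<bar> \<le> c i * (real k * dist x y)"
        using t_Lip c [OF i] by (simp add: mult_left_mono)
    qed
    finally show ?thesis by (simp add: sum_distrib_right mult.assoc)
  qed
  have G: "0 \<le> G k x" "G k x \<le> g x" "G k x \<le> sum c I" for k x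
  proof -
    show "0 \<le> G k x" unfolding G_def using c t by (intro sum_nonneg) auto
    show "G k x \<le> g x" unfolding G_def g_def using c t by (intro sum_mono mult_left_mono) auto
    show "G k x \<le> sum c I" unfolding G_def using c t by (intro sum_mono) (auto simp: mult_left_le)
  qed
  have G_cont: "continuous_on UNIV (G k)" for k
    unfolding G_def t_def by (intro continuous_intros)
  have lim: "(\<lambda>k. \<integral>x. G k x \<partial>N) \<longlonglongrightarrow> (\<integral>x. g x \<partial>N)"
  proof (rule integral_dominated_convergence [where w = "\<lambda>_. sum c I"])
    show "G k \<in> borel_measurable N" for k
      using borel_measurable_continuous_onI [OF G_cont] by (simp add: measurable_cong_sets [OF N(2) refl])
    have "(\<lambda>x. c i * indicator (U i) x) \<in> borel_measurable borel" if "i \<in> I" for i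
      using U [OF that] by (intro borel_measurable_times borel_measurable_const borel_measurable_indicator) auto
    then show "g \<in> borel_measurable N"
      unfolding g_def measurable_cong_sets [OF N(2) refl] by (intro borel_measurable_sum)
    show "AE x in N. (\<lambda>k. G k x) \<longlonglongrightarrow> g x"
      unfolding G_def g_def t_def using U by (intro AE_I2 tendsto_sum tendsto_mult tendsto_const tendsto_open_approximation) auto
    show "AE x in N. norm (G k x) \<le> sum c I" for k
      using G by simp
  qed simp
  have le: "ennreal ((\<integral>x. G k x \<partial>N)\<^sup>2) \<le> ennreal K * (\<integral>\<^sup>+x. ennreal ((g x)\<^sup>2) \<partial>V)" for k
  proof -
    have "ennreal ((\<integral>x. G k x \<partial>N)\<^sup>2) \<le> ennreal K * (\<integral>\<^sup>+x. ennreal ((G k x)\<^sup>2) \<partial>V)"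
      by (rule key [OF _ G_Lip G(1) G(3)]) (auto intro!: sum_nonneg mult_nonneg_nonneg c)
    also have "\<dots> \<le> ennreal K * (\<integral>\<^sup>+x. ennreal ((g x)\<^sup>2) \<partial>V)"
      using G by (intro mult_left_mono nn_integral_mono ennreal_leI power_mono) auto
    finally show ?thesis .
  qed
  have "(\<lambda>k. ennreal ((\<integral>x. G k x \<partial>N)\<^sup>2)) \<longlonglongrightarrow> ennreal ((\<integral>x. g x \<partial>N)\<^sup>2)"
    by (intro tendsto_ennrealI tendsto_power lim)
  then have "ennreal ((\<integral>x. g x \<partial>N)\<^sup>2) \<le> ennreal K * (\<integral>\<^sup>+x. ennreal ((g x)\<^sup>2) \<partial>V)"
    by (rule LIMSEQ_le_const2) (use le in auto)
  then show ?thesis by (simp only: g_def)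
qed

text \<open>The functional \<open>g \<mapsto> \<integral> g dN\<close> is bounded in the norm of
  \<open>L\<^sup>2(V)\<close> on Lipschitz functions. The sets \<open>W k\<close> exhaust the
  space by open sets of finite measure. They differ from the whole space so that distances to
  their complements make sense.\<close>

locale L2_dominated =
  fixes V N :: "'a::{second_countable_topology, complete_space} measure" and K :: real and W :: "nat \<Rightarrow> 'a set"
  assumes V: "sets V = sets borel" "sigma_finite_measure V" and N: "prob_space N" "sets N = sets borel" and K: "0 \<le> K"
    and key: "\<And>(g :: 'a \<Rightarrow> real) L B. 0 \<le> L \<Longrightarrow> (\<And>x y. \<bar>g x - g y\<bar> \<le> L * dist x y) \<Longrightarrow> (\<And>x. 0 \<le> g x) \<Longrightarrow> (\<And>x. g x \<le> B) \<Longrightarrow>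
      ennreal ((\<integral>x. g x \<partial>N)\<^sup>2) \<le> ennreal K * (\<integral>\<^sup>+x. ennreal ((g x)\<^sup>2) \<partial>V)"
    and W: "\<And>k. open (W k)" "\<And>k. W k \<noteq> UNIV" "incseq W" "(\<Union>k. W k) = UNIV" "\<And>k. emeasure V (W k) < \<infinity>"
begin

text \<open>Outer regularity for the finite measure \<open>V\<close> restricted to \<open>W
  k\<close>.\<close>

lemma open_superset:
  assumes "A \<in> sets borel" "A \<subseteq> W k" "0 < d"
  obtains U where "open U" "A \<subseteq> U" "U \<subseteq> W k" "emeasure V (U - A) \<le> ennreal d"
proof -
  have Wk [measurable]: "W k \<in> sets V" using W(1) V(1) by auto
  let ?M = "density V (indicator (W k))"
  have M: "emeasure ?M X = emeasure V (W k \<inter> X)" if "X \<in> sets borel" for X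
    using that Wk V(1) by (subst emeasure_density) (auto simp: indicator_inter_arith [symmetric])
  have "emeasure ?M (space ?M) \<noteq> \<infinity>"
    using M [of UNIV] W(5) [of k] sets_eq_imp_space_eq [OF V(1)] by (simp add: less_top)
  from outer_regular [OF _ this assms(1)]
  have "emeasure ?M A = (INF U \<in> {U. A \<subseteq> U \<and> open U}. emeasure ?M U)" using V(1) by simp
  moreover have "emeasure ?M A < emeasure ?M A + ennreal d"
  proof -
    have "emeasure ?M A \<noteq> \<infinity>" using M [OF assms(1)] W(5) [of k] assms(2) emeasure_mono [OF Int_lower1 Wk, of A]
      by (metis infinity_ennreal_def leD less_top order_le_less_trans)
    then show ?thesis
      using assms(3) ennreal_add_left_cancel_less [of "emeasure ?M A" 0 "ennreal d"] by simp
  qed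
  ultimately obtain U where U: "A \<subseteq> U" "open U" "emeasure ?M U < emeasure ?M A + ennreal d"
    by (auto simp: INF_less_iff)
  have Um: "U \<in> sets V" "A \<in> sets V" using U(2) assms(1) V(1) by auto
  have fin: "emeasure V A < \<infinity>"
    using emeasure_mono [OF assms(2) Wk] W(5) [of k] by (rule order_le_less_trans)
  have "emeasure V A + emeasure V (U \<inter> W k - A) = emeasure V (U \<inter> W k)"
    using U(1) assms(2) Um Wk by (subst plus_emeasure) (auto intro!: arg_cong [where f = "emeasure V"])
  also have "\<dots> = emeasure ?M U" using M [of U] U(2) by (simp add: Int_commute)
  also have "\<dots> \<le> emeasure V A + ennreal d"
    using U(3) M [OF assms(1)] assms(2) by (simp add: Int_absorb1 less_imp_le)
  finally have "emeasure V (U \<inter> W k - A) \<le> ennreal d"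
    using fin by (auto simp: ennreal_add_left_cancel_le)
  then show ?thesis using U(1,2) W(1) assms(2) by (intro that [of "U \<inter> W k"]) auto
qed

text \<open>Replace every level set by a slightly larger open set. Where the enlarged function
  differs from \<open>g\<close>, it is bounded by the sum \<open>S\<close> of the values, on a set
  of small measure.\<close>

lemma simple_le:
  fixes g :: "'a \<Rightarrow> real"
  assumes g [measurable]: "g \<in> borel_measurable borel" and fin: "finite (range g)" and g0: "\<And>x. 0 \<le> g x"
    and supp: "\<And>x. x \<notin> W k \<Longrightarrow> g x = 0"
  shows "ennreal ((\<integral>x. g x \<partial>N)\<^sup>2) \<le> ennreal K * (\<integral>\<^sup>+x. ennreal ((g x)\<^sup>2) \<partial>V)"
proof (rule ennreal_le_epsilon)
  fix e :: real assume e: "0 < e"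
  interpret prob_space N by (rule N(1))
  define I where "I = range g - {0}"
  define A where "A c = g -` {c}" for c
  define S where "S = \<Sum>I"
  \<comment> \<open>The errors on the sets added to the level sets amount to at most \<open>K
    S\<^sup>2 d\<close> for each value; the \<open>1\<close> keeps the denominator positive.\<close>
  define d where "d = e / (K * S\<^sup>2 * real (card I) + 1)"
  have finI: "finite I" and I: "\<And>c. c \<in> I \<Longrightarrow> 0 < c" using fin g0 by (auto simp: I_def less_le)
  have S: "0 \<le> S" using I unfolding S_def by (intro sum_nonneg) (simp add: less_imp_le)
  have D: "0 < K * S\<^sup>2 * real (card I) + 1" using K by (simp add: add_nonneg_pos)
  then have d: "0 < d" using e by (simp add: d_def)
  have A: "A c \<in> sets borel" for c using measurable_sets [OF g, of "{c}"] by (simp add: A_def)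
  have AW: "A c \<subseteq> W k" if "c \<in> I" for c using that supp by (auto simp: A_def I_def)
  have "\<forall>c\<in>I. \<exists>U. open U \<and> A c \<subseteq> U \<and> U \<subseteq> W k \<and> emeasure V (U - A c) \<le> ennreal d"
    using open_superset [OF A AW d] by metis
  then obtain U where U: "\<And>c. c \<in> I \<Longrightarrow> open (U c) \<and> A c \<subseteq> U c \<and> U c \<subseteq> W k \<and> emeasure V (U c - A c) \<le> ennreal d"
    by metis
  define G where "G x = (\<Sum>c\<in>I. c * indicator (U c) x)" for x :: 'a
  have g_eq: "g x = (\<Sum>c\<in>I. c * indicator (A c) x)" for x
  proof (cases "g x = 0")
    case True
    then show ?thesis by (auto simp: A_def I_def indicator_def intro!: sum.neutral [symmetric])
  next
    case False
    have "(\<Sum>c\<in>I. c * indicator (A c) x) = (\<Sum>c\<in>I. if c = g x then g x else 0)"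
      by (intro sum.cong refl) (auto simp: A_def indicator_def)
    then show ?thesis using False finI by (simp add: I_def)
  qed
  have gG: "g x \<le> G x" for x
    unfolding g_eq G_def using U I by (intro sum_mono mult_left_mono) (auto simp: indicator_def less_imp_le)
  have GS: "G x \<le> S" "0 \<le> G x" for x
  proof -
    show "G x \<le> S" unfolding G_def S_def using I by (intro sum_mono) (auto simp: indicator_def less_imp_le)
    show "0 \<le> G x" using gG g0 order_trans by blast
  qed
  have G2: "(G x)\<^sup>2 \<le> (g x)\<^sup>2 + (\<Sum>c\<in>I. S\<^sup>2 * indicator (U c - A c) x)" for x
  proof (cases "\<exists>c\<in>I. x \<in> U c - A c")
    case True
    then obtain c where c: "c \<in> I" "x \<in> U c - A c" by blast
    have "(G x)\<^sup>2 \<le> S\<^sup>2" using GS by (rule power_mono)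
    also have "S\<^sup>2 = S\<^sup>2 * indicator (U c - A c) x" using c by simp
    also have "\<dots> \<le> (\<Sum>c\<in>I. S\<^sup>2 * indicator (U c - A c) x)"
      using finI c(1) by (intro member_le_sum) auto
    finally show ?thesis by (simp add: add_increasing)
  next
    case False
    then have "G x = g x"
      unfolding G_def g_eq using U by (intro sum.cong refl) (auto simp: indicator_def)
    then show ?thesis by (simp add: sum_nonneg)
  qed
  have [measurable]: "U c \<in> sets borel" if "c \<in> I" for c using U [OF that] by auto
  have Gm: "G \<in> borel_measurable borel"
    unfolding G_def by (intro borel_measurable_sum borel_measurable_times borel_measurable_const borel_measurable_indicator) auto
  have int: "integrable N h" if "h \<in> borel_measurable borel" "\<And>x. 0 \<le> h x" "\<And>x. h x \<le> S" for h :: "'a \<Rightarrow> real"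
    using that by (intro integrable_const_bound [where B = S]) (auto simp: measurable_cong_sets [OF N(2) refl])
  have "(\<integral>x. g x \<partial>N) \<le> (\<integral>x. G x \<partial>N)"
    using gG GS g0 order_trans [OF gG GS(1)] by (intro integral_mono int g Gm) auto
  then have "ennreal ((\<integral>x. g x \<partial>N)\<^sup>2) \<le> ennreal ((\<integral>x. G x \<partial>N)\<^sup>2)"
    using g0 by (intro ennreal_leI power_mono integral_nonneg_AE) auto
  also have "\<dots> \<le> ennreal K * (\<integral>\<^sup>+x. ennreal ((G x)\<^sup>2) \<partial>V)"
    unfolding G_def
  proof (rule open_combination_le [OF V(1) N K key finI])
    show "open (U c) \<and> U c \<noteq> UNIV" "0 \<le> c" if "c \<in> I" for c
      using U [OF that] W(2) [of k] I [OF that] by auto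
  qed
  also have "\<dots> \<le> ennreal K * (\<integral>\<^sup>+x. ennreal ((g x)\<^sup>2) + (\<Sum>c\<in>I. ennreal (S\<^sup>2) * indicator (U c - A c) x) \<partial>V)"
  proof (intro mult_left_mono nn_integral_mono)
    fix x
    have "ennreal ((G x)\<^sup>2) \<le> ennreal ((g x)\<^sup>2 + (\<Sum>c\<in>I. S\<^sup>2 * indicator (U c - A c) x))"
      by (intro ennreal_leI G2)
    also have "\<dots> = ennreal ((g x)\<^sup>2) + (\<Sum>c\<in>I. ennreal (S\<^sup>2 * indicator (U c - A c) x))"
      by (simp add: sum_nonneg ennreal_plus sum_ennreal)
    also have "(\<Sum>c\<in>I. ennreal (S\<^sup>2 * indicator (U c - A c) x)) = (\<Sum>c\<in>I. ennreal (S\<^sup>2) * indicator (U c - A c) x)"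
      by (intro sum.cong refl) (simp add: indicator_def)
    finally show "ennreal ((G x)\<^sup>2) \<le> ennreal ((g x)\<^sup>2) + (\<Sum>c\<in>I. ennreal (S\<^sup>2) * indicator (U c - A c) x)" .
  qed simp
  also have "(\<integral>\<^sup>+x. ennreal ((g x)\<^sup>2) + (\<Sum>c\<in>I. ennreal (S\<^sup>2) * indicator (U c - A c) x) \<partial>V) =
    (\<integral>\<^sup>+x. ennreal ((g x)\<^sup>2) \<partial>V) + (\<Sum>c\<in>I. ennreal (S\<^sup>2) * emeasure V (U c - A c))"
  proof -
    have UA: "U c - A c \<in> sets V" if "c \<in> I" for c using U [OF that] A [of c] V(1) by auto
    have m1: "(\<lambda>x. ennreal ((g x)\<^sup>2)) \<in> borel_measurable V" unfolding measurable_cong_sets [OF V(1) refl] by measurable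
    have m2: "(\<lambda>x. ennreal (S\<^sup>2) * indicator (U c - A c) x) \<in> borel_measurable V" if "c \<in> I" for c
      using UA [OF that] by (intro borel_measurable_times_ennreal borel_measurable_const borel_measurable_indicator)
    show ?thesis
      using m1 m2 UA by (simp add: nn_integral_add nn_integral_sum nn_integral_cmult_indicator borel_measurable_sum)
  qed
  also have "ennreal K * ((\<integral>\<^sup>+x. ennreal ((g x)\<^sup>2) \<partial>V) + (\<Sum>c\<in>I. ennreal (S\<^sup>2) * emeasure V (U c - A c))) \<le>
    ennreal K * ((\<integral>\<^sup>+x. ennreal ((g x)\<^sup>2) \<partial>V) + (\<Sum>c\<in>I. ennreal (S\<^sup>2) * ennreal d))"
    using U by (intro mult_left_mono add_left_mono sum_mono) auto
  also have "\<dots> = ennreal K * (\<integral>\<^sup>+x. ennreal ((g x)\<^sup>2) \<partial>V) + ennreal (K * S\<^sup>2 * real (card I) * d)"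
    using K d by (simp add: distrib_left ennreal_mult ennreal_of_nat_eq_real_of_nat mult_ac)
  also have "ennreal (K * S\<^sup>2 * real (card I) * d) \<le> ennreal e"
  proof (rule ennreal_leI)
    have "K * S\<^sup>2 * real (card I) * d \<le> (K * S\<^sup>2 * real (card I) + 1) * d" using d by (simp add: distrib_right)
    also have "\<dots> = e" using D by (simp add: d_def)
    finally show "K * S\<^sup>2 * real (card I) * d \<le> e" .
  qed
  finally show "ennreal ((\<integral>x. g x \<partial>N)\<^sup>2) \<le> ennreal K * (\<integral>\<^sup>+x. ennreal ((g x)\<^sup>2) \<partial>V) + ennreal e"
    by (simp add: add_left_mono)
qed

lemma absolutely_continuous: "absolutely_continuous V N"
  unfolding absolutely_continuous_def
proof
  fix A assume A: "A \<in> null_sets V"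
  interpret prob_space N by (rule N(1))
  have Am: "A \<in> sets borel" using A V(1) by auto
  have Wm: "W k \<in> sets borel" for k using W(1) by auto
  have "A \<inter> W k \<in> null_sets N" for k
  proof -
    have AW: "A \<inter> W k \<in> sets borel" using Am Wm by auto
    have "ennreal ((\<integral>x. indicator (A \<inter> W k) x \<partial>N)\<^sup>2) \<le> ennreal K * (\<integral>\<^sup>+x. ennreal ((indicator (A \<inter> W k) x)\<^sup>2) \<partial>V)"
    proof (rule simple_le [where k = k])
      show "finite (range (indicator (A \<inter> W k) :: 'a \<Rightarrow> real))"
        by (rule finite_subset [of _ "{0, 1}"]) (auto simp: indicator_def)
    qed (use AW in auto)
    also have "(\<integral>\<^sup>+x. ennreal ((indicator (A \<inter> W k) x)\<^sup>2) \<partial>V) = (\<integral>\<^sup>+x. indicator (A \<inter> W k) x \<partial>V)"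
      by (intro nn_integral_cong) (simp add: indicator_def)
    also have "\<dots> = emeasure V (A \<inter> W k)" using AW V(1) by (intro nn_integral_indicator) simp
    also have "\<dots> = 0" using null_set_Int1 [OF A, of "W k"] Wm V(1) by (simp add: Int_commute null_setsD1)
    finally have "ennreal ((\<integral>x. indicator (A \<inter> W k) x \<partial>N)\<^sup>2) \<le> ennreal K * 0" .
    then have "(\<integral>x. indicator (A \<inter> W k) x \<partial>N)\<^sup>2 \<le> (0 :: real)"
      by (metis ennreal_eq_0_iff le_zero_eq mult_zero_right)
    then have "measure N (A \<inter> W k) = 0" using AW N(2) by (simp add: sets_eq_imp_space_eq [OF N(2)])
    then show ?thesis using AW N(2) by (simp add: null_sets_def emeasure_eq_measure)
  qed
  then have "(\<Union>k. A \<inter> W k) \<in> null_sets N" by (rule null_sets_UN)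
  moreover have "(\<Union>k. A \<inter> W k) = A" using W(4) by auto
  ultimately show "A \<in> null_sets N" by simp
qed

text \<open>The Riesz argument in explicit form. For a truncated simple function \<open>h \<le>
  g\<close> below the density \<open>g\<close>, the number \<open>X = \<integral> h\<^sup>2
  dV\<close> is at most \<open>\<integral> h dN\<close>, whose square is at most \<open>K
  X\<close> by duality. Hence \<open>X \<le> K\<close>, and Fatou's lemma lets \<open>h\<close>
  increase to \<open>g\<close>.\<close>

lemma nn_integral_RN_deriv_square: "(\<integral>\<^sup>+x. (RN_deriv V N x)\<^sup>2 \<partial>V) \<le> ennreal K"
proof -
  interpret NP: prob_space N by (rule N(1))
  interpret VS: sigma_finite_measure V by (rule V(2))
  define g where "g = RN_deriv V N"
  have gm [measurable]: "g \<in> borel_measurable V" by (simp add: g_def)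
  have dens: "density V g = N"
    unfolding g_def by (rule VS.density_RN_deriv [OF absolutely_continuous]) (simp add: V(1) N(2))
  obtain s where s: "\<And>i. simple_function V (s i)" "incseq s" "\<And>i x. s i x < top" "\<And>x. (SUP i. s i x) = g x"
    using borel_measurable_implies_simple_function_sequence' [OF gm] by blast
  define h where "h k x = enn2real (s k x) * indicator (W k) x" for k x
  have Wm: "W k \<in> sets borel" for k using W(1) by auto
  have sm: "s k \<in> borel_measurable borel" for k
    using borel_measurable_simple_function [OF s(1), of k] by (simp add: measurable_cong_sets [OF V(1) refl])
  have hm: "h k \<in> borel_measurable borel" for k
  proof -
    note sm [measurable] Wm [measurable]
    show ?thesis unfolding h_def by measurable
  qed
  have h0: "0 \<le> h k x" for k x by (simp add: h_def)
  have hg: "ennreal (h k x) \<le> g x" for k x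
  proof -
    have "ennreal (h k x) \<le> s k x" using s(3) [of k x] by (simp add: h_def indicator_def)
    also have "\<dots> \<le> g x" using s(4) [of x] by (metis SUP_upper UNIV_I)
    finally show ?thesis .
  qed
  have frange: "finite (range (h k))" for k
  proof -
    have "finite (range (s k))"
      using simple_functionD(1) [OF s(1) [of k]] sets_eq_imp_space_eq [OF V(1)] by simp
    moreover have "range (h k) \<subseteq> insert 0 (enn2real ` range (s k))" by (auto simp: h_def indicator_def)
    ultimately show ?thesis by (meson finite_imageI finite_insert finite_subset)
  qed
  have bound: "(\<integral>\<^sup>+x. ennreal ((h k x)\<^sup>2) \<partial>V) \<le> ennreal K" for k
  proof -
    define X where "X = (\<integral>\<^sup>+x. ennreal ((h k x)\<^sup>2) \<partial>V)"
    obtain B where B: "\<And>x. h k x \<le> B" using frange [of k] by (metis Max_ge rangeI)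
    have int: "integrable N (h k)"
      using hm h0 B by (intro NP.integrable_const_bound [where B = B]) (auto simp: measurable_cong_sets [OF N(2) refl])
    have "X \<le> (\<integral>\<^sup>+x. ennreal (B\<^sup>2) * indicator (W k) x \<partial>V)"
      unfolding X_def
    proof (rule nn_integral_mono)
      fix x
      show "ennreal ((h k x)\<^sup>2) \<le> ennreal (B\<^sup>2) * indicator (W k) x"
      proof (cases "x \<in> W k")
        case True
        then show ?thesis using power_mono [OF B [of x] h0, of 2] by (simp add: ennreal_leI)
      qed (simp add: h_def)
    qed
    also have "\<dots> = ennreal (B\<^sup>2) * emeasure V (W k)"
      using Wm V(1) by (intro nn_integral_cmult_indicator) simp
    also have "\<dots> < \<infinity>" using W(5) [of k] by (simp add: ennreal_mult_less_top)
    \<comment> \<open>Finiteness of \<open>X\<close> permits cancelling it from \<open>X\<^sup>2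
      \<le> K X\<close>.\<close>
    finally have Xfin: "X < \<infinity>" .
    have "X \<le> (\<integral>\<^sup>+x. g x * ennreal (h k x) \<partial>V)"
      unfolding X_def using hg h0 by (intro nn_integral_mono) (simp add: power2_eq_square ennreal_mult mult_right_mono)
    also have "\<dots> = (\<integral>\<^sup>+x. ennreal (h k x) \<partial>N)"
      unfolding dens [symmetric] using hm by (intro nn_integral_density [symmetric] gm) (simp add: measurable_cong_sets [OF V(1) refl])
    also have "\<dots> = ennreal (\<integral>x. h k x \<partial>N)" using int h0 by (intro nn_integral_eq_integral) auto
    finally have XI: "X \<le> ennreal (\<integral>x. h k x \<partial>N)" .
    have "ennreal ((\<integral>x. h k x \<partial>N)\<^sup>2) \<le> ennreal K * X"
      unfolding X_def by (rule simple_le [where k = k, OF hm frange h0]) (simp add: h_def)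
    moreover have "X * X \<le> ennreal ((\<integral>x. h k x \<partial>N)\<^sup>2)"
      using mult_mono [OF XI XI] h0 by (simp add: power2_eq_square ennreal_mult integral_nonneg_AE)
    ultimately have "X * X \<le> ennreal K * X" by (rule order_trans [rotated])
    then have "X \<le> ennreal K"
    proof (cases "X = 0")
      case False
      have "X * X \<le> X * ennreal K" using \<open>X * X \<le> ennreal K * X\<close> by (simp only: mult.commute)
      then show ?thesis using False Xfin by (subst (asm) ennreal_mult_le_mult_iff) auto
    qed simp
    then show ?thesis by (simp add: X_def)
  qed
  have lim: "(\<lambda>k. ennreal ((h k x)\<^sup>2)) \<longlonglongrightarrow> (g x)\<^sup>2" for x
  proof -
    have "(\<lambda>k. s k x) \<longlonglongrightarrow> g x"
      using LIMSEQ_SUP [of "\<lambda>k. s k x"] s(2,4) by (simp add: incseq_def le_fun_def)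
    moreover obtain k0 where "x \<in> W k0" using W(4) by auto
    then have "eventually (\<lambda>k. x \<in> W k) sequentially"
      unfolding eventually_sequentially using W(3) by (meson incseqD subsetD)
    then have "eventually (\<lambda>k. s k x = ennreal (h k x)) sequentially"
      by eventually_elim (use s(3) in \<open>simp add: h_def\<close>)
    ultimately have l: "(\<lambda>k. ennreal (h k x)) \<longlonglongrightarrow> g x"
      by (rule Lim_transform_eventually)
    have "(\<lambda>k. ennreal (h k x) * ennreal (h k x)) \<longlonglongrightarrow> g x * g x"
      by (rule tendsto_mult_ennreal [OF l l]) auto
    then show ?thesis using h0 by (simp add: power2_eq_square ennreal_mult)
  qed
  have "(\<integral>\<^sup>+x. (g x)\<^sup>2 \<partial>V) = (\<integral>\<^sup>+x. liminf (\<lambda>k. ennreal ((h k x)\<^sup>2)) \<partial>V)"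
    by (intro nn_integral_cong lim_imp_Liminf [symmetric] lim) simp
  also have "\<dots> \<le> liminf (\<lambda>k. \<integral>\<^sup>+x. ennreal ((h k x)\<^sup>2) \<partial>V)"
    using hm by (intro nn_integral_liminf) (simp add: measurable_cong_sets [OF V(1) refl])
  also have "\<dots> \<le> liminf (\<lambda>k. ennreal K)" by (intro Liminf_mono always_eventually allI bound)
  finally show ?thesis by (simp add: g_def Liminf_const)
qed

end

section \<open>The density of the SRB measure\<close>

context invertible_skew begin

text \<open>The fibre part of the initial density: the uniform distribution on the unit cube of
  the fibre.\<close>

definition unit_mass :: "real^'d \<Rightarrow> ennreal" where "unit_mass = indicator unit_cube"

lemma unit_mass_measurable [measurable]: "unit_mass \<in> borel_measurable borel"
  unfolding unit_mass_def by (intro borel_measurable_indicator) measurable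

lemma nn_integral_unit_mass: "(\<integral>\<^sup>+y. unit_mass y \<partial>lborel) = 1"
  unfolding unit_mass_def by (subst nn_integral_indicator) auto

text \<open>The step inequality along multiples of \<open>q\<close> is the recursion \<open>b
  \<mapsto> l b + K\<close> with \<open>l < 1\<close>, as the integral of the density is
  preserved.\<close>

lemma iterated_L2_bound:
  assumes rt: "robustly_transversal q N"
    and N: "real N < J ^ q"
  obtains B where "0 \<le> B"
    "\<And>j. (\<integral>\<^sup>+z. (transfer_op (j * q) (fiber_density unit_mass) z)\<^sup>2 \<partial>volume) \<le> ennreal B"
proof -
  obtain K where K0: "0 \<le> K" and K: "\<And>n \<psi>. \<psi> \<in> borel_measurable borel \<Longrightarrow>
      (\<integral>\<^sup>+z. transfer_op (q + n) (fiber_density \<psi>) z * transfer_op (q + n) (fiber_density \<psi>) z \<partial>volume) \<le>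
      ennreal (real N / J ^ q) * (\<integral>\<^sup>+z. transfer_op n (fiber_density \<psi>) z * transfer_op n (fiber_density \<psi>) z \<partial>volume) +
      ennreal K * ((\<integral>\<^sup>+y. \<psi> y \<partial>lborel) * (\<integral>\<^sup>+y. \<psi> y \<partial>lborel))"
    using transfer_op_L2_step [OF rt] by blast
  define l where "l = real N / J ^ q"
  have l: "0 \<le> l" "l < 1" using N J_pos by (simp_all add: l_def divide_less_eq)
  \<comment> \<open>The fixed point of the recursion, enlarged by the value \<open>1\<close> at
    the start.\<close>
  define B where "B = 1 + K / (1 - l)"
  have B0: "0 \<le> B" using K0 l by (simp add: B_def)
  have B_step: "l * B + K \<le> B"
  proof -
    have "l * (K / (1 - l)) + K = K / (1 - l)" using l by (simp add: field_simps)
    then show ?thesis using l by (simp add: B_def distrib_left)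
  qed
  have "(\<integral>\<^sup>+z. transfer_op (j * q) (fiber_density unit_mass) z * transfer_op (j * q) (fiber_density unit_mass) z \<partial>volume) \<le> ennreal B" for j
  proof (induction j)
    case 0
    have "(\<integral>\<^sup>+z. fiber_density unit_mass z * fiber_density unit_mass z \<partial>volume) =
      (\<integral>\<^sup>+x. (\<integral>\<^sup>+y. fiber_density unit_mass (x, y) * fiber_density unit_mass (x, y) \<partial>lborel) \<partial>torus_lebesgue)"
      by (rule nn_integral_volume) measurable
    also have "\<dots> = (\<integral>\<^sup>+(x :: 'u torus). (\<integral>\<^sup>+y. unit_mass y \<partial>lborel) \<partial>torus_lebesgue)"
      by (intro nn_integral_cong) (simp add: fiber_density_def unit_mass_def indicator_def)
    also have "\<dots> = 1" unfolding nn_integral_unit_mass by simp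
    also have "1 \<le> ennreal B" using K0 l by (simp add: B_def)
    finally show ?case by simp
  next
    case (Suc j)
    have "(\<integral>\<^sup>+z. transfer_op (Suc j * q) (fiber_density unit_mass) z * transfer_op (Suc j * q) (fiber_density unit_mass) z \<partial>volume) \<le>
      ennreal l * (\<integral>\<^sup>+z. transfer_op (j * q) (fiber_density unit_mass) z * transfer_op (j * q) (fiber_density unit_mass) z \<partial>volume) + ennreal K"
      using K [OF unit_mass_measurable, of "j * q"] by (simp add: nn_integral_unit_mass l_def)
    also have "\<dots> \<le> ennreal l * ennreal B + ennreal K"
      by (intro add_right_mono mult_left_mono Suc) simp
    also have "\<dots> = ennreal (l * B + K)" using l B0 K0 by (simp add: ennreal_mult)
    also have "\<dots> \<le> ennreal B" by (rule ennreal_leI [OF B_step])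
    finally show ?case .
  qed
  then show ?thesis using B0 that by (simp add: power2_eq_square)
qed

lemma norm_unit_cube: "y \<in> unit_cube \<Longrightarrow> norm y \<le> real CARD('d)" for y :: "real^'d"
proof -
  assume y: "y \<in> unit_cube"
  have "norm y \<le> (\<Sum>i\<in>UNIV. \<bar>y $ i\<bar>)" by (rule norm_le_l1_cart)
  also have "\<dots> \<le> (\<Sum>i\<in>(UNIV :: 'd set). 1)" using y by (intro sum_mono) (simp add: unit_cube_def less_imp_le)
  finally show ?thesis by simp
qed

text \<open>The measure with density \<open>P^n h0\<close> and the image of the zero section under
  \<open>T^n\<close> have nearly the same integral of \<open>g\<close>, because the fibres have
  been contracted. The former is controlled by Cauchy--Schwarz and the \<open>L\<^sup>2\<close>
  bound, the latter converges to the integral against \<open>srb\<close>.\<close>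

lemma srb_integral_le:
  fixes g :: "('u, 'd) phase \<Rightarrow> real"
  assumes B: "0 \<le> B" "\<And>j. (\<integral>\<^sup>+z. (transfer_op (j * q) (fiber_density unit_mass) z)\<^sup>2 \<partial>volume) \<le> ennreal B"
    and q: "1 \<le> q"
    and L: "0 \<le> L" "\<And>x y. \<bar>g x - g y\<bar> \<le> L * dist x y" and g0: "\<And>x. 0 \<le> g x" and gD: "\<And>x. g x \<le> D"
  shows "ennreal ((\<integral>x. g x \<partial>srb)\<^sup>2) \<le> ennreal B * (\<integral>\<^sup>+x. ennreal ((g x)\<^sup>2) \<partial>volume)"
proof -
  define G where "G = (\<integral>\<^sup>+x. ennreal ((g x)\<^sup>2) \<partial>volume)"
  have "L-lipschitz_on UNIV g" using L by (intro lipschitz_onI) (auto simp: dist_real_def)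
  then have cont: "continuous_on UNIV g" by (rule lipschitz_on_continuous_on)
  have gm [measurable]: "g \<in> borel_measurable (borel \<Otimes>\<^sub>M borel)"
    unfolding borel_prod using cont by (rule borel_measurable_continuous_onI)
  define h where "h n = transfer_op n (fiber_density unit_mass)" for n
  have hm [measurable]: "h n \<in> borel_measurable (borel \<Otimes>\<^sub>M borel)" for n unfolding h_def by measurable
  \<comment> \<open>The error caused by replacing points of the unit cube in the fibre by the zero
    section.\<close>
  define \<epsilon> where "\<epsilon> n = L * (norm C ^ n * real CARD('d))" for n
  have \<epsilon>0: "0 \<le> \<epsilon> n" for n using L by (simp add: \<epsilon>_def)
  have zm: "zero_fiber_obs g n \<in> borel_measurable borel" for n
  proof -
    obtain K' where "K' \<ge> 0" "\<And>x y. \<bar>zero_fiber_obs g n x - zero_fiber_obs g n y\<bar> \<le> K' * dist x y"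
      using zero_fiber_obs_lipschitz [OF L] by blast
    then have "K'-lipschitz_on UNIV (zero_fiber_obs g n)" by (intro lipschitz_onI) (auto simp: dist_real_def)
    then show ?thesis by (intro borel_measurable_continuous_onI lipschitz_on_continuous_on)
  qed
  have z0: "0 \<le> zero_fiber_obs g n x" "zero_fiber_obs g n x \<le> D" for n x using g0 gD by (simp_all add: zero_fiber_obs_def)
  have upper: "ennreal (\<integral>x. zero_fiber_obs g n x \<partial>torus_lebesgue) \<le> (\<integral>\<^sup>+z. ennreal (g z) * h n z \<partial>volume) + ennreal (\<epsilon> n)" for n
  proof -
    have pt: "ennreal (zero_fiber_obs g n x) * unit_mass y \<le> ennreal (g ((T ^^ n) (x, y))) * unit_mass y + ennreal (\<epsilon> n) * unit_mass y" for x y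
    proof (cases "y \<in> unit_cube")
      case True
      have "dist ((T ^^ n) (x, 0)) ((T ^^ n) (x, y)) = norm ((blinfun_apply C ^^ n) y)"
        by (simp add: T_pow dist_Pair_Pair linear_0 [OF linear_C_pow] dist_norm)
      also have "\<dots> \<le> norm C ^ n * real CARD('d)"
        by (rule order_trans [OF norm_C_pow]) (intro mult_left_mono norm_unit_cube True; simp)
      finally have "L * dist ((T ^^ n) (x, 0)) ((T ^^ n) (x, y)) \<le> \<epsilon> n" unfolding \<epsilon>_def using L(1) by (rule mult_left_mono)
      then have "zero_fiber_obs g n x \<le> g ((T ^^ n) (x, y)) + \<epsilon> n"
        using L(2) [of "(T ^^ n) (x, 0)" "(T ^^ n) (x, y)"] unfolding zero_fiber_obs_def by linarith
      then have "ennreal (zero_fiber_obs g n x) \<le> ennreal (g ((T ^^ n) (x, y)) + \<epsilon> n)" by (rule ennreal_leI)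
      then show ?thesis using True g0 \<epsilon>0 by (simp add: unit_mass_def ennreal_plus)
    qed (simp add: unit_mass_def)
    have "ennreal (\<integral>x. zero_fiber_obs g n x \<partial>torus_lebesgue) = (\<integral>\<^sup>+x. ennreal (zero_fiber_obs g n x) \<partial>torus_lebesgue)"
      using z0 zm by (intro nn_integral_eq_integral [symmetric] integrable_torus [where B = D]) auto
    also have "\<dots> = (\<integral>\<^sup>+x. (\<integral>\<^sup>+y. ennreal (zero_fiber_obs g n x) * unit_mass y \<partial>lborel) \<partial>torus_lebesgue)"
      by (simp add: nn_integral_cmult nn_integral_unit_mass)
    also have "\<dots> \<le> (\<integral>\<^sup>+x. (\<integral>\<^sup>+y. ennreal (g ((T ^^ n) (x, y))) * unit_mass y + ennreal (\<epsilon> n) * unit_mass y \<partial>lborel) \<partial>torus_lebesgue)"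
      by (intro nn_integral_mono pt)
    also have "\<dots> = (\<integral>\<^sup>+x. (\<integral>\<^sup>+y. ennreal (g ((T ^^ n) (x, y))) * unit_mass y \<partial>lborel) + ennreal (\<epsilon> n) \<partial>torus_lebesgue)"
      by (intro nn_integral_cong, subst nn_integral_add, measurable) (simp add: nn_integral_cmult nn_integral_unit_mass)
    also have "\<dots> = (\<integral>\<^sup>+x. (\<integral>\<^sup>+y. ennreal (g ((T ^^ n) (x, y))) * unit_mass y \<partial>lborel) \<partial>torus_lebesgue) + ennreal (\<epsilon> n)"
      by (subst nn_integral_add) simp_all
    also have "(\<integral>\<^sup>+x. (\<integral>\<^sup>+y. ennreal (g ((T ^^ n) (x, y))) * unit_mass y \<partial>lborel) \<partial>torus_lebesgue) =
      (\<integral>\<^sup>+z. ennreal (g ((T ^^ n) z)) * fiber_density unit_mass z \<partial>volume)"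
      by (subst nn_integral_volume, measurable) (simp add: fiber_density_def)
    also have "\<dots> = (\<integral>\<^sup>+z. ennreal (g z) * h n z \<partial>volume)"
      unfolding h_def by (rule transfer_op_dual [symmetric]) measurable
    finally show ?thesis .
  qed
  show ?thesis
  proof (cases "ennreal B * G = top")
    case True
    then show ?thesis by (simp add: G_def)
  next
    case False
    define s where "s = enn2real (ennreal B * G)"
    have s: "ennreal s = ennreal B * G" "0 \<le> s" using False by (simp_all add: s_def less_top)
    have CS: "(\<integral>\<^sup>+z. ennreal (g z) * h (j * q) z \<partial>volume) \<le> ennreal (sqrt s)" for j
    proof -
      let ?X = "\<integral>\<^sup>+z. ennreal (g z) * h (j * q) z \<partial>volume"
      have "?X\<^sup>2 \<le> (\<integral>\<^sup>+z. (ennreal (g z))\<^sup>2 \<partial>volume) * (\<integral>\<^sup>+z. (h (j * q) z)\<^sup>2 \<partial>volume)"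
        by (rule Cauchy_Schwarz_nn_integral) (unfold borel_pair_volume [symmetric], measurable)
      also have "\<dots> \<le> G * ennreal B"
        unfolding G_def h_def using g0 by (intro mult_mono B) (simp_all add: ennreal_power)
      also have "\<dots> = (ennreal (sqrt s))\<^sup>2" using s by (simp add: ennreal_power mult.commute)
      finally have "?X\<^sup>2 \<le> (ennreal (sqrt s))\<^sup>2" .
      then show ?thesis
      proof (cases ?X)
        case (real x)
        then have "ennreal (x\<^sup>2) \<le> ennreal ((sqrt s)\<^sup>2)" using \<open>?X\<^sup>2 \<le> (ennreal (sqrt s))\<^sup>2\<close> s(2) by (simp add: ennreal_power)
        then have "x\<^sup>2 \<le> (sqrt s)\<^sup>2" using s(2) by (subst (asm) ennreal_le_iff) auto
        then have "x \<le> sqrt s" using s(2) by (simp add: real_le_rsqrt)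
        then show ?thesis using real by (simp add: ennreal_leI)
      next
        case top
        then show ?thesis using \<open>?X\<^sup>2 \<le> (ennreal (sqrt s))\<^sup>2\<close> s(2) by (simp add: ennreal_power top_unique)
      qed
    qed
    have real_le: "(\<integral>x. zero_fiber_obs g (j * q) x \<partial>torus_lebesgue) \<le> sqrt s + \<epsilon> (j * q)" for j
    proof -
      have "ennreal (\<integral>x. zero_fiber_obs g (j * q) x \<partial>torus_lebesgue) \<le> ennreal (sqrt s) + ennreal (\<epsilon> (j * q))"
        by (rule order_trans [OF upper]) (intro add_right_mono CS)
      also have "\<dots> = ennreal (sqrt s + \<epsilon> (j * q))" using s(2) \<epsilon>0 by (simp add: ennreal_plus)
      finally show ?thesis using s(2) \<epsilon>0 by (subst (asm) ennreal_le_iff) (auto simp: add_nonneg_nonneg)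
    qed
    have sub: "filterlim (\<lambda>j. j * q) sequentially sequentially"
      using q by (intro filterlim_subseq) (auto simp: strict_mono_def)
    have l1: "(\<lambda>j. \<integral>x. zero_fiber_obs g (j * q) x \<partial>torus_lebesgue) \<longlonglongrightarrow> (\<integral>z. g z \<partial>srb)"
    proof (rule filterlim_compose [OF zero_fiber_obs_tendsto sub])
      show "continuous_on UNIV g" by (rule cont)
      show "bounded (range g)" using g0 gD unfolding bounded_iff by (intro exI [of _ D]) auto
    qed
    have "(\<lambda>n. \<epsilon> n) \<longlonglongrightarrow> L * (0 * real CARD('d))"
      unfolding \<epsilon>_def using norm_C by (intro tendsto_intros LIMSEQ_power_zero) simp
    then have "(\<lambda>j. \<epsilon> (j * q)) \<longlonglongrightarrow> 0" using filterlim_compose [OF _ sub, of \<epsilon>] by simp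
    then have l2: "(\<lambda>j. sqrt s + \<epsilon> (j * q)) \<longlonglongrightarrow> sqrt s + 0" by (intro tendsto_intros)
    have "(\<integral>z. g z \<partial>srb) \<le> sqrt s"
      using LIMSEQ_le [OF l1 l2] real_le by auto
    then have "(\<integral>z. g z \<partial>srb)\<^sup>2 \<le> (sqrt s)\<^sup>2"
      using g0 by (intro power_mono integral_nonneg_AE) auto
    then have "ennreal ((\<integral>z. g z \<partial>srb)\<^sup>2) \<le> ennreal s" using s(2) by (intro ennreal_leI) simp
    then show ?thesis using s(1) by (simp add: G_def)
  qed
qed

lemma srb_absolutely_continuous_L2:
  assumes rt: "robustly_transversal q N"
    and N: "real N < J ^ q" and q: "1 \<le> q"
  shows "absolutely_continuous phase_volume srb \<and>
    (\<integral>\<^sup>+z. (RN_deriv phase_volume srb z)\<^sup>2 \<partial>phase_volume) < \<infinity>"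
proof -
  obtain B where B: "0 \<le> B"
    "\<And>j. (\<integral>\<^sup>+z. (transfer_op (j * q) (fiber_density unit_mass) z)\<^sup>2 \<partial>volume) \<le> ennreal B"
    using iterated_L2_bound [OF rt N] by blast
  \<comment> \<open>The exhaustion that the duality argument needs: the torus is compact, so only
    the fibre is cut off.\<close>
  define W :: "nat \<Rightarrow> ('u, 'd) phase set" where "W k = UNIV \<times> ball 0 (real k)" for k
  interpret L2_dominated volume srb B W
  proof (rule L2_dominated.intro)
    show "sets volume = sets borel" by (rule sets_phase_volume)
    show "sigma_finite_measure volume"
    proof -
      interpret pair_sigma_finite "torus_lebesgue :: 'u torus measure" "lborel :: (real^'d) measure" ..
      show ?thesis unfolding phase_volume_def by (rule sigma_finite_measure_axioms)
    qed
    show "0 \<le> B" by (rule B)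
    show "ennreal ((\<integral>x. g x \<partial>srb)\<^sup>2) \<le> ennreal B * (\<integral>\<^sup>+x. ennreal ((g x)\<^sup>2) \<partial>volume)"
      if "0 \<le> L" "\<And>x y. \<bar>g x - g y\<bar> \<le> L * dist x y" "\<And>x. 0 \<le> g x" "\<And>x. g x \<le> D" for g L D
      by (rule srb_integral_le [OF B q that])
    show "open (W k)" for k by (simp add: W_def open_Times)
    show "W k \<noteq> UNIV" for k
    proof -
      obtain y :: "real^'d" where "norm y = real k + 1" using vector_choose_size [of "real k + 1"] by auto
      then have "(proj 0, y) \<notin> W k" by (simp add: W_def dist_norm)
      then show ?thesis by blast
    qed
    show "incseq W" unfolding W_def by (intro incseq_SucI) (auto intro: subset_ball)
    show "(\<Union>k. W k) = UNIV"
    proof -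
      have "z \<in> (\<Union>k. W k)" for z
      proof -
        obtain k :: nat where "norm (snd z) < real k" using reals_Archimedean2 by blast
        then have "z \<in> W k" by (cases z) (simp add: W_def)
        then show ?thesis by blast
      qed
      then show ?thesis by blast
    qed
    show "emeasure volume (W k) < \<infinity>" for k
    proof -
      have "emeasure volume (W k) = emeasure torus_lebesgue (UNIV :: 'u torus set) * emeasure lborel (ball (0 :: real^'d) (real k))"
        unfolding W_def phase_volume_def by (rule lborel.emeasure_pair_measure_Times) auto
      then show ?thesis using emeasure_bounded_finite [of "ball (0 :: real^'d) (real k)"] by simp
    qed
  qed (simp_all add: prob_space_srb)
  show ?thesis
    using absolutely_continuous nn_integral_RN_deriv_square by (auto intro: order_le_less_trans)
qed

end

section \<open>Markov partitions and nontransversal preimages\<close>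

lemma emeasure_torus_open_pos:
  fixes U :: "'u::finite torus set"
  assumes "open U" "U \<noteq> {}"
  shows "emeasure torus_lebesgue U \<noteq> 0"
proof -
  obtain x where x: "x \<in> U" using assms(2) by blast
  define v where "v = cube_rep x"
  have v: "v \<in> unit_cube" "proj v \<in> U" using x by (simp_all add: v_def)
  have "open (proj -` U :: (real^'u) set)" by (rule open_vimage [OF assms(1) continuous_on_proj])
  then obtain e where e: "e > 0" "ball v e \<subseteq> proj -` U" using v(2) open_contains_ball by blast
  \<comment> \<open>A small box in the positive direction from \<open>v\<close> stays in the
    half-open cube and in the ball.\<close>
  define t where "t = min (e / real CARD('u)) (Min (range (\<lambda>i. 1 - v $ i)))"
  have t: "0 < t"
    using e(1) v(1) by (auto simp: t_def unit_cube_def)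
  have t_le: "t \<le> 1 - v $ i" for i by (auto simp: t_def intro: min.coboundedI2)
  let ?b = "\<chi> i. v $ i + t"
  have sub: "box v ?b \<subseteq> unit_cube \<inter> ball v e"
  proof
    fix w assume w: "w \<in> box v ?b"
    then have wi: "v $ i < w $ i" "w $ i < v $ i + t" for i by (simp_all add: mem_box_cart)
    have "w \<in> unit_cube"
      unfolding unit_cube_def
    proof (safe)
      fix i
      have "0 \<le> v $ i" using v(1) by (simp add: unit_cube_def)
      then show "0 \<le> w $ i" "w $ i < 1" using wi [of i] t_le [of i] by linarith+
    qed
    moreover have "norm (v - w) < e"
    proof -
      have "norm (v - w) \<le> (\<Sum>i\<in>UNIV. \<bar>(v - w) $ i\<bar>)" by (rule norm_le_l1_cart)
      also have "\<dots> < (\<Sum>i\<in>(UNIV :: 'u set). t)"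
      proof (intro sum_strict_mono)
        show "\<bar>(v - w) $ i\<bar> < t" for i using wi [of i] by simp
      qed auto
      also have "\<dots> \<le> e"
      proof -
        have "t \<le> e / real CARD('u)" by (simp add: t_def)
        then show ?thesis by (simp add: pos_le_divide_eq mult.commute)
      qed
      finally show ?thesis .
    qed
    ultimately show "w \<in> unit_cube \<inter> ball v e" by (simp add: dist_norm)
  qed
  have "0 < emeasure lborel (box v ?b)"
  proof -
    have "emeasure lborel (box v ?b) = ennreal (\<Prod>b\<in>Basis. (?b - v) \<bullet> b)"
      using t by (intro emeasure_lborel_box) (auto simp: Basis_vec_def inner_axis)
    moreover have "0 < (\<Prod>b\<in>Basis. (?b - v) \<bullet> b)"
      using t by (intro prod_pos) (auto simp: Basis_vec_def inner_axis)
    ultimately show ?thesis by simp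
  qed
  also have "\<dots> = (\<integral>\<^sup>+w. indicator (box v ?b) w \<partial>lborel)" by simp
  also have "\<dots> \<le> (\<integral>\<^sup>+w. indicator unit_cube w * indicator U (proj w) \<partial>lborel)"
    using sub e(2) by (intro nn_integral_mono) (auto simp: indicator_def)
  also have "\<dots> = (\<integral>\<^sup>+x. indicator U x \<partial>torus_lebesgue)"
    using assms(1) by (intro nn_integral_torus [symmetric] borel_measurable_indicator) auto
  also have "\<dots> = emeasure torus_lebesgue U" using assms(1) by (intro nn_integral_indicator) auto
  finally show ?thesis by simp
qed

text \<open>The dimension hypothesis makes the supremum range over a nonempty set; the strict
  inequality then selects a subspace. By homogeneity the infimum over its unit sphere bounds all
  its vectors.\<close>

lemma max_conorm_imp_conorm_ge:
  fixes A :: "(real^'u::finite) \<Rightarrow>\<^sub>L (real^'d::finite)"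
  assumes d: "CARD('d) \<le> CARD('u)" and c: "c < max_conorm A"
  shows "\<exists>c'>c. conorm_ge A c'"
proof -
  let ?S = "{W :: (real^'u) set. subspace W \<and> dim W = CARD('d)}"
  let ?f = "\<lambda>W. INF v\<in>{v \<in> W. norm v = 1}. norm (blinfun_apply A v)"
  have unit: "\<exists>v\<in>W. norm v = 1" if "W \<in> ?S" for W :: "(real^'u) set"
  proof -
    have "dim W \<noteq> 0" using that by simp
    then have "\<not> W \<subseteq> {0}" by (simp add: dim_eq_0)
    then obtain w where w: "w \<in> W" "w \<noteq> 0" by blast
    then have "(1 / norm w) *\<^sub>R w \<in> W" using that by (simp add: subspace_scale)
    then show ?thesis using w(2) by (intro bexI [of _ "(1 / norm w) *\<^sub>R w"]) auto
  qed
  have bb: "bdd_below ((\<lambda>v. norm (blinfun_apply A v)) ` {v \<in> W. norm v = 1})" for W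
    by (rule bdd_belowI2 [of _ 0]) simp
  have "?S \<noteq> {}"
    using choose_subspace_of_subspace [of "CARD('d)" "UNIV :: (real^'u) set"] d by auto
  moreover have "bdd_above (?f ` ?S)"
  proof (rule bdd_aboveI2 [of _ _ "norm A"])
    fix W assume "W \<in> ?S"
    then obtain v where v: "v \<in> W" "norm v = 1" using unit by blast
    have "?f W \<le> norm (blinfun_apply A v)" using v by (intro cINF_lower bb) simp
    also have "\<dots> \<le> norm A" using norm_blinfun [of A v] v by simp
    finally show "?f W \<le> norm A" .
  qed
  ultimately obtain W where W: "W \<in> ?S" "c < ?f W"
    using c unfolding max_conorm_def by (subst (asm) less_cSUP_iff) auto
  have "?f W * norm v \<le> norm (blinfun_apply A v)" if v: "v \<in> W" for v
  proof (cases "v = 0")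
    case False
    have "(1 / norm v) *\<^sub>R v \<in> W" using W(1) v by (simp add: subspace_scale)
    then have "?f W \<le> norm (blinfun_apply A ((1 / norm v) *\<^sub>R v))"
      using False by (intro cINF_lower bb) simp
    also have "\<dots> = norm (blinfun_apply A v) / norm v" by (simp add: blinfun.scaleR_right)
    finally show ?thesis using False by (simp add: pos_le_divide_eq)
  qed simp
  then have "conorm_ge A (?f W)" unfolding conorm_ge_def using W(1) by blast
  then show ?thesis using W(2) by blast
qed

locale markov_endo = torus_endo E for E :: "('u::finite) lin" +
  fixes \<gamma> :: real and r :: nat and R :: "nat \<Rightarrow> 'u torus set"
  assumes markov: "markov_partition E \<gamma> r R"
begin

definition cells :: "'u torus set" where "cells = (\<Union>i\<in>{1..r}. R i)"

lemma open_R: "i \<in> {1..r} \<Longrightarrow> open (R i)"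
  and inj_R: "i \<in> {1..r} \<Longrightarrow> inj_on (torus_map E) (R i)"
  and cover_R: "\<exists>i\<in>{1..r}. x \<in> closure (R i)"
  and markov_R: "i \<in> {1..r} \<Longrightarrow> j \<in> {1..r} \<Longrightarrow> y \<in> R i \<Longrightarrow> torus_map E y \<in> R j \<Longrightarrow> R j \<subseteq> torus_map E ` R i"
proof -
  show "i \<in> {1..r} \<Longrightarrow> open (R i)" "i \<in> {1..r} \<Longrightarrow> inj_on (torus_map E) (R i)"
    using markov by (simp_all add: markov_partition_def)
  show "\<exists>i\<in>{1..r}. x \<in> closure (R i)"
    using markov unfolding markov_partition_def by blast
  show "i \<in> {1..r} \<Longrightarrow> j \<in> {1..r} \<Longrightarrow> y \<in> R i \<Longrightarrow> torus_map E y \<in> R j \<Longrightarrow> R j \<subseteq> torus_map E ` R i"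
    using markov unfolding markov_partition_def by blast
qed

text \<open>The inverse branches contract, so the image of a ball contains the ball of the same
  radius.\<close>

lemma ball_subset_image: "ball (torus_map E x) \<delta> \<subseteq> torus_map E ` ball x \<delta>"
proof
  fix y assume y: "y \<in> ball (torus_map E x) \<delta>"
  obtain t where t: "y = tadd (torus_map E x) t" "norm t = dist (torus_map E x) y" by (rule torus_lift)
  have "dist x (tadd x (Ei t)) \<le> norm (Ei t)" by (rule dist_tadd_le)
  also have "\<dots> \<le> 1 * norm t" using norm_Ei [of t] lam_less_1 mult_right_mono [of lam 1 "norm t"] by simp
  finally have "tadd x (Ei t) \<in> ball x \<delta>" using y t by simp
  moreover have "torus_map E (tadd x (Ei t)) = y" by (simp add: torus_map_tadd t)
  ultimately show "y \<in> torus_map E ` ball x \<delta>" by blast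
qed

text \<open>Let \<open>x\<close> be a point of the closure of \<open>R i\<close> outside all cells
  and suppose that its image is in \<open>R j\<close>. By the Markov property \<open>R j\<close>
  is covered by the image of \<open>R i\<close>, so the image of \<open>x\<close> has another
  preimage \<open>x'\<close> inside \<open>R i\<close>. Points of \<open>R i\<close> near
  \<open>x\<close> and points near \<open>x'\<close> then have common images, which contradicts
  injectivity on \<open>R i\<close>.\<close>

lemma boundary_invariant:
  assumes "x \<notin> cells"
  shows "torus_map E x \<notin> cells"
proof
  assume "torus_map E x \<in> cells"
  then obtain j where j: "j \<in> {1..r}" "torus_map E x \<in> R j" by (auto simp: cells_def)
  obtain i where i: "i \<in> {1..r}" "x \<in> closure (R i)" using cover_R by blast
  have meets: "\<exists>z\<in>R i. z \<in> V" if "open V" "x \<in> V" for V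
    using i(2) that by (meson closure_iff_nhds_not_empty disjoint_iff order_refl)
  have "open (torus_map E -` R j)" by (rule open_vimage [OF open_R [OF j(1)] continuous_torus_map])
  then obtain y where "y \<in> R i" "torus_map E y \<in> R j" using meets [of "torus_map E -` R j"] j(2) by auto
  then have "R j \<subseteq> torus_map E ` R i" using markov_R i(1) j(1) by blast
  then obtain x' where x': "x' \<in> R i" "torus_map E x' = torus_map E x" using j(2) by auto
  have "x \<noteq> x'" using x'(1) i(1) assms by (auto simp: cells_def)
  obtain e where e: "e > 0" "ball x' e \<subseteq> R i" using open_R [OF i(1)] x'(1) open_contains_ball by blast
  define \<delta> where "\<delta> = min e (dist x x' / 2)"
  have \<delta>: "0 < \<delta>" using e \<open>x \<noteq> x'\<close> by (simp add: \<delta>_def)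
  have "open (ball x \<delta> \<inter> torus_map E -` ball (torus_map E x) \<delta>)"
    by (intro open_Int open_ball open_vimage continuous_torus_map)
  \<comment> \<open>Some \<open>z \<in> R i\<close> near \<open>x\<close> has an image near that
    of \<open>x\<close>, which is the image of \<open>x'\<close>. That image is also taken at a
    point \<open>z'\<close> near \<open>x'\<close>.\<close>
  then obtain z where z: "z \<in> R i" "z \<in> ball x \<delta>" "torus_map E z \<in> ball (torus_map E x') \<delta>"
    using meets [of "ball x \<delta> \<inter> torus_map E -` ball (torus_map E x) \<delta>"] \<delta> x'(2) by auto
  then obtain z' where z': "z' \<in> ball x' \<delta>" "torus_map E z' = torus_map E z" using ball_subset_image by fastforce
  have "z' \<in> R i" using z'(1) e(2) by (auto simp: \<delta>_def)
  then have "z' = z" using inj_R [OF i(1)] z(1) z'(2) by (auto dest: inj_onD)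
  then have "dist x x' < \<delta> + \<delta>" using z(2) z'(1) dist_triangle_less_add [of x z \<delta> x' \<delta>] by (simp add: dist_commute)
  then show False by (simp add: \<delta>_def min_def split: if_splits)
qed

text \<open>The boundaries of the cells may a priori have positive measure. However, a point
  outside the cells never enters them, so along its orbit the averages of the distance to the
  complement of the cells vanish. For almost every point these averages tend to the mean of the
  distance, which is positive because the cells are open.\<close>

lemma AE_in_cells: "AE x in torus_lebesgue. x \<in> cells"
proof (cases "cells = UNIV")
  case False
  define N where "N = - cells"
  define g where "g x = min 1 (infdist x N)" for x
  have op: "open cells" unfolding cells_def using open_R by blast
  have N: "closed N" "N \<noteq> {}" using op False by (auto simp: N_def)
  have L: "\<bar>g x - g y\<bar> \<le> 1 * dist x y" for x y
  proof -
    have "\<bar>infdist x N - infdist y N\<bar> \<le> dist x y" by (rule infdist_triangle_abs)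
    then show ?thesis unfolding g_def by linarith
  qed
  have gm: "g \<in> borel_measurable borel"
    unfolding g_def by (intro borel_measurable_continuous_onI continuous_intros)
  have g01: "0 \<le> g x" "g x \<le> 1" for x by (simp_all add: g_def infdist_nonneg)
  have g0: "g x = 0 \<longleftrightarrow> x \<in> N" for x
    using in_closed_iff_infdist_zero [OF N, of x] infdist_nonneg [of x N] by (auto simp: g_def min_def)
  have "cells \<noteq> {}"
  proof -
    obtain i where "i \<in> {1..r}" "proj 0 \<in> closure (R i)" using cover_R by blast
    then have "R i \<noteq> {}" by (metis closure_empty empty_iff)
    then show ?thesis using \<open>i \<in> {1..r}\<close> unfolding cells_def by blast
  qed
  have pos: "(\<integral>x. g x \<partial>torus_lebesgue) \<noteq> 0"
  proof
    assume "(\<integral>x. g x \<partial>torus_lebesgue) = 0"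
    then have "AE x in torus_lebesgue. g x = 0"
      using g01 by (subst (asm) integral_nonneg_eq_0_iff_AE) (auto intro!: integrable_torus [where B = 1] gm)
    then have "AE x in torus_lebesgue. x \<notin> cells" by (simp add: g0 N_def)
    then have "emeasure torus_lebesgue cells = 0"
      using op by (subst (asm) AE_iff_measurable [of cells]) auto
    then show False using emeasure_torus_open_pos [OF op \<open>cells \<noteq> {}\<close>] by simp
  qed
  have "AE x in torus_lebesgue. (\<lambda>n. (\<Sum>k<n. g ((torus_map E ^^ k) x)) / real n) \<longlonglongrightarrow> (\<integral>x. g x \<partial>torus_lebesgue)"
    by (rule birkhoff_lipschitz [OF zero_le_one L])
  then show ?thesis
  proof eventually_elim
    fix x assume lim: "(\<lambda>n. (\<Sum>k<n. g ((torus_map E ^^ k) x)) / real n) \<longlonglongrightarrow> (\<integral>x. g x \<partial>torus_lebesgue)"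
    show "x \<in> cells"
    proof (rule ccontr)
      assume x: "x \<notin> cells"
      have "(torus_map E ^^ k) x \<notin> cells" for k
        by (induction k) (auto simp: x boundary_invariant)
      then have "g ((torus_map E ^^ k) x) = 0" for k by (simp add: g0 N_def)
      then have "(\<lambda>n. 0 :: real) \<longlonglongrightarrow> (\<integral>x. g x \<partial>torus_lebesgue)" using lim by simp
      then show False using pos by (simp add: LIMSEQ_const_iff)
    qed
  qed
qed simp

lemma AE_orbit_in_cells: "AE x in torus_lebesgue. \<forall>i. (torus_map E ^^ i) x \<in> cells"
proof -
  have "AE x in torus_lebesgue. (torus_map E ^^ i) x \<in> cells" for i
  proof (induction i)
    case 0
    show ?case using AE_in_cells by simp
  next
    case (Suc i)
    then have "AE x in distr torus_lebesgue borel (torus_map E). (torus_map E ^^ i) x \<in> cells" by (subst distr_torus_map)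
    then have "AE x in torus_lebesgue. (torus_map E ^^ i) (torus_map E x) \<in> cells"
      by (rule AE_distrD [rotated]) simp
    then show ?case by (simp only: funpow_Suc_right o_apply)
  qed
  then show ?thesis by (simp add: AE_all_countable)
qed

lemma past_in_cells:
  assumes "(torus_map E ^^ n) a \<in> cells" "j \<le> n"
  shows "(torus_map E ^^ j) a \<in> cells"
proof (rule ccontr)
  assume nj: "(torus_map E ^^ j) a \<notin> cells"
  have "(torus_map E ^^ k) ((torus_map E ^^ j) a) \<notin> cells" for k
    by (induction k) (auto simp: nj boundary_invariant)
  moreover have "(torus_map E ^^ (n - j)) ((torus_map E ^^ j) a) = (torus_map E ^^ n) a"
    using assms(2) by (metis comp_apply funpow_add le_add_diff_inverse2)
  ultimately show False using assms(1) by metis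
qed

definition cell_index :: "'u torus \<Rightarrow> nat" where
  "cell_index x = (SOME i. i \<in> {1..r} \<and> x \<in> R i)"

lemma cell_index: "x \<in> cells \<Longrightarrow> cell_index x \<in> {1..r}" "x \<in> cells \<Longrightarrow> x \<in> R (cell_index x)"
proof -
  assume "x \<in> cells"
  then have "\<exists>i. i \<in> {1..r} \<and> x \<in> R i" by (auto simp: cells_def)
  from someI_ex [OF this] show "cell_index x \<in> {1..r}" "x \<in> R (cell_index x)" by (simp_all add: cell_index_def)
qed

text \<open>The words list the cells backwards in time: the last letter is the cell of
  \<open>x\<close> itself and the first letter that of its image under \<open>n - 1\<close> steps.\<close>

definition itinerary :: "nat \<Rightarrow> 'u torus \<Rightarrow> nat list" where
  "itinerary n x = map (\<lambda>k. cell_index ((torus_map E ^^ (n - 1 - k)) x)) [0..<n]"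

lemma length_itinerary [simp]: "length (itinerary n x) = n"
  by (simp add: itinerary_def)

lemma nth_itinerary: "k < n \<Longrightarrow> itinerary n x ! k = cell_index ((torus_map E ^^ (n - 1 - k)) x)"
  by (simp add: itinerary_def)

lemma in_cylinder_itinerary:
  assumes "\<And>i. i < n \<Longrightarrow> (torus_map E ^^ i) x \<in> cells"
  shows "x \<in> cylinder E R (itinerary n x)"
  unfolding cylinder_def using assms cell_index(2) by (auto simp: nth_itinerary)

lemma itinerary_in_words:
  assumes c: "\<And>i. i < n \<Longrightarrow> (torus_map E ^^ i) x \<in> cells"
  shows "itinerary n x \<in> words E r R n"
proof -
  have "set (itinerary n x) \<subseteq> {1..r}"
    using c cell_index(1) by (auto simp: itinerary_def)
  moreover have "torus_map E ` R (itinerary n x ! (i + 1)) \<inter> R (itinerary n x ! i) \<noteq> {}" if i: "i + 1 < n" for i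
  proof -
    let ?y = "(torus_map E ^^ (n - 1 - (i + 1))) x"
    have "?y \<in> R (itinerary n x ! (i + 1))" using i c by (simp add: nth_itinerary cell_index(2))
    moreover have "torus_map E ?y = (torus_map E ^^ (n - 1 - i)) x"
    proof -
      have "n - 1 - i = Suc (n - 1 - (i + 1))" using i by simp
      then show ?thesis by simp
    qed
    moreover have "(torus_map E ^^ (n - 1 - i)) x \<in> R (itinerary n x ! i)" using i c by (simp add: nth_itinerary cell_index(2))
    ultimately show ?thesis by (metis disjoint_iff image_eqI)
  qed
  ultimately show ?thesis by (simp add: words_def)
qed

lemma open_cylinder:
  assumes "set w \<subseteq> {1..r}"
  shows "open (cylinder E R w)"
  unfolding cylinder_def
proof (intro open_INT finite_lessThan ballI)
  fix i assume "i \<in> {..<length w}"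
  then have "w ! (length w - i - 1) \<in> {1..r}" using assms nth_mem [of "length w - i - 1" w] by force
  moreover have "continuous_on UNIV (torus_map E ^^ i)"
  proof (induction i)
    case (Suc i)
    then show ?case using continuous_on_compose [OF Suc continuous_on_subset [OF continuous_torus_map]] by simp
  qed (simp add: id_def)
  ultimately show "open ((torus_map E ^^ i) -` R (w ! (length w - i - 1)))"
    by (intro open_vimage open_R)
qed

text \<open>Injectivity on the cells determines the orbit step by step backwards from its end
  point.\<close>

lemma cylinder_unique:
  assumes w: "set w \<subseteq> {1..r}" and y: "y \<in> cylinder E R w" "y' \<in> cylinder E R w"
    and eq: "(torus_map E ^^ length w) y = (torus_map E ^^ length w) y'"
  shows "y = y'"
proof -
  have "(torus_map E ^^ (length w - k)) y = (torus_map E ^^ (length w - k)) y'" if "k \<le> length w" for k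
    using that
  proof (induction k)
    case (Suc k)
    define i where "i = length w - Suc k"
    have i: "i < length w" "length w - k = Suc i" using Suc.prems by (auto simp: i_def)
    have "torus_map E ((torus_map E ^^ i) y) = torus_map E ((torus_map E ^^ i) y')"
      using Suc.IH Suc.prems i(2) by simp
    moreover have "(torus_map E ^^ i) y \<in> R (w ! (length w - i - 1))" "(torus_map E ^^ i) y' \<in> R (w ! (length w - i - 1))"
      using y i(1) by (auto simp: cylinder_def)
    moreover have "w ! (length w - i - 1) \<in> {1..r}" using w i(1) nth_mem [of "length w - i - 1" w] by force
    ultimately show ?case using inj_R by (auto simp: i_def dest: inj_onD)
  qed (simp add: eq)
  from this [of "length w"] show ?thesis by simp
qed

lemma preimage_point_take:
  assumes w: "set w \<subseteq> {1..r}" and y: "y \<in> cylinder E R w" and i: "i \<le> length w"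
  shows "preimage_point E R (take i w) ((torus_map E ^^ length w) y) = (torus_map E ^^ (length w - i)) y"
  unfolding preimage_point_def
proof (rule the_equality)
  have pow: "(torus_map E ^^ j) ((torus_map E ^^ k) z) = (torus_map E ^^ (j + k)) z" for j k z
    by (simp add: funpow_add)
  have mem: "(torus_map E ^^ (length w - i)) y \<in> cylinder E R (take i w)"
  proof -
    have "(torus_map E ^^ (j + (length w - i))) y \<in> R (w ! (i - j - 1))" if j: "j < i" for j
    proof -
      have "j + (length w - i) \<in> {..<length w}" using i j by auto
      then have "(torus_map E ^^ (j + (length w - i))) y \<in> R (w ! (length w - (j + (length w - i)) - 1))"
        using y by (auto simp: cylinder_def)
      also have "length w - (j + (length w - i)) - 1 = i - j - 1" using i j by simp
      finally show ?thesis .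
    qed
    then show ?thesis using i by (simp add: cylinder_def pow min_absorb2)
  qed
  have img: "(torus_map E ^^ length (take i w)) ((torus_map E ^^ (length w - i)) y) = (torus_map E ^^ length w) y"
    using i by (simp add: pow min_absorb2)
  show "(torus_map E ^^ (length w - i)) y \<in> cylinder E R (take i w) \<and>
    (torus_map E ^^ length (take i w)) ((torus_map E ^^ (length w - i)) y) = (torus_map E ^^ length w) y"
    using mem img by blast
  have wt: "set (take i w) \<subseteq> {1..r}" by (rule subset_trans [OF set_take_subset w])
  fix z assume "z \<in> cylinder E R (take i w) \<and> (torus_map E ^^ length (take i w)) z = (torus_map E ^^ length w) y"
  then show "z = (torus_map E ^^ (length w - i)) y"
    using cylinder_unique [OF wt _ mem] img by metis
qed

lemma finite_words: "finite (words E r R n)"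
proof (rule finite_subset)
  show "words E r R n \<subseteq> {w. set w \<subseteq> {1..r} \<and> length w = n}" by (auto simp: words_def)
qed (rule finite_lists_length_eq, simp)

text \<open>The infimum of a set of natural numbers is attained, and over finite sets of words the
  suprema are upper bounds.\<close>

lemma tau_witness:
  "\<exists>p\<ge>1. \<forall>c\<in>words E r R p. \<forall>a\<in>words_over E r R q c.
    card {b \<in> words_over E r R q c. \<not> transversal E C f R q c a b} \<le> tau E C f r R q"
proof -
  let ?G = "\<lambda>c a. card {b \<in> words_over E r R q c. \<not> transversal E C f R q c a b}"
  let ?H = "\<lambda>p. SUP c\<in>words E r R p. SUP a\<in>words_over E r R q c. ?G c a"
  have "tau E C f r R q \<in> ?H ` {1..}" unfolding tau_def by (rule Inf_nat_def1) auto
  then obtain p where p: "1 \<le> p" "tau E C f r R q = ?H p" by auto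
  show ?thesis
  proof (intro exI [of _ p] conjI ballI p(1))
    fix c a assume c: "c \<in> words E r R p" and a: "a \<in> words_over E r R q c"
    have fin: "finite (words_over E r R q c)" for c
      by (rule finite_subset [OF _ finite_words [of q]]) (auto simp: words_over_def)
    have "?G c a \<le> (SUP a\<in>words_over E r R q c. ?G c a)"
      using a by (intro cSUP_upper bdd_above_finite finite_imageI fin)
    also have "\<dots> \<le> ?H p"
      using c by (intro cSUP_upper bdd_above_finite finite_imageI finite_words)
    finally show "?G c a \<le> tau E C f r R q" by (simp add: p(2))
  qed
qed

end

locale markov_skew = markov_endo E \<gamma> r R + skew E C f
  for E :: "('u::finite) lin" and \<gamma> :: real and r :: nat and R :: "nat \<Rightarrow> 'u torus set"
    and C :: "('d::finite) lin" and f :: "'u torus \<Rightarrow> real^'d"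
begin

lemma S_sum_eq_fiber_sum:
  assumes "set w \<subseteq> {1..r}" "y \<in> cylinder E R w"
  shows "S_sum E C f R w ((torus_map E ^^ length w) y) = fiber_sum (length w) y"
  unfolding S_sum_def fiber_sum_def
  by (rule sum.cong [OF refl]) (simp add: preimage_point_take [OF assms])

text \<open>On the open cylinder the extension coincides with the sum along the word, which is the
  fibre sum along the local inverse branch through \<open>a\<close>. Hence it has the same
  derivative.\<close>

lemma extension_deriv:
  assumes ext: "C2_extension (cylinder E R c) (S_sum E C f R w) F"
    and c: "set c \<subseteq> {1..r}" "x \<in> cylinder E R c"
    and w: "set w \<subseteq> {1..r}" "a \<in> cylinder E R w" "(torus_map E ^^ length w) a = x"
  shows "torus_deriv F x = fiber_deriv (length w) a"
proof (rule torus_deriv_eq, unfold has_torus_derivative_def, intro allI impI)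
  fix v :: "real^'u" assume v: "proj v = x"
  let ?q = "length w"
  let ?y = "\<lambda>v'. tadd a ((Ei ^^ ?q) (v' - v))"
  have "((\<lambda>v'. fiber_sum ?q (?y v')) has_derivative blinfun_apply (fiber_deriv ?q (?y v))) (at v)"
    by (rule fiber_sum_has_derivative)
  moreover have "?y v = a" by (simp add: linear_0 [OF linear_Ei_pow])
  ultimately have der: "((\<lambda>v'. fiber_sum ?q (?y v')) has_derivative blinfun_apply (fiber_deriv ?q a)) (at v)" by simp
  have lin: "continuous_on UNIV (Ei ^^ ?q)"
    using linear_Ei_pow by (simp add: linear_continuous_on linear_conv_bounded_linear)
  have cont: "continuous_on UNIV ?y"
    unfolding tadd_def by (intro continuous_on_compose2 [OF continuous_on_proj [of UNIV]] continuous_intros continuous_on_compose2 [OF lin]) auto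
  have "open (?y -` cylinder E R w \<inter> proj -` cylinder E R c)"
    by (intro open_Int open_vimage open_cylinder w(1) c(1) cont continuous_on_proj)
  moreover have "v \<in> ?y -` cylinder E R w \<inter> proj -` cylinder E R c"
    using \<open>?y v = a\<close> w(2) c(2) v by simp
  moreover have "fiber_sum ?q (?y v') = F (proj v')" if "v' \<in> ?y -` cylinder E R w \<inter> proj -` cylinder E R c" for v'
  proof -
    have "(torus_map E ^^ ?q) (?y v') = proj v'"
      unfolding torus_map_pow_tadd w(3) v [symmetric] by simp
    then have "S_sum E C f R w (proj v') = fiber_sum ?q (?y v')"
      using S_sum_eq_fiber_sum [OF w(1), of "?y v'"] that by simp
    then show ?thesis using ext that by (simp add: C2_extension_def)
  qed
  ultimately show "((\<lambda>v'. F (proj v')) has_derivative blinfun_apply (fiber_deriv ?q a)) (at v)"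
    by (rule has_derivative_transform_within_open [OF der])
qed

lemma transversal_imp_conorm_ge:
  assumes d: "CARD('d) \<le> CARD('u)"
    and tr: "transversal E C f R q c w w'"
    and c: "set c \<subseteq> {1..r}" "x \<in> cylinder E R c"
    and w: "set w \<subseteq> {1..r}" "length w = q" "a \<in> cylinder E R w" "(torus_map E ^^ q) a = x"
    and w': "set w' \<subseteq> {1..r}" "length w' = q" "b \<in> cylinder E R w'" "(torus_map E ^^ q) b = x"
  shows "\<exists>c1 > 3 * theta E C ^ q * alpha0 C f. conorm_ge (fiber_deriv q a - fiber_deriv q b) c1"
proof -
  obtain F G where F: "C2_extension (cylinder E R c) (S_sum E C f R w) F"
    and G: "C2_extension (cylinder E R c) (S_sum E C f R w') G"
    and big: "\<forall>x\<in>closure (cylinder E R c). \<forall>y\<in>closure (cylinder E R c).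
               max_conorm (torus_deriv F x - torus_deriv G y) > 3 * theta E C ^ q * alpha0 C f"
    using tr unfolding transversal_def by blast
  have "x \<in> closure (cylinder E R c)" using c(2) closure_subset by blast
  then have "max_conorm (torus_deriv F x - torus_deriv G x) > 3 * theta E C ^ q * alpha0 C f" using big by blast
  then show ?thesis
    using max_conorm_imp_conorm_ge [OF d] extension_deriv [OF F c w(1,3)] extension_deriv [OF G c w'(1,3)] w w' by simp
qed

text \<open>Let all iterates of \<open>x\<close> lie in cells. Then so do the iterates of its
  preimages up to order \<open>q\<close>. The itinerary map from preimages to words over the
  cylinder of \<open>x\<close> is injective, and it sends preimages that fail to be transversal at
  \<open>x\<close> to words that fail to be transversal.\<close>

lemma AE_nontransversal_preimages:
  assumes d: "CARD('d) \<le> CARD('u)"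
  shows "AE x in torus_lebesgue. \<forall>a\<in>preimages q x.
    card {b \<in> preimages q x. \<not> (\<exists>c1 > 3 * theta E C ^ q * alpha0 C f. conorm_ge (fiber_deriv q a - fiber_deriv q b) c1)}
      \<le> tau E C f r R q"
proof -
  obtain p where p: "1 \<le> p" "\<And>c a. c \<in> words E r R p \<Longrightarrow> a \<in> words_over E r R q c \<Longrightarrow>
    card {b \<in> words_over E r R q c. \<not> transversal E C f R q c a b} \<le> tau E C f r R q"
    using tau_witness [of q C f] by blast
  show ?thesis
    using AE_orbit_in_cells
  proof eventually_elim
    fix x assume x: "\<forall>i. (torus_map E ^^ i) x \<in> cells"
    show "\<forall>a\<in>preimages q x.
      card {b \<in> preimages q x. \<not> (\<exists>c1 > 3 * theta E C ^ q * alpha0 C f. conorm_ge (fiber_deriv q a - fiber_deriv q b) c1)} \<le> tau E C f r R q"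
    proof
      fix a assume a: "a \<in> preimages q x"
      define c where "c = itinerary p x"
      have c: "c \<in> words E r R p" "x \<in> cylinder E R c"
        unfolding c_def using x by (auto intro!: itinerary_in_words in_cylinder_itinerary)
      have c_set: "set c \<subseteq> {1..r}" using c(1) by (simp add: words_def)
      have pre: "itinerary q b \<in> words_over E r R q c" "b \<in> cylinder E R (itinerary q b)" "set (itinerary q b) \<subseteq> {1..r}" "(torus_map E ^^ q) b = x"
        if b: "b \<in> preimages q x" for b
      proof -
        show bx: "(torus_map E ^^ q) b = x" using b by (simp add: preimages_def)
        have "x \<in> cells" using x [rule_format, of 0] by simp
        then have orb: "(torus_map E ^^ i) b \<in> cells" if "i < q" for i
          using past_in_cells [of q b i] bx that by simp
        then have bw: "itinerary q b \<in> words E r R q" by (rule itinerary_in_words)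
        then show "set (itinerary q b) \<subseteq> {1..r}" by (simp add: words_def)
        show bc: "b \<in> cylinder E R (itinerary q b)" using orb by (rule in_cylinder_itinerary)
        have "x \<in> (torus_map E ^^ q) ` cylinder E R (itinerary q b)" using bx bc by blast
        then show "itinerary q b \<in> words_over E r R q c" using bw c(2) by (auto simp: words_over_def)
      qed
      have inj: "inj_on (itinerary q) (preimages q x)"
      proof (rule inj_onI)
        fix b b' assume b: "b \<in> preimages q x" "b' \<in> preimages q x" "itinerary q b = itinerary q b'"
        show "b = b'"
          using cylinder_unique [OF pre(3) [OF b(1)] pre(2) [OF b(1)], of b'] pre(2) [OF b(2)] pre(4) [OF b(1)] pre(4) [OF b(2)] b(3) by simp
      qed
      let ?A = "{b \<in> preimages q x. \<not> (\<exists>c1 > 3 * theta E C ^ q * alpha0 C f. conorm_ge (fiber_deriv q a - fiber_deriv q b) c1)}"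
      let ?B = "{b \<in> words_over E r R q c. \<not> transversal E C f R q c (itinerary q a) b}"
      have "card ?A \<le> card ?B"
      proof (rule card_inj_on_le)
        show "inj_on (itinerary q) ?A" using inj by (rule inj_on_subset) auto
        show "itinerary q ` ?A \<subseteq> ?B"
        proof
          fix w assume "w \<in> itinerary q ` ?A"
          then obtain b where b: "b \<in> ?A" "w = itinerary q b" by blast
          then have bp: "b \<in> preimages q x" by simp
          have "\<not> transversal E C f R q c (itinerary q a) (itinerary q b)"
            using b(1) transversal_imp_conorm_ge [OF d _ c_set c(2) pre(3) [OF a] length_itinerary pre(2) [OF a] pre(4) [OF a]
              pre(3) [OF bp] length_itinerary pre(2) [OF bp] pre(4) [OF bp]] by blast
          then show "w \<in> ?B" using pre(1) [OF bp] b(2) by simp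
        qed
        show "finite ?B" by (rule finite_subset [OF _ finite_words [of q]]) (auto simp: words_over_def)
      qed
      also have "\<dots> \<le> tau E C f r R q" by (rule p(2) [OF c(1) pre(1) [OF a]])
      finally show "card ?A \<le> tau E C f r R q" .
    qed
  qed
qed

end

section \<open>Stability under perturbation\<close>

lemma C1_map_diff:
  assumes "C1_map f" "C1_map g"
  shows "C1_map (\<lambda>x. f x - g x)" "torus_deriv (\<lambda>x. f x - g x) x = torus_deriv f x - torus_deriv g x"
proof -
  have h: "has_torus_derivative (\<lambda>x. f x - g x) (torus_deriv f x - torus_deriv g x) x" for x
    unfolding has_torus_derivative_def minus_blinfun.rep_eq
    using C1_map_lift [OF assms(1)] C1_map_lift [OF assms(2)] by (auto intro!: has_derivative_diff)
  then have eq: "torus_deriv (\<lambda>x. f x - g x) x = torus_deriv f x - torus_deriv g x" for x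
    by (rule torus_deriv_eq)
  show "torus_deriv (\<lambda>x. f x - g x) x = torus_deriv f x - torus_deriv g x" by (rule eq)
  have "continuous_on UNIV (\<lambda>x. torus_deriv f x - torus_deriv g x)"
    using assms by (intro continuous_intros) (simp_all add: C1_map_def)
  then show "C1_map (\<lambda>x. f x - g x)"
    unfolding C1_map_def using h by (simp add: eq [abs_def])
qed

lemma norm_torus_deriv_le_C2_norm:
  assumes "C1_map f"
  shows "norm (torus_deriv f x) \<le> C2_norm f"
proof -
  obtain B where "\<And>x. norm (torus_deriv f x) \<le> B"
    using bounded_torus assms unfolding C1_map_def by blast
  then have "bdd_above (range (\<lambda>x. norm (torus_deriv f x)))" by (intro bdd_aboveI2)
  then have "norm (torus_deriv f x) \<le> (SUP x. norm (torus_deriv f x))" by (rule cSUP_upper [OF UNIV_I])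
  also have "\<dots> \<le> C2_norm f" unfolding C2_norm_def by (rule Max_ge) auto
  finally show ?thesis .
qed

lemma continuous_lin_det: "continuous_on UNIV (lin_det :: ('n::finite) lin \<Rightarrow> real)"
proof -
  have "continuous_on UNIV (\<lambda>A :: 'n lin. blinfun_apply A v $ i)" for v i
    by (intro continuous_intros)
  then have "continuous_on UNIV (\<lambda>A :: 'n lin. \<Sum>p\<in>{p. p permutes UNIV}. of_int (sign p) * (\<Prod>i\<in>UNIV. blinfun_apply A (axis (p i) 1) $ i))"
    by (intro continuous_intros)
  then show ?thesis by (simp add: lin_det_def [abs_def] det_def matrix_def)
qed

text \<open>One step of the recursion adds the change of \<open>C\<close> applied to the
  derivative, plus the change of \<open>Df\<close>; the errors made before are not expanded.\<close>

lemma fiber_deriv_perturb: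
  assumes S: "skew E C f" and S': "skew E C' f'" and e: "0 \<le> e" "norm (C' - C) \<le> e"
    "\<And>x. norm (torus_deriv f' x - torus_deriv f x) \<le> e"
    and M: "0 \<le> M" "\<And>x. norm (torus_deriv f x) \<le> M"
  shows "norm (skew.fiber_deriv E C' f' n a - skew.fiber_deriv E C f n a) \<le> real n * (e * (M / (1 - norm C)) + e)"
proof -
  interpret S: skew E C f by (rule S)
  interpret S': skew E C' f' by (rule S')
  let ?b = "e * (M / (1 - norm C)) + e"
  have b: "0 \<le> ?b" using e M S.norm_C by simp
  show ?thesis
  proof (induction n)
    case (Suc n)
    let ?D = "S.fiber_deriv n a" and ?D' = "S'.fiber_deriv n a" and ?x = "(torus_map E ^^ n) a"
    have eq: "S'.fiber_deriv (Suc n) a - S.fiber_deriv (Suc n) a =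
      ((C' o\<^sub>L (?D' - ?D)) + ((C' - C) o\<^sub>L ?D) + (torus_deriv f' ?x - torus_deriv f ?x)) o\<^sub>L S.Ei_lin"
      by (rule blinfun_eqI) (simp add: blinfun.diff_left blinfun.add_left blinfun.diff_right)
    have "norm (S'.fiber_deriv (Suc n) a - S.fiber_deriv (Suc n) a) \<le>
      norm ((C' o\<^sub>L (?D' - ?D)) + ((C' - C) o\<^sub>L ?D) + (torus_deriv f' ?x - torus_deriv f ?x)) * norm S.Ei_lin"
      unfolding eq by (rule norm_blinfun_compose)
    also have "\<dots> \<le> norm ((C' o\<^sub>L (?D' - ?D)) + ((C' - C) o\<^sub>L ?D) + (torus_deriv f' ?x - torus_deriv f ?x)) * 1"
      using S.lam_less_1 by (intro mult_left_mono) (auto simp: S.norm_Ei_lin)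
    also have "\<dots> \<le> norm (C' o\<^sub>L (?D' - ?D)) + norm ((C' - C) o\<^sub>L ?D) + norm (torus_deriv f' ?x - torus_deriv f ?x)"
      by (simp add: norm_triangle_le norm_triangle_ineq)
    also have "\<dots> \<le> real n * ?b + e * (M / (1 - norm C)) + e"
    proof (intro add_mono e(3))
      have "norm (C' o\<^sub>L (?D' - ?D)) \<le> norm C' * norm (?D' - ?D)" by (rule norm_blinfun_compose)
      also have "\<dots> \<le> 1 * (real n * ?b)"
        using S'.norm_C Suc b by (intro mult_mono) auto
      finally show "norm (C' o\<^sub>L (?D' - ?D)) \<le> real n * ?b" by simp
      have "norm ((C' - C) o\<^sub>L ?D) \<le> norm (C' - C) * norm ?D" by (rule norm_blinfun_compose)
      also have "\<dots> \<le> e * (M / (1 - norm C))"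
        using e S.fiber_deriv_le [OF M, of n a] by (intro mult_mono) auto
      finally show "norm ((C' - C) o\<^sub>L ?D) \<le> e * (M / (1 - norm C))" .
    qed
    also have "\<dots> = real (Suc n) * ?b" by (simp add: distrib_right)
    finally show ?case .
  qed simp
qed

text \<open>For \<open>e = 0\<close> the inequality says \<open>2a < 3a\<close>, and the left-hand
  side is continuous in \<open>e\<close>. The term with factor \<open>q\<close> is twice the bound
  of \<open>fiber_deriv_perturb\<close>.\<close>

lemma perturbation_margin:
  fixes c l M :: real
  assumes c: "0 < c" "c < 1" and l: "0 < l" and M: "0 < M"
  obtains e where "0 < e" "c + e < 1"
    "2 * (((c + e) * l) ^ q * ((M + e) / (1 - (c + e)))) + 2 * (real q * (e * (M / (1 - c)) + e)) < 3 * (c * l) ^ q * (M / (1 - c))"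
proof -
  let ?F = "\<lambda>e. 2 * (((c + e) * l) ^ q * ((M + e) / (1 - (c + e)))) + 2 * (real q * (e * (M / (1 - c)) + e))"
  have "(?F \<longlongrightarrow> 2 * (((c + 0) * l) ^ q * ((M + 0) / (1 - (c + 0)))) + 2 * (real q * (0 * (M / (1 - c)) + 0))) (at_right 0)"
    using c by (intro tendsto_intros) auto
  moreover have "2 * (((c + 0) * l) ^ q * ((M + 0) / (1 - (c + 0)))) + 2 * (real q * (0 * (M / (1 - c)) + 0)) < 3 * (c * l) ^ q * (M / (1 - c))"
  proof -
    let ?A = "(c * l) ^ q * (M / (1 - c))"
    have "0 < ?A" using c l M by simp
    moreover have "2 * a < 3 * a" if "0 < a" for a :: real using that by simp
    ultimately have "2 * ?A < 3 * ?A" by blast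
    then show ?thesis by (simp only: add_0_right mult_zero_left mult_zero_right mult.assoc)
  qed
  ultimately have "eventually (\<lambda>e. ?F e < 3 * (c * l) ^ q * (M / (1 - c))) (at_right 0)"
    by (rule order_tendstoD(2))
  moreover have "eventually (\<lambda>e. e < 1 - c) (at_right (0 :: real))"
    using c by (intro order_tendstoD(2) [OF tendsto_ident_at]) simp
  moreover have "eventually (\<lambda>e. 0 < e) (at_right (0 :: real))"
    by (rule eventually_at_right_less)
  ultimately have "eventually (\<lambda>e. 0 < e \<and> c + e < 1 \<and> ?F e < 3 * (c * l) ^ q * (M / (1 - c))) (at_right 0)"
    by eventually_elim auto
  then obtain e where "0 < e \<and> c + e < 1 \<and> ?F e < 3 * (c * l) ^ q * (M / (1 - c))"
    using eventually_happens [of _ "at_right (0 :: real)"] by (auto simp: trivial_limit_at_right_real)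
  then show ?thesis using that by blast
qed

lemma AE_torus_ex:
  assumes "AE x in (torus_lebesgue :: 'u::finite torus measure). P x"
  shows "\<exists>x. P x"
proof (rule ccontr)
  assume "\<nexists>x. P x"
  then have "AE x in (torus_lebesgue :: 'u torus measure). False" using assms by (auto elim: AE_mp)
  then show False by simp
qed

lemma not_conorm_ge_0:
  assumes "0 < c"
  shows "\<not> conorm_ge (0 :: (real^'u::finite) \<Rightarrow>\<^sub>L (real^'d::finite)) c"
proof
  assume "conorm_ge (0 :: (real^'u) \<Rightarrow>\<^sub>L (real^'d)) c"
  then obtain W :: "(real^'u) set" where W: "dim W = CARD('d)" "\<And>v. v \<in> W \<Longrightarrow> c * norm v \<le> 0"
    by (auto simp: conorm_ge_def)
  then have "W \<subseteq> {0}" using assms by (force simp: mult_le_0_iff)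
  then have "dim W = 0" by (simp add: dim_eq_0)
  then show False using W(1) by simp
qed

text \<open>If \<open>C2_norm f > 0\<close>, the margin \<open>3 \<theta>^q
  \<alpha>\<^sub>0\<close> is strictly larger than two tails \<open>2 \<theta>^q
  \<alpha>\<^sub>0\<close>, so that some room is left for perturbing \<open>C\<close> and
  \<open>f\<close>.

  If \<open>C2_norm f = 0\<close>, the margin vanishes. But then all fibre derivatives vanish, no
  pair of preimages is transversal, and \<open>N\<close> is at least the total number of
  preimages. The count therefore holds trivially for every perturbation.\<close>

lemma nontransversal_count_stable:
  fixes E :: "('u::finite) lin" and C :: "('d::finite) lin" and f :: "'u torus \<Rightarrow> real^'d"
  assumes S: "skew E C f" and normC: "0 < norm C"
    and nontr: "AE x in torus_lebesgue. \<forall>a\<in>torus_endo.preimages E q x.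
      card {b \<in> torus_endo.preimages E q x. \<not> (\<exists>c1 > 3 * theta E C ^ q * alpha0 C f.
        conorm_ge (skew.fiber_deriv E C f q a - skew.fiber_deriv E C f q b) c1)} \<le> N"
  obtains e where "0 < e"
    "\<And>C' f'. skew E C' f' \<Longrightarrow> norm (C' - C) \<le> e \<Longrightarrow> (\<And>x. norm (torus_deriv f' x - torus_deriv f x) \<le> e) \<Longrightarrow>
    skew.robustly_transversal E C' f' q N"
proof -
  interpret S: skew E C f by (rule S)
  define M0 where "M0 = C2_norm f"
  define t0 where "t0 = 3 * theta E C ^ q * alpha0 C f"
  have t0: "t0 = 3 * (norm C * S.lam) ^ q * (M0 / (1 - norm C))"
    by (simp add: t0_def alpha0_def M0_def S.theta_eq)
  have DM: "norm (torus_deriv f x) \<le> M0" for x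
    unfolding M0_def by (rule norm_torus_deriv_le_C2_norm [OF S.C1])
  have M0: "0 \<le> M0" using DM [of "proj 0"] norm_ge_zero order_trans by blast
  show ?thesis
  proof (cases "M0 = 0")
    case True
    have D0: "S.fiber_deriv q a = 0" for a
      using S.fiber_deriv_le [of 0 q a] DM True by simp
    obtain x0 where x0: "\<forall>a\<in>S.preimages q x0. card {b \<in> S.preimages q x0. \<not> (\<exists>c1 > t0.
        conorm_ge (S.fiber_deriv q a - S.fiber_deriv q b) c1)} \<le> N"
      using AE_torus_ex [OF nontr] unfolding t0_def by blast
    \<comment> \<open>At a point where the count holds, all preimages are counted.\<close>
    have deg_N: "S.deg ^ q \<le> real N"
    proof -
      have "0 < card (S.preimages q x0)" using S.card_preimages [of q x0] S.deg_pos by (metis of_nat_0_less_iff zero_less_power)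
      then have "S.preimages q x0 \<noteq> {}" by auto
      then obtain a where a: "a \<in> S.preimages q x0" by blast
      have "{b \<in> S.preimages q x0. \<not> (\<exists>c1 > t0. conorm_ge (S.fiber_deriv q a - S.fiber_deriv q b) c1)} = S.preimages q x0"
        using not_conorm_ge_0 by (auto simp: D0 t0 True)
      moreover have "card {b \<in> S.preimages q x0. \<not> (\<exists>c1 > t0. conorm_ge (S.fiber_deriv q a - S.fiber_deriv q b) c1)} \<le> N"
        using x0 a by (rule bspec)
      ultimately have "card (S.preimages q x0) \<le> N" by simp
      then show ?thesis using S.card_preimages [of q x0] by (metis of_nat_le_iff)
    qed
    show ?thesis
    proof (rule that [OF zero_less_one])
      fix C' f' assume "skew E C' f'"
      then interpret S': skew E C' f' .
      obtain M' where M': "0 < M'" "\<And>x. norm (torus_deriv f' x) \<le> M'"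
        using bounded_torus S'.C1 unfolding C1_map_def by blast
      have "card {b \<in> S.preimages q x. P b} \<le> N" for x P
      proof -
        have "card {b \<in> S.preimages q x. P b} \<le> card (S.preimages q x)" by (intro card_mono) auto
        moreover have "real (card (S.preimages q x)) \<le> real N" using deg_N by (simp add: S.card_preimages)
        ultimately show ?thesis by linarith
      qed
      then show "skew.robustly_transversal E C' f' q N"
        unfolding S'.robustly_transversal_def
        using M' by (intro exI [of _ M'] exI [of _ "2 * (theta E C' ^ q * (M' / (1 - norm C'))) + 1"]) auto
    qed
  next
    case False
    then have M0p: "0 < M0" using M0 by simp
    obtain e where e: "0 < e" "norm C + e < 1"
      "2 * (((norm C + e) * S.lam) ^ q * ((M0 + e) / (1 - (norm C + e)))) + 2 * (real q * (e * (M0 / (1 - norm C)) + e)) < t0"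
      using perturbation_margin [OF normC S.norm_C S.lam_pos M0p] unfolding t0 by blast
    \<comment> \<open>\<open>\<beta>\<close> bounds the change of one fibre derivative of order
      \<open>q\<close>, so the margin \<open>t0\<close> decreases by at most \<open>2 *
      \<beta>\<close>.\<close>
    define \<beta> where "\<beta> = real q * (e * (M0 / (1 - norm C)) + e)"
    show ?thesis
    proof (rule that [OF e(1)])
      fix C' f' assume "skew E C' f'" and C'C: "norm (C' - C) \<le> e"
        and f'f: "\<And>x. norm (torus_deriv f' x - torus_deriv f x) \<le> e"
      then interpret S': skew E C' f' by simp
      have c': "norm C' \<le> norm C + e" using C'C norm_triangle_sub [of C' C] by linarith
      have D': "norm (torus_deriv f' x) \<le> M0 + e" for x
        using DM [of x] f'f [of x] norm_triangle_sub [of "torus_deriv f' x" "torus_deriv f x"] by linarith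
      have \<beta>: "norm (S'.fiber_deriv q a - S.fiber_deriv q a) \<le> \<beta>" for a
        unfolding \<beta>_def using e(1) by (intro fiber_deriv_perturb [OF S \<open>skew E C' f'\<close> _ C'C f'f M0 DM]) simp
      have "theta E C' ^ q * ((M0 + e) / (1 - norm C')) \<le> ((norm C + e) * S.lam) ^ q * ((M0 + e) / (1 - (norm C + e)))"
        unfolding S'.theta_eq using c' e M0 S.lam_nonneg
        by (intro mult_mono power_mono divide_left_mono mult_right_mono mult_pos_pos divide_nonneg_pos zero_le_power mult_nonneg_nonneg) auto
      then have margin: "2 * (theta E C' ^ q * ((M0 + e) / (1 - norm C'))) < t0 - 2 * \<beta>"
        using e(3) by (simp add: \<beta>_def)
      have "conorm_ge (S'.fiber_deriv q a - S'.fiber_deriv q b) (t0 - 2 * \<beta>)"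
        if "c1 > t0" "conorm_ge (S.fiber_deriv q a - S.fiber_deriv q b) c1" for a b c1
      proof (rule conorm_ge_perturb [OF that(2), of _ "2 * \<beta>"])
        have "(S'.fiber_deriv q a - S'.fiber_deriv q b) - (S.fiber_deriv q a - S.fiber_deriv q b) =
          (S'.fiber_deriv q a - S.fiber_deriv q a) - (S'.fiber_deriv q b - S.fiber_deriv q b)" by simp
        also have "norm \<dots> \<le> \<beta> + \<beta>" by (intro order_trans [OF norm_triangle_ineq4] add_mono \<beta>)
        finally show "norm ((S'.fiber_deriv q a - S'.fiber_deriv q b) - (S.fiber_deriv q a - S.fiber_deriv q b)) \<le> 2 * \<beta>" by simp
      qed (use that(1) in simp)
      then have sub: "{b \<in> S.preimages q x. \<not> conorm_ge (S'.fiber_deriv q a - S'.fiber_deriv q b) (t0 - 2 * \<beta>)} \<subseteq>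
        {b \<in> S.preimages q x. \<not> (\<exists>c1 > t0. conorm_ge (S.fiber_deriv q a - S.fiber_deriv q b) c1)}" for a x
        by blast
      have cnt: "AE x in torus_lebesgue. \<forall>a\<in>S.preimages q x.
        card {b \<in> S.preimages q x. \<not> conorm_ge (S'.fiber_deriv q a - S'.fiber_deriv q b) (t0 - 2 * \<beta>)} \<le> N"
        using nontr unfolding t0_def [symmetric]
      proof eventually_elim
        fix x assume x: "\<forall>a\<in>S.preimages q x. card {b \<in> S.preimages q x. \<not> (\<exists>c1 > t0. conorm_ge (S.fiber_deriv q a - S.fiber_deriv q b) c1)} \<le> N"
        show "\<forall>a\<in>S.preimages q x. card {b \<in> S.preimages q x. \<not> conorm_ge (S'.fiber_deriv q a - S'.fiber_deriv q b) (t0 - 2 * \<beta>)} \<le> N"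
        proof
          fix a assume "a \<in> S.preimages q x"
          then show "card {b \<in> S.preimages q x. \<not> conorm_ge (S'.fiber_deriv q a - S'.fiber_deriv q b) (t0 - 2 * \<beta>)} \<le> N"
            using x card_mono [OF _ sub [of x a]] by (fastforce intro: order_trans)
        qed
      qed
      show "skew.robustly_transversal E C' f' q N"
        unfolding S'.robustly_transversal_def
        using D' margin cnt M0 e(1) by (intro exI [of _ "M0 + e"] exI [of _ "t0 - 2 * \<beta>"]) auto
    qed
  qed
qed

theorem theoremD:
  fixes E :: "(real^'u) \<Rightarrow>\<^sub>L (real^'u)"
    and C :: "(real^'d) \<Rightarrow>\<^sub>L (real^'d)"
    and f :: "'u torus \<Rightarrow> real^'d"
    and \<gamma> :: real and r :: nat and R :: "nat \<Rightarrow> 'u torus set"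
  assumes "CARD('d) \<le> CARD('u)"
    and "E \<in> expanding_maps"
    and "C \<in> contractions"
    and "\<bar>lin_det E * lin_det C\<bar> > 1"
    and "C2_on UNIV f"
    and "branch_radius E \<gamma>"
    and "markov_partition E \<gamma> r R"
    and "transversality_condition E C f r R"
  shows "\<exists>U. is_neighbourhood U C f \<and>
    (\<forall>(C', f')\<in>U. \<exists>\<mu>. is_SRB_measure (skew_product E C' f') \<mu> \<and>
       absolutely_continuous phase_volume \<mu> \<and>
       (\<integral>\<^sup>+ z. (RN_deriv phase_volume \<mu> z)\<^sup>2 \<partial>phase_volume) < \<infinity>)"
proof -
  note C1 = C2_on_imp_C1_map [OF assms(5)]
  have skew: "skew E C f" by unfold_locales (use assms C1 in auto)
  interpret M: markov_skew E \<gamma> r R C f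
    by unfold_locales (use assms C1 in auto)
  obtain q where q: "1 \<le> q" "real (tau E C f r R q) < jacobian E C ^ q"
    using assms(8) by (auto simp: transversality_condition_def)
  \<comment> \<open>By the Markov partition, almost every point has at most
    \<open>\<tau>(q)\<close> nontransversal partners for each of its preimages.\<close>
  define N where "N = tau E C f r R q"
  have nontr: "AE x in torus_lebesgue. \<forall>a\<in>M.preimages q x.
    card {b \<in> M.preimages q x. \<not> (\<exists>c1 > 3 * theta E C ^ q * alpha0 C f. conorm_ge (M.fiber_deriv q a - M.fiber_deriv q b) c1)} \<le> N"
    unfolding N_def by (rule M.AE_nontransversal_preimages [OF assms(1)])
  have detC: "lin_det C \<noteq> 0" using assms(4) by auto
  \<comment> \<open>Only for \<open>C \<noteq> 0\<close> is the margin \<open>3 \<theta>^q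
    \<alpha>\<^sub>0\<close> positive.\<close>
  have normC: "0 < norm C"
  proof (rule ccontr)
    assume "\<not> 0 < norm C"
    then have "C = 0" by simp
    then have "lin_det C = 0"
      unfolding lin_det_def matrix_def
      by (intro det_zero_row(1)) (simp add: zero_blinfun.rep_eq row_def vec_eq_iff)
    then show False using detC by simp
  qed
  obtain e1 where e1: "0 < e1" and count: "\<And>C' f'. skew E C' f' \<Longrightarrow> norm (C' - C) \<le> e1 \<Longrightarrow>
    (\<And>x. norm (torus_deriv f' x - torus_deriv f x) \<le> e1) \<Longrightarrow>
    skew.robustly_transversal E C' f' q N"
    using nontransversal_count_stable [OF skew normC nontr] by blast
  \<comment> \<open>The Jacobian depends continuously on \<open>C\<close>, so the strict
    inequality \<open>\<tau>(q) < J^q\<close> is stable as well.\<close>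
  have "((\<lambda>C'. (M.deg * \<bar>lin_det C'\<bar>) ^ q) \<longlongrightarrow> (M.deg * \<bar>lin_det C\<bar>) ^ q) (nhds C)"
    using continuous_lin_det [where 'n = 'd] by (intro tendsto_intros) (simp add: continuous_on_eq_continuous_at isCont_def tendsto_at_iff_tendsto_nhds)
  moreover have "real N < (M.deg * \<bar>lin_det C\<bar>) ^ q"
    using q(2) by (simp add: N_def jacobian_def M.deg_def abs_mult)
  ultimately have "eventually (\<lambda>C'. real N < (M.deg * \<bar>lin_det C'\<bar>) ^ q) (nhds C)"
    by (rule order_tendstoD(1))
  then obtain e2 where e2: "0 < e2" "\<And>C'. norm (C' - C) < e2 \<Longrightarrow> real N < (M.deg * \<bar>lin_det C'\<bar>) ^ q"
    unfolding eventually_nhds_metric dist_norm by blast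
  define e where "e = min e1 e2"
  define U where "U = {(C', f'). (C', f') \<in> parameter_space \<and> norm (C' - C) < e \<and> C2_norm (\<lambda>x. f' x - f x) < e}"
  have "is_neighbourhood U C f"
    unfolding is_neighbourhood_def U_def using e1 e2(1) by (auto intro!: exI [of _ e] simp: e_def)
  moreover have "\<exists>\<mu>. is_SRB_measure (skew_product E C' f') \<mu> \<and> absolutely_continuous phase_volume \<mu> \<and>
       (\<integral>\<^sup>+ z. (RN_deriv phase_volume \<mu> z)\<^sup>2 \<partial>phase_volume) < \<infinity>"
    if U: "(C', f') \<in> U" for C' f'
  proof -
    have C': "C' \<in> contractions" and f': "C2_on UNIV f'" and near: "norm (C' - C) < e1" "norm (C' - C) < e2"
      and near_f: "C2_norm (\<lambda>x. f' x - f x) < e1"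
      using U by (auto simp: U_def parameter_space_def e_def)
    note C1' = C2_on_imp_C1_map [OF f']
    have "norm (torus_deriv f' x - torus_deriv f x) \<le> e1" for x
      using norm_torus_deriv_le_C2_norm [OF C1_map_diff(1) [OF C1' C1], of x] near_f
      by (simp add: C1_map_diff(2) [OF C1' C1])
    moreover have "skew E C' f'" by unfold_locales (use C' C1' assms(2) in auto)
    ultimately have rt: "skew.robustly_transversal E C' f' q N"
      using count near(1) by simp
    have J': "real N < (M.deg * \<bar>lin_det C'\<bar>) ^ q" using e2(2) near(2) by blast
    have "lin_det C' \<noteq> 0"
    proof
      assume "lin_det C' = 0"
      then have "real N < 0 ^ q" using J' by simp
      then show False using q(1) by (simp add: power_0_left)
    qed
    then interpret S': invertible_skew E C' f'
      by unfold_locales (use C' C1' assms(2) in auto)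
    have "absolutely_continuous phase_volume S'.srb \<and>
      (\<integral>\<^sup>+z. (RN_deriv phase_volume S'.srb z)\<^sup>2 \<partial>phase_volume) < \<infinity>"
      by (rule S'.srb_absolutely_continuous_L2 [OF rt _ q(1)]) (use J' in \<open>simp add: S'.J_eq\<close>)
    then show ?thesis using S'.srb_is_SRB by blast
  qed
  ultimately show ?thesis by blast
qed

end
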